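(* Let $\mathcal{C}$ be the 2-Calabi--Yau category associated to the $A_2$ quiver and let $\mathbf{S}$ be the set of spherical objects of $\mathcal{C}$ up to isomorphism and shift, regarded as a subset of $\mathbf{P}^1(\mathbf{R})$ via the bijection $i\colon\mathbf{S}\to\mathbf{P}^1(\mathbf{Z})\subset\mathbf{P}^1(\mathbf{R})$. Then the map $h\colon\mathbf{S}\to\mathbf{P}^{\mathbf{S}}$, $h(x)=[\overline{\mathrm{hom}}(x,-)]$, extends to a continuous map $\mathbf{P}^1(\mathbf{R})\to\mathbf{P}^{\mathbf{S}}$, which is a homeomorphism onto its image.
   Context: Fix a field $\mathbf{k}$. Let $A$ be the quotient of the path algebra over $\mathbf{k}$ of the quiver with vertices $1,2$ and one arrow in each direction, by all paths of length three, graded by path length and regarded as a dg algebra with zero differential. Let $P_i=A(i)$, where $(i)$ is the idempotent at vertex $i$. $\mathcal{C}$ is the smallest full strict triangulated subcategory containing $P_1,P_2$ of the homotopy category of finite-dimensional dg $A$-modules. It is 2-Calabi--Yau. Write $\mathrm{Hom}^n(x,y)=\mathrm{Hom}(x,y[n])$. An object $x$ is spherical if $\bigoplus_n\mathrm{Hom}^n(x,x)\cong\mathbf{k}[t]/t^2$ with $\deg t=2$. The spherical twist $\sigma_a$ in a spherical object $a$ sends $y$ to the cone of the evaluation map $\bigoplus_n\mathrm{Hom}^n(a,y)\otimes a[-n]\to y$. The braid group $B_3=\langle\sigma_1,\sigma_2\mid\sigma_1\sigma_2\sigma_1=\sigma_2\sigma_1\sigma_2\rangle$ acts on $\mathcal{C}$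 by $\sigma_i\mapsto\sigma_{P_i}$; it acts transitively on spherical objects. The action of $B_3$ on $\mathbf{S}$ factors through $B_3/Z(B_3)\cong\mathrm{PSL}_2(\mathbf{Z})$, $\sigma_1\mapsto\begin{pmatrix}1&1\\0&1\end{pmatrix}$, $\sigma_2\mapsto\begin{pmatrix}1&0\\-1&1\end{pmatrix}$. The map $i\colon\mathbf{S}\to\mathbf{P}^1(\mathbf{Z})$ is the unique $\mathrm{PSL}_2(\mathbf{Z})$-equivariant bijection with $P_1\mapsto[1:0]$. For spherical objects $a,x$: $\overline{\mathrm{hom}}(a,x)=\sum_n\dim\mathrm{Hom}^n(a,x)$ if $x$ is not isomorphic to a shift of $a$, and $\overline{\mathrm{hom}}(a,x)=0$ if $x\cong a[j]$ for some $j$. $\mathbf{R}^{\mathbf{S}}$ (functions $\mathbf{S}\to\mathbf{R}$) has the product topology and $\mathbf{P}^{\mathbf{S}}=(\mathbf{R}^{\mathbf{S}}\setminus\{0\})/\mathbf{R}^\times$ the quotient topology. *)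

theory Defs
  imports
    "HOL-Analysis.Analysis"
    "HOL-Computational_Algebra.Polynomial"
    "Jordan_Normal_Form.VS_Connect"
begin

section \<open>The algebra \<open>A\<close>\<close>

datatype vertex = V1 | V2

fun opp :: "vertex \<Rightarrow> vertex" where
  "opp V1 = V2"
| "opp V2 = V1"

text \<open>Each vertex has exactly one outgoing arrow, so a path is determined by its source and its
  length. The paths of length at most two form a basis of \<open>A\<close>; the argument of each constructor is
  the source.\<close>

datatype qpath = Triv vertex | Arrow vertex | Loop vertex

fun len :: "qpath \<Rightarrow> nat" where
  "len (Triv v) = 0"
| "len (Arrow v) = 1"
| "len (Loop v) = 2"

fun src :: "qpath \<Rightarrow> vertex" where
  "src (Triv v) = v"
| "src (Arrow v) = v"
| "src (Loop v) = v"

fun tgt :: "qpath \<Rightarrow> vertex" where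
  "tgt (Triv v) = v"
| "tgt (Arrow v) = opp v"
| "tgt (Loop v) = v"

text \<open>The product \<open>p q\<close> in \<open>A\<close> of two basis paths (first \<open>q\<close>, then \<open>p\<close>); \<open>None\<close> stands for \<open>0\<close>.\<close>

fun pmul :: "qpath \<Rightarrow> qpath \<Rightarrow> qpath option" where
  "pmul (Triv v) q = (if tgt q = v then Some q else None)"
| "pmul p (Triv v) = (if src p = v then Some p else None)"
| "pmul (Arrow v) (Arrow w) = (if tgt (Arrow w) = v then Some (Loop w) else None)"
| "pmul _ _ = None"

section \<open>Finite-dimensional dg modules and their homotopy category\<close>

text \<open>A finite-dimensional graded left module with a chosen homogeneous basis: \<open>degs\<close> lists the
  degrees of the basis vectors, \<open>act p\<close> is the matrix of the basis path \<open>p\<close>, and \<open>diff\<close> is that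
  of the differential. Choosing bases replaces the category of all finite-dimensional dg modules by
  an equivalent one.\<close>

record 'k dgmod =
  degs :: "int list"
  act :: "qpath \<Rightarrow> 'k mat"
  diff :: "'k mat"

abbreviation mdim :: "'k dgmod \<Rightarrow> nat" where
  "mdim M \<equiv> length (degs M)"

definition sgn_pow :: "int \<Rightarrow> 'k::field" where
  "sgn_pow n = (if even n then 1 else - 1)"

text \<open>Matrices of linear maps of degree \<open>n\<close>.\<close>

definition homogeneous :: "int \<Rightarrow> int list \<Rightarrow> int list \<Rightarrow> 'k::field mat set" where
  "homogeneous n ds es = {f \<in> carrier_mat (length es) (length ds).
     \<forall>i < length es. \<forall>j < length ds. f $$ (i, j) \<noteq> 0 \<longrightarrow> es ! i = ds ! j + n}"

definition dg_module :: "'k::field dgmod \<Rightarrow> bool" where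
  "dg_module M \<longleftrightarrow>
     (\<forall>p. act M p \<in> homogeneous (int (len p)) (degs M) (degs M)) \<and>
     (\<forall>p q. act M p * act M q =
        (case pmul p q of Some r \<Rightarrow> act M r | None \<Rightarrow> 0\<^sub>m (mdim M) (mdim M))) \<and>
     act M (Triv V1) + act M (Triv V2) = 1\<^sub>m (mdim M) \<and>
     diff M \<in> homogeneous 1 (degs M) (degs M) \<and>
     diff M * diff M = 0\<^sub>m (mdim M) (mdim M) \<and>
     (\<forall>p. diff M * act M p = sgn_pow (int (len p)) \<cdot>\<^sub>m (act M p * diff M))"

text \<open>\<open>shift n M\<close> is \<open>M[n]\<close>, with \<open>M[n]\<^sup>k = M\<^sup>k\<^sup>+\<^sup>n\<close> and the usual signs for left modules.\<close>

definition shift :: "int \<Rightarrow> 'k::field dgmod \<Rightarrow> 'k dgmod" where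
  "shift n M =
     \<lparr>degs = map (\<lambda>d. d - n) (degs M),
      act = (\<lambda>p. sgn_pow (n * int (len p)) \<cdot>\<^sub>m act M p),
      diff = sgn_pow n \<cdot>\<^sub>m diff M\<rparr>"

definition dg_hom :: "'k::field dgmod \<Rightarrow> 'k dgmod \<Rightarrow> 'k mat set" where
  "dg_hom M N = {f \<in> homogeneous 0 (degs M) (degs N).
     (\<forall>p. f * act M p = act N p * f) \<and> f * diff M = diff N * f}"

definition null_hom :: "'k::field dgmod \<Rightarrow> 'k dgmod \<Rightarrow> 'k mat set" where
  "null_hom M N = {diff N * s + s * diff M | s.
     s \<in> homogeneous (- 1) (degs M) (degs N) \<and>
     (\<forall>p. s * act M p = sgn_pow (int (len p)) \<cdot>\<^sub>m (act N p * s))}"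

definition hclass :: "'k::field dgmod \<Rightarrow> 'k dgmod \<Rightarrow> 'k mat \<Rightarrow> 'k mat set" where
  "hclass M N f = {g \<in> dg_hom M N. g - f \<in> null_hom M N}"

text \<open>The vector space \<open>Hom(M, N)\<close> of homotopy classes. The ring fields \<open>mult\<close> and \<open>one\<close> of the
  module record play no role.\<close>

definition Hom :: "'k::field dgmod \<Rightarrow> 'k dgmod \<Rightarrow> ('k, 'k mat set) module" where
  "Hom M N =
     \<lparr>carrier = hclass M N ` dg_hom M N,
      mult = undefined,
      one = undefined,
      zero = null_hom M N,
      add = (\<lambda>F G. {f + g | f g. f \<in> F \<and> g \<in> G}),
      smult = (\<lambda>c F. {c \<cdot>\<^sub>m f + b | f b. f \<in> F \<and> b \<in> null_hom M N})\<rparr>"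

abbreviation Hom_deg :: "int \<Rightarrow> 'k::field dgmod \<Rightarrow> 'k dgmod \<Rightarrow> ('k, 'k mat set) module" where
  "Hom_deg n M N \<equiv> Hom M (shift n N)"

definition isom :: "'k::field dgmod \<Rightarrow> 'k dgmod \<Rightarrow> bool" where
  "isom M N \<longleftrightarrow> (\<exists>f \<in> dg_hom M N. \<exists>g \<in> dg_hom N M.
     hclass M M (g * f) = hclass M M (1\<^sub>m (mdim M)) \<and>
     hclass N N (f * g) = hclass N N (1\<^sub>m (mdim N)))"

definition zero_dgmod :: "'k::field dgmod" where
  "zero_dgmod = \<lparr>degs = [], act = (\<lambda>_. 0\<^sub>m 0 0), diff = 0\<^sub>m 0 0\<rparr>"

definition dsum :: "'k::field dgmod \<Rightarrow> 'k dgmod \<Rightarrow> 'k dgmod" where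
  "dsum M N =
     \<lparr>degs = degs M @ degs N,
      act = (\<lambda>p. four_block_mat (act M p) (0\<^sub>m (mdim M) (mdim N))
                                (0\<^sub>m (mdim N) (mdim M)) (act N p)),
      diff = four_block_mat (diff M) (0\<^sub>m (mdim M) (mdim N))
                            (0\<^sub>m (mdim N) (mdim M)) (diff N)\<rparr>"

definition mcone :: "'k::field dgmod \<Rightarrow> 'k dgmod \<Rightarrow> 'k mat \<Rightarrow> 'k dgmod" where
  "mcone M N f = (dsum (shift 1 M) N)
     \<lparr>diff := four_block_mat (diff (shift 1 M)) (0\<^sub>m (mdim M) (mdim N)) f (diff N)\<rparr>"

section \<open>The category \<open>C\<close> and its spherical objects\<close>

text \<open>\<open>Pmod v = A e\<^sub>v\<close> has as basis the paths with source \<open>v\<close>.\<close>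

definition Pmod :: "vertex \<Rightarrow> 'k::field dgmod" where
  "Pmod v = (let b = [Triv v, Arrow v, Loop v] in
     \<lparr>degs = map (\<lambda>q. int (len q)) b,
      act = (\<lambda>p. mat 3 3 (\<lambda>(i, j). if pmul p (b ! j) = Some (b ! i) then 1 else 0)),
      diff = 0\<^sub>m 3 3\<rparr>)"

text \<open>The objects of \<open>C\<close>; it is a full subcategory, so its morphisms are given by \<^const>\<open>Hom\<close>.\<close>

inductive_set Cat :: "'k::field dgmod set" where
  Cat_P: "Pmod v \<in> Cat"
| Cat_shift: "x \<in> Cat \<Longrightarrow> shift n x \<in> Cat"
| Cat_cone: "x \<in> Cat \<Longrightarrow> y \<in> Cat \<Longrightarrow> f \<in> dg_hom x y \<Longrightarrow> mcone x y f \<in> Cat"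
| Cat_isom: "x \<in> Cat \<Longrightarrow> dg_module y \<Longrightarrow> isom x y \<Longrightarrow> y \<in> Cat"

text \<open>The degree \<open>n\<close> part of \<open>k[t]/t\<^sup>2\<close>, \<open>deg t = 2\<close>, elements being represented by polynomials of
  degree less than two.\<close>

definition dual_numbers :: "int \<Rightarrow> 'k::field poly set" where
  "dual_numbers n = (if n = 0 then range (\<lambda>c. [:c:])
     else if n = 2 then range (\<lambda>c. [:0, c:]) else {0})"

text \<open>An isomorphism of graded algebras from the endomorphism algebra of \<open>x\<close> to \<open>k[t]/t\<^sup>2\<close>. Shifting
  a morphism does not change its matrix, so composition in the graded algebra is the matrix product.\<close>

definition spherical :: "'k::field dgmod \<Rightarrow> bool" where
  "spherical x \<longleftrightarrow> (\<exists>\<phi> :: int \<Rightarrow> 'k mat set \<Rightarrow> 'k poly.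
     (\<forall>n. bij_betw (\<phi> n) (carrier (Hom_deg n x x)) (dual_numbers n) \<and>
        (\<forall>F \<in> carrier (Hom_deg n x x). \<forall>G \<in> carrier (Hom_deg n x x).
           \<phi> n (F \<oplus>\<^bsub>Hom_deg n x x\<^esub> G) = \<phi> n F + \<phi> n G) \<and>
        (\<forall>c. \<forall>F \<in> carrier (Hom_deg n x x).
           \<phi> n (c \<odot>\<^bsub>Hom_deg n x x\<^esub> F) = Polynomial.smult c (\<phi> n F))) \<and>
     (\<forall>m n. \<forall>f \<in> dg_hom x (shift m x). \<forall>g \<in> dg_hom x (shift n x).
        \<phi> (m + n) (hclass x (shift (m + n) x) (f * g)) =
          (\<phi> m (hclass x (shift m x) f) * \<phi> n (hclass x (shift n x) g)) mod [:0, 0, 1:]) \<and>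
     \<phi> 0 (hclass x (shift 0 x) (1\<^sub>m (mdim x))) = 1)"

definition sph_objects :: "'k::field dgmod set" where
  "sph_objects = {x \<in> Cat. spherical x}"

definition sph_class :: "'k::field dgmod \<Rightarrow> 'k dgmod set" where
  "sph_class x = {y \<in> sph_objects. \<exists>j. isom y (shift j x)}"

definition \<S> :: "'k::field dgmod set set" where
  "\<S> = sph_class ` sph_objects"

definition rep :: "'k::field dgmod set \<Rightarrow> 'k dgmod" where
  "rep X = (SOME x. x \<in> X)"

section \<open>Spherical twists and the braid group action\<close>

text \<open>A list \<open>(n\<^sub>1, f\<^sub>1), (n\<^sub>2, f\<^sub>2), \<dots>\<close> whose entries with first component \<open>n\<close> represent a basis of
  \<open>Hom\<^sup>n(a, y)\<close>, for every \<open>n\<close>.\<close>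

definition hom_basis :: "'k::field dgmod \<Rightarrow> 'k dgmod \<Rightarrow> (int \<times> 'k mat) list \<Rightarrow> bool" where
  "hom_basis a y fs \<longleftrightarrow>
     (\<forall>(n, f) \<in> set fs. f \<in> dg_hom a (shift n y)) \<and>
     (\<forall>n. let Fs = map (\<lambda>(m, f). hclass a (shift n y) f) (filter (\<lambda>(m, f). m = n) fs) in
        distinct Fs \<and> vectorspace.basis class_ring (Hom_deg n a y) (set Fs))"

text \<open>With such a basis, the evaluation map becomes the map from \<open>a[-n\<^sub>1] \<oplus> a[-n\<^sub>2] \<oplus> \<dots>\<close> to \<open>y\<close> with
  components \<open>f\<^sub>1, f\<^sub>2, \<dots>\<close>.\<close>

fun ev_source :: "'k::field dgmod \<Rightarrow> (int \<times> 'k mat) list \<Rightarrow> 'k dgmod" where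
  "ev_source a [] = zero_dgmod"
| "ev_source a ((n, f) # fs) = dsum (shift (- n) a) (ev_source a fs)"

fun ev_map :: "'k::field dgmod \<Rightarrow> (int \<times> 'k mat) list \<Rightarrow> 'k mat" where
  "ev_map y [] = 0\<^sub>m (mdim y) 0"
| "ev_map y ((n, f) # fs) =
     four_block_mat f (ev_map y fs) (0\<^sub>m 0 (dim_col f)) (0\<^sub>m 0 (dim_col (ev_map y fs)))"

definition twist :: "'k::field dgmod \<Rightarrow> 'k dgmod \<Rightarrow> 'k dgmod" where
  "twist a y = (let fs = (SOME fs. hom_basis a y fs) in mcone (ev_source a fs) y (ev_map y fs))"

text \<open>Elements of \<open>B\<^sub>3\<close> are given by words in \<open>\<sigma>\<^sub>1\<close> (\<open>V1\<close>), \<open>\<sigma>\<^sub>2\<close> (\<open>V2\<close>) and their inverses, a letter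
  being inverted when its second component is \<open>True\<close>.\<close>

definition twist_class :: "vertex \<Rightarrow> 'k::field dgmod set \<Rightarrow> 'k dgmod set" where
  "twist_class v X = sph_class (twist (Pmod v) (rep X))"

fun braid_act :: "(vertex \<times> bool) list \<Rightarrow> 'k::field dgmod set \<Rightarrow> 'k dgmod set" where
  "braid_act [] X = X"
| "braid_act ((v, inverted) # w) X =
     (if inverted then inv_into \<S> (twist_class v) else twist_class v) (braid_act w X)"

fun sigma_mat :: "vertex \<Rightarrow> real^2^2" where
  "sigma_mat V1 = vector [vector [1, 1], vector [0, 1]]"
| "sigma_mat V2 = vector [vector [1, 0], vector [- 1, 1]]"

fun braid_mat :: "(vertex \<times> bool) list \<Rightarrow> real^2^2" where
  "braid_mat [] = Finite_Cartesian_Product.mat 1"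
| "braid_mat ((v, inverted) # w) =
     (if inverted then matrix_inv (sigma_mat v) else sigma_mat v) ** braid_mat w"

section \<open>Projective spaces\<close>

definition quotient_topology :: "'a topology \<Rightarrow> ('a \<Rightarrow> 'b) \<Rightarrow> 'b topology" where
  "quotient_topology X q =
     topology (\<lambda>U. U \<subseteq> q ` topspace X \<and> openin X {x \<in> topspace X. q x \<in> U})"

lemma openin_quotient_topology:
  "openin (quotient_topology X q) U \<longleftrightarrow>
     U \<subseteq> q ` topspace X \<and> openin X {x \<in> topspace X. q x \<in> U}"
proof -
  have "openin X {x \<in> topspace X. q x \<in> S \<inter> T}"
    if "openin X {x \<in> topspace X. q x \<in> S}" "openin X {x \<in> topspace X. q x \<in> T}" for S T
  proof -
    have "{x \<in> topspace X. q x \<in> S \<inter> T} =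
        {x \<in> topspace X. q x \<in> S} \<inter> {x \<in> topspace X. q x \<in> T}"
      by blast
    then show ?thesis
      using openin_Int[OF that] by metis
  qed
  moreover have "openin X {x \<in> topspace X. q x \<in> \<Union>K}"
    if "\<forall>S\<in>K. openin X {x \<in> topspace X. q x \<in> S}" for K
  proof -
    have "{x \<in> topspace X. q x \<in> \<Union>K} = \<Union>((\<lambda>S. {x \<in> topspace X. q x \<in> S}) ` K)"
      by blast
    moreover have "openin X (\<Union>((\<lambda>S. {x \<in> topspace X. q x \<in> S}) ` K))"
      using that by (intro openin_Union) blast
    ultimately show ?thesis
      by metis
  qed
  ultimately have "istopology (\<lambda>U. U \<subseteq> q ` topspace X \<and> openin X {x \<in> topspace X. q x \<in> U})"
    unfolding istopology_def by (intro conjI allI impI) (blast+)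
  then show ?thesis
    unfolding quotient_topology_def by (subst topology_inverse') (assumption, rule refl)
qed

lemma quotient_map_quotient_topology: "quotient_map X (quotient_topology X q) q"
proof -
  have top: "topspace (quotient_topology X q) = q ` topspace X"
  proof
    show "topspace (quotient_topology X q) \<subseteq> q ` topspace X"
      using openin_topspace[of "quotient_topology X q"]
      unfolding openin_quotient_topology by (rule conjunct1)
    have "{x \<in> topspace X. q x \<in> q ` topspace X} = topspace X"
      by blast
    then have "openin (quotient_topology X q) (q ` topspace X)"
      unfolding openin_quotient_topology by simp
    then show "q ` topspace X \<subseteq> topspace (quotient_topology X q)"
      by (rule openin_subset)
  qed
  then show ?thesis
    unfolding quotient_map_def openin_quotient_topology by simp
qed

definition line :: "real^2 \<Rightarrow> (real^2) set" where
  "line v = {c *\<^sub>R v | c. c \<noteq> 0}"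

definition P1_R :: "(real^2) set topology" where
  "P1_R = quotient_topology (top_of_set (UNIV - {0})) line"

definition P1_Z :: "(real^2) set set" where
  "P1_Z = {line v | v. v \<noteq> 0 \<and> (\<forall>i. v $ i \<in> \<int>)}"

text \<open>Functions on \<open>\<S>\<close> are extensional, i.e. \<^const>\<open>undefined\<close> outside \<open>\<S>\<close>.\<close>

definition RS :: "('k::field dgmod set \<Rightarrow> real) topology" where
  "RS = product_topology (\<lambda>_. euclideanreal) \<S>"

definition PS_class :: "('k::field dgmod set \<Rightarrow> real) \<Rightarrow> ('k dgmod set \<Rightarrow> real) set" where
  "PS_class u = {(\<lambda>X\<in>\<S>. c * u X) | c. c \<noteq> 0}"

definition PS :: "('k::field dgmod set \<Rightarrow> real) set topology" where
  "PS = quotient_topology (subtopology RS (- {\<lambda>X\<in>\<S>. 0})) PS_class"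

section \<open>The maps \<open>i\<close> and \<open>h\<close>\<close>

text \<open>The action of \<open>PSL\<^sub>2(Z)\<close> on \<open>\<S>\<close> is induced by that of \<open>B\<^sub>3\<close>, so equivariance is required for all
  braid words. Since \<open>PSL\<^sub>2(Z)\<close> acts transitively on the target, at most one map (on \<open>\<S>\<close>) satisfies these
  conditions.\<close>

definition is_slope_map :: "('k::field dgmod set \<Rightarrow> (real^2) set) \<Rightarrow> bool" where
  "is_slope_map i \<longleftrightarrow>
     bij_betw i \<S> P1_Z \<and>
     (\<forall>w. \<forall>X \<in> \<S>. i (braid_act w X) = (*v) (braid_mat w) ` i X) \<and>
     i (sph_class (Pmod V1)) = line (vector [1, 0])"

definition hom_bar :: "'k::field dgmod \<Rightarrow> 'k dgmod \<Rightarrow> nat" where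
  "hom_bar a x = (if \<exists>j. isom x (shift j a) then 0
     else \<Sum>n | vectorspace.dim class_ring (Hom_deg n a x) \<noteq> 0.
       vectorspace.dim class_ring (Hom_deg n a x))"

definition hmap :: "'k::field dgmod set \<Rightarrow> ('k dgmod set \<Rightarrow> real) set" where
  "hmap X = PS_class (\<lambda>Y\<in>\<S>. real (hom_bar (rep X) (rep Y)))"

end

theory Submission
  imports Defs "HOL-Library.Function_Algebras" "HOL-Computational_Algebra.Formal_Power_Series"
begin

text \<open>The twist in \<open>P_u\<close> is the cone of \<open>P_u \<otimes> e_u y \<rightarrow> y\<close>. As a functor of \<open>y\<close> it has an adjoint, which is
  also a left inverse up to homotopy, so it preserves the dimensions of all morphism spaces; hence
  \<open>hom\<close> is invariant under the braid group. Running Euclid's algorithm on slopes, an object of slope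
  \<open>[a : c]\<close> with \<open>a \<ge> 0\<close>, \<open>c \<ge> 1\<close> is an explicit twisted complex of \<open>a\<close> copies of \<open>P_1\<close> and \<open>c\<close> copies of
  \<open>P_2\<close>, and for \<open>a < c\<close> the morphisms from \<open>P_1\<close> to it have total dimension \<open>c\<close>. By invariance
  \<open>hom(x, y)\<close> is the absolute value of the determinant of the slopes of \<open>x\<close> and \<open>y\<close>. Thus \<open>h\<close> extends to the map
  sending the line through \<open>v\<close> to the class of \<open>y \<mapsto> \<bar>det (v, slope y)\<bar>\<close>, which is injective because \<open>\<bar>v\<^sub>1\<bar>\<close>, \<open>\<bar>v\<^sub>2\<bar>\<close>
  and \<open>\<bar>v\<^sub>1 - v\<^sub>2\<bar>\<close> determine \<open>v\<close> up to sign; it is an embedding because the source is compact and the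
  target is Hausdorff.\<close>

section \<open>Vectors, scaling and pairing\<close>

text \<open>The twist of the definitions depends on a chosen basis of \<open>Hom\<close>, hence is
  not functorial on the nose. It is replaced by \<open>Tw\<close>, which tensors \<open>P_u\<close>
  with the whole complex \<open>e_u y\<close> instead of its cohomology. This involves no choice, so
  the adjoint, the unit and all homotopies can be written down and checked componentwise; over a
  field the two versions are equivalent because a complex retracts onto its cohomology. The adjoint
  \<open>Ti\<close> is explicit because \<open>A\<close> is a Frobenius algebra, with the
  coefficients of the loops as form: \<open>P_u \<otimes> W\<close> is also coinduced, so a map into
  it is determined by its loop component.

  The twisted complexes that occur have no differential from \<open>P_2\<close> back to
  \<open>P_1\<close>. Hence any linear maps of the right degrees define one, and only two splittings
  must be carried along: a left inverse for the twist in \<open>P_1\<close>, a right inverse for the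
  inverse twist in \<open>P_2\<close>. Each operation preserves one of them and creates the other.

  Bijectivity of the slope map turns arithmetic into statements about objects: every primitive
  vector is the slope of a spherical class, and classes of equal slope coincide.\<close>

text \<open>All modules live in one space of sequences. Power series serve only as the type of sequences; their
  multiplication plays no role. The pairing \<open>pr\<close> interleaves two sequences, which gives direct sums
  without leaving the type.\<close>

type_synonym 'k U = "'k fps"
type_synonym 'k fam = "int \<Rightarrow> vertex \<Rightarrow> 'k U \<Rightarrow> 'k U"

definition sc :: "'k::field \<Rightarrow> 'k U \<Rightarrow> 'k U" (infixr "\<star>" 75) where
  "c \<star> x = Abs_fps (\<lambda>i. c * fps_nth x i)"

definition fsc :: "'k::field \<Rightarrow> 'k fam \<Rightarrow> 'k fam" where
  "fsc c f = (\<lambda>n w x. c \<star> f n w x)"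

lemma sc_nth [simp]: "fps_nth (c \<star> x) i = c * fps_nth x i"
  by (simp add: sc_def)

lemma sc_simps [simp]:
  "c \<star> (d \<star> x) = (c * d) \<star> x" "1 \<star> x = x" "0 \<star> x = 0" "c \<star> 0 = 0"
  "c \<star> (- x) = - (c \<star> x)" "(- c) \<star> x = - (c \<star> x)"
  by (simp_all add: fps_eq_iff)

lemma sc_add: "c \<star> (x + y) = c \<star> x + c \<star> y"
  and sc_diff: "c \<star> (x - y) = c \<star> x - c \<star> y"
  and sc_add_left: "(c + d) \<star> x = c \<star> x + d \<star> x"
  by (simp_all add: fps_eq_iff algebra_simps)

definition pr :: "'k::field U \<Rightarrow> 'k U \<Rightarrow> 'k U" where
  "pr x y = Abs_fps (\<lambda>i. if even i then fps_nth x (i div 2) else fps_nth y (i div 2))"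
definition p1 :: "'k::field U \<Rightarrow> 'k U" where "p1 x = Abs_fps (\<lambda>i. fps_nth x (2 * i))"
definition p2 :: "'k::field U \<Rightarrow> 'k U" where "p2 x = Abs_fps (\<lambda>i. fps_nth x (2 * i + 1))"

lemma p1_pr [simp]: "p1 (pr x y) = x"
  and p2_pr [simp]: "p2 (pr x y) = y"
  by (simp_all add: pr_def p1_def p2_def fps_eq_iff)

lemma pr_p1_p2 [simp]: "pr (p1 x) (p2 x) = x"
  by (auto simp: pr_def p1_def p2_def fps_eq_iff)

lemma pr_eqI: "p1 x = p1 y \<Longrightarrow> p2 x = p2 y \<Longrightarrow> x = y"
  by (metis pr_p1_p2)

lemma pr_inject [simp]: "pr x y = pr x' y' \<longleftrightarrow> x = x' \<and> y = y'"
  by (metis p1_pr p2_pr)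

lemma p1_ops [simp]: "p1 (x + y) = p1 x + p1 y" "p1 (x - y) = p1 x - p1 y" "p1 (- x) = - p1 x"
   "p1 (c \<star> x) = c \<star> p1 x" "p1 0 = 0"
  by (simp_all add: p1_def fps_eq_iff)

lemma p2_ops [simp]: "p2 (x + y) = p2 x + p2 y" "p2 (x - y) = p2 x - p2 y" "p2 (- x) = - p2 x"
   "p2 (c \<star> x) = c \<star> p2 x" "p2 0 = 0"
  by (simp_all add: p2_def fps_eq_iff)

lemma pr_0_0 [simp]: "pr 0 0 = 0"
  by (rule pr_eqI) simp_all

section \<open>Linear maps and subspaces inside the space of sequences\<close>

definition lin :: "('k::field U \<Rightarrow> 'k U) \<Rightarrow> bool" where
  "lin f \<longleftrightarrow> (\<forall>x y. f (x + y) = f x + f y) \<and> (\<forall>c x. f (c \<star> x) = c \<star> f x)"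

lemma linI: "(\<And>x y. f (x + y) = f x + f y) \<Longrightarrow> (\<And>c x. f (c \<star> x) = c \<star> f x) \<Longrightarrow> lin f"
  by (simp add: lin_def)

lemma lin_add: "lin f \<Longrightarrow> f (x + y) = f x + f y"
  and lin_sc: "lin f \<Longrightarrow> f (c \<star> x) = c \<star> f x"
  by (simp_all add: lin_def)

lemma lin_0: assumes "lin f" shows "f 0 = 0"
  using lin_sc[OF assms, of 0 0] by simp

lemma lin_neg: assumes "lin f" shows "f (- x) = - f x"
  using lin_sc[OF assms, of "-1" x] by simp

lemma lin_diff: assumes "lin f" shows "f (x - y) = f x - f y"
  using lin_add[OF assms, of x "- y"] lin_neg[OF assms, of y] by simp

lemmas lin_simps = lin_add lin_sc lin_0 lin_neg lin_diff

lemma lin_sum: assumes "lin f" shows "f (\<Sum>i\<in>I. g i) = (\<Sum>i\<in>I. f (g i))"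
  by (induction I rule: infinite_finite_induct) (simp_all add: lin_0[OF assms] lin_add[OF assms])

lemma lin_id: "lin (\<lambda>x. x)" by (auto intro: linI)
lemma lin_zero: "lin (\<lambda>x. 0)" by (auto intro: linI)
lemma lin_comp: "lin f \<Longrightarrow> lin g \<Longrightarrow> lin (\<lambda>x. f (g x))" by (auto simp: lin_def)
lemma lin_plus: "lin f \<Longrightarrow> lin g \<Longrightarrow> lin (\<lambda>x. f x + g x)" by (auto simp: lin_def sc_add)
lemma lin_minus: "lin f \<Longrightarrow> lin g \<Longrightarrow> lin (\<lambda>x. f x - g x)" by (auto simp: lin_def sc_diff)
lemma lin_uminus: "lin f \<Longrightarrow> lin (\<lambda>x. - f x)" by (auto simp: lin_def)
lemma lin_scale: "lin f \<Longrightarrow> lin (\<lambda>x. c \<star> f x)" by (auto simp: lin_def sc_add mult.commute)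
lemma lin_plus': "lin f \<Longrightarrow> lin g \<Longrightarrow> lin (f + g)" by (auto simp: lin_def sc_add)
lemma lin_zero': "lin 0" by (auto simp: lin_def)
lemma lin_pr: "lin f \<Longrightarrow> lin g \<Longrightarrow> lin (\<lambda>x. pr (f x) (g x))"
  unfolding lin_def by (intro conjI allI; rule pr_eqI; simp)
lemma lin_p1_comp: "lin f \<Longrightarrow> lin (\<lambda>x. p1 (f x))" by (auto simp: lin_def)
lemma lin_p2_comp: "lin f \<Longrightarrow> lin (\<lambda>x. p2 (f x))" by (auto simp: lin_def)

lemmas lin_intros = lin_id lin_zero lin_plus lin_minus lin_uminus lin_scale lin_pr lin_p1_comp lin_p2_comp

definition sub :: "'k::field U set \<Rightarrow> bool" where
  "sub S \<longleftrightarrow> 0 \<in> S \<and> (\<forall>x\<in>S. \<forall>y\<in>S. x + y \<in> S) \<and> (\<forall>c. \<forall>x\<in>S. c \<star> x \<in> S)"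

lemma sub_0: "sub S \<Longrightarrow> 0 \<in> S" by (simp add: sub_def)
lemma sub_add: "sub S \<Longrightarrow> x \<in> S \<Longrightarrow> y \<in> S \<Longrightarrow> x + y \<in> S" by (simp add: sub_def)
lemma sub_sc: "sub S \<Longrightarrow> x \<in> S \<Longrightarrow> c \<star> x \<in> S" by (simp add: sub_def)
lemma sub_neg: "sub S \<Longrightarrow> x \<in> S \<Longrightarrow> - x \<in> S" using sub_sc[of S x "-1"] by simp
lemma sub_diff: "sub S \<Longrightarrow> x \<in> S \<Longrightarrow> y \<in> S \<Longrightarrow> x - y \<in> S"
  using sub_add[of S x "-y"] sub_neg[of S y] by simp
lemma sub_sum: "sub S \<Longrightarrow> (\<And>i. i \<in> I \<Longrightarrow> g i \<in> S) \<Longrightarrow> (\<Sum>i\<in>I. g i) \<in> S"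
  by (induction I rule: infinite_finite_induct) (auto simp: sub_0 sub_add)

lemmas sub_closed = sub_0 sub_add sub_sc sub_neg sub_diff

lemma sgn_pow_sq [simp]: "sgn_pow m * sgn_pow m = (1::'k::field)"
  by (simp add: sgn_pow_def)
lemma sgn_pow_sq' [simp]: "sgn_pow m * (sgn_pow m * x) = (x::'k::field)"
  by (simp add: sgn_pow_def)
lemma sgn_pow_add: "sgn_pow (m + n) = (sgn_pow m * sgn_pow n :: 'k::field)"
  by (simp add: sgn_pow_def)
lemma sgn_pow_0 [simp]: "sgn_pow 0 = 1" by (simp add: sgn_pow_def)
lemma sgn_pow_1 [simp]: "sgn_pow 1 = (-1 :: 'k::field)" by (simp add: sgn_pow_def)
lemma sgn_pow_minus [simp]: "sgn_pow (- m) = (sgn_pow m :: 'k::field)" by (simp add: sgn_pow_def)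
lemma sgn_pow_diff: "sgn_pow (m - n) = (sgn_pow m * sgn_pow n :: 'k::field)"
  by (simp add: sgn_pow_def)

lemma opp_opp [simp]: "opp (opp v) = v" by (cases v) auto
lemma opp_neq [simp]: "opp v \<noteq> v" "v \<noteq> opp v" by (cases v; auto)+
lemma vertex_cases: "w = u \<or> w = opp u" by (cases u; cases w) auto

section \<open>Graded modules as families of subspaces\<close>

text \<open>\<open>V n w\<close> is the degree \<open>n\<close> part at the vertex \<open>w\<close>, \<open>A w\<close> the action of the arrow with source \<open>w\<close> and \<open>D\<close> the
  differential. Only the values on \<open>V\<close> matter.\<close>

record 'k kmod =
  V :: "int \<Rightarrow> vertex \<Rightarrow> 'k U set"
  A :: "vertex \<Rightarrow> 'k U \<Rightarrow> 'k U"
  D :: "'k fam"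

text \<open>An arrow has degree 1, so the differential of a left module anticommutes with it. Loops
  are not recorded: they act as products of two arrows, and \<open>A A A = 0\<close> is the
  vanishing of paths of length three.\<close>

definition kmod :: "'k::field kmod \<Rightarrow> bool" where
  "kmod M \<longleftrightarrow> (\<forall>n w. sub (V M n w) \<and> lin (A M w) \<and> lin (D M n w)) \<and>
    (\<forall>n w. \<forall>x \<in> V M n w.
      A M w x \<in> V M (n + 1) (opp w) \<and> D M n w x \<in> V M (n + 1) w \<and>
      D M (n + 1) w (D M n w x) = 0 \<and> A M w (A M (opp w) (A M w x)) = 0 \<and>
      D M (n + 1) (opp w) (A M w x) = - A M w (D M n w x))"

lemma kmod_sub: "kmod M \<Longrightarrow> sub (V M n w)"
  and kmod_linA: "kmod M \<Longrightarrow> lin (A M w)"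
  and kmod_linD: "kmod M \<Longrightarrow> lin (D M n w)"
  and kmod_A: "kmod M \<Longrightarrow> x \<in> V M n w \<Longrightarrow> A M w x \<in> V M (n + 1) (opp w)"
  and kmod_D: "kmod M \<Longrightarrow> x \<in> V M n w \<Longrightarrow> D M n w x \<in> V M (n + 1) w"
  and kmod_DD: "kmod M \<Longrightarrow> x \<in> V M n w \<Longrightarrow> D M (n + 1) w (D M n w x) = 0"
  and kmod_AAA: "kmod M \<Longrightarrow> x \<in> V M n w \<Longrightarrow> A M w (A M (opp w) (A M w x)) = 0"
  and kmod_DA: "kmod M \<Longrightarrow> x \<in> V M n w \<Longrightarrow> D M (n + 1) (opp w) (A M w x) = - A M w (D M n w x)"
  unfolding kmod_def by blast+

section \<open>Complexes of graded morphisms, composition and homotopy equivalence\<close>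

definition hom :: "int \<Rightarrow> 'k::field kmod \<Rightarrow> 'k kmod \<Rightarrow> 'k fam set" where
  "hom m M N = {f. (\<forall>n w. lin (f n w)) \<and> (\<forall>n w. \<forall>x \<in> V M n w. f n w x \<in> V N (n + m) w \<and>
     f (n + 1) (opp w) (A M w x) = sgn_pow m \<star> A N w (f n w x))}"

definition diff_hom :: "int \<Rightarrow> 'k::field kmod \<Rightarrow> 'k kmod \<Rightarrow> 'k fam \<Rightarrow> 'k fam" where
  "diff_hom m M N f = (\<lambda>n w x. D N (n + m) w (f n w x) - sgn_pow m \<star> f (n + 1) w (D M n w x))"

definition cyc :: "int \<Rightarrow> 'k::field kmod \<Rightarrow> 'k kmod \<Rightarrow> 'k fam set" where
  "cyc m M N = {f \<in> hom m M N. \<forall>n w. \<forall>x \<in> V M n w.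
     f (n + 1) w (D M n w x) = sgn_pow m \<star> D N (n + m) w (f n w x)}"

text \<open>The equation is required on \<open>V\<close> only. In particular every family vanishing
  on \<open>V\<close> is a boundary, so families that agree on the module are identified modulo
  boundaries.\<close>

definition bdr :: "int \<Rightarrow> 'k::field kmod \<Rightarrow> 'k kmod \<Rightarrow> 'k fam set" where
  "bdr m M N = {f. \<exists>s \<in> hom (m - 1) M N. \<forall>n w. \<forall>x \<in> V M n w. f n w x = diff_hom (m - 1) M N s n w x}"

definition comp :: "int \<Rightarrow> 'k fam \<Rightarrow> 'k fam \<Rightarrow> 'k fam" where
  "comp m g f = (\<lambda>n w x. g (n + m) w (f n w x))"

definition idf :: "'k fam" where "idf = (\<lambda>n w x. x)"

text \<open>An equivalence of degree \<open>m\<close> stands for an equivalence of \<open>M\<close>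
  with \<open>N[m]\<close>; carrying the degree avoids a shift operation on families.\<close>

definition heq :: "int \<Rightarrow> 'k::field kmod \<Rightarrow> 'k kmod \<Rightarrow> bool" where
  "heq m M N \<longleftrightarrow> (\<exists>f \<in> cyc m M N. \<exists>g \<in> cyc (- m) N M.
     comp m g f - idf \<in> bdr 0 M M \<and> comp (- m) f g - idf \<in> bdr 0 N N)"

lemma homD: assumes "f \<in> hom m M N"
  shows "lin (f n w)" "x \<in> V M n w \<Longrightarrow> f n w x \<in> V N (n + m) w"
    "x \<in> V M n w \<Longrightarrow> f (n + 1) (opp w) (A M w x) = sgn_pow m \<star> A N w (f n w x)"
  using assms unfolding hom_def by blast+

lemma homI: assumes "\<And>n w. lin (f n w)" "\<And>n w x. x \<in> V M n w \<Longrightarrow> f n w x \<in> V N (n + m) w"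
    "\<And>n w x. x \<in> V M n w \<Longrightarrow> f (n + 1) (opp w) (A M w x) = sgn_pow m \<star> A N w (f n w x)"
  shows "f \<in> hom m M N"
  using assms unfolding hom_def by blast

lemma cycD: assumes "f \<in> cyc m M N"
  shows "f \<in> hom m M N"
    "x \<in> V M n w \<Longrightarrow> f (n + 1) w (D M n w x) = sgn_pow m \<star> D N (n + m) w (f n w x)"
  using assms unfolding cyc_def by blast+

lemma cycI: assumes "f \<in> hom m M N"
    "\<And>n w x. x \<in> V M n w \<Longrightarrow> f (n + 1) w (D M n w x) = sgn_pow m \<star> D N (n + m) w (f n w x)"
  shows "f \<in> cyc m M N"
  using assms unfolding cyc_def by blast

lemma bdrI: assumes "s \<in> hom (m - 1) M N"
    "\<And>n w x. x \<in> V M n w \<Longrightarrow> f n w x = D N (n + m - 1) w (s n w x) + sgn_pow m \<star> s (n + 1) w (D M n w x)"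
  shows "f \<in> bdr m M N"
  unfolding bdr_def diff_hom_def using assms by (auto simp: sgn_pow_diff algebra_simps intro!: bexI[of _ s])

lemma bdrE: assumes "f \<in> bdr m M N"
  obtains s where "s \<in> hom (m - 1) M N"
    "\<And>n w x. x \<in> V M n w \<Longrightarrow> f n w x = D N (n + m - 1) w (s n w x) + sgn_pow m \<star> s (n + 1) w (D M n w x)"
proof -
  from assms obtain s where s: "s \<in> hom (m - 1) M N"
    "\<And>n w x. x \<in> V M n w \<Longrightarrow> f n w x = diff_hom (m - 1) M N s n w x" unfolding bdr_def by blast
  show thesis by (rule that[OF s(1)]) (use s(2) in \<open>auto simp: diff_hom_def sgn_pow_diff algebra_simps\<close>)
qed

lemma hom_add: assumes "kmod N" "f \<in> hom m M N" "g \<in> hom m M N" shows "f + g \<in> hom m M N"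
  using assms by (intro homI)
    (auto simp: homD sc_add kmod_linA lin_simps intro!: lin_plus' sub_closed[OF kmod_sub] dest: homD)

lemma hom_fsc: assumes "kmod N" "f \<in> hom m M N" shows "fsc c f \<in> hom m M N"
  using assms by (intro homI)
    (auto simp: fsc_def homD kmod_linA lin_simps mult.commute intro!: lin_scale sub_closed[OF kmod_sub] dest: homD)

lemma hom_0: assumes "kmod N" shows "0 \<in> hom m M N"
  using assms by (intro homI) (auto simp: kmod_linA lin_simps intro!: lin_zero' sub_closed[OF kmod_sub])

lemma fsc_apply [simp]: "fsc c f n w x = c \<star> f n w x" by (simp add: fsc_def)

lemma cyc_add: assumes "kmod N" "f \<in> cyc m M N" "g \<in> cyc m M N" shows "f + g \<in> cyc m M N"
  using assms by (intro cycI hom_add) (auto simp: cycD sc_add kmod_linD lin_simps dest: cycD)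

lemma cyc_fsc: assumes "kmod N" "f \<in> cyc m M N" shows "fsc c f \<in> cyc m M N"
  using assms by (intro cycI hom_fsc) (auto simp: cycD kmod_linD lin_simps mult.commute dest: cycD)

lemma cyc_0: assumes "kmod N" shows "0 \<in> cyc m M N"
  using assms by (intro cycI hom_0) (auto simp: kmod_linD lin_simps)

lemma bdr_add: assumes "kmod N" "f \<in> bdr m M N" "g \<in> bdr m M N" shows "f + g \<in> bdr m M N"
proof -
  obtain s where s: "s \<in> hom (m - 1) M N" "\<And>n w x. x \<in> V M n w \<Longrightarrow> f n w x = D N (n + m - 1) w (s n w x) + sgn_pow m \<star> s (n + 1) w (D M n w x)"
    by (rule bdrE[OF assms(2)]) (rule that)
  obtain t where t: "t \<in> hom (m - 1) M N" "\<And>n w x. x \<in> V M n w \<Longrightarrow> g n w x = D N (n + m - 1) w (t n w x) + sgn_pow m \<star> t (n + 1) w (D M n w x)"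
    by (rule bdrE[OF assms(3)]) (rule that)
  show ?thesis
    by (rule bdrI[OF hom_add[OF assms(1) s(1) t(1)]])
      (simp add: s(2) t(2) lin_simps[OF kmod_linD[OF assms(1)]] sc_add algebra_simps)
qed

lemma bdr_fsc: assumes "kmod N" "f \<in> bdr m M N" shows "fsc c f \<in> bdr m M N"
proof -
  obtain s where s: "s \<in> hom (m - 1) M N" "\<And>n w x. x \<in> V M n w \<Longrightarrow> f n w x = D N (n + m - 1) w (s n w x) + sgn_pow m \<star> s (n + 1) w (D M n w x)"
    by (rule bdrE[OF assms(2)]) (rule that)
  show ?thesis
    by (rule bdrI[OF hom_fsc[OF assms(1) s(1), of c]])
      (simp add: s(2) lin_simps[OF kmod_linD[OF assms(1)]] sc_add mult.commute)
qed

lemma bdr_0: assumes "kmod N" shows "0 \<in> bdr m M N"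
  by (rule bdrI[OF hom_0[OF assms]]) (simp add: lin_simps[OF kmod_linD[OF assms(1)]])

lemma fsc_neg: "fsc (- 1) f = - f" by (auto simp: fun_eq_iff)

lemma bdr_neg: assumes "kmod N" "f \<in> bdr m M N" shows "- f \<in> bdr m M N"
  using bdr_fsc[OF assms, of "-1"] by (simp add: fsc_neg)

lemma bdr_diff: assumes "kmod N" "f \<in> bdr m M N" "g \<in> bdr m M N" shows "f - g \<in> bdr m M N"
  using bdr_add[OF assms(1,2) bdr_neg[OF assms(1,3)]] by simp

lemma cyc_diff: assumes "kmod N" "f \<in> cyc m M N" "g \<in> cyc m M N" shows "f - g \<in> cyc m M N"
  using cyc_add[OF assms(1,2) cyc_fsc[OF assms(1,3), of "-1"]] by (simp add: fsc_neg)

lemma bdr_cong: assumes "f \<in> bdr m M N" "\<And>n w x. x \<in> V M n w \<Longrightarrow> f n w x = g n w x"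
  shows "g \<in> bdr m M N"
  using assms by (auto simp: bdr_def)

lemma hom_comp: assumes "f \<in> hom m M N" "g \<in> hom k N P" "\<And>w. lin (A P w)"
  shows "comp m g f \<in> hom (m + k) M P"
proof (rule homI)
  fix n w x show "lin (comp m g f n w)" unfolding comp_def
    by (rule lin_comp[OF homD(1)[OF assms(2)] homD(1)[OF assms(1)]])
  assume x: "x \<in> V M n w"
  have y: "f n w x \<in> V N (n + m) w" using homD(2)[OF assms(1) x] .
  show "comp m g f n w x \<in> V P (n + (m + k)) w"
    using homD(2)[OF assms(2) y] by (simp add: comp_def ac_simps)
  show "comp m g f (n + 1) (opp w) (A M w x) = sgn_pow (m + k) \<star> A P w (comp m g f n w x)"
    using homD(3)[OF assms(2) y] homD(3)[OF assms(1) x] homD(1)[OF assms(2)]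
    by (simp add: comp_def lin_simps sgn_pow_add ac_simps)
qed

lemma cyc_comp: assumes "f \<in> cyc m M N" "g \<in> cyc k N P" "kmod P"
  shows "comp m g f \<in> cyc (m + k) M P"
proof (rule cycI)
  show "comp m g f \<in> hom (m + k) M P"
    using assms by (intro hom_comp) (auto dest: cycD kmod_linA)
  fix n w x assume x: "x \<in> V M n w"
  have y: "f n w x \<in> V N (n + m) w" using homD(2)[OF cycD(1)[OF assms(1)] x] .
  show "comp m g f (n + 1) w (D M n w x) = sgn_pow (m + k) \<star> D P (n + (m + k)) w (comp m g f n w x)"
    using cycD(2)[OF assms(2) y] cycD(2)[OF assms(1) x] homD(1)[OF cycD(1)[OF assms(2)]]
    by (simp add: comp_def lin_simps sgn_pow_add ac_simps)
qed

text \<open>If \<open>f\<close> is the boundary of \<open>s\<close>, then \<open>g f\<close> is the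
  boundary of \<open>(-1)^k g s\<close>, because \<open>g\<close> passes the differential with the
  sign \<open>(-1)^k\<close>.\<close>

lemma bdr_post: assumes "f \<in> bdr m M N" "g \<in> cyc k N P" "kmod N" "kmod P" "kmod M"
  shows "comp m g f \<in> bdr (m + k) M P"
proof -
  obtain s where s: "s \<in> hom (m - 1) M N"
    "\<And>n w x. x \<in> V M n w \<Longrightarrow> f n w x = D N (n + m - 1) w (s n w x) + sgn_pow m \<star> s (n + 1) w (D M n w x)"
    by (rule bdrE[OF assms(1)]) (rule that)
  have "comp (m - 1) g s \<in> hom ((m - 1) + k) M P"
    using assms s by (intro hom_comp) (auto dest: cycD kmod_linA)
  then have t: "fsc (sgn_pow k) (comp (m - 1) g s) \<in> hom (m + k - 1) M P"
    using hom_fsc[OF assms(4)] by (simp add: algebra_simps)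
  show ?thesis
  proof (rule bdrI[OF t])
    fix n w x assume x: "x \<in> V M n w"
    have y: "s n w x \<in> V N (n + m - 1) w" using homD(2)[OF s(1) x] by (simp add: algebra_simps)
    have y2: "s (n + 1) w (D M n w x) \<in> V N (n + m) w"
      using homD(2)[OF s(1) kmod_D[OF assms(5) x]] by (simp add: algebra_simps)
    have l: "lin (g n w)" for n w using homD(1)[OF cycD(1)[OF assms(2)]] .
    show "comp m g f n w x = D P (n + (m + k) - 1) w (fsc (sgn_pow k) (comp (m - 1) g s) n w x) +
       sgn_pow (m + k) \<star> fsc (sgn_pow k) (comp (m - 1) g s) (n + 1) w (D M n w x)"
      using s(2)[OF x] cycD(2)[OF assms(2) y]
      by (simp add: comp_def lin_simps[OF l] lin_simps[OF kmod_linD[OF assms(4)]] sgn_pow_add sc_add algebra_simps)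
  qed
qed

lemma bdr_pre: assumes "f \<in> bdr m N P" "g \<in> cyc k M N" "kmod N" "kmod P" "kmod M"
  shows "comp k f g \<in> bdr (k + m) M P"
proof -
  obtain s where s: "s \<in> hom (m - 1) N P"
    "\<And>n w x. x \<in> V N n w \<Longrightarrow> f n w x = D P (n + m - 1) w (s n w x) + sgn_pow m \<star> s (n + 1) w (D N n w x)"
    by (rule bdrE[OF assms(1)]) (rule that)
  have t: "comp k s g \<in> hom (k + m - 1) M P"
    using hom_comp[OF cycD(1)[OF assms(2)] s(1) kmod_linA[OF assms(4)]] by (simp add: algebra_simps)
  show ?thesis
  proof (rule bdrI[OF t])
    fix n w x assume x: "x \<in> V M n w"
    have y: "g n w x \<in> V N (n + k) w" using homD(2)[OF cycD(1)[OF assms(2)] x] by (simp add: algebra_simps)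
    have l: "lin (s n w)" for n w using homD(1)[OF s(1)] .
    show "comp k f g n w x = D P (n + (k + m) - 1) w (comp k s g n w x) +
       sgn_pow (k + m) \<star> comp k s g (n + 1) w (D M n w x)"
      using s(2)[OF y] cycD(2)[OF assms(2) x]
      by (simp add: comp_def lin_simps[OF l] sgn_pow_add sc_add algebra_simps)
  qed
qed

lemma comp_idf [simp]: "comp 0 f idf = f" "comp m idf f = f" by (auto simp: comp_def idf_def)

lemma comp_diff_left: "comp m (g - g') f = comp m g f - comp m g' f"
  by (auto simp: comp_def fun_eq_iff)
lemma comp_diff_right: assumes "\<And>n w. lin (g n w)" shows "comp m g (f - f') = comp m g f - comp m g f'"
  by (simp add: comp_def fun_eq_iff lin_simps[OF assms])

lemma heq_refl: assumes "kmod M" shows "heq 0 M M"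
  unfolding heq_def
proof (intro bexI conjI)
  have l: "idf n w = (\<lambda>x. x)" for n w unfolding idf_def by simp
  show *: "idf \<in> cyc 0 M M" by (intro cycI homI) (auto simp: l lin_intros)
  then show "idf \<in> cyc (- 0) M M" by simp
qed (use bdr_0[OF assms] in auto)

lemma heq_sym: "heq m M N \<Longrightarrow> heq (- m) N M"
  unfolding heq_def by force

text \<open>Sandwiching the homotopy from \<open>g' f'\<close> to the identity between
  \<open>g\<close> and \<open>f\<close> compares \<open>g g' f' f\<close> with \<open>g f\<close>,
  which is itself homotopic to the identity. Both halves of transitivity are instances.\<close>

lemma heq_trans_aux:
  assumes M: "kmod M" "kmod N" "kmod P"
    and f: "f \<in> cyc m M N" "g \<in> cyc (- m) N M" "comp m g f - idf \<in> bdr 0 M M"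
    and f': "f' \<in> cyc k N P" "g' \<in> cyc (- k) P N" "comp k g' f' - idf \<in> bdr 0 N N"
  shows "comp (m + k) (comp (- k) g g') (comp m f' f) - idf \<in> bdr 0 M M"
proof -
  have lg: "lin (g n w)" for n w using homD(1)[OF cycD(1)[OF f(2)]] .
  have "comp m (comp k g' f' - idf) f \<in> bdr m M N"
    using bdr_pre[OF f'(3) f(1)] M by simp
  from bdr_post[OF this f(2)] M have "comp m g (comp m (comp k g' f' - idf) f) \<in> bdr 0 M M" by simp
  then have "comp m g (comp m (comp k g' f') f) - comp m g f \<in> bdr 0 M M"
    by (simp add: comp_diff_left comp_diff_right[OF lg])
  from bdr_add[OF M(1) this f(3)] show ?thesis
    by (simp add: comp_def ac_simps)
qed

lemma heq_trans: assumes M: "kmod M" "kmod N" "kmod P" and "heq m M N" "heq k N P"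
  shows "heq (m + k) M P"
proof -
  from assms obtain f g where f: "f \<in> cyc m M N" "g \<in> cyc (- m) N M" "comp m g f - idf \<in> bdr 0 M M" "comp (- m) f g - idf \<in> bdr 0 N N"
    unfolding heq_def by blast
  from assms obtain f' g' where f': "f' \<in> cyc k N P" "g' \<in> cyc (- k) P N" "comp k g' f' - idf \<in> bdr 0 N N" "comp (- k) f' g' - idf \<in> bdr 0 P P"
    unfolding heq_def by blast
  show ?thesis unfolding heq_def
  proof (intro bexI conjI)
    show "comp m f' f \<in> cyc (m + k) M P" using f f' M by (intro cyc_comp)
    show "comp (-k) g g' \<in> cyc (- (m + k)) P M" using cyc_comp[OF f'(2) f(2) M(1)] by (simp add: algebra_simps)
    show "comp (m + k) (comp (- k) g g') (comp m f' f) - idf \<in> bdr 0 M M"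
      by (rule heq_trans_aux[OF M f(1-3) f'(1-3)])
    show "comp (- (m + k)) (comp m f' f) (comp (- k) g g') - idf \<in> bdr 0 P P"
      using heq_trans_aux[OF M(3,2,1) f'(2) _ f'(4) f(2) _ f(4)] f f' by (simp add: algebra_simps)
  qed
qed

section \<open>Dimension of a quotient\<close>

text \<open>Elements of \<open>Z\<close> representing a basis of \<open>Z / B\<close>, so that no
  quotient space has to be formed. It serves both for morphism complexes and for the cohomology of a
  module at a vertex.\<close>

definition quot_basis :: "('k::field \<Rightarrow> 'x \<Rightarrow> 'x) \<Rightarrow> 'x::ab_group_add set \<Rightarrow> 'x set \<Rightarrow> (nat \<Rightarrow> 'x) \<Rightarrow> nat \<Rightarrow> bool" where
  "quot_basis scl Z B b r \<longleftrightarrow> (\<forall>i<r. b i \<in> Z) \<and>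
    (\<forall>f\<in>Z. \<exists>c. f - (\<Sum>i<r. scl (c i) (b i)) \<in> B) \<and>
    (\<forall>c. (\<Sum>i<r. scl (c i) (b i)) \<in> B \<longrightarrow> (\<forall>i<r. c i = 0))"

text \<open>A linear map inducing an isomorphism of the quotients carries representatives of a basis
  to representatives of a basis; surjectivity is needed only modulo \<open>B'\<close>.\<close>

lemma quot_basis_transfer:
  assumes quot_basis: "quot_basis scl Z B b r"
    and Z: "0 \<in> Z" "\<And>x y. x \<in> Z \<Longrightarrow> y \<in> Z \<Longrightarrow> x + y \<in> Z" "\<And>x y. x \<in> Z \<Longrightarrow> y \<in> Z \<Longrightarrow> x - y \<in> Z" "\<And>c x. x \<in> Z \<Longrightarrow> scl c x \<in> Z"
    and phi: "\<And>x y. \<phi> (x + y) = \<phi> x + \<phi> y" "\<And>c x. \<phi> (scl c x) = scl' c (\<phi> x)"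
    and im: "\<And>x. x \<in> Z \<Longrightarrow> \<phi> x \<in> Z'" and B: "\<And>x. x \<in> Z \<Longrightarrow> \<phi> x \<in> B' \<longleftrightarrow> x \<in> B"
    and surj: "\<And>y. y \<in> Z' \<Longrightarrow> \<exists>x\<in>Z. y - \<phi> x \<in> B'"
    and B': "\<And>x y. x \<in> B' \<Longrightarrow> y \<in> B' \<Longrightarrow> x + y \<in> B'"
  shows "quot_basis scl' Z' B' (\<lambda>i. \<phi> (b i)) r"
proof -
  have p0: "\<phi> 0 = 0" using phi(1)[of 0 0] by simp
  have ps: "\<phi> (\<Sum>i\<in>I. g i) = (\<Sum>i\<in>I. \<phi> (g i))" for I :: "nat set" and g
    by (induction I rule: infinite_finite_induct) (auto simp: p0 phi)
  have pd: "\<phi> (x - y) = \<phi> x - \<phi> y" for x y using phi(1)[of "x - y" y] by simp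
  have bZ: "b i \<in> Z" if "i < r" for i using quot_basis that unfolding quot_basis_def by blast
  have sZ: "(\<Sum>i\<in>I. scl (c i) (b i)) \<in> Z" if "I \<subseteq> {..<r}" for c I
    using that by (induction I rule: infinite_finite_induct) (auto simp: Z bZ)
  have eq: "(\<Sum>i<r. scl' (c i) (\<phi> (b i))) = \<phi> (\<Sum>i<r. scl (c i) (b i))" for c
    by (simp add: ps phi)
  show ?thesis unfolding quot_basis_def eq
  proof (intro conjI allI ballI impI)
    show "\<phi> (b i) \<in> Z'" if "i < r" for i using bZ im that by blast
  next
    fix y assume "y \<in> Z'"
    then obtain x where x: "x \<in> Z" "y - \<phi> x \<in> B'" using surj by blast
    obtain c where c: "x - (\<Sum>i<r. scl (c i) (b i)) \<in> B" using quot_basis x(1) unfolding quot_basis_def by blast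
    have "\<phi> (x - (\<Sum>i<r. scl (c i) (b i))) \<in> B'"
      using B[of "x - (\<Sum>i<r. scl (c i) (b i))"] c Z(3)[OF x(1) sZ] by simp
    then have "y - \<phi> x + (\<phi> x - \<phi> (\<Sum>i<r. scl (c i) (b i))) \<in> B'"
      using x(2) by (intro B') (auto simp: pd)
    then show "\<exists>c. y - \<phi> (\<Sum>i<r. scl (c i) (b i)) \<in> B'" by auto
  next
    fix c i assume "\<phi> (\<Sum>i<r. scl (c i) (b i)) \<in> B'" "i < r"
    then show "c i = 0" using B[OF sZ[of "{..<r}" c]] quot_basis unfolding quot_basis_def by auto
  qed
qed

text \<open>A relation rather than a function: it asserts finite dimension together with its value,
  and it can be transported along isomorphisms before the number is known to be unique.\<close>

definition hdim :: "int \<Rightarrow> 'k::field kmod \<Rightarrow> 'k kmod \<Rightarrow> nat \<Rightarrow> bool" where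
  "hdim m M N r \<longleftrightarrow> (\<exists>b. quot_basis fsc (cyc m M N) (bdr m M N) b r)"

lemma hdim_transfer:
  assumes hdim: "hdim m M N r" and N: "kmod N" "kmod N'"
    and phi: "\<And>x y. \<phi> (x + y) = \<phi> x + \<phi> y" "\<And>c x. \<phi> (fsc c x) = fsc c (\<phi> x)"
    and "\<And>x. x \<in> cyc m M N \<Longrightarrow> \<phi> x \<in> cyc m' M' N'" "\<And>x. x \<in> cyc m M N \<Longrightarrow> \<phi> x \<in> bdr m' M' N' \<longleftrightarrow> x \<in> bdr m M N"
    and "\<And>y. y \<in> cyc m' M' N' \<Longrightarrow> \<exists>x\<in>cyc m M N. y - \<phi> x \<in> bdr m' M' N'"
  shows "hdim m' M' N' r"
proof -
  obtain b where "quot_basis fsc (cyc m M N) (bdr m M N) b r" using hdim unfolding hdim_def by blast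
  then have "quot_basis fsc (cyc m' M' N') (bdr m' M' N') (\<lambda>i. \<phi> (b i)) r"
    by (rule quot_basis_transfer) (fact assms cyc_0[OF N(1)] cyc_add[OF N(1)] cyc_diff[OF N(1)] cyc_fsc[OF N(1)] bdr_add[OF N(2)])+
  then show ?thesis unfolding hdim_def by blast
qed

text \<open>Composition with \<open>f\<close> is invertible modulo boundaries, with composition with
  \<open>g\<close> as inverse; an equivalence of degree \<open>k\<close> in the target moves degrees
  of morphisms by \<open>k\<close>.\<close>

lemma hdim_post: assumes M: "kmod M" "kmod N" "kmod N'" and "heq k N N'" and hdim: "hdim m M N r"
  shows "hdim (m + k) M N' r"
proof -
  from assms obtain f g where f: "f \<in> cyc k N N'" "g \<in> cyc (- k) N' N" "comp k g f - idf \<in> bdr 0 N N" "comp (- k) f g - idf \<in> bdr 0 N' N'"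
    unfolding heq_def by blast
  have lf: "lin (f n w)" for n w using homD(1)[OF cycD(1)[OF f(1)]] .
  have lg: "lin (g n w)" for n w using homD(1)[OF cycD(1)[OF f(2)]] .
  show ?thesis
  proof (rule hdim_transfer[OF hdim M(2,3), where \<phi>="comp m f"])
    show "comp m f (x + y) = comp m f x + comp m f y" "comp m f (fsc c x) = fsc c (comp m f x)" for x y c
      by (simp_all add: comp_def fun_eq_iff lin_simps[OF lf])
    fix x assume x: "x \<in> cyc m M N"
    show "comp m f x \<in> cyc (m + k) M N'" using x f M by (intro cyc_comp)
    show "comp m f x \<in> bdr (m + k) M N' \<longleftrightarrow> x \<in> bdr m M N"
    proof
      assume "x \<in> bdr m M N" then show "comp m f x \<in> bdr (m + k) M N'" using f M by (intro bdr_post)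
    next
      assume "comp m f x \<in> bdr (m + k) M N'"
      \<comment> \<open>\<open>g f x\<close> is a boundary, and it differs from \<open>x\<close> by
        the homotopy of \<open>g f\<close> to the identity composed with \<open>x\<close>.\<close>
      from bdr_post[OF this f(2) M(3,2,1)] have a: "comp (m + k) g (comp m f x) \<in> bdr m M N" by simp
      have "comp m (comp k g f - idf) x \<in> bdr m M N" using bdr_pre[OF f(3) x M(2,2,1)] by simp
      moreover have "comp (m + k) g (comp m f x) - comp m (comp k g f - idf) x = x"
        by (simp add: comp_def idf_def fun_eq_iff ac_simps)
      ultimately show "x \<in> bdr m M N" using bdr_diff[OF M(2) a] by metis
    qed
  next
    fix y assume y: "y \<in> cyc (m + k) M N'"
    have "comp (m + k) g y \<in> cyc m M N" using cyc_comp[OF y f(2) M(2)] by simp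
    moreover have "comp (m + k) (comp (- k) f g - idf) y \<in> bdr (m + k) M N'"
      using bdr_pre[OF f(4) y M(3,3,1)] by simp
    then have "- comp (m + k) (comp (- k) f g - idf) y \<in> bdr (m + k) M N'" by (rule bdr_neg[OF M(3)])
    moreover have "- comp (m + k) (comp (- k) f g - idf) y = y - comp m f (comp (m + k) g y)"
      by (simp add: comp_def comp_diff_left idf_def fun_eq_iff)
    ultimately show "\<exists>x\<in>cyc m M N. y - comp m f x \<in> bdr (m + k) M N'" by metis
  qed
qed

text \<open>The contravariant counterpart: precomposition with the inverse \<open>g\<close>, which
  has degree \<open>- k\<close>.\<close>

lemma hdim_pre: assumes M: "kmod M" "kmod M'" "kmod N" and "heq k M M'" and hdim: "hdim m M N r"
  shows "hdim (m - k) M' N r"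
proof -
  from assms obtain f g where f: "f \<in> cyc k M M'" "g \<in> cyc (- k) M' M" "comp k g f - idf \<in> bdr 0 M M" "comp (- k) f g - idf \<in> bdr 0 M' M'"
    unfolding heq_def by blast
  show ?thesis
  proof (rule hdim_transfer[OF hdim M(3,3), where \<phi>="\<lambda>x. comp (-k) x g"])
    show "comp (-k) (x + y) g = comp (-k) x g + comp (-k) y g" "comp (-k) (fsc c x) g = fsc c (comp (-k) x g)" for x y c
      by (simp_all add: comp_def fun_eq_iff)
    fix x assume x: "x \<in> cyc m M N"
    have lx: "lin (x n w)" for n w using homD(1)[OF cycD(1)[OF x(1)]] .
    show "comp (-k) x g \<in> cyc (m - k) M' N" using cyc_comp[OF f(2) x M(3)] by (simp add: algebra_simps)
    show "comp (-k) x g \<in> bdr (m - k) M' N \<longleftrightarrow> x \<in> bdr m M N"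
    proof
      assume "x \<in> bdr m M N" from bdr_pre[OF this f(2) M(1,3,2)]
      show "comp (-k) x g \<in> bdr (m - k) M' N" by (simp add: algebra_simps)
    next
      assume "comp (-k) x g \<in> bdr (m - k) M' N"
      from bdr_pre[OF this f(1) M(2,3,1)] have a: "comp k (comp (-k) x g) f \<in> bdr m M N" by simp
      have "comp 0 x (comp k g f - idf) \<in> bdr m M N" using bdr_post[OF f(3) x M(1,3,1)] by simp
      moreover have "comp k (comp (-k) x g) f - comp 0 x (comp k g f - idf) = x"
        by (simp add: comp_def idf_def fun_eq_iff ac_simps lin_simps[OF lx])
      ultimately show "x \<in> bdr m M N" using bdr_diff[OF M(3) a] by metis
    qed
  next
    fix y assume y: "y \<in> cyc (m - k) M' N"
    have ly: "lin (y n w)" for n w using homD(1)[OF cycD(1)[OF y(1)]] .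
    have "comp k y f \<in> cyc m M N" using cyc_comp[OF f(1) y M(3)] by simp
    moreover have "comp 0 y (comp (- k) f g - idf) \<in> bdr (m - k) M' N"
      using bdr_post[OF f(4) y M(2,3,2)] by simp
    then have "- comp 0 y (comp (- k) f g - idf) \<in> bdr (m - k) M' N" by (rule bdr_neg[OF M(3)])
    moreover have "- comp 0 y (comp (- k) f g - idf) = y - comp (-k) (comp k y f) g"
      by (simp add: comp_def idf_def fun_eq_iff lin_simps[OF ly])
    ultimately show "\<exists>x\<in>cyc m M N. y - comp (-k) x g \<in> bdr (m - k) M' N" by metis
  qed
qed

section \<open>The twist functor and its adjoint\<close>

lemma pr_ops [simp]: "pr a b + pr a' b' = pr (a + a') (b + b')" "pr a b - pr a' b' = pr (a - a') (b - b')"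
   "- pr a b = pr (- a) (- b)" "c \<star> pr a b = pr (c \<star> a) (c \<star> b)"
  by (rule pr_eqI; simp)+

lemma pr_eq_0 [simp]: "pr a b = 0 \<longleftrightarrow> a = 0 \<and> b = 0"
  by (metis pr_0_0 pr_inject)

abbreviation AA :: "vertex \<Rightarrow> 'k::field kmod \<Rightarrow> 'k U \<Rightarrow> 'k U" where
  "AA u M x \<equiv> A M (opp u) (A M u x)"

lemma kmod_A': "kmod M \<Longrightarrow> x \<in> V M n (opp u) \<Longrightarrow> A M (opp u) x \<in> V M (n + 1) u"
  using kmod_A[of M x n "opp u"] by simp
lemma kmod_DA': "kmod M \<Longrightarrow> x \<in> V M n (opp u) \<Longrightarrow> D M (n + 1) u (A M (opp u) x) = - A M (opp u) (D M n (opp u) x)"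
  using kmod_DA[of M x n "opp u"] by simp
lemma kmod_AAA': "kmod M \<Longrightarrow> x \<in> V M n (opp u) \<Longrightarrow> A M (opp u) (A M u (A M (opp u) x)) = 0"
  using kmod_AAA[of M x n "opp u"] by simp
lemma kmod_AA: "kmod M \<Longrightarrow> x \<in> V M n u \<Longrightarrow> AA u M x \<in> V M (n + 2) u"
  using kmod_A'[OF _ kmod_A, of M x n u] by (simp add: algebra_simps)
lemma kmod_DAA: "kmod M \<Longrightarrow> x \<in> V M n u \<Longrightarrow> D M (n + 2) u (AA u M x) = AA u M (D M n u x)"
  using kmod_DA'[OF _ kmod_A, of M x n u] kmod_DA[of M x n u]
  by (simp add: algebra_simps lin_simps[OF kmod_linA])
lemma lin_AA: "kmod M \<Longrightarrow> lin (AA u M)"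
  using lin_comp[OF kmod_linA kmod_linA] by blast

text \<open>\<open>TT\<close> is the cone of \<open>P_u \<otimes> W \<rightarrow> y\<close> for a complex \<open>(W, e)\<close> and a map \<open>c\<close> from \<open>W\<close> to the part of \<open>y\<close> at \<open>u\<close>.
  There are two copies of \<open>W\<close> at \<open>u\<close>, for the idempotent and the loop.\<close>

definition TT :: "vertex \<Rightarrow> (int \<Rightarrow> 'k::field U set) \<Rightarrow> (int \<Rightarrow> 'k U \<Rightarrow> 'k U) \<Rightarrow> (int \<Rightarrow> 'k U \<Rightarrow> 'k U) \<Rightarrow> 'k kmod \<Rightarrow> 'k kmod" where
  "TT u W c e y = \<lparr>
    V = (\<lambda>n w. if w = u then {x. p1 (p1 x) \<in> W (n + 1) \<and> p2 (p1 x) \<in> W (n - 1) \<and> p2 x \<in> V y n u}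
               else {x. p1 x \<in> W n \<and> p2 x \<in> V y n w}),
    A = (\<lambda>w x. if w = u then pr (p1 (p1 x)) (A y u (p2 x)) else pr (pr 0 (p1 x)) (A y w (p2 x))),
    D = (\<lambda>n w x. if w = u then pr (pr (- e (n + 1) (p1 (p1 x))) (- e (n - 1) (p2 (p1 x))))
                    (D y n u (p2 x) + c (n + 1) (p1 (p1 x)) + AA u y (c (n - 1) (p2 (p1 x))))
               else pr (e n (p1 x)) (D y n w (p2 x) - A y u (c n (p1 x))))\<rparr>"

definition cpx :: "vertex \<Rightarrow> (int \<Rightarrow> 'k::field U set) \<Rightarrow> (int \<Rightarrow> 'k U \<Rightarrow> 'k U) \<Rightarrow> (int \<Rightarrow> 'k U \<Rightarrow> 'k U) \<Rightarrow> 'k kmod \<Rightarrow> bool" where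
  "cpx u W c e y \<longleftrightarrow> (\<forall>n. sub (W n) \<and> lin (c n) \<and> lin (e n)) \<and> (\<forall>n. \<forall>x \<in> W n.
     c n x \<in> V y n u \<and> e n x \<in> W (n + 1) \<and> e (n + 1) (e n x) = 0 \<and> D y n u (c n x) = c (n + 1) (e n x))"

lemma TT_simps [simp]:
  "V (TT u W c e y) n u = {x. p1 (p1 x) \<in> W (n + 1) \<and> p2 (p1 x) \<in> W (n - 1) \<and> p2 x \<in> V y n u}"
  "V (TT u W c e y) n (opp u) = {x. p1 x \<in> W n \<and> p2 x \<in> V y n (opp u)}"
  "A (TT u W c e y) u = (\<lambda>x. pr (p1 (p1 x)) (A y u (p2 x)))"
  "A (TT u W c e y) (opp u) = (\<lambda>x. pr (pr 0 (p1 x)) (A y (opp u) (p2 x)))"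
  "D (TT u W c e y) n u = (\<lambda>x. pr (pr (- e (n + 1) (p1 (p1 x))) (- e (n - 1) (p2 (p1 x))))
                    (D y n u (p2 x) + c (n + 1) (p1 (p1 x)) + AA u y (c (n - 1) (p2 (p1 x)))))"
  "D (TT u W c e y) n (opp u) = (\<lambda>x. pr (e n (p1 x)) (D y n (opp u) (p2 x) - A y u (c n (p1 x))))"
  by (auto simp: TT_def)

text \<open>The square of the differential vanishes because \<open>c\<close> is a chain map. The
  signs of \<open>e\<close> at \<open>u\<close> and of \<open>A y u\<close> at the other vertex are
  those for which the differential anticommutes with the arrow; the loop copy then contributes
  nothing, as three arrows compose to 0.\<close>

lemma kmod_TT: assumes y: "kmod y" and W: "cpx u W c e y" shows "kmod (TT u W c e y)"
proof -
  have l: "sub (W n)" "lin (c n)" "lin (e n)" for n using W by (auto simp: cpx_def)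
  have W': "x \<in> W n \<Longrightarrow> c n x \<in> V y n u" "x \<in> W n \<Longrightarrow> e n x \<in> W (n + 1)"
     "x \<in> W n \<Longrightarrow> e (n + 1) (e n x) = 0" "x \<in> W n \<Longrightarrow> D y n u (c n x) = c (n + 1) (e n x)" for n x
    using W by (auto simp: cpx_def)
  note lins = lin_simps[OF l(2)] lin_simps[OF l(3)] lin_simps[OF kmod_linA[OF y]] lin_simps[OF kmod_linD[OF y]]
  have s: "sub (V y n w)" for n w using kmod_sub[OF y] .
  note cl = sub_closed[OF s] sub_closed[OF l(1)]
  have a: "sub (V (TT u W c e y) n w) \<and> lin (A (TT u W c e y) w) \<and> lin (D (TT u W c e y) n w)" for n w
  proof -
    have "sub (V (TT u W c e y) n u)" "sub (V (TT u W c e y) n (opp u))"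
      by (auto simp: sub_def[of "Collect _"] cl)
    moreover have "lin (A (TT u W c e y) u)" "lin (A (TT u W c e y) (opp u))"
       "lin (D (TT u W c e y) n u)" "lin (D (TT u W c e y) n (opp u))"
      unfolding lin_def TT_simps by (auto simp: lins sc_add sc_diff algebra_simps)
    ultimately show ?thesis using vertex_cases[of w u] by auto
  qed
  have b: "A M w x \<in> V M (n + 1) (opp w) \<and> D M n w x \<in> V M (n + 1) w \<and> D M (n + 1) w (D M n w x) = 0 \<and>
       A M w (A M (opp w) (A M w x)) = 0 \<and> D M (n + 1) (opp w) (A M w x) = - A M w (D M n w x)"
    if x: "x \<in> V M n w" and M: "M = TT u W c e y" for n w x M
  proof -
    consider "w = u" | "w = opp u" using vertex_cases by blast
    then show ?thesis
    proof cases
      case 1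
      from x have m: "p1 (p1 x) \<in> W (n + 1)" "p2 (p1 x) \<in> W (n - 1)" "p2 x \<in> V y n u" by (auto simp: 1 M)
      have e: "e (n - 1) (p2 (p1 x)) \<in> W n" "e n (e (n - 1) (p2 (p1 x))) = 0" "e (n+1) (p1 (p1 x)) \<in> W (n + 1 + 1)"
          "e (n + 1 + 1) (e (n + 1) (p1 (p1 x))) = 0"
        using W'(2,3)[OF m(2)] W'(2,3)[OF m(1)] by (simp_all add: algebra_simps)
      have AAm: "AA u y (c (n - 1) (p2 (p1 x))) \<in> V y (n + 1) u"
        using kmod_AA[OF y W'(1)[OF m(2)]] by (simp add: algebra_simps)
      have DAA: "D y (n + 1) u (AA u y (c (n - 1) (p2 (p1 x)))) = AA u y (c n (e (n - 1) (p2 (p1 x))))"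
        using kmod_DAA[OF y W'(1)[OF m(2)]] W'(4)[OF m(2)] by (simp add: algebra_simps)
      have AAA: "A y u (AA u y (c (n - 1) (p2 (p1 x)))) = 0"
        using kmod_AAA[OF y W'(1)[OF m(2)]] .
      show ?thesis unfolding 1 M TT_simps
        using m e AAm DAA AAA W'(1)[OF m(1)] W'(4)[OF m(1)]
        by (auto simp: lins kmod_A[OF y] kmod_D[OF y] kmod_DD[OF y] kmod_DA[OF y] kmod_AAA[OF y] cl)
    next
      case 2
      from x have m: "p1 x \<in> W n" "p2 x \<in> V y n (opp u)" by (auto simp: 2 M)
      have c: "c n (p1 x) \<in> V y n u" using W'(1)[OF m(1)] .
      have Ac: "A y u (c n (p1 x)) \<in> V y (n + 1) (opp u)" using kmod_A[OF y c] .
      show ?thesis unfolding 2 M TT_simps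
        using m W'(2-4)[OF m(1)] Ac kmod_DA[OF y c] kmod_AAA[OF y c]
        by (auto simp: lins cl kmod_A'[OF y] kmod_DA'[OF y] kmod_AAA'[OF y] kmod_D[OF y] kmod_DD[OF y] opp_opp simp del: opp_neq)
    qed
  qed
  show ?thesis unfolding kmod_def using a b by blast
qed

text \<open>The cocone of a map from \<open>z\<close> to a shift of \<open>P_u \<otimes> W\<close>.
  Such a map is given by a linear map \<open>r\<close> on the part at \<open>u\<close>, because
  \<open>P_u \<otimes> W\<close> is also coinduced: the loop coefficient is \<open>r x\<close>, and
  linearity over \<open>A\<close> forces \<open>r (A x)\<close> on the arrow, up to sign, and
  \<open>r (A A x)\<close> on the idempotent. After the \<open>z\<close>-component, the components
  are loop and idempotent at \<open>u\<close>, and the arrow at the other vertex.\<close>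

definition TI :: "vertex \<Rightarrow> (int \<Rightarrow> 'k::field U set) \<Rightarrow> (int \<Rightarrow> 'k U \<Rightarrow> 'k U) \<Rightarrow> (int \<Rightarrow> 'k U \<Rightarrow> 'k U) \<Rightarrow> 'k kmod \<Rightarrow> 'k kmod" where
  "TI u W r e z = \<lparr>
    V = (\<lambda>n w. if w = u then {x. p1 x \<in> V z n u \<and> p1 (p2 x) \<in> W (n - 1) \<and> p2 (p2 x) \<in> W (n + 1)}
               else {x. p1 x \<in> V z n w \<and> p2 x \<in> W n}),
    A = (\<lambda>w x. if w = u then pr (A z u (p1 x)) (p2 (p2 x)) else pr (A z w (p1 x)) (pr (p2 x) 0)),
    D = (\<lambda>n w x. if w = u then pr (D z n u (p1 x)) (pr (r n (p1 x) - e (n - 1) (p1 (p2 x)))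
                    (r (n + 2) (AA u z (p1 x)) - e (n + 1) (p2 (p2 x))))
               else pr (D z n w (p1 x)) (e n (p2 x) - r (n + 1) (A z w (p1 x))))\<rparr>"

text \<open>The mirror image of \<open>cpx\<close>: the chain map now goes from the part of
  \<open>z\<close> at \<open>u\<close> to the complex \<open>W\<close>.\<close>

definition quo :: "vertex \<Rightarrow> (int \<Rightarrow> 'k::field U set) \<Rightarrow> (int \<Rightarrow> 'k U \<Rightarrow> 'k U) \<Rightarrow> (int \<Rightarrow> 'k U \<Rightarrow> 'k U) \<Rightarrow> 'k kmod \<Rightarrow> bool" where
  "quo u W r e z \<longleftrightarrow> (\<forall>n. sub (W n) \<and> lin (r n) \<and> lin (e n)) \<and>
     (\<forall>n. \<forall>x \<in> W n. e n x \<in> W (n + 1) \<and> e (n + 1) (e n x) = 0) \<and>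
     (\<forall>n. \<forall>x \<in> V z n u. r n x \<in> W n \<and> r (n + 1) (D z n u x) = e n (r n x))"

lemma TI_simps [simp]:
  "V (TI u W r e z) n u = {x. p1 x \<in> V z n u \<and> p1 (p2 x) \<in> W (n - 1) \<and> p2 (p2 x) \<in> W (n + 1)}"
  "V (TI u W r e z) n (opp u) = {x. p1 x \<in> V z n (opp u) \<and> p2 x \<in> W n}"
  "A (TI u W r e z) u = (\<lambda>x. pr (A z u (p1 x)) (p2 (p2 x)))"
  "A (TI u W r e z) (opp u) = (\<lambda>x. pr (A z (opp u) (p1 x)) (pr (p2 x) 0))"
  "D (TI u W r e z) n u = (\<lambda>x. pr (D z n u (p1 x)) (pr (r n (p1 x) - e (n - 1) (p1 (p2 x)))
                    (r (n + 2) (AA u z (p1 x)) - e (n + 1) (p2 (p2 x)))))"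
  "D (TI u W r e z) n (opp u) = (\<lambda>x. pr (D z n (opp u) (p1 x)) (e n (p2 x) - r (n + 1) (A z (opp u) (p1 x))))"
  by (auto simp: TI_def)

lemma kmod_TI: assumes z: "kmod z" and W: "quo u W r e z" shows "kmod (TI u W r e z)"
proof -
  have l: "sub (W n)" "lin (r n)" "lin (e n)" for n using W by (auto simp: quo_def)
  have W': "x \<in> W n \<Longrightarrow> e n x \<in> W (n + 1)" "x \<in> W n \<Longrightarrow> e (n + 1) (e n x) = 0" for n x
    using W by (auto simp: quo_def)
  have R: "x \<in> V z n u \<Longrightarrow> r n x \<in> W n" "x \<in> V z n u \<Longrightarrow> r (n + 1) (D z n u x) = e n (r n x)" for n x
    using W by (auto simp: quo_def)
  note lins = lin_simps[OF l(2)] lin_simps[OF l(3)] lin_simps[OF kmod_linA[OF z]] lin_simps[OF kmod_linD[OF z]]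
  have s: "sub (V z n w)" for n w using kmod_sub[OF z] .
  note cl = sub_closed[OF s] sub_closed[OF l(1)]
  have a: "sub (V (TI u W r e z) n w) \<and> lin (A (TI u W r e z) w) \<and> lin (D (TI u W r e z) n w)" for n w
  proof -
    have "sub (V (TI u W r e z) n u)" "sub (V (TI u W r e z) n (opp u))"
      by (auto simp: sub_def[of "Collect _"] cl)
    moreover have "lin (A (TI u W r e z) u)" "lin (A (TI u W r e z) (opp u))"
       "lin (D (TI u W r e z) n u)" "lin (D (TI u W r e z) n (opp u))"
      unfolding lin_def TI_simps by (auto simp: lins sc_add sc_diff algebra_simps)
    ultimately show ?thesis using vertex_cases[of w u] by auto
  qed
  have b: "A M w x \<in> V M (n + 1) (opp w) \<and> D M n w x \<in> V M (n + 1) w \<and> D M (n + 1) w (D M n w x) = 0 \<and>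
       A M w (A M (opp w) (A M w x)) = 0 \<and> D M (n + 1) (opp w) (A M w x) = - A M w (D M n w x)"
    if x: "x \<in> V M n w" and M: "M = TI u W r e z" for n w x M
  proof -
    consider "w = u" | "w = opp u" using vertex_cases by blast
    then show ?thesis
    proof cases
      case 1
      from x have m: "p1 x \<in> V z n u" "p1 (p2 x) \<in> W (n - 1)" "p2 (p2 x) \<in> W (n + 1)" by (auto simp: 1 M)
      have e: "e (n - 1) (p1 (p2 x)) \<in> W n" "e n (e (n - 1) (p1 (p2 x))) = 0" "e (n+1) (p2 (p2 x)) \<in> W (n + 2)"
          "e (n + 2) (e (n + 1) (p2 (p2 x))) = 0"
        using W'[OF m(2)] W'[OF m(3)] by (simp_all add: algebra_simps)
      have AAm: "AA u z (p1 x) \<in> V z (n + 2) u" using kmod_AA[OF z m(1)] .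
      have DAA: "r (n + 3) (AA u z (D z n u (p1 x))) = e (n + 2) (r (n + 2) (AA u z (p1 x)))"
        using kmod_DAA[OF z m(1)] R(2)[OF AAm] by (simp add: algebra_simps)
      have i: "n + 1 + 1 = n + 2" "n + 1 + 2 = n + 3" by simp_all
      show ?thesis unfolding 1 M TI_simps
        using m e AAm DAA R[OF m(1)] R(1)[OF AAm]
        by (auto simp: lins kmod_A[OF z] kmod_D[OF z] kmod_DD[OF z] kmod_DA[OF z] kmod_AAA[OF z] cl i)
    next
      case 2
      from x have m: "p1 x \<in> V z n (opp u)" "p2 x \<in> W n" by (auto simp: 2 M)
      have c: "A z (opp u) (p1 x) \<in> V z (n + 1) u" using kmod_A'[OF z m(1)] .
      have d: "D z n (opp u) (p1 x) \<in> V z (n + 1) (opp u)" using kmod_D[OF z m(1)] .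
      have rd: "r (n + 2) (A z (opp u) (D z n (opp u) (p1 x))) = - e (n + 1) (r (n + 1) (A z (opp u) (p1 x)))"
        using R(2)[OF c] kmod_DA'[OF z m(1)] by (simp add: lins algebra_simps equation_minus_iff)
      have i: "n + 1 + 1 = n + 2" "n + 1 + 2 = n + 3" by simp_all
      show ?thesis unfolding 2 M TI_simps
        using m c d rd W'[OF m(2)] R(1)[OF c]
        by (auto simp: lins cl kmod_A'[OF z] kmod_DA'[OF z] kmod_AAA'[OF z] kmod_D[OF z] kmod_DD[OF z] i)
    qed
  qed
  show ?thesis unfolding kmod_def using a b by blast
qed

section \<open>The twist functor, the inverse twist and their action on morphisms\<close>

definition Tw :: "vertex \<Rightarrow> 'k::field kmod \<Rightarrow> 'k kmod" where
  "Tw u y = TT u (\<lambda>n. V y n u) (\<lambda>n x. x) (\<lambda>n. D y n u) y"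
definition Ti :: "vertex \<Rightarrow> 'k::field kmod \<Rightarrow> 'k kmod" where
  "Ti u y = TI u (\<lambda>n. V y n u) (\<lambda>n x. x) (\<lambda>n. D y n u) y"

lemma kmod_Tw: assumes "kmod y" shows "kmod (Tw u y)"
  unfolding Tw_def by (rule kmod_TT[OF assms])
    (use assms in \<open>auto simp: cpx_def kmod_sub kmod_linD kmod_D kmod_DD lin_id\<close>)

lemma kmod_Ti: assumes "kmod y" shows "kmod (Ti u y)"
  unfolding Ti_def by (rule kmod_TI[OF assms])
    (use assms in \<open>auto simp: quo_def kmod_sub kmod_linD kmod_D kmod_DD lin_id\<close>)

lemma Tw_simps [simp]:
  "V (Tw u y) n u = {x. p1 (p1 x) \<in> V y (n + 1) u \<and> p2 (p1 x) \<in> V y (n - 1) u \<and> p2 x \<in> V y n u}"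
  "V (Tw u y) n (opp u) = {x. p1 x \<in> V y n u \<and> p2 x \<in> V y n (opp u)}"
  "A (Tw u y) u = (\<lambda>x. pr (p1 (p1 x)) (A y u (p2 x)))"
  "A (Tw u y) (opp u) = (\<lambda>x. pr (pr 0 (p1 x)) (A y (opp u) (p2 x)))"
  "D (Tw u y) n u = (\<lambda>x. pr (pr (- D y (n + 1) u (p1 (p1 x))) (- D y (n - 1) u (p2 (p1 x))))
                    (D y n u (p2 x) + p1 (p1 x) + AA u y (p2 (p1 x))))"
  "D (Tw u y) n (opp u) = (\<lambda>x. pr (D y n u (p1 x)) (D y n (opp u) (p2 x) - A y u (p1 x)))"
  unfolding Tw_def by simp_all

lemma Ti_simps [simp]:
  "V (Ti u z) n u = {x. p1 x \<in> V z n u \<and> p1 (p2 x) \<in> V z (n - 1) u \<and> p2 (p2 x) \<in> V z (n + 1) u}"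
  "V (Ti u z) n (opp u) = {x. p1 x \<in> V z n (opp u) \<and> p2 x \<in> V z n u}"
  "A (Ti u z) u = (\<lambda>x. pr (A z u (p1 x)) (p2 (p2 x)))"
  "A (Ti u z) (opp u) = (\<lambda>x. pr (A z (opp u) (p1 x)) (pr (p2 x) 0))"
  "D (Ti u z) n u = (\<lambda>x. pr (D z n u (p1 x)) (pr (p1 x - D z (n - 1) u (p1 (p2 x)))
                    (AA u z (p1 x) - D z (n + 1) u (p2 (p2 x)))))"
  "D (Ti u z) n (opp u) = (\<lambda>x. pr (D z n (opp u) (p1 x)) (D z n u (p2 x) - A z (opp u) (p1 x)))"
  unfolding Ti_def by simp_all

text \<open>The two copies at \<open>u\<close> are shifted by one, which costs the sign
  \<open>(-1)^m\<close>. On the arrow copy this sign cancels against the one for passing the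
  arrow.\<close>

definition Tm :: "vertex \<Rightarrow> int \<Rightarrow> 'k::field fam \<Rightarrow> 'k fam" where
  "Tm u m f = (\<lambda>n w x. if w = u
     then pr (pr (sgn_pow m \<star> f (n + 1) u (p1 (p1 x))) (sgn_pow m \<star> f (n - 1) u (p2 (p1 x)))) (f n u (p2 x))
     else pr (f n u (p1 x)) (f n w (p2 x)))"

definition Im :: "vertex \<Rightarrow> int \<Rightarrow> 'k::field fam \<Rightarrow> 'k fam" where
  "Im u m f = (\<lambda>n w x. if w = u
     then pr (f n u (p1 x)) (pr (sgn_pow m \<star> f (n - 1) u (p1 (p2 x))) (sgn_pow m \<star> f (n + 1) u (p2 (p2 x))))
     else pr (f n w (p1 x)) (f n u (p2 x)))"

lemma vertex_all_intro: "P u \<Longrightarrow> P (opp u) \<Longrightarrow> P w"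
  using vertex_cases by metis

lemma homI2: assumes "\<And>n. lin (f n u)" "\<And>n. lin (f n (opp u))"
    "\<And>n x. x \<in> V M n u \<Longrightarrow> f n u x \<in> V N (n + m) u"
    "\<And>n x. x \<in> V M n (opp u) \<Longrightarrow> f n (opp u) x \<in> V N (n + m) (opp u)"
    "\<And>n x. x \<in> V M n u \<Longrightarrow> f (n + 1) (opp u) (A M u x) = sgn_pow m \<star> A N u (f n u x)"
    "\<And>n x. x \<in> V M n (opp u) \<Longrightarrow> f (n + 1) u (A M (opp u) x) = sgn_pow m \<star> A N (opp u) (f n (opp u) x)"
  shows "f \<in> hom m M N"
proof (rule homI)
  fix n w
  show "lin (f n w)" using vertex_cases[of w u] assms(1,2) by auto
  fix x assume x: "x \<in> V M n w"
  show "f n w x \<in> V N (n + m) w" using vertex_cases[of w u] assms(3,4) x by auto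
  show "f (n + 1) (opp w) (A M w x) = sgn_pow m \<star> A N w (f n w x)"
    using vertex_cases[of w u] assms(5,6) x by auto
qed

lemma cycI2: assumes "f \<in> hom m M N"
    "\<And>n x. x \<in> V M n u \<Longrightarrow> f (n + 1) u (D M n u x) = sgn_pow m \<star> D N (n + m) u (f n u x)"
    "\<And>n x. x \<in> V M n (opp u) \<Longrightarrow> f (n + 1) (opp u) (D M n (opp u) x) = sgn_pow m \<star> D N (n + m) (opp u) (f n (opp u) x)"
  shows "f \<in> cyc m M N"
proof (rule cycI[OF assms(1)])
  fix n w x assume x: "x \<in> V M n w"
  show "f (n + 1) w (D M n w x) = sgn_pow m \<star> D N (n + m) w (f n w x)"
    using vertex_cases[of w u] assms(2,3) x by auto
qed

lemma bdrI2: assumes "s \<in> hom (m - 1) M N"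
    "\<And>n x. x \<in> V M n u \<Longrightarrow> f n u x = D N (n + m - 1) u (s n u x) + sgn_pow m \<star> s (n + 1) u (D M n u x)"
    "\<And>n x. x \<in> V M n (opp u) \<Longrightarrow> f n (opp u) x = D N (n + m - 1) (opp u) (s n (opp u) x) + sgn_pow m \<star> s (n + 1) (opp u) (D M n (opp u) x)"
  shows "f \<in> bdr m M N"
proof (rule bdrI[OF assms(1)])
  fix n w x assume x: "x \<in> V M n w"
  show "f n w x = D N (n + m - 1) w (s n w x) + sgn_pow m \<star> s (n + 1) w (D M n w x)"
    using vertex_cases[of w u] assms(2,3) x by auto
qed

lemma homD': assumes "f \<in> hom m M N"
  shows "x \<in> V M n (opp u) \<Longrightarrow> f (n + 1) u (A M (opp u) x) = sgn_pow m \<star> A N (opp u) (f n (opp u) x)"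
  using homD(3)[OF assms, of x n "opp u"] by simp

lemma hom_AA: assumes f: "f \<in> hom m M N" and M: "kmod M" "kmod N" and x: "x \<in> V M n u"
  shows "f (n + 2) u (AA u M x) = AA u N (f n u x)"
  using homD'[OF f kmod_A[OF M(1) x]] homD(3)[OF f x]
  by (simp add: lin_simps[OF kmod_linA[OF M(2)]] algebra_simps)

lemma Tm_simps [simp]: "Tm u m f n u x = pr (pr (sgn_pow m \<star> f (n + 1) u (p1 (p1 x))) (sgn_pow m \<star> f (n - 1) u (p2 (p1 x)))) (f n u (p2 x))"
  "Tm u m f n (opp u) x = pr (f n u (p1 x)) (f n (opp u) (p2 x))"
  by (simp_all add: Tm_def)
lemma Im_simps [simp]: "Im u m f n u x = pr (f n u (p1 x)) (pr (sgn_pow m \<star> f (n - 1) u (p1 (p2 x))) (sgn_pow m \<star> f (n + 1) u (p2 (p2 x))))"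
  "Im u m f n (opp u) x = pr (f n (opp u) (p1 x)) (f n u (p2 x))"
  by (simp_all add: Im_def)

lemma Tm_hom: assumes M: "kmod M" "kmod N" and f: "f \<in> hom m M N"
  shows "Tm u m f \<in> hom m (Tw u M) (Tw u N)"
proof -
  note l = lin_simps[OF homD(1)[OF f]]
  have h: "x \<in> V M k u \<Longrightarrow> k + m = j \<Longrightarrow> f k u x \<in> V N j u" for k j x using homD(2)[OF f] by auto
  note s = sub_closed[OF kmod_sub[OF M(2)]]
  show ?thesis
    by (rule homI2[where u=u]) (auto simp: lin_def l sc_add mult.commute homD(3)[OF f] homD'[OF f] h homD(2)[OF f] intro!: s h)
qed

lemma Im_hom: assumes M: "kmod M" "kmod N" and f: "f \<in> hom m M N"
  shows "Im u m f \<in> hom m (Ti u M) (Ti u N)"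
proof -
  note l = lin_simps[OF homD(1)[OF f]]
  have h: "x \<in> V M k u \<Longrightarrow> k + m = j \<Longrightarrow> f k u x \<in> V N j u" for k j x using homD(2)[OF f] by auto
  note s = sub_closed[OF kmod_sub[OF M(2)]]
  show ?thesis
    by (rule homI2[where u=u]) (auto simp: lin_def l sc_add mult.commute homD(3)[OF f] homD'[OF f] h homD(2)[OF f] intro!: s h)
qed

lemma Tm_cyc: assumes M: "kmod M" "kmod N" and f: "f \<in> cyc m M N"
  shows "Tm u m f \<in> cyc m (Tw u M) (Tw u N)"
proof (rule cycI2[OF Tm_hom[OF M cycD(1)[OF f]]])
  note l = lin_simps[OF homD(1)[OF cycD(1)[OF f]]]
  note lN = lin_simps[OF kmod_linA[OF M(2)]] lin_simps[OF kmod_linD[OF M(2)]]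
  fix n x
  {
    assume x: "x \<in> V (Tw u M) n u"
    then have m: "p1 (p1 x) \<in> V M (n + 1) u" "p2 (p1 x) \<in> V M (n - 1) u" "p2 x \<in> V M n u" by auto
    show "Tm u m f (n + 1) u (D (Tw u M) n u x) = sgn_pow m \<star> D (Tw u N) (n + m) u (Tm u m f n u x)"
      using cycD(2)[OF f m(1)] cycD(2)[OF f m(2)] cycD(2)[OF f m(3)] hom_AA[OF cycD(1)[OF f] M m(2)]
      by (simp add: l lN sc_add algebra_simps)
  }
  {
    assume x: "x \<in> V (Tw u M) n (opp u)"
    then have m: "p1 x \<in> V M n u" "p2 x \<in> V M n (opp u)" by auto
    show "Tm u m f (n + 1) (opp u) (D (Tw u M) n (opp u) x) = sgn_pow m \<star> D (Tw u N) (n + m) (opp u) (Tm u m f n (opp u) x)"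
      using cycD(2)[OF f m(1)] cycD(2)[OF f m(2)] homD(3)[OF cycD(1)[OF f] m(1)]
      by (simp add: l lN sc_add sc_diff algebra_simps)
  }
qed

lemma Im_cyc: assumes M: "kmod M" "kmod N" and f: "f \<in> cyc m M N"
  shows "Im u m f \<in> cyc m (Ti u M) (Ti u N)"
proof (rule cycI2[OF Im_hom[OF M cycD(1)[OF f]]])
  note l = lin_simps[OF homD(1)[OF cycD(1)[OF f]]]
  note lN = lin_simps[OF kmod_linA[OF M(2)]] lin_simps[OF kmod_linD[OF M(2)]]
  fix n x
  {
    assume x: "x \<in> V (Ti u M) n u"
    then have m: "p1 x \<in> V M n u" "p1 (p2 x) \<in> V M (n - 1) u" "p2 (p2 x) \<in> V M (n + 1) u" by auto
    show "Im u m f (n + 1) u (D (Ti u M) n u x) = sgn_pow m \<star> D (Ti u N) (n + m) u (Im u m f n u x)"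
      using cycD(2)[OF f m(1)] cycD(2)[OF f m(2)] cycD(2)[OF f m(3)] hom_AA[OF cycD(1)[OF f] M m(1)]
      by (simp add: l lN sc_add sc_diff algebra_simps)
  }
  {
    assume x: "x \<in> V (Ti u M) n (opp u)"
    then have m: "p1 x \<in> V M n (opp u)" "p2 x \<in> V M n u" by auto
    show "Im u m f (n + 1) (opp u) (D (Ti u M) n (opp u) x) = sgn_pow m \<star> D (Ti u N) (n + m) (opp u) (Im u m f n (opp u) x)"
      using cycD(2)[OF f m(1)] cycD(2)[OF f m(2)] homD'[OF cycD(1)[OF f] m(1)]
      by (simp add: l lN sc_add sc_diff algebra_simps)
  }
qed

text \<open>The functor sends a homotopy, a morphism of degree -1, to a homotopy; degree 0 is the
  case that occurs in \<open>heq\<close>.\<close>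

lemma Tm_bdr: assumes M: "kmod M" "kmod N" and f: "f \<in> bdr 0 M N"
  shows "Tm u 0 f \<in> bdr 0 (Tw u M) (Tw u N)"
proof -
  obtain s where s: "s \<in> hom (0 - 1) M N" "\<And>n w x. x \<in> V M n w \<Longrightarrow> f n w x = D N (n + 0 - 1) w (s n w x) + sgn_pow 0 \<star> s (n + 1) w (D M n w x)"
    by (rule bdrE[OF f]) (rule that)
  note l = lin_simps[OF homD(1)[OF s(1)]]
  note lN = lin_simps[OF kmod_linA[OF M(2)]] lin_simps[OF kmod_linD[OF M(2)]]
  show ?thesis
  proof (rule bdrI2[OF Tm_hom[OF M s(1)]])
    fix n x
    {
      assume x: "x \<in> V (Tw u M) n u"
      then have m: "p1 (p1 x) \<in> V M (n + 1) u" "p2 (p1 x) \<in> V M (n - 1) u" "p2 x \<in> V M n u" by auto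
      show "Tm u 0 f n u x = D (Tw u N) (n + 0 - 1) u (Tm u (0 - 1) s n u x) + sgn_pow 0 \<star> Tm u (0 - 1) s (n + 1) u (D (Tw u M) n u x)"
        using s(2)[OF m(1)] s(2)[OF m(2)] s(2)[OF m(3)] hom_AA[OF s(1) M m(2)]
        by (simp add: l lN sc_add algebra_simps)
    }
    {
      assume x: "x \<in> V (Tw u M) n (opp u)"
      then have m: "p1 x \<in> V M n u" "p2 x \<in> V M n (opp u)" by auto
      show "Tm u 0 f n (opp u) x = D (Tw u N) (n + 0 - 1) (opp u) (Tm u (0 - 1) s n (opp u) x) + sgn_pow 0 \<star> Tm u (0 - 1) s (n + 1) (opp u) (D (Tw u M) n (opp u) x)"
        using s(2)[OF m(1)] s(2)[OF m(2)] homD(3)[OF s(1) m(1)]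
        by (simp add: l lN sc_add sc_diff algebra_simps)
    }
  qed
qed

lemma Im_bdr: assumes M: "kmod M" "kmod N" and f: "f \<in> bdr 0 M N"
  shows "Im u 0 f \<in> bdr 0 (Ti u M) (Ti u N)"
proof -
  obtain s where s: "s \<in> hom (0 - 1) M N" "\<And>n w x. x \<in> V M n w \<Longrightarrow> f n w x = D N (n + 0 - 1) w (s n w x) + sgn_pow 0 \<star> s (n + 1) w (D M n w x)"
    by (rule bdrE[OF f]) (rule that)
  note l = lin_simps[OF homD(1)[OF s(1)]]
  note lN = lin_simps[OF kmod_linA[OF M(2)]] lin_simps[OF kmod_linD[OF M(2)]]
  show ?thesis
  proof (rule bdrI2[OF Im_hom[OF M s(1)]])
    fix n x
    {
      assume x: "x \<in> V (Ti u M) n u"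
      then have m: "p1 x \<in> V M n u" "p1 (p2 x) \<in> V M (n - 1) u" "p2 (p2 x) \<in> V M (n + 1) u" by auto
      show "Im u 0 f n u x = D (Ti u N) (n + 0 - 1) u (Im u (0 - 1) s n u x) + sgn_pow 0 \<star> Im u (0 - 1) s (n + 1) u (D (Ti u M) n u x)"
        using s(2)[OF m(1)] s(2)[OF m(2)] s(2)[OF m(3)] hom_AA[OF s(1) M m(1)]
        by (simp add: l lN sc_add sc_diff algebra_simps)
    }
    {
      assume x: "x \<in> V (Ti u M) n (opp u)"
      then have m: "p1 x \<in> V M n (opp u)" "p2 x \<in> V M n u" by auto
      show "Im u 0 f n (opp u) x = D (Ti u N) (n + 0 - 1) (opp u) (Im u (0 - 1) s n (opp u) x) + sgn_pow 0 \<star> Im u (0 - 1) s (n + 1) (opp u) (D (Ti u M) n (opp u) x)"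
        using s(2)[OF m(1)] s(2)[OF m(2)] homD'[OF s(1) m(1)]
        by (simp add: l lN sc_add sc_diff algebra_simps)
    }
  qed
qed

lemma heq_Tw: assumes M: "kmod M" "kmod N" and "heq m M N" shows "heq m (Tw u M) (Tw u N)"
proof -
  obtain f g where f: "f \<in> cyc m M N" "g \<in> cyc (- m) N M" "comp m g f - idf \<in> bdr 0 M M" "comp (- m) f g - idf \<in> bdr 0 N N"
    using assms(3) unfolding heq_def by blast
  \<comment> \<open>The functor respects composites and identities: the signs of \<open>f\<close>
    and \<open>g\<close> on the shifted copies multiply to 1.\<close>
  have c: "comp m (Tm u (- m) g) (Tm u m f) - idf = Tm u 0 (comp m g f - idf)"
    if "\<And>n w. lin (g n w)" for m and f g :: "'a fam"
  proof (intro ext)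
    fix n w x
    show "(comp m (Tm u (- m) g) (Tm u m f) - idf) n w x = Tm u 0 (comp m g f - idf) n w x"
    proof (rule vertex_all_intro[of _ u w])
      show "(comp m (Tm u (- m) g) (Tm u m f) - idf) n u x = Tm u 0 (comp m g f - idf) n u x"
        by (rule pr_eqI; (rule pr_eqI)?; simp add: comp_def idf_def lin_simps[OF that] algebra_simps)
      show "(comp m (Tm u (- m) g) (Tm u m f) - idf) n (opp u) x = Tm u 0 (comp m g f - idf) n (opp u) x"
        by (rule pr_eqI; simp add: comp_def idf_def)
    qed
  qed
  show ?thesis unfolding heq_def
  proof (intro bexI conjI)
    show "Tm u m f \<in> cyc m (Tw u M) (Tw u N)" "Tm u (- m) g \<in> cyc (- m) (Tw u N) (Tw u M)"
      using M f by (auto intro!: Tm_cyc)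
    show "comp m (Tm u (- m) g) (Tm u m f) - idf \<in> bdr 0 (Tw u M) (Tw u M)"
      using Tm_bdr[OF M(1,1) f(3)] homD(1)[OF cycD(1)[OF f(2)]] by (subst c) auto
    show "comp (- m) (Tm u m f) (Tm u (- m) g) - idf \<in> bdr 0 (Tw u N) (Tw u N)"
      using Tm_bdr[OF M(2,2) f(4)] homD(1)[OF cycD(1)[OF f(1)]] c[of f "- m" g] by simp
  qed
qed

lemma heq_Ti: assumes M: "kmod M" "kmod N" and "heq m M N" shows "heq m (Ti u M) (Ti u N)"
proof -
  obtain f g where f: "f \<in> cyc m M N" "g \<in> cyc (- m) N M" "comp m g f - idf \<in> bdr 0 M M" "comp (- m) f g - idf \<in> bdr 0 N N"
    using assms(3) unfolding heq_def by blast
  have c: "comp m (Im u (- m) g) (Im u m f) - idf = Im u 0 (comp m g f - idf)"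
    if "\<And>n w. lin (g n w)" for m and f g :: "'a fam"
  proof (intro ext)
    fix n w x
    show "(comp m (Im u (- m) g) (Im u m f) - idf) n w x = Im u 0 (comp m g f - idf) n w x"
    proof (rule vertex_all_intro[of _ u w])
      show "(comp m (Im u (- m) g) (Im u m f) - idf) n u x = Im u 0 (comp m g f - idf) n u x"
        by (rule pr_eqI; (rule pr_eqI)?; simp add: comp_def idf_def lin_simps[OF that] algebra_simps)
      show "(comp m (Im u (- m) g) (Im u m f) - idf) n (opp u) x = Im u 0 (comp m g f - idf) n (opp u) x"
        by (rule pr_eqI; simp add: comp_def idf_def)
    qed
  qed
  show ?thesis unfolding heq_def
  proof (intro bexI conjI)
    show "Im u m f \<in> cyc m (Ti u M) (Ti u N)" "Im u (- m) g \<in> cyc (- m) (Ti u N) (Ti u M)"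
      using M f by (auto intro!: Im_cyc)
    show "comp m (Im u (- m) g) (Im u m f) - idf \<in> bdr 0 (Ti u M) (Ti u M)"
      using Im_bdr[OF M(1,1) f(3)] homD(1)[OF cycD(1)[OF f(2)]] by (subst c) auto
    show "comp (- m) (Im u m f) (Im u (- m) g) - idf \<in> bdr 0 (Ti u N) (Ti u N)"
      using Im_bdr[OF M(2,2) f(4)] homD(1)[OF cycD(1)[OF f(1)]] c[of f "- m" g] by simp
  qed
qed

text \<open>The homotopy inverse of the unit contracts the two acyclic pairs of summands of \<open>Ti u (Tw u z)\<close>.\<close>

lemma heq_Ti_Tw: assumes z: "kmod z" shows "heq 0 z (Ti u (Tw u z))"
proof -
  let ?T = "Ti u (Tw u z)"
  \<comment> \<open>The adjunction unit: the formula of \<open>coadj\<close> below, applied to the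
    identity of \<open>Tw u z\<close>.\<close>
  define f :: "'a fam" where "f = (\<lambda>n w x. if w = u
      then pr (pr (pr 0 0) x) (pr (pr (pr x 0) 0) (pr (pr (AA u z x) 0) 0))
      else pr (pr 0 x) (pr (pr (A z w x) 0) 0))"
  \<comment> \<open>Projection to the summand \<open>z\<close>, corrected on summands carrying the
    inner loop coefficient so that it commutes with the differentials. It is a strict left inverse
    of \<open>f\<close>.\<close>
  define g :: "'a fam" where "g = (\<lambda>n w x. if w = u
      then p2 (p1 x) - p2 (p1 (p2 (p2 x))) - AA u z (p2 (p1 (p1 (p2 x))))
      else p2 (p1 x) - A z u (p2 (p1 (p2 x))))"
  define s :: "'a fam" where "s = (\<lambda>n w x. if w = u
      then pr (pr (pr (p2 (p1 (p2 (p2 x)))) (p2 (p1 (p1 (p2 x))))) 0)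
             (pr (pr (pr (- p2 (p1 (p2 x))) 0) 0) (pr (pr (- p2 (p2 (p2 x))) 0) 0))
      else pr (pr (- p2 (p1 (p2 x))) 0) (pr (pr (p2 (p2 x)) 0) 0))"
  have fs [simp]: "f n u x = pr (pr (pr 0 0) x) (pr (pr (pr x 0) 0) (pr (pr (AA u z x) 0) 0))"
    "f n (opp u) x = pr (pr 0 x) (pr (pr (A z (opp u) x) 0) 0)" for n x by (auto simp: f_def)
  have gs [simp]: "g n u x = p2 (p1 x) - p2 (p1 (p2 (p2 x))) - AA u z (p2 (p1 (p1 (p2 x))))"
    "g n (opp u) x = p2 (p1 x) - A z u (p2 (p1 (p2 x)))" for n x by (auto simp: g_def)
  have ss [simp]: "s n u x = pr (pr (pr (p2 (p1 (p2 (p2 x)))) (p2 (p1 (p1 (p2 x))))) 0)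
             (pr (pr (pr (- p2 (p1 (p2 x))) 0) 0) (pr (pr (- p2 (p2 (p2 x))) 0) 0))"
    "s n (opp u) x = pr (pr (- p2 (p1 (p2 x))) 0) (pr (pr (p2 (p2 x)) 0) 0)" for n x by (auto simp: s_def)
  note l = lin_simps[OF kmod_linA[OF z]] lin_simps[OF kmod_linD[OF z]]
  note cl = sub_closed[OF kmod_sub[OF z]]
  note zz = kmod_AAA[OF z] kmod_AAA'[OF z] kmod_DA[OF z] kmod_DA'[OF z] kmod_A[OF z] kmod_A'[OF z] kmod_D[OF z] kmod_DD[OF z]
  have AA: "x \<in> V z m u \<Longrightarrow> m + 2 = k \<Longrightarrow> AA u z x \<in> V z k u" for x m k using kmod_AA[OF z] by auto
  have DAA: "x \<in> V z m u \<Longrightarrow> m + 2 = k \<Longrightarrow> D z k u (AA u z x) = AA u z (D z m u x)" for x m k using kmod_DAA[OF z] by auto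
  have A1: "x \<in> V z m u \<Longrightarrow> m + 1 = k \<Longrightarrow> A z u x \<in> V z k (opp u)" for x m k using kmod_A[OF z] by auto
  have f: "f \<in> cyc 0 z ?T"
  proof (rule cycI2[where u=u])
    show "f \<in> hom 0 z ?T"
      by (rule homI2[where u=u]) (auto simp: lin_def l sc_add zz cl AA)
  qed (auto simp: l zz cl DAA)
  have g: "g \<in> cyc 0 ?T z"
  proof (rule cycI2[where u=u])
    show "g \<in> hom 0 ?T z"
      by (rule homI2[where u=u]) (auto simp: lin_def l sc_add sc_diff zz cl AA A1 algebra_simps)
  next
    fix n x assume "x \<in> V ?T n u"
    then have m: "p2 (p1 (p1 (p2 x))) \<in> V z (n - 2) u" by (auto simp: algebra_simps)
    show "g (n + 1) u (D ?T n u x) = sgn_pow 0 \<star> D z (n + 0) u (g n u x)"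
      using DAA[OF m, of n] by (simp add: l algebra_simps)
  next
    fix n x assume "x \<in> V ?T n (opp u)"
    then have m: "p2 (p1 (p2 x)) \<in> V z (n - 1) u" by (auto simp: algebra_simps)
    show "g (n + 1) (opp u) (D ?T n (opp u) x) = sgn_pow 0 \<star> D z (n + 0) (opp u) (g n (opp u) x)"
      using kmod_DA[OF z m] by (simp add: l algebra_simps)
  qed
  have s: "s \<in> hom (0 - 1) ?T ?T"
    by (rule homI2[where u=u]) (auto simp: lin_def l sc_add sc_diff zz cl algebra_simps)
  have "comp 0 g f - idf \<in> bdr 0 z z"
  proof -
    have "comp 0 g f - idf = (0 :: 'a fam)"
      unfolding comp_def idf_def fun_eq_iff by (simp add: f_def g_def l)
    then show ?thesis using bdr_0[OF z] by metis
  qed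
  moreover have "- (comp 0 f g - idf) \<in> bdr 0 ?T ?T"
  proof (rule bdrI2[OF s])
    fix n x assume x: "x \<in> V ?T n u"
    then have m: "p2 (p1 (p1 (p2 x))) \<in> V z (n - 2) u" "p2 (p1 (p2 (p2 x))) \<in> V z n u" by (auto simp: algebra_simps)
    have i: "n - 1 - 1 = n - 2" by simp
    show "(- (comp 0 f g - idf)) n u x = D ?T (n + 0 - 1) u (s n u x) + sgn_pow 0 \<star> s (n + 1) u (D ?T n u x)"
      using kmod_AAA[OF z m(1)]
      by (simp add: comp_def idf_def l algebra_simps i; intro pr_eqI; simp; intro pr_eqI; simp)
  next
    fix n x assume x: "x \<in> V ?T n (opp u)"
    then have m: "p2 (p1 (p2 x)) \<in> V z (n - 1) u" by (auto simp: algebra_simps)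
    show "(- (comp 0 f g - idf)) n (opp u) x = D ?T (n + 0 - 1) (opp u) (s n (opp u) x) + sgn_pow 0 \<star> s (n + 1) (opp u) (D ?T n (opp u) x)"
      using m
      by (simp add: comp_def idf_def l algebra_simps; intro pr_eqI; simp; intro pr_eqI; simp)
  qed
  then have "comp (- 0) f g - idf \<in> bdr 0 ?T ?T"
    using bdr_neg[OF kmod_Ti[OF kmod_Tw[OF z]]] by fastforce
  ultimately show ?thesis unfolding heq_def using f g by (intro bexI[of _ f] bexI[of _ g]) auto
qed

lemma diff_hom_hom: assumes M: "kmod M" "kmod N" and f: "f \<in> hom m M N" shows "diff_hom m M N f \<in> hom (m + 1) M N"
proof (rule homI)
  note l = lin_simps[OF homD(1)[OF f]] lin_simps[OF kmod_linA[OF M(2)]] lin_simps[OF kmod_linD[OF M(2)]]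
  fix n w show "lin (diff_hom m M N f n w)"
    unfolding lin_def diff_hom_def by (simp add: l lin_simps[OF kmod_linD[OF M(1)]] sc_add sc_diff mult.commute algebra_simps)
  fix x assume x: "x \<in> V M n w"
  have d: "D M n w x \<in> V M (n + 1) w" using kmod_D[OF M(1) x] .
  have fd: "f (n + 1) w (D M n w x) \<in> V N (n + m + 1) w" using homD(2)[OF f d] by (simp add: algebra_simps)
  have fx: "f n w x \<in> V N (n + m) w" using homD(2)[OF f x] .
  show "diff_hom m M N f n w x \<in> V N (n + (m + 1)) w"
    using fd kmod_D[OF M(2) fx] by (auto simp: diff_hom_def ac_simps intro!: sub_closed[OF kmod_sub[OF M(2)]])
  have "f (n + 1 + 1) (opp w) (D M (n + 1) (opp w) (A M w x)) = - (sgn_pow m \<star> A N w (f (n + 1) w (D M n w x)))"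
    using homD(3)[OF f d] kmod_DA[OF M(1) x] by (simp add: l)
  then show "diff_hom m M N f (n + 1) (opp w) (A M w x) = sgn_pow (m + 1) \<star> A N w (diff_hom m M N f n w x)"
    using homD(3)[OF f x] kmod_DA[OF M(2) fx] by (simp add: diff_hom_def l sgn_pow_add sc_diff algebra_simps)
qed

text \<open>The transpose from maps \<open>y -> Ti u z\<close> to maps \<open>Tw u y -> z\<close>.
  On the idempotent copy the value is the loop coefficient of \<open>G\<close>, with the sign of the
  shift; linearity dictates the arrow and loop copies, and on \<open>y\<close> the value is the
  \<open>z\<close>-component of \<open>G\<close>.\<close>

definition adj :: "vertex \<Rightarrow> int \<Rightarrow> 'k::field kmod \<Rightarrow> 'k fam \<Rightarrow> 'k fam" where
  "adj u m z G = (\<lambda>n w x. if w = u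
     then sgn_pow m \<star> p1 (p2 (G (n + 1) u (p1 (p1 x)))) + AA u z (sgn_pow m \<star> p1 (p2 (G (n - 1) u (p2 (p1 x)))))
        + p1 (G n u (p2 x))
     else A z u (p1 (p2 (G n u (p1 x)))) + p1 (G n w (p2 x)))"

text \<open>The inverse transpose. The loop coefficient at \<open>x\<close> is the value of
  \<open>F\<close> on the idempotent copy of \<open>x\<close>; the arrow and idempotent coefficients
  are loop coefficients at \<open>A x\<close> and \<open>A A x\<close>.\<close>

definition coadj :: "vertex \<Rightarrow> int \<Rightarrow> 'k::field kmod \<Rightarrow> 'k fam \<Rightarrow> 'k fam" where
  "coadj u m y F = (\<lambda>n w x. if w = u
     then pr (F n u (pr 0 x)) (pr (sgn_pow m \<star> F (n - 1) u (pr (pr x 0) 0))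
        (sgn_pow m \<star> F (n + 1) u (pr (pr (AA u y x) 0) 0)))
     else pr (F n w (pr 0 x)) (F n u (pr (pr (A y w x) 0) 0)))"

lemma adj_simps [simp]:
  "adj u m z G n u x = sgn_pow m \<star> p1 (p2 (G (n + 1) u (p1 (p1 x)))) + AA u z (sgn_pow m \<star> p1 (p2 (G (n - 1) u (p2 (p1 x)))))
        + p1 (G n u (p2 x))"
  "adj u m z G n (opp u) x = A z u (p1 (p2 (G n u (p1 x)))) + p1 (G n (opp u) (p2 x))"
  by (simp_all add: adj_def)
lemma coadj_simps [simp]:
  "coadj u m y F n u x = pr (F n u (pr 0 x)) (pr (sgn_pow m \<star> F (n - 1) u (pr (pr x 0) 0))
        (sgn_pow m \<star> F (n + 1) u (pr (pr (AA u y x) 0) 0)))"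
  "coadj u m y F n (opp u) x = pr (F n (opp u) (pr 0 x)) (F n u (pr (pr (A y (opp u) x) 0) 0))"
  by (simp_all add: coadj_def)

section \<open>The adjunction between the twist and the inverse twist\<close>

context
  fixes y z :: "'k::field kmod" and u :: vertex
  assumes y: "kmod y" and z: "kmod z"
begin

text \<open>Linearity of \<open>G\<close> over \<open>A\<close>, read off in components. The last
  two facts express arrow and idempotent coefficients through loop coefficients, which is
  coinduction in explicit form.\<close>

lemma adj_hom_facts: assumes G: "G \<in> hom m y (Ti u z)"
  shows "x \<in> V y n u \<Longrightarrow> p1 (G n u x) \<in> V z (n + m) u"
    "x \<in> V y n u \<Longrightarrow> p1 (p2 (G n u x)) \<in> V z (n + m - 1) u"
    "x \<in> V y n u \<Longrightarrow> p1 (G (n + 1) (opp u) (A y u x)) = sgn_pow m \<star> A z u (p1 (G n u x))"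
    "x \<in> V y n u \<Longrightarrow> p2 (G (n + 1) (opp u) (A y u x)) = sgn_pow m \<star> p2 (p2 (G n u x))"
    "x \<in> V y n (opp u) \<Longrightarrow> p1 (G n (opp u) x) \<in> V z (n + m) (opp u)"
    "x \<in> V y n (opp u) \<Longrightarrow> p1 (G (n + 1) u (A y (opp u) x)) = sgn_pow m \<star> A z (opp u) (p1 (G n (opp u) x))"
    "x \<in> V y n (opp u) \<Longrightarrow> p1 (p2 (G (n + 1) u (A y (opp u) x))) = sgn_pow m \<star> p2 (G n (opp u) x)"
    "x \<in> V y n u \<Longrightarrow> p1 (p2 (G (n + 2) u (AA u y x))) = p2 (p2 (G n u x))"
proof -
  show 1: "x \<in> V y n u \<Longrightarrow> p1 (G n u x) \<in> V z (n + m) u" "x \<in> V y n u \<Longrightarrow> p1 (p2 (G n u x)) \<in> V z (n + m - 1) u"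
    using homD(2)[OF G, of x n u] by auto
  show 3: "x \<in> V y n u \<Longrightarrow> p1 (G (n + 1) (opp u) (A y u x)) = sgn_pow m \<star> A z u (p1 (G n u x))"
    "x \<in> V y n u \<Longrightarrow> p2 (G (n + 1) (opp u) (A y u x)) = sgn_pow m \<star> p2 (p2 (G n u x))"
    using homD(3)[OF G, of x n u] by auto
  show "x \<in> V y n (opp u) \<Longrightarrow> p1 (G n (opp u) x) \<in> V z (n + m) (opp u)"
    using homD(2)[OF G, of x n "opp u"] by auto
  show 4: "x \<in> V y n (opp u) \<Longrightarrow> p1 (G (n + 1) u (A y (opp u) x)) = sgn_pow m \<star> A z (opp u) (p1 (G n (opp u) x))"
    "x \<in> V y n (opp u) \<Longrightarrow> p1 (p2 (G (n + 1) u (A y (opp u) x))) = sgn_pow m \<star> p2 (G n (opp u) x)" for x n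
    using homD'[OF G, of x n] by auto
  show "x \<in> V y n u \<Longrightarrow> p1 (p2 (G (n + 2) u (AA u y x))) = p2 (p2 (G n u x))"
    using 3(2) 4(2)[OF kmod_A[OF y]] by (simp add: algebra_simps)
qed

lemma adj_hom: assumes G: "G \<in> hom m y (Ti u z)" shows "adj u m z G \<in> hom m (Tw u y) z"
proof -
  note l = lin_simps[OF homD(1)[OF G]] lin_simps[OF kmod_linA[OF z]] lin_simps[OF kmod_linD[OF z]]
  note G' = adj_hom_facts[OF G]
  note cl = sub_closed[OF kmod_sub[OF z]]
  show ?thesis
  proof (rule homI2[where u=u])
    fix n
    show "lin (adj u m z G n u)" "lin (adj u m z G n (opp u))"
      unfolding lin_def by (auto simp: l sc_add algebra_simps)
    fix x
    {
      assume "x \<in> V (Tw u y) n u"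
      then have x: "p1 (p1 x) \<in> V y (n + 1) u" "p2 (p1 x) \<in> V y (n - 1) u" "p2 x \<in> V y n u" by auto
      have i: "n - 1 + m - 1 + 2 = n + m" "n + 1 + m - 1 = n + m" by simp_all
      show "adj u m z G n u x \<in> V z (n + m) u"
        using G'(1)[OF x(3)] G'(2)[OF x(1)] kmod_AA[OF z G'(2)[OF x(2)]] by (simp add: cl i l)
      show "adj u m z G (n + 1) (opp u) (A (Tw u y) u x) = sgn_pow m \<star> A z u (adj u m z G n u x)"
        using G'(3)[OF x(3)] kmod_AAA[OF z G'(2)[OF x(2)]] by (simp add: l sc_add)
    next
      assume "x \<in> V (Tw u y) n (opp u)"
      then have x: "p1 x \<in> V y n u" "p2 x \<in> V y n (opp u)" by auto
      show "adj u m z G n (opp u) x \<in> V z (n + m) (opp u)"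
        using kmod_A[OF z G'(2)[OF x(1)]] G'(5)[OF x(2)] by (simp add: cl)
      show "adj u m z G (n + 1) u (A (Tw u y) (opp u) x) = sgn_pow m \<star> A z (opp u) (adj u m z G n (opp u) x)"
        using G'(6)[OF x(2)] by (simp add: l sc_add)
    }
  qed
qed

lemma coadj_hom: assumes F: "F \<in> hom m (Tw u y) z" shows "coadj u m y F \<in> hom m y (Ti u z)"
proof -
  note l = lin_simps[OF homD(1)[OF F]] lin_simps[OF kmod_linA[OF z]] lin_simps[OF kmod_linA[OF y]]
  note cl = sub_closed[OF kmod_sub[OF z]]
  note cy = sub_closed[OF kmod_sub[OF y]]
  have la: "pr 0 (a + b) = pr 0 a + pr 0 b" "pr (a + b) 0 = pr a 0 + pr b 0" "pr 0 (c \<star> a) = c \<star> pr 0 a" "pr (c \<star> a) 0 = c \<star> pr a 0" for a b :: "'k U" and c by simp_all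
  have m1: "x \<in> V y n u \<Longrightarrow> F n u (pr 0 x) \<in> V z (n + m) u" for n x
    using homD(2)[OF F, of "pr 0 x" n u] by (simp add: cy)
  have m2: "x \<in> V y n u \<Longrightarrow> n + m - 1 = k \<Longrightarrow> F (n - 1) u (pr (pr x 0) 0) \<in> V z k u" for n x k
    using homD(2)[OF F, of "pr (pr x 0) 0" "n - 1" u] by (simp add: cy algebra_simps)
  have m3: "x \<in> V y n (opp u) \<Longrightarrow> F n (opp u) (pr 0 x) \<in> V z (n + m) (opp u)" for n x
    using homD(2)[OF F, of "pr 0 x" n "opp u"] by (simp add: cy)
  have a1: "x \<in> V y n u \<Longrightarrow> F (n + 1) (opp u) (pr 0 (A y u x)) = sgn_pow m \<star> A z u (F n u (pr 0 x))" for n x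
    using homD(3)[OF F, of "pr 0 x" n u] by (simp add: cy)
  have a2: "x \<in> V y n (opp u) \<Longrightarrow> F (n + 1) u (pr 0 (A y (opp u) x)) = sgn_pow m \<star> A z (opp u) (F n (opp u) (pr 0 x))" for n x
    using homD'[OF F, of "pr 0 x" n u] by (simp add: cy)
  show ?thesis
  proof (rule homI2[where u=u])
    fix n
    show "lin (coadj u m y F n u)" "lin (coadj u m y F n (opp u))"
      unfolding lin_def by (simp_all add: la l sc_add algebra_simps del: pr_ops) (simp_all add: mult.commute)
    fix x
    {
      assume x: "x \<in> V y n u"
      show "coadj u m y F n u x \<in> V (Ti u z) (n + m) u"
        using m1[OF x] m2[OF x refl] m2[OF kmod_AA[OF y x] refl] by (simp add: cl algebra_simps)
      show "coadj u m y F (n + 1) (opp u) (A y u x) = sgn_pow m \<star> A (Ti u z) u (coadj u m y F n u x)"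
        using a1[OF x] by (simp add: l)
    next
      assume x: "x \<in> V y n (opp u)"
      show "coadj u m y F n (opp u) x \<in> V (Ti u z) (n + m) (opp u)"
        using m3[OF x] m2[OF kmod_A'[OF y x], of "n + m"] by (simp add: cl)
      show "coadj u m y F (n + 1) u (A y (opp u) x) = sgn_pow m \<star> A (Ti u z) (opp u) (coadj u m y F n (opp u) x)"
        using a2[OF x] kmod_AAA'[OF y x] lin_simps(3)[OF homD(1)[OF F]] by (simp add: l)
    }
  qed
qed

text \<open>A morphism out of \<open>Tw u y\<close> is determined by its values on \<open>y\<close>
  and on the idempotent copy, since arrows carry the latter to the arrow and loop copies.\<close>

lemma adj_coadj: assumes F: "F \<in> hom m (Tw u y) z" and x: "x \<in> V (Tw u y) n w"
  shows "adj u m z (coadj u m y F) n w x = F n w x"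
proof -
  note l = lin_add[OF homD(1)[OF F]]
  note la = lin_simps[OF kmod_linA[OF z]]
  note cy = sub_closed[OF kmod_sub[OF y]]
  consider "w = u" | "w = opp u" using vertex_cases by blast
  then show ?thesis
  proof cases
    case 1
    from x 1 have m: "p1 (p1 x) \<in> V y (n + 1) u" "p2 (p1 x) \<in> V y (n - 1) u" "p2 x \<in> V y n u" by auto
    have "pr (pr (p2 (p1 x)) 0) 0 \<in> V (Tw u y) (n - 2) u" using m(2) by (simp add: cy)
    from hom_AA[OF F kmod_Tw[OF y] z this]
    have "F n u (pr (pr 0 (p2 (p1 x))) 0) = AA u z (F (n - 2) u (pr (pr (p2 (p1 x)) 0) 0))"
      by (simp add: lin_simps[OF kmod_linA[OF y]])
    moreover have "F n u x = F n u (pr (pr (p1 (p1 x)) 0) 0 + pr (pr 0 (p2 (p1 x))) 0 + pr 0 (p2 x))"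
      by (rule arg_cong[where f="F n u"]) (rule pr_eqI; (rule pr_eqI)?; simp)
    ultimately show ?thesis by (simp add: 1 l la del: pr_ops)
  next
    case 2
    from x 2 have m: "p1 x \<in> V y n u" "p2 x \<in> V y n (opp u)" by auto
    have "pr (pr (p1 x) 0) 0 \<in> V (Tw u y) (n - 1) u" using m(1) by (simp add: cy)
    from homD(3)[OF F this]
    have "F n (opp u) (pr (p1 x) 0) = sgn_pow m \<star> A z u (F (n - 1) u (pr (pr (p1 x) 0) 0))"
      by (simp add: lin_simps[OF kmod_linA[OF y]])
    moreover have "F n (opp u) x = F n (opp u) (pr (p1 x) 0 + pr 0 (p2 x))"
      by (rule arg_cong[where f="F n (opp u)"]) (rule pr_eqI; simp)
    ultimately show ?thesis by (simp add: 2 l la del: pr_ops)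
  qed
qed

text \<open>This makes the transpose an isomorphism of morphism complexes and not only of graded
  morphisms, so that it descends to homotopy classes.\<close>

lemma adj_bd: assumes G: "G \<in> hom m y (Ti u z)" and x: "x \<in> V (Tw u y) n w"
  shows "diff_hom m (Tw u y) z (adj u m z G) n w x = adj u (m + 1) z (diff_hom m y (Ti u z) G) n w x"
proof -
  note l = lin_simps[OF homD(1)[OF G]] lin_simps[OF kmod_linA[OF z]] lin_simps[OF kmod_linD[OF z]]
  note G' = adj_hom_facts[OF G]
  consider "w = u" | "w = opp u" using vertex_cases by blast
  then show ?thesis
  proof cases
    case 1
    from x 1 have m: "p1 (p1 x) \<in> V y (n + 1) u" "p2 (p1 x) \<in> V y (n - 1) u" "p2 x \<in> V y n u" by auto
    have i: "n - 1 + m - 1 + 2 = n + m" "n - 1 + 2 = n + 1" by simp_all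
    have a: "D z (m + n) u (AA u z (p1 (p2 (G (n - 1) u (p2 (p1 x)))))) = AA u z (D z (m + n - 2) u (p1 (p2 (G (n - 1) u (p2 (p1 x))))))"
      using kmod_DAA[OF z G'(2)[OF m(2)]] by (simp add: i algebra_simps)
    have b: "p1 (G (1 + n) u (AA u y (p2 (p1 x)))) = AA u z (p1 (G (n - 1) u (p2 (p1 x))))"
      using G'(6)[OF kmod_A[OF y m(2)]] G'(3)[OF m(2)] by (simp add: l algebra_simps)
    show ?thesis unfolding 1 by (simp add: diff_hom_def l a b sgn_pow_add sc_add sc_diff algebra_simps)
  next
    case 2
    from x 2 have m: "p1 x \<in> V y n u" "p2 x \<in> V y n (opp u)" by auto
    have a: "D z (m + n) (opp u) (A z u (p1 (p2 (G n u (p1 x))))) = - A z u (D z (m + n - 1) u (p1 (p2 (G n u (p1 x)))))"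
      using kmod_DA[OF z G'(2)[OF m(1)]] by (simp add: algebra_simps)
    show ?thesis unfolding 2 using G'(3)[OF m(1)]
      by (simp add: diff_hom_def l a sgn_pow_add sc_add sc_diff algebra_simps)
  qed
qed

text \<open>The idempotent copy of \<open>Tw u y\<close> detects the loop coefficients of
  \<open>G\<close>, which determine its other coefficients along \<open>P_u\<close>; the summand
  \<open>y\<close> detects the \<open>z\<close>-component.\<close>

lemma adj_inj: assumes G: "G \<in> hom m y (Ti u z)" and 0: "\<And>n w x. x \<in> V (Tw u y) n w \<Longrightarrow> adj u m z G n w x = 0"
    and x: "x \<in> V y n w" shows "G n w x = 0"
proof -
  note l = lin_simps[OF homD(1)[OF G]] lin_simps[OF kmod_linA[OF z]]
  note G' = adj_hom_facts[OF G]
  note cy = sub_closed[OF kmod_sub[OF y]]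
  have ge: "p1 (p2 (G n u x)) = 0" if "x \<in> V y n u" for n x
  proof -
    have "sgn_pow m \<star> p1 (p2 (G n u x)) = 0"
      using 0[of "pr (pr x 0) 0" "n - 1" u] that by (simp add: cy l)
    then have "sgn_pow m \<star> sgn_pow m \<star> p1 (p2 (G n u x)) = sgn_pow m \<star> 0" by (rule arg_cong)
    then show ?thesis by simp
  qed
  consider "w = u" | "w = opp u" using vertex_cases by blast
  then show ?thesis
  proof cases
    case 1
    with x have x': "x \<in> V y n u" by simp
    have "p1 (G n u x) = 0" using 0[of "pr 0 x" n u] x' by (simp add: cy l)
    moreover have "p2 (p2 (G n u x)) = 0" using G'(8)[OF x'] ge[OF kmod_AA[OF y x']] by simp
    moreover have "p2 (G n u x) = 0" by (rule pr_eqI) (simp_all add: ge[OF x'] calculation)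
    ultimately show ?thesis unfolding 1 by - (rule pr_eqI, simp_all)
  next
    case 2
    with x have x': "x \<in> V y n (opp u)" by simp
    have "p1 (G n (opp u) x) = 0" using 0[of "pr 0 x" n "opp u"] x' by (simp add: cy l)
    moreover have "sgn_pow m \<star> p2 (G n (opp u) x) = 0" using G'(7)[OF x'] ge[OF kmod_A'[OF y x']] by simp
    then have "sgn_pow m \<star> sgn_pow m \<star> p2 (G n (opp u) x) = sgn_pow m \<star> 0" by (rule arg_cong)
    ultimately show ?thesis unfolding 2 by - (rule pr_eqI, simp_all)
  qed
qed

lemma adj_cong: assumes "\<And>n w x. x \<in> V y n w \<Longrightarrow> G n w x = H n w x" "x \<in> V (Tw u y) n w"
  shows "adj u m z G n w x = adj u m z H n w x"
  using vertex_cases[of w u] assms by auto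

lemma adj_diff: "adj u m z (G - H) = adj u m z G - adj u m z H"
  by (intro ext) (simp add: adj_def lin_simps[OF kmod_linA[OF z]] sc_diff algebra_simps)

lemma hom_diff: assumes "kmod N" "f \<in> hom m M N" "g \<in> hom m M N" shows "f - g \<in> hom m M N"
  using hom_add[OF assms(1,2) hom_fsc[OF assms(1,3), of "-1"]] by (simp add: fsc_neg)

lemma hdim_adj: assumes "hdim m y (Ti u z) r" shows "hdim m (Tw u y) z r"
proof (rule hdim_transfer[OF assms kmod_Ti[OF z] z, where \<phi>="adj u m z"])
  note lz = lin_simps[OF kmod_linA[OF z]]
  show "adj u m z (f + g) = adj u m z f + adj u m z g" "adj u m z (fsc c f) = fsc c (adj u m z f)" for f g c
    by (intro ext, simp add: adj_def lz sc_add algebra_simps)+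
  have bdZ: "f \<in> cyc m' M N \<longleftrightarrow> f \<in> hom m' M N \<and> (\<forall>n w. \<forall>x \<in> V M n w. diff_hom m' M N f n w x = 0)" for f :: "'k fam" and m' M N
  proof -
    have "f (n + 1) w (D M n w x) = sgn_pow m' \<star> D N (n + m') w (f n w x) \<longleftrightarrow> diff_hom m' M N f n w x = 0" for n w x
    proof -
      have "a = sgn_pow m' \<star> b \<longleftrightarrow> b - sgn_pow m' \<star> a = 0" for a b :: "'k U"
      proof -
        have "a = sgn_pow m' \<star> b \<Longrightarrow> b - sgn_pow m' \<star> a = 0" by simp
        moreover have "b - sgn_pow m' \<star> a = 0 \<Longrightarrow> sgn_pow m' \<star> b = a" by simp
        ultimately show ?thesis by blast
      qed
      then show ?thesis unfolding diff_hom_def by blast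
    qed
    then show ?thesis unfolding cyc_def by blast
  qed
  have bdC: "diff_hom m' M N f n w x = diff_hom m' M N g n w x" if "kmod M" "\<And>n w x. x \<in> V M n w \<Longrightarrow> f n w x = g n w x" "x \<in> V M n w"
    for f g :: "'k fam" and m' M N n w x
    using that(2)[OF that(3)] that(2)[OF kmod_D[OF that(1,3)]] by (simp add: diff_hom_def)
  fix G assume G: "G \<in> cyc m y (Ti u z)"
  note Gh = cycD(1)[OF G]
  show "adj u m z G \<in> cyc m (Tw u y) z"
  proof -
    have "diff_hom m (Tw u y) z (adj u m z G) n w x = 0" if x: "x \<in> V (Tw u y) n w" for n w x
    proof -
      have "adj u (m + 1) z (diff_hom m y (Ti u z) G) n w x = adj u (m + 1) z 0 n w x"
        using G by (intro adj_cong[OF _ x]) (auto simp: bdZ)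
      also have "\<dots> = 0" by (simp add: adj_def lz)
      finally show ?thesis using adj_bd[OF Gh x] by simp
    qed
    then show ?thesis using adj_hom[OF Gh] by (simp add: bdZ)
  qed
  show "adj u m z G \<in> bdr m (Tw u y) z \<longleftrightarrow> G \<in> bdr m y (Ti u z)"
  proof
    assume "G \<in> bdr m y (Ti u z)"
    then obtain S where S: "S \<in> hom (m - 1) y (Ti u z)" "\<And>n w x. x \<in> V y n w \<Longrightarrow> G n w x = diff_hom (m - 1) y (Ti u z) S n w x"
      unfolding bdr_def by blast
    have "adj u m z G n w x = diff_hom (m - 1) (Tw u y) z (adj u (m - 1) z S) n w x" if x: "x \<in> V (Tw u y) n w" for n w x
      using adj_bd[OF S(1) x] adj_cong[OF S(2) x, where m=m] by simp
    then show "adj u m z G \<in> bdr m (Tw u y) z" unfolding bdr_def using adj_hom[OF S(1)] by blast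
  next
    assume "adj u m z G \<in> bdr m (Tw u y) z"
    then obtain S where S: "S \<in> hom (m - 1) (Tw u y) z" "\<And>n w x. x \<in> V (Tw u y) n w \<Longrightarrow> adj u m z G n w x = diff_hom (m - 1) (Tw u y) z S n w x"
      unfolding bdr_def by blast
    \<comment> \<open>The transposed homotopy. Its boundary and \<open>G\<close> have the same
      transpose on \<open>V\<close>, hence agree by injectivity.\<close>
    define S' where "S' = coadj u (m - 1) y S"
    have S': "S' \<in> hom (m - 1) y (Ti u z)" unfolding S'_def by (rule coadj_hom[OF S(1)])
    have b: "diff_hom (m - 1) y (Ti u z) S' \<in> hom m y (Ti u z)" using diff_hom_hom[OF y kmod_Ti[OF z] S'] by simp
    have "adj u m z (G - diff_hom (m - 1) y (Ti u z) S') n w x = 0" if x: "x \<in> V (Tw u y) n w" for n w x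
    proof -
      have "diff_hom (m - 1) (Tw u y) z S n w x = diff_hom (m - 1) (Tw u y) z (adj u (m - 1) z S') n w x"
        unfolding S'_def by (rule bdC[OF kmod_Tw[OF y] _ x]) (simp add: adj_coadj[OF S(1)])
      then show ?thesis using adj_bd[OF S' x] S(2)[OF x] by (simp add: adj_diff)
    qed
    from adj_inj[OF hom_diff[OF kmod_Ti[OF z] Gh b] this]
    have "G n w x = diff_hom (m - 1) y (Ti u z) S' n w x" if "x \<in> V y n w" for n w x
      using that by force
    then show "G \<in> bdr m y (Ti u z)" unfolding bdr_def using S' by blast
  qed
next
  fix F assume F: "F \<in> cyc m (Tw u y) z"
  note Fh = cycD(1)[OF F]
  define G where "G = coadj u m y F"
  have G: "G \<in> hom m y (Ti u z)" unfolding G_def by (rule coadj_hom[OF Fh])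
  have FG: "x \<in> V (Tw u y) n w \<Longrightarrow> adj u m z G n w x = F n w x" for n w x
    unfolding G_def by (rule adj_coadj[OF Fh])
  have bG: "diff_hom m y (Ti u z) G \<in> hom (m + 1) y (Ti u z)" using diff_hom_hom[OF y kmod_Ti[OF z] G] .
  have "adj u (m + 1) z (diff_hom m y (Ti u z) G) n w x = 0" if x: "x \<in> V (Tw u y) n w" for n w x
  proof -
    have "adj u (m + 1) z (diff_hom m y (Ti u z) G) n w x = diff_hom m (Tw u y) z F n w x"
      using adj_bd[OF G x] FG[OF x] FG[OF kmod_D[OF kmod_Tw[OF y] x]] by (simp add: diff_hom_def)
    also have "\<dots> = 0" using cycD(2)[OF F x] by (simp add: diff_hom_def)
    finally show ?thesis .
  qed
  from adj_inj[OF bG this] have b0: "x \<in> V y n w \<Longrightarrow> diff_hom m y (Ti u z) G n w x = 0" for n w x by blast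
  have "G (n + 1) w (D y n w x) = sgn_pow m \<star> D (Ti u z) (n + m) w (G n w x)" if "x \<in> V y n w" for n w x
  proof -
    have "D (Ti u z) (n + m) w (G n w x) = sgn_pow m \<star> G (n + 1) w (D y n w x)" using b0[OF that] by (simp add: diff_hom_def)
    then show ?thesis by simp
  qed
  then have "G \<in> cyc m y (Ti u z)" using G by (intro cycI) auto
  moreover have "F - adj u m z G \<in> bdr m (Tw u y) z"
    by (rule bdr_cong[OF bdr_0[OF z]]) (simp add: FG)
  ultimately show "\<exists>G\<in>cyc m y (Ti u z). F - adj u m z G \<in> bdr m (Tw u y) z" by blast
qed

end

text \<open>The chain \<open>Hom(y, z) = Hom(y, Ti Tw z) = Hom(Tw y, Tw z)\<close>: the unit is an
  equivalence, then the adjunction applies.\<close>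

theorem hdim_Tw: assumes y: "kmod y" "kmod z" and "hdim m y z r" shows "hdim m (Tw u y) (Tw u z) r"
proof -
  have "hdim (m + 0) y (Ti u (Tw u z)) r"
    by (rule hdim_post[OF y kmod_Ti[OF kmod_Tw[OF y(2)]] heq_Ti_Tw[OF y(2)] assms(3)])
  then show ?thesis using hdim_adj[OF y(1) kmod_Tw[OF y(2)]] by simp
qed

text \<open>A deformation retraction of the complex at \<open>u\<close> onto \<open>H\<close>, with
  inclusion \<open>c\<close>, retraction \<open>\<rho>\<close> and homotopy \<open>k\<close>,
  extends to the cones: \<open>f\<close> is induced by \<open>c\<close>, and \<open>g\<close> by
  \<open>\<rho>\<close> with a term in \<open>k\<close> that makes it a chain map. The side
  condition \<open>k c = 0\<close> makes \<open>g f\<close> the identity on the module.\<close>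

lemma heq_TT:
  assumes y: "kmod y" and W: "cpx u H c (\<lambda>n x. 0) y"
    and lr: "\<And>n. lin (\<rho> n)" and lk: "\<And>n. lin (k n)"
    and rH: "\<And>n x. x \<in> V y n u \<Longrightarrow> \<rho> n x \<in> H n" and rc: "\<And>n a. a \<in> H n \<Longrightarrow> \<rho> n (c n a) = a"
    and rD: "\<And>n x. x \<in> V y n u \<Longrightarrow> \<rho> (n + 1) (D y n u x) = 0"
    and kV: "\<And>n x. x \<in> V y n u \<Longrightarrow> k n x \<in> V y (n - 1) u" and kc: "\<And>n a. a \<in> H n \<Longrightarrow> k n (c n a) = 0"
    and hty: "\<And>n x. x \<in> V y n u \<Longrightarrow> x - c n (\<rho> n x) = D y (n - 1) u (k n x) + k (n + 1) (D y n u x)"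
  shows "heq 0 (TT u H c (\<lambda>n x. 0) y) (Tw u y)"
proof -
  let ?S = "TT u H c (\<lambda>n x. 0) y"
  have lc: "\<And>n. lin (c n)" and sH: "\<And>n. sub (H n)" and cV: "\<And>n x. x \<in> H n \<Longrightarrow> c n x \<in> V y n u"
     and Dc: "\<And>n x. x \<in> H n \<Longrightarrow> D y n u (c n x) = 0"
    using W unfolding cpx_def by (auto simp: lin_0)
  define f :: "'a fam" where "f = (\<lambda>n w x. if w = u then pr (pr (c (n + 1) (p1 (p1 x))) (c (n - 1) (p2 (p1 x)))) (p2 x)
      else pr (c n (p1 x)) (p2 x))"
  define g :: "'a fam" where "g = (\<lambda>n w x. if w = u
      then pr (pr (\<rho> (n + 1) (p1 (p1 x))) (\<rho> (n - 1) (p2 (p1 x)))) (p2 x + k (n + 1) (p1 (p1 x)) + AA u y (k (n - 1) (p2 (p1 x))))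
      else pr (\<rho> n (p1 x)) (p2 x + A y u (k n (p1 x))))"
  define s :: "'a fam" where "s = (\<lambda>n w x. if w = u
      then pr (pr (- k (n + 1) (p1 (p1 x))) (- k (n - 1) (p2 (p1 x)))) 0
      else pr (k n (p1 x)) 0)"
  have fs [simp]: "f n u x = pr (pr (c (n + 1) (p1 (p1 x))) (c (n - 1) (p2 (p1 x)))) (p2 x)"
      "f n (opp u) x = pr (c n (p1 x)) (p2 x)" for n x by (auto simp: f_def)
  have gs [simp]: "g n u x = pr (pr (\<rho> (n + 1) (p1 (p1 x))) (\<rho> (n - 1) (p2 (p1 x)))) (p2 x + k (n + 1) (p1 (p1 x)) + AA u y (k (n - 1) (p2 (p1 x))))"
      "g n (opp u) x = pr (\<rho> n (p1 x)) (p2 x + A y u (k n (p1 x)))" for n x by (auto simp: g_def)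
  have ss [simp]: "s n u x = pr (pr (- k (n + 1) (p1 (p1 x))) (- k (n - 1) (p2 (p1 x)))) 0"
      "s n (opp u) x = pr (k n (p1 x)) 0" for n x by (auto simp: s_def)
  note l = lin_simps[OF kmod_linA[OF y]] lin_simps[OF kmod_linD[OF y]] lin_simps[OF lc] lin_simps[OF lr] lin_simps[OF lk]
  note cl = sub_closed[OF kmod_sub[OF y]] sub_closed[OF sH]
  have kV': "x \<in> V y m u \<Longrightarrow> m - 1 = j \<Longrightarrow> k m x \<in> V y j u" for x m j using kV by auto
  have AA: "x \<in> V y m u \<Longrightarrow> m + 2 = j \<Longrightarrow> AA u y x \<in> V y j u" for x m j using kmod_AA[OF y] by auto
  have A1: "x \<in> V y m u \<Longrightarrow> m + 1 = j \<Longrightarrow> A y u x \<in> V y j (opp u)" for x m j using kmod_A[OF y] by auto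
  have kmod: "kmod ?S" "kmod (Tw u y)" by (rule kmod_TT[OF y W], rule kmod_Tw[OF y])
  have f: "f \<in> cyc 0 ?S (Tw u y)"
  proof (rule cycI2[where u=u])
    show "f \<in> hom 0 ?S (Tw u y)"
      by (rule homI2[where u=u]) (auto simp: lin_def l sc_add cl cV)
  qed (auto simp: l Dc)
  have g: "g \<in> cyc 0 (Tw u y) ?S"
  proof (rule cycI2[where u=u])
    show "g \<in> hom 0 (Tw u y) ?S"
    proof (rule homI2[where u=u])
      fix n x
      {
        assume "x \<in> V (Tw u y) n u"
        then have x: "p1 (p1 x) \<in> V y (n + 1) u" "p2 (p1 x) \<in> V y (n - 1) u" "p2 x \<in> V y n u" by auto
        show "g n u x \<in> V ?S (n + 0) u"
          using rH[OF x(1)] rH[OF x(2)] x(3) kV'[OF x(1), of n] AA[OF kV[OF x(2)], of n] by (simp add: cl)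
        show "g (n + 1) (opp u) (A (Tw u y) u x) = sgn_pow 0 \<star> A ?S u (g n u x)"
          using kmod_AAA[OF y kV[OF x(2)]] by (simp add: l)
      next
        assume "x \<in> V (Tw u y) n (opp u)"
        then have x: "p1 x \<in> V y n u" "p2 x \<in> V y n (opp u)" by auto
        show "g n (opp u) x \<in> V ?S (n + 0) (opp u)"
          using rH[OF x(1)] x(2) A1[OF kV[OF x(1)], of n] by (simp add: cl)
        show "g (n + 1) u (A (Tw u y) (opp u) x) = sgn_pow 0 \<star> A ?S (opp u) (g n (opp u) x)"
          by (simp add: l)
      }
    qed (auto simp: lin_def l sc_add algebra_simps)
  next
    fix n x assume "x \<in> V (Tw u y) n u"
    then have x: "p1 (p1 x) \<in> V y (n + 1) u" "p2 (p1 x) \<in> V y (n - 1) u" "p2 x \<in> V y n u" by auto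
    have e1: "p1 (p1 x) - k (n + 2) (D y (n + 1) u (p1 (p1 x))) = D y n u (k (n + 1) (p1 (p1 x))) + c (n + 1) (\<rho> (n + 1) (p1 (p1 x)))"
      using hty[OF x(1)] by (simp add: algebra_simps)
    have e2: "AA u y (p2 (p1 x)) = AA u y (c (n - 1) (\<rho> (n - 1) (p2 (p1 x)))) + AA u y (D y (n - 2) u (k (n - 1) (p2 (p1 x)))) + AA u y (k n (D y (n - 1) u (p2 (p1 x))))"
      using arg_cong[where f="AA u y", OF hty[OF x(2)]] by (simp add: l algebra_simps)
    have e3: "D y n u (AA u y (k (n - 1) (p2 (p1 x)))) = AA u y (D y (n - 2) u (k (n - 1) (p2 (p1 x))))"
      using kmod_DAA[OF y kV[OF x(2)]] by (simp add: algebra_simps)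
    have i: "n + 1 + 1 = n + 2" by simp
    show "g (n + 1) u (D (Tw u y) n u x) = sgn_pow 0 \<star> D ?S (n + 0) u (g n u x)"
      using rD[OF x(1)] rD[OF x(2)] e1 e2 e3 by (simp add: l i)
  next
    fix n x assume "x \<in> V (Tw u y) n (opp u)"
    then have x: "p1 x \<in> V y n u" "p2 x \<in> V y n (opp u)" by auto
    have e1: "A y u (p1 x) = A y u (c n (\<rho> n (p1 x))) + A y u (D y (n - 1) u (k n (p1 x))) + A y u (k (n + 1) (D y n u (p1 x)))"
      using arg_cong[where f="A y u", OF hty[OF x(1)]] by (simp add: l algebra_simps)
    show "g (n + 1) (opp u) (D (Tw u y) n (opp u) x) = sgn_pow 0 \<star> D ?S (n + 0) (opp u) (g n (opp u) x)"
      using rD[OF x(1)] e1 kmod_DA[OF y kV[OF x(1)]] by (simp add: l)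
  qed
  have s: "s \<in> hom (0 - 1) (Tw u y) (Tw u y)"
    by (rule homI2[where u=u]) (auto simp: lin_def l sc_add cl intro!: kV' cl)
  have "comp 0 g f - idf \<in> bdr 0 ?S ?S"
  proof (rule bdr_cong[OF bdr_0[OF kmod(1)]])
    fix n w x assume x: "x \<in> V ?S n w"
    show "(0 :: 'a fam) n w x = (comp 0 g f - idf) n w x"
    proof (cases "w = u")
      case True
      then show ?thesis using x
        by (simp add: comp_def idf_def rc kc l)
    next
      case False
      then have w: "w = opp u" using vertex_cases by metis
      show ?thesis using x unfolding w
        by (simp add: comp_def idf_def rc kc l)
    qed
  qed
  moreover have "- (comp 0 f g - idf) \<in> bdr 0 (Tw u y) (Tw u y)"
  proof (rule bdrI2[OF s])
    fix n x assume "x \<in> V (Tw u y) n u"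
    then have x: "p1 (p1 x) \<in> V y (n + 1) u" "p2 (p1 x) \<in> V y (n - 1) u" "p2 x \<in> V y n u" by auto
    have i: "n + 1 + 1 = n + 2" "n - 1 - 1 = n - 2" by simp_all
    show "(- (comp 0 f g - idf)) n u x = D (Tw u y) (n + 0 - 1) u (s n u x) + sgn_pow 0 \<star> s (n + 1) u (D (Tw u y) n u x)"
      using hty[OF x(1)] hty[OF x(2)] by - (rule pr_eqI; (rule pr_eqI)?; simp add: comp_def idf_def l i algebra_simps)
  next
    fix n x assume "x \<in> V (Tw u y) n (opp u)"
    then have x: "p1 x \<in> V y n u" "p2 x \<in> V y n (opp u)" by auto
    show "(- (comp 0 f g - idf)) n (opp u) x = D (Tw u y) (n + 0 - 1) (opp u) (s n (opp u) x) + sgn_pow 0 \<star> s (n + 1) (opp u) (D (Tw u y) n (opp u) x)"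
      using hty[OF x(1)] by - (rule pr_eqI; simp add: comp_def idf_def l algebra_simps)
  qed
  then have "comp (- 0) f g - idf \<in> bdr 0 (Tw u y) (Tw u y)"
    using bdr_neg[OF kmod(2)] by fastforce
  ultimately show ?thesis unfolding heq_def using f g by (intro bexI[of _ f] bexI[of _ g]) auto
qed

text \<open>Families consist of linear maps on the whole sequence space, so the inverse is wanted
  globally defined, with values in \<open>S\<close>.\<close>

lemma lin_right_inverse: assumes f: "lin (f :: 'k::field U \<Rightarrow> 'k U)" and S: "sub S"
  shows "\<exists>g. lin g \<and> (\<forall>y. g y \<in> S) \<and> (\<forall>v\<in>S. f (g (f v)) = f v)"
proof -
  interpret vector_space_pair "(\<star>) :: 'k \<Rightarrow> _" "(\<star>) :: 'k \<Rightarrow> _"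
    by unfold_locales (auto simp: sc_add sc_add_left)
  have lin: "Vector_Spaces.linear (\<star>) (\<star>) h \<longleftrightarrow> lin h" for h :: "'k U \<Rightarrow> 'k U"
    unfolding lin_def Vector_Spaces.linear_iff using vs1.vector_space_axioms by blast
  have "vs1.subspace S" using S unfolding sub_def vs1.subspace_def by auto
  from linear_exists_right_inverse_on[OF _ this, of f] f lin obtain g where
    "range g \<subseteq> S" "lin g" "\<forall>v\<in>f ` S. f (g v) = v" by blast
  then show ?thesis by (intro exI[of _ g]) auto
qed

text \<open>Over a field a complex retracts onto its cohomology. A linear right inverse of
  \<open>(h, w) |-> c h + D w\<close> splits a cycle into a class and a boundary; composing with a
  projection onto cycles extends this to all elements.\<close>

lemma exists_splitting:
  assumes y: "kmod y" and W: "cpx u H c (\<lambda>n x. 0) y"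
    and surj: "\<And>n x. x \<in> V y n u \<Longrightarrow> D y n u x = 0 \<Longrightarrow> \<exists>a\<in>H n. \<exists>w\<in>V y (n - 1) u. x = c n a + D y (n - 1) u w"
    and inj: "\<And>n a w. a \<in> H n \<Longrightarrow> w \<in> V y (n - 1) u \<Longrightarrow> c n a = D y (n - 1) u w \<Longrightarrow> a = 0"
  shows "heq 0 (TT u H c (\<lambda>n x. 0) y) (Tw u y)"
proof -
  have lc: "\<And>n. lin (c n)" and sH: "\<And>n. sub (H n)" and cV: "\<And>n x. x \<in> H n \<Longrightarrow> c n x \<in> V y n u"
     and Dc: "\<And>n x. x \<in> H n \<Longrightarrow> D y n u (c n x) = 0"
    using W unfolding cpx_def by (auto simp: lin_0)
  have "\<exists>g. lin g \<and> (\<forall>x. p1 (g x) \<in> H n \<and> p2 (g x) \<in> V y (n - 1) u) \<and>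
     (\<forall>x\<in>V y n u. D y n u x = 0 \<longrightarrow> x = c n (p1 (g x)) + D y (n - 1) u (p2 (g x)))" for n
  proof -
    let ?f = "\<lambda>v. c n (p1 v) + D y (n - 1) u (p2 v)" and ?S = "{v. p1 v \<in> H n \<and> p2 v \<in> V y (n - 1) u}"
    have "lin ?f" by (simp add: lin_def lin_simps[OF lc] lin_simps[OF kmod_linD[OF y]] sc_add)
    moreover have "sub ?S" by (auto simp: sub_def[of ?S] sub_closed[OF sH] sub_closed[OF kmod_sub[OF y]])
    ultimately obtain g where g: "lin g" "\<And>y. g y \<in> ?S" "\<And>v. v \<in> ?S \<Longrightarrow> ?f (g (?f v)) = ?f v"
      using lin_right_inverse[of ?f ?S] by blast
    have "x = c n (p1 (g x)) + D y (n - 1) u (p2 (g x))" if "x \<in> V y n u" "D y n u x = 0" for x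
    proof -
      from surj[OF that] obtain a w where "a \<in> H n" "w \<in> V y (n - 1) u" "x = c n a + D y (n - 1) u w" by blast
      then show ?thesis using g(3)[of "pr a w"] by simp
    qed
    then show ?thesis using g(1,2) by blast
  qed
  then obtain g where g: "\<And>n. lin (g n)" "\<And>n x. p1 (g n x) \<in> H n" "\<And>n x. p2 (g n x) \<in> V y (n - 1) u"
     "\<And>n x. x \<in> V y n u \<Longrightarrow> D y n u x = 0 \<Longrightarrow> x = c n (p1 (g n x)) + D y (n - 1) u (p2 (g n x))"
    by metis
  define a where "a = (\<lambda>n x. p1 (g n x))"
  \<comment> \<open>The second term subtracts the value at the representative
    \<open>c (a x)\<close>, so that \<open>b\<close> vanishes on the image of \<open>c\<close>. This
    yields the side condition on the homotopy.\<close>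
  define b where "b = (\<lambda>n x. p2 (g n x) - p2 (g n (c n (p1 (g n x)))))"
  have la: "\<And>n. lin (a n)" and lb: "\<And>n. lin (b n)"
    unfolding a_def b_def lin_def by (simp_all add: lin_simps[OF g(1)] lin_simps[OF lc] sc_diff)
  note l = lin_simps[OF kmod_linA[OF y]] lin_simps[OF kmod_linD[OF y]] lin_simps[OF lc] lin_simps[OF la] lin_simps[OF lb] lin_simps[OF g(1)]
  note cl = sub_closed[OF kmod_sub[OF y]] sub_closed[OF sH]
  have aH: "a n x \<in> H n" for n x using g(2) by (simp add: a_def)
  have bV: "b n x \<in> V y (n - 1) u" for n x using g(3) by (simp add: b_def cl)
  have uniq: "a n (c n h + D y (n - 1) u w) = h" if h: "h \<in> H n" and w: "w \<in> V y (n - 1) u" for n h w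
  proof -
    let ?x = "c n h + D y (n - 1) u w"
    have "?x \<in> V y n u" "D y n u ?x = 0" using cV[OF h] Dc[OF h] kmod_D[OF y w] kmod_DD[OF y w] by (auto simp: cl l)
    from g(4)[OF this] have "c n (h - a n ?x) = D y (n - 1) u (p2 (g n ?x) - w)"
      unfolding a_def by (simp add: l(11-15) l(6-10) algebra_simps)
    from inj[OF _ _ this] have "h - a n ?x = 0" using h aH g(3) w by (simp add: cl)
    then show ?thesis by simp
  qed
  have ac: "a n (c n h) = h" if "h \<in> H n" for n h
    using uniq[OF that, of 0] by (simp add: cl l)
  have aD: "a n (D y (n - 1) u w) = 0" if "w \<in> V y (n - 1) u" for n w
    using uniq[OF _ that, of 0] by (simp add: cl l)
  have dec: "x = c n (a n x) + D y (n - 1) u (b n x)" if x: "x \<in> V y n u" "D y n u x = 0" for n x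
  proof -
    have "D y (n - 1) u (p2 (g n (c n (a n x)))) = 0"
      using g(4)[OF cV[OF aH] Dc[OF aH], of n x] ac[OF aH, of n x] by (simp add: a_def)
    then show ?thesis using g(4)[OF x] by (simp add: b_def a_def l)
  qed
  have bc: "b n (c n h) = 0" if "h \<in> H n" for n h
    using ac[OF that] by (simp add: b_def a_def)
  \<comment> \<open>Projection onto the cycles: the class of \<open>D x\<close> is 0, so
    \<open>D x\<close> is the boundary of \<open>b (D x)\<close>.\<close>
  define q where "q = (\<lambda>n x. x - b (n + 1) (D y n u x))"
  have lq: "lin (q n)" for n unfolding lin_def q_def by (simp add: l sc_diff)
  have qV: "q n x \<in> V y n u" if "x \<in> V y n u" for n x
    using that bV[of "n + 1"] by (simp add: q_def cl)
  have Dq: "D y n u (q n x) = 0" if x: "x \<in> V y n u" for n x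
  proof -
    have Dx: "D y n u x \<in> V y (n + 1) u" "D y (n + 1) u (D y n u x) = 0" using kmod_D[OF y x] kmod_DD[OF y x] by auto
    have "a (n + 1) (D y n u x) = 0" using aD[of x "n + 1"] x by simp
    then have "D y n u x = D y n u (b (n + 1) (D y n u x))" using dec[OF Dx] by (simp add: l)
    then show ?thesis by (simp add: q_def l)
  qed
  show ?thesis
  proof (rule heq_TT[OF y W, where \<rho>="\<lambda>n x. a n (q n x)" and k="\<lambda>n x. b n (q n x)"])
    fix n show "lin (\<lambda>x. a n (q n x))" "lin (\<lambda>x. b n (q n x))" by (rule lin_comp[OF la lq], rule lin_comp[OF lb lq])
    fix x show "a n (q n x) \<in> H n" "b n (q n x) \<in> V y (n - 1) u" by (rule aH, rule bV)
    show "a n (q n (c n x)) = x" "b n (q n (c n x)) = 0" if "x \<in> H n"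
      using ac[OF that] bc[OF that] Dc[OF that] by (simp_all add: q_def l)
    assume x: "x \<in> V y n u"
    have qD: "q (n + 1) (D y n u x) = D y n u x" using kmod_DD[OF y x] by (simp add: q_def l)
    show "a (n + 1) (q (n + 1) (D y n u x)) = 0" using aD[of x "n + 1"] x qD by simp
    show "x - c n (a n (q n x)) = D y (n - 1) u (b n (q n x)) + b (n + 1) (q (n + 1) (D y n u x))"
      using dec[OF qV[OF x] Dq[OF x]] unfolding qD by (simp add: q_def algebra_simps)
  qed
qed

section \<open>Linear models of the objects of positive slope\<close>

text \<open>A twisted complex of copies of \<open>P_u\<close> (multiplicity spaces \<open>X\<close>) and of the other projective (\<open>Y\<close>). Elements
  have components \<open>(x0, x2, y1)\<close> at \<open>u\<close> and \<open>(x1, y0, y2)\<close> at the other vertex, the digit being the length of the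
  path; \<open>L\<close> and \<open>K\<close> are the components of the differential along the loops, \<open>B\<close> the one along the arrow.\<close>

definition Model :: "vertex \<Rightarrow> (int \<Rightarrow> 'k::field U set) \<Rightarrow> (int \<Rightarrow> 'k U set) \<Rightarrow> (int \<Rightarrow> 'k U \<Rightarrow> 'k U) \<Rightarrow>
    (int \<Rightarrow> 'k U \<Rightarrow> 'k U) \<Rightarrow> (int \<Rightarrow> 'k U \<Rightarrow> 'k U) \<Rightarrow> 'k kmod" where
  "Model u X Y L B K = \<lparr>
    V = (\<lambda>n w. if w = u then {x. p1 x \<in> X n \<and> p1 (p2 x) \<in> X (n - 2) \<and> p2 (p2 x) \<in> Y (n - 1)}
               else {x. p1 x \<in> X (n - 1) \<and> p1 (p2 x) \<in> Y n \<and> p2 (p2 x) \<in> Y (n - 2)}),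
    A = (\<lambda>w x. if w = u then pr (p1 x) (pr 0 (p2 (p2 x))) else pr 0 (pr (p1 x) (p1 (p2 x)))),
    D = (\<lambda>n w x. if w = u then pr 0 (pr (L n (p1 x)) (B n (p1 x)))
                  else pr 0 (pr 0 (K n (p1 (p2 x)) - B (n - 1) (p1 x))))\<rparr>"

lemma Model_simps [simp]:
  "V (Model u X Y L B K) n u = {x. p1 x \<in> X n \<and> p1 (p2 x) \<in> X (n - 2) \<and> p2 (p2 x) \<in> Y (n - 1)}"
  "V (Model u X Y L B K) n (opp u) = {x. p1 x \<in> X (n - 1) \<and> p1 (p2 x) \<in> Y n \<and> p2 (p2 x) \<in> Y (n - 2)}"
  "A (Model u X Y L B K) u = (\<lambda>x. pr (p1 x) (pr 0 (p2 (p2 x))))"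
  "A (Model u X Y L B K) (opp u) = (\<lambda>x. pr 0 (pr (p1 x) (p1 (p2 x))))"
  "D (Model u X Y L B K) n u = (\<lambda>x. pr 0 (pr (L n (p1 x)) (B n (p1 x))))"
  "D (Model u X Y L B K) n (opp u) = (\<lambda>x. pr 0 (pr 0 (K n (p1 (p2 x)) - B (n - 1) (p1 x))))"
  by (auto simp: Model_def)

text \<open>Only degrees are constrained. Since nothing maps from \<open>Y\<close> back to
  \<open>X\<close>, the differential lands in components that it annihilates, and its square
  vanishes for all \<open>L\<close>, \<open>B\<close>, \<open>K\<close>.\<close>

definition mdl :: "(int \<Rightarrow> 'k::field U set) \<Rightarrow> (int \<Rightarrow> 'k U set) \<Rightarrow> (int \<Rightarrow> 'k U \<Rightarrow> 'k U) \<Rightarrow>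
    (int \<Rightarrow> 'k U \<Rightarrow> 'k U) \<Rightarrow> (int \<Rightarrow> 'k U \<Rightarrow> 'k U) \<Rightarrow> bool" where
  "mdl X Y L B K \<longleftrightarrow> (\<forall>n. sub (X n) \<and> sub (Y n) \<and> lin (L n) \<and> lin (B n) \<and> lin (K n)) \<and>
     (\<forall>n. \<forall>x \<in> X n. L n x \<in> X (n - 1) \<and> B n x \<in> Y n) \<and> (\<forall>n. \<forall>y \<in> Y n. K n y \<in> Y (n - 1))"

text \<open>With a left inverse of \<open>x |-> (L x, B x)\<close> the differential at
  \<open>u\<close> is injective on the components \<open>x0\<close>, so its cohomology comes from
  the cycles \<open>(x2, y1)\<close>.\<close>

definition linv :: "(int \<Rightarrow> 'k::field U set) \<Rightarrow> (int \<Rightarrow> 'k U set) \<Rightarrow> (int \<Rightarrow> 'k U \<Rightarrow> 'k U) \<Rightarrow>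
    (int \<Rightarrow> 'k U \<Rightarrow> 'k U) \<Rightarrow> (int \<Rightarrow> 'k U \<Rightarrow> 'k U) \<Rightarrow> bool" where
  "linv X Y L B \<mu> \<longleftrightarrow> (\<forall>n. lin (\<mu> n)) \<and> (\<forall>n. \<forall>p\<in>X (n - 1). \<forall>q\<in>Y n. \<mu> n (pr p q) \<in> X n) \<and>
     (\<forall>n. \<forall>x\<in>X n. \<mu> n (pr (L n x) (B n x)) = x)"

text \<open>With a right inverse of \<open>(x, y) |-> K y - B x\<close> every \<open>y2\<close> at
  the other vertex is a boundary.\<close>

definition rinv :: "(int \<Rightarrow> 'k::field U set) \<Rightarrow> (int \<Rightarrow> 'k U set) \<Rightarrow> (int \<Rightarrow> 'k U \<Rightarrow> 'k U) \<Rightarrow>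
    (int \<Rightarrow> 'k U \<Rightarrow> 'k U) \<Rightarrow> (int \<Rightarrow> 'k U \<Rightarrow> 'k U) \<Rightarrow> bool" where
  "rinv X Y B K \<nu> \<longleftrightarrow> (\<forall>n. lin (\<nu> n)) \<and> (\<forall>n. \<forall>y\<in>Y n. p1 (\<nu> n y) \<in> X n \<and> p2 (\<nu> n y) \<in> Y (n + 1) \<and>
     K (n + 1) (p2 (\<nu> n y)) - B n (p1 (\<nu> n y)) = y)"

text \<open>The multiplicities of \<open>P_u\<close> after the twist in \<open>P_u\<close>: the
  cycles \<open>(x2, y1)\<close> of degree \<open>n + 1\<close> at \<open>u\<close>. The remaining
  copies, indexed by \<open>x0\<close>, cancel against the copies of \<open>P_u\<close> in the
  model.\<close>

definition XT :: "(int \<Rightarrow> 'k::field U set) \<Rightarrow> (int \<Rightarrow> 'k U set) \<Rightarrow> int \<Rightarrow> 'k U set" where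
  "XT X Y n = {w. p1 w \<in> X (n - 1) \<and> p2 w \<in> Y n}"
definition LT :: "(int \<Rightarrow> 'k::field U \<Rightarrow> 'k U) \<Rightarrow> (int \<Rightarrow> 'k U \<Rightarrow> 'k U) \<Rightarrow> int \<Rightarrow> 'k U \<Rightarrow> 'k U" where
  "LT L B n w = pr (L (n - 1) (p1 w)) (B (n - 1) (p1 w))"
definition BT :: "int \<Rightarrow> 'k::field U \<Rightarrow> 'k U" where "BT n w = p2 w"

text \<open>The multiplicities of the other projective after the inverse twist in it: the components
  \<open>(x1, y0)\<close> of degree \<open>n + 1\<close> at the other vertex.\<close>

definition YI :: "(int \<Rightarrow> 'k::field U set) \<Rightarrow> (int \<Rightarrow> 'k U set) \<Rightarrow> int \<Rightarrow> 'k U set" where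
  "YI X Y n = {w. p1 w \<in> X n \<and> p2 w \<in> Y (n + 1)}"
definition KI :: "(int \<Rightarrow> 'k::field U \<Rightarrow> 'k U) \<Rightarrow> (int \<Rightarrow> 'k U \<Rightarrow> 'k U) \<Rightarrow> int \<Rightarrow> 'k U \<Rightarrow> 'k U" where
  "KI B K n w = pr 0 (K (n + 1) (p2 w) - B n (p1 w))"
definition BI :: "int \<Rightarrow> 'k::field U \<Rightarrow> 'k U" where "BI n x = pr (- x) 0"

lemma XT_iff [simp]: "w \<in> XT X Y n \<longleftrightarrow> p1 w \<in> X (n - 1) \<and> p2 w \<in> Y n" by (simp add: XT_def)
lemma YI_iff [simp]: "w \<in> YI X Y n \<longleftrightarrow> p1 w \<in> X n \<and> p2 w \<in> Y (n + 1)" by (simp add: YI_def)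

context
  fixes X Y :: "int \<Rightarrow> 'k::field U set" and L B K :: "int \<Rightarrow> 'k U \<Rightarrow> 'k U"
  assumes mdl: "mdl X Y L B K"
begin

lemma mdl_facts: "sub (X n)" "sub (Y n)" "lin (L n)" "lin (B n)" "lin (K n)"
  "x \<in> X n \<Longrightarrow> n - 1 = m \<Longrightarrow> L n x \<in> X m" "x \<in> X n \<Longrightarrow> B n x \<in> Y n" "y \<in> Y n \<Longrightarrow> n - 1 = m \<Longrightarrow> K n y \<in> Y m"
  using mdl by (auto simp: mdl_def)

lemmas mdl_lin = lin_simps[OF mdl_facts(3)] lin_simps[OF mdl_facts(4)] lin_simps[OF mdl_facts(5)]
lemmas mdl_cl = sub_closed[OF mdl_facts(1)] sub_closed[OF mdl_facts(2)]

lemma kmod_Model: "kmod (Model u X Y L B K)"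
proof -
  let ?M = "Model u X Y L B K"
  have a: "sub (V ?M n w) \<and> lin (A ?M w) \<and> lin (D ?M n w)" for n w
    by (rule vertex_all_intro[of _ u w])
      (auto simp: sub_def[of "Collect _"] mdl_cl lin_def mdl_lin sc_diff algebra_simps)
  have i: "n + 1 - 2 = n - (1::int)" for n by simp
  have b: "\<forall>x\<in>V ?M n w. A ?M w x \<in> V ?M (n + 1) (opp w) \<and> D ?M n w x \<in> V ?M (n + 1) w \<and> D ?M (n + 1) w (D ?M n w x) = 0 \<and>
       A ?M w (A ?M (opp w) (A ?M w x)) = 0 \<and> D ?M (n + 1) (opp w) (A ?M w x) = - A ?M w (D ?M n w x)" for n w
    by (rule vertex_all_intro[of _ u w]) (auto simp: mdl_cl mdl_lin mdl_facts(6-8) i)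
  show ?thesis unfolding kmod_def using a b by blast
qed

lemma mdl_T: "mdl (XT X Y) Y (LT L B) BT K"
  unfolding mdl_def
  by (auto simp: LT_def BT_def lin_def mdl_lin mdl_facts sc_add sub_def[of "XT _ _ _"] mdl_cl)

lemma mdl_I: "mdl X (YI X Y) L BI (KI B K)"
  unfolding mdl_def
  by (auto simp: KI_def BI_def lin_def mdl_lin mdl_facts sc_add sc_diff sub_def[of "YI _ _ _"] mdl_cl algebra_simps)

text \<open>\<open>f\<close> forgets the component \<open>x0\<close> of the complex at
  \<open>u\<close> and replaces an \<open>x0\<close> of the model by its boundary
  \<open>(L x0, B x0)\<close>. Conversely \<open>\<mu>\<close> extracts an \<open>x0\<close> from a
  pair, and \<open>e\<close> keeps what is left after removing its boundary.\<close>

lemma heq_Tw_Model: assumes \<mu>: "linv X Y L B \<mu>"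
  shows "heq 0 (Tw u (Model u X Y L B K)) (Model u (XT X Y) Y (LT L B) BT K)"
proof -
  let ?M = "Model u X Y L B K" and ?N = "Model u (XT X Y) Y (LT L B) BT K"
  have lm: "\<And>n. lin (\<mu> n)" and mX: "\<And>n w. w \<in> XT X Y n \<Longrightarrow> \<mu> n w \<in> X n"
    and mLB: "\<And>n x. x \<in> X n \<Longrightarrow> \<mu> n (pr (L n x) (B n x)) = x"
    using \<mu> unfolding linv_def by (auto, metis pr_p1_p2)
  define f :: "'k fam" where "f = (\<lambda>n w x. if w = u
      then pr (pr (L n (p1 (p2 x)) + p1 (p2 (p1 (p1 x)))) (B n (p1 (p2 x)) + p2 (p2 (p1 (p1 x)))))
          (pr (pr (L (n - 2) (p1 (p2 (p2 x))) + p1 (p2 (p2 (p1 x)))) (B (n - 2) (p1 (p2 (p2 x))) + p2 (p2 (p2 (p1 x)))))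
              (p2 (p2 (p2 x))))
      else pr (pr (L (n - 1) (p1 (p2 x)) + p1 (p2 (p1 x))) (B (n - 1) (p1 (p2 x)) + p2 (p2 (p1 x)))) (p2 (p2 x)))"
  define e where "e = (\<lambda>n w. pr 0 (pr (p1 w - L n (\<mu> n w)) (p2 w - B n (\<mu> n w))))"
  define g :: "'k fam" where "g = (\<lambda>n w x. if w = u
      then pr (pr (e n (p1 x)) (e (n - 2) (p1 (p2 x)))) (pr (\<mu> n (p1 x)) (pr (\<mu> (n - 2) (p1 (p2 x))) (p2 (p2 x))))
      else pr (e (n - 1) (p1 x)) (pr (\<mu> (n - 1) (p1 x)) (p2 x)))"
  define s :: "'k fam" where "s = (\<lambda>n w x. if w = u
      then pr (pr (pr (- \<mu> n (p2 (p1 (p1 x)))) 0) (pr (- \<mu> (n - 2) (p2 (p2 (p1 x)))) 0)) 0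
      else pr (pr (\<mu> (n - 1) (p2 (p1 x))) 0) 0)"
  have fs [simp]: "f n u x = pr (pr (L n (p1 (p2 x)) + p1 (p2 (p1 (p1 x)))) (B n (p1 (p2 x)) + p2 (p2 (p1 (p1 x)))))
          (pr (pr (L (n - 2) (p1 (p2 (p2 x))) + p1 (p2 (p2 (p1 x)))) (B (n - 2) (p1 (p2 (p2 x))) + p2 (p2 (p2 (p1 x)))))
              (p2 (p2 (p2 x))))"
      "f n (opp u) x = pr (pr (L (n - 1) (p1 (p2 x)) + p1 (p2 (p1 x))) (B (n - 1) (p1 (p2 x)) + p2 (p2 (p1 x)))) (p2 (p2 x))"
      for n x by (auto simp: f_def)
  have gs [simp]: "g n u x = pr (pr (e n (p1 x)) (e (n - 2) (p1 (p2 x)))) (pr (\<mu> n (p1 x)) (pr (\<mu> (n - 2) (p1 (p2 x))) (p2 (p2 x))))"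
      "g n (opp u) x = pr (e (n - 1) (p1 x)) (pr (\<mu> (n - 1) (p1 x)) (p2 x))" for n x by (auto simp: g_def)
  have ss [simp]: "s n u x = pr (pr (pr (- \<mu> n (p2 (p1 (p1 x)))) 0) (pr (- \<mu> (n - 2) (p2 (p2 (p1 x)))) 0)) 0"
      "s n (opp u) x = pr (pr (\<mu> (n - 1) (p2 (p1 x))) 0) 0" for n x by (auto simp: s_def)
  note l = mdl_lin lin_simps[OF lm]
  have i: "n + 1 - 2 = n - 1" "n - 1 - 2 = n - 3" "n - 2 - 1 = n - 3" "n - 1 - 1 = n - 2" "n + 1 + 1 = n + 2" for n :: int by simp_all
  note cl = mdl_cl mdl_facts(6-8) mX
  have kmod: "kmod (Tw u ?M)" "kmod ?N"
    by (rule kmod_Tw[OF kmod_Model]) (simp add: Submission.kmod_Model[OF mdl_T])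
  have f: "f \<in> cyc 0 (Tw u ?M) ?N"
  proof (rule cycI2[where u=u])
    show "f \<in> hom 0 (Tw u ?M) ?N"
      by (rule homI2[where u=u]) (auto simp: lin_def l sc_add sc_diff cl i algebra_simps)
  qed (auto simp: l i LT_def BT_def cl algebra_simps)
  have g: "g \<in> cyc 0 ?N (Tw u ?M)"
  proof (rule cycI2[where u=u])
    show "g \<in> hom 0 ?N (Tw u ?M)"
      by (rule homI2[where u=u]) (auto simp: lin_def e_def l sc_add sc_diff cl i algebra_simps)
  qed (auto simp: l i e_def LT_def BT_def mLB algebra_simps)
  have s: "s \<in> hom (0 - 1) (Tw u ?M) (Tw u ?M)"
    by (rule homI2[where u=u]) (auto simp: lin_def l sc_add cl i)
  have mLB': "x \<in> X n \<Longrightarrow> \<mu> n (pr (L n x + p) (B n x + q)) = x + \<mu> n (pr p q)" for n x p q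
    using lin_add[OF lm, of n "pr (L n x) (B n x)" "pr p q"] mLB[of x n] by simp
  have mLBn: "x \<in> X n \<Longrightarrow> \<mu> n (pr (- L n x) (- B n x)) = - x" for n x
    using lin_neg[OF lm, of n "pr (L n x) (B n x)"] mLB[of x n] by simp
  have "comp 0 g f - idf \<in> bdr 0 (Tw u ?M) (Tw u ?M)"
  proof -
    have "- (comp 0 g f - idf) \<in> bdr 0 (Tw u ?M) (Tw u ?M)"
    proof (rule bdrI2[OF s])
      fix n x assume "x \<in> V (Tw u ?M) n u"
      then have x: "p1 (p1 (p1 x)) \<in> X (n + 1)" "p1 (p2 (p1 x)) \<in> X (n - 1)" "p1 (p2 x) \<in> X n" "p1 (p2 (p2 x)) \<in> X (n - 2)" by auto
      show "(- (comp 0 g f - idf)) n u x = D (Tw u ?M) (n + 0 - 1) u (s n u x) + sgn_pow 0 \<star> s (n + 1) u (D (Tw u ?M) n u x)"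
        using x by - (rule pr_eqI; rule pr_eqI; (rule pr_eqI)?; (rule pr_eqI)?; simp add: comp_def idf_def l i e_def mLB' mLB mLBn)
    next
      fix n x assume "x \<in> V (Tw u ?M) n (opp u)"
      then have x: "p1 (p1 x) \<in> X n" "p1 (p2 x) \<in> X (n - 1)" by auto
      show "(- (comp 0 g f - idf)) n (opp u) x = D (Tw u ?M) (n + 0 - 1) (opp u) (s n (opp u) x) + sgn_pow 0 \<star> s (n + 1) (opp u) (D (Tw u ?M) n (opp u) x)"
        using x by - (rule pr_eqI; rule pr_eqI; (rule pr_eqI)?; (rule pr_eqI)?; simp add: comp_def idf_def l i e_def mLB' mLB mLBn)
    qed
    then show ?thesis using bdr_neg[OF kmod(1)] by fastforce
  qed
  moreover have "comp (- 0) f g - idf \<in> bdr 0 ?N ?N"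
  proof (rule bdr_cong[OF bdr_0[OF kmod(2)]])
    fix n w x
    show "(0 :: 'k fam) n w x = (comp (- 0) f g - idf) n w x"
    proof (rule vertex_all_intro[of _ u w])
      show "(0 :: 'k fam) n u x = (comp (- 0) f g - idf) n u x"
        by (simp add: comp_def idf_def e_def)
      show "(0 :: 'k fam) n (opp u) x = (comp (- 0) f g - idf) n (opp u) x"
        by (simp add: comp_def idf_def e_def)
    qed
  qed
  ultimately show ?thesis unfolding heq_def using f g by (intro bexI[of _ f] bexI[of _ g]) auto
qed

text \<open>The mirror image of the preceding computation: the copies indexed by \<open>y2\<close>
  cancel against the copies of the other projective in the model, and those indexed by
  \<open>(x1, y0)\<close> remain. As every \<open>y2\<close> is a boundary, \<open>\<nu>\<close>
  provides the correction that turns the projection into a chain map.\<close>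

lemma heq_Ti_Model: assumes \<nu>: "rinv X Y B K \<nu>"
  shows "heq 0 (Ti (opp u) (Model u X Y L B K)) (Model u X (YI X Y) L BI (KI B K))"
proof -
  define v where "v = opp u"
  have uv: "opp v = u" "opp u = v" unfolding v_def by simp_all
  let ?M = "Model u X Y L B K" and ?N = "Model u X (YI X Y) L BI (KI B K)"
  note TS = Ti_simps[of v, unfolded uv] and MS = Model_simps[of u, unfolded uv]
  have ln: "\<And>n. lin (\<nu> n)" and n1: "\<And>n y. y \<in> Y n \<Longrightarrow> p1 (\<nu> n y) \<in> X n" and n2: "\<And>n m y. y \<in> Y n \<Longrightarrow> n + 1 = m \<Longrightarrow> p2 (\<nu> n y) \<in> Y m"
    and n3: "\<And>n m y. y \<in> Y n \<Longrightarrow> n + 1 = m \<Longrightarrow> K m (p2 (\<nu> n y)) = y + B n (p1 (\<nu> n y))"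
    using \<nu> unfolding rinv_def by (auto simp: algebra_simps)
  define g :: "'k fam" where "g = (\<lambda>n w x. if w = v
      then pr (pr (p1 x) (pr (K (n + 1) (p2 (p1 (p2 x))) - B n (p1 (p1 (p2 x)))) (K (n - 1) (p2 (p2 (p2 x))) - B (n - 2) (p1 (p2 (p2 x))))))
          (pr (pr (p1 (p2 (p2 x))) (pr (p2 (p2 (p2 x))) 0)) (pr (p1 (p1 (p2 x))) (pr (p2 (p1 (p2 x))) 0)))
      else pr (pr (p1 x) (pr (p1 (p2 x)) (K n (p2 (p2 (p2 x))) - B (n - 1) (p1 (p2 (p2 x))))))
          (pr (p1 (p2 (p2 x))) (pr (p2 (p2 (p2 x))) 0)))"
  \<comment> \<open>\<open>d n y w\<close> corrects the components \<open>(x1, y0)\<close> of \<open>w\<close> so that they are mapped to \<open>y\<close>.\<close>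
  define d where "d = (\<lambda>n y w. pr (p1 w) (p1 (p2 w)) + \<nu> n (y - (K (n + 1) (p1 (p2 w)) - B n (p1 w))))"
  define f :: "'k fam" where "f = (\<lambda>n w x. if w = v
      then pr (p1 (p1 x)) (pr (d n (p1 (p2 (p1 x))) (p2 (p2 x))) (d (n - 2) (p2 (p2 (p1 x))) (p1 (p2 x))))
      else pr (p1 (p1 x)) (pr (p1 (p2 (p1 x))) (d (n - 1) (p2 (p2 (p1 x))) (p2 x))))"
  define ex where "ex = (\<lambda>z. pr (p1 z) (pr (p2 z) (0 :: 'k U)))"
  define s :: "'k fam" where "s = (\<lambda>n w x. if w = v
      then pr 0 (pr (- ex (\<nu> (n - 3) (p2 (p2 (p1 (p2 x)))))) (- ex (\<nu> (n - 1) (p2 (p2 (p2 (p2 x)))))))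
      else pr 0 (ex (\<nu> (n - 2) (p2 (p2 (p2 x))))))"
  have gs [simp]: "g n v x = pr (pr (p1 x) (pr (K (n + 1) (p2 (p1 (p2 x))) - B n (p1 (p1 (p2 x)))) (K (n - 1) (p2 (p2 (p2 x))) - B (n - 2) (p1 (p2 (p2 x))))))
          (pr (pr (p1 (p2 (p2 x))) (pr (p2 (p2 (p2 x))) 0)) (pr (p1 (p1 (p2 x))) (pr (p2 (p1 (p2 x))) 0)))"
      "g n u x = pr (pr (p1 x) (pr (p1 (p2 x)) (K n (p2 (p2 (p2 x))) - B (n - 1) (p1 (p2 (p2 x))))))
          (pr (p1 (p2 (p2 x))) (pr (p2 (p2 (p2 x))) 0))" for n x by (auto simp: g_def v_def)
  have fs [simp]: "f n v x = pr (p1 (p1 x)) (pr (d n (p1 (p2 (p1 x))) (p2 (p2 x))) (d (n - 2) (p2 (p2 (p1 x))) (p1 (p2 x))))"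
      "f n u x = pr (p1 (p1 x)) (pr (p1 (p2 (p1 x))) (d (n - 1) (p2 (p2 (p1 x))) (p2 x)))" for n x by (auto simp: f_def v_def)
  have ss [simp]: "s n v x = pr 0 (pr (- ex (\<nu> (n - 3) (p2 (p2 (p1 (p2 x)))))) (- ex (\<nu> (n - 1) (p2 (p2 (p2 (p2 x)))))))"
      "s n u x = pr 0 (ex (\<nu> (n - 2) (p2 (p2 (p2 x)))))" for n x by (auto simp: s_def v_def)
  note l = mdl_lin lin_simps[OF ln]
  have i: "n + 1 - 2 = n - 1" "n - 1 - 2 = n - 3" "n - 2 - 1 = n - 3" "n - 1 - 1 = n - 2" "n + 1 + 1 = n + 2" "n - 2 + 1 = n - 1" "n - 3 + 1 = n - 2" for n :: int by simp_all
  note cl = mdl_cl mdl_facts(6-8) n1 n2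
  note ZnI3 = cycI2[where u=v, unfolded uv] and homI3 = homI2[where u=v, unfolded uv] and BnI3 = bdrI2[where u=v, unfolded uv]
  have kmod: "kmod (Ti v ?M)" "kmod ?N"
    by (rule kmod_Ti[OF kmod_Model]) (simp add: Submission.kmod_Model[OF mdl_I])
  have f: "f \<in> cyc 0 (Ti v ?M) ?N"
  proof (rule ZnI3)
    show "f \<in> hom 0 (Ti v ?M) ?N"
      by (rule homI3) (auto simp: uv TS MS lin_def d_def l sc_add sc_diff cl i algebra_simps)
    show "f (n + 1) v (D (Ti v ?M) n v x) = sgn_pow 0 \<star> D ?N (n + 0) v (f n v x)" if "x \<in> V (Ti v ?M) n v" for n x
    proof -
      have m: "p1 (p2 (p1 x)) - (K (n + 1) (p1 (p2 (p2 (p2 x)))) - B n (p1 (p2 (p2 x)))) \<in> Y n"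
        using that by (simp add: uv TS MS cl)
      show ?thesis using n3[OF m refl] by (simp add: uv TS MS l i d_def KI_def BI_def algebra_simps)
    qed
  qed (auto simp: uv TS MS l i d_def KI_def BI_def algebra_simps)
  have g: "g \<in> cyc 0 ?N (Ti v ?M)"
  proof (rule ZnI3)
    show "g \<in> hom 0 ?N (Ti v ?M)"
      by (rule homI3) (auto simp: uv TS MS lin_def l sc_add sc_diff cl i algebra_simps)
  qed (auto simp: uv TS MS l i KI_def BI_def algebra_simps)
  have s: "s \<in> hom (0 - 1) (Ti v ?M) (Ti v ?M)"
    by (rule homI3) (auto simp: uv TS MS lin_def ex_def l sc_add cl i)
  have "comp 0 g f - idf \<in> bdr 0 (Ti v ?M) (Ti v ?M)"
  proof -
    have "- (comp 0 g f - idf) \<in> bdr 0 (Ti v ?M) (Ti v ?M)"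
    proof (rule BnI3[OF s])
      fix n x assume x: "x \<in> V (Ti v ?M) n v"
      have m: "p1 (p2 (p1 x)) - (K (n + 1) (p1 (p2 (p2 (p2 x)))) - B n (p1 (p2 (p2 x)))) \<in> Y n"
          "p2 (p2 (p1 x)) - (K (n - 1) (p1 (p2 (p1 (p2 x)))) - B (n - 2) (p1 (p1 (p2 x)))) \<in> Y (n - 2)"
          "p2 (p2 (p1 (p2 x))) \<in> Y (n - 3)" "p2 (p2 (p2 (p2 x))) \<in> Y (n - 1)"
        using x by (simp_all add: TS MS cl i)
      show "(- (comp 0 g f - idf)) n v x = D (Ti v ?M) (n + 0 - 1) v (s n v x) + sgn_pow 0 \<star> s (n + 1) v (D (Ti v ?M) n v x)"
        using n3[OF m(1) refl] n3[OF m(2), of "n - 1"] n3[OF m(3), of "n - 2"] n3[OF m(4), of n]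
        by - (rule pr_eqI; rule pr_eqI; (rule pr_eqI)?; (rule pr_eqI)?; simp add: uv TS MS comp_def idf_def l i d_def ex_def algebra_simps)
    next
      fix n x assume x: "x \<in> V (Ti v ?M) n u"
      have m: "p2 (p2 (p1 x)) - (K n (p1 (p2 (p2 x))) - B (n - 1) (p1 (p2 x))) \<in> Y (n - 1)"
          "p2 (p2 (p2 x)) \<in> Y (n - 2)"
        using x by (simp_all add: TS MS cl i)
      show "(- (comp 0 g f - idf)) n u x = D (Ti v ?M) (n + 0 - 1) u (s n u x) + sgn_pow 0 \<star> s (n + 1) u (D (Ti v ?M) n u x)"
        using n3[OF m(1), of n] n3[OF m(2), of "n - 1"]
        by - (rule pr_eqI; rule pr_eqI; (rule pr_eqI)?; (rule pr_eqI)?; simp add: uv TS MS comp_def idf_def l i d_def ex_def algebra_simps)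
    qed
    then show ?thesis using bdr_neg[OF kmod(1)] by fastforce
  qed
  moreover have "comp (- 0) f g - idf \<in> bdr 0 ?N ?N"
  proof (rule bdr_cong[OF bdr_0[OF kmod(2)]])
    fix n w x
    show "(0 :: 'k fam) n w x = (comp (- 0) f g - idf) n w x"
    proof (rule vertex_all_intro[of _ v w, unfolded uv])
      show "(0 :: 'k fam) n v x = (comp (- 0) f g - idf) n v x"
        by (simp add: comp_def idf_def d_def l i)
      show "(0 :: 'k fam) n u x = (comp (- 0) f g - idf) n u x"
        by (simp add: comp_def idf_def d_def l i)
    qed
  qed
  ultimately show ?thesis unfolding heq_def v_def[symmetric] using f g by (intro bexI[of _ f] bexI[of _ g]) auto
qed

text \<open>The first coordinate is recovered from \<open>(L, B)\<close> of the old model; the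
  second is already the new arrow component.\<close>

lemma linv_T: "linv X Y L B \<mu> \<Longrightarrow> linv (XT X Y) Y (LT L B) BT (\<lambda>n w. pr (\<mu> (n - 1) (p1 w)) (p2 w))"
  unfolding linv_def
proof (elim conjE, intro conjI allI ballI)
  assume a: "\<forall>n. lin (\<mu> n)" "\<forall>n. \<forall>p\<in>X (n - 1). \<forall>q\<in>Y n. \<mu> n (pr p q) \<in> X n" "\<forall>n. \<forall>x\<in>X n. \<mu> n (pr (L n x) (B n x)) = x"
  fix n
  show "lin (\<lambda>w. pr (\<mu> (n - 1) (p1 w)) (p2 w))" using a(1) by (auto simp: lin_def)
  fix p q assume "p \<in> XT X Y (n - 1)" "q \<in> Y n"
  then show "pr (\<mu> (n - 1) (p1 (pr p q))) (p2 (pr p q)) \<in> XT X Y n"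
    using a(2)[rule_format, of "p1 p" "n - 1" "p2 p"] by simp
next
  fix n x assume a: "\<forall>n. \<forall>x\<in>X n. \<mu> n (pr (L n x) (B n x)) = x" and "x \<in> XT X Y n"
  then show "pr (\<mu> (n - 1) (p1 (pr (LT L B n x) (BT n x)))) (p2 (pr (LT L B n x) (BT n x))) = x"
    by (simp add: LT_def BT_def)
qed

text \<open>After the twist the arrow component is the projection onto \<open>Y\<close>, so
  surjectivity is immediate, with \<open>- y\<close> in the second summand as preimage.\<close>

lemma rinv_T: "rinv (XT X Y) Y BT K (\<lambda>n y. pr (pr 0 (- y)) 0)"
  unfolding rinv_def by (auto simp: BT_def lin_def mdl_lin mdl_cl)

text \<open>After the inverse twist the arrow component embeds \<open>X\<close> with the sign -1,
  which the left inverse undoes.\<close>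

lemma linv_I: "linv X (YI X Y) L BI (\<lambda>n w. - p1 (p2 w))"
  unfolding linv_def by (auto simp: BI_def lin_def mdl_cl)

text \<open>The new arrow component covers the summand \<open>X\<close>; the summand
  \<open>Y\<close> is covered by the old splitting one degree higher.\<close>

lemma rinv_I: "rinv X Y B K \<nu> \<Longrightarrow> rinv X (YI X Y) BI (KI B K) (\<lambda>n w. pr (p1 w) (\<nu> (n + 1) (p2 w)))"
proof -
  assume a: "rinv X Y B K \<nu>"
  then have n: "\<And>n. lin (\<nu> n)" "\<And>n y. y \<in> Y (n + 1) \<Longrightarrow> p1 (\<nu> (n + 1) y) \<in> X (n + 1) \<and> p2 (\<nu> (n + 1) y) \<in> Y (n + 1 + 1) \<and>
     K (n + 1 + 1) (p2 (\<nu> (n + 1) y)) - B (n + 1) (p1 (\<nu> (n + 1) y)) = y"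
    unfolding rinv_def by blast+
  show ?thesis unfolding rinv_def
    using n(2) by (auto simp: BI_def KI_def lin_def lin_simps[OF n(1)] mdl_cl)
qed

end

section \<open>From matrices to families of linear maps\<close>

text \<open>Coordinates beyond the columns are ignored and those beyond the rows are 0, so that
  matrices of all sizes act on one space.\<close>

definition matop :: "'k::field mat \<Rightarrow> 'k U \<Rightarrow> 'k U" where
  "matop f x = Abs_fps (\<lambda>i. if i < dim_row f then \<Sum>j<dim_col f. f $$ (i, j) * fps_nth x j else 0)"

definition unit :: "nat \<Rightarrow> 'k::field U" where "unit j = Abs_fps (\<lambda>i. if i = j then 1 else 0)"

lemma unit_nth [simp]: "fps_nth (unit j) i = (if i = j then 1 else 0)" by (simp add: unit_def)

lemma matop_nth: "fps_nth (matop f x) i = (if i < dim_row f then \<Sum>j<dim_col f. f $$ (i, j) * fps_nth x j else 0)"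
  by (simp add: matop_def)

lemma lin_matop: "lin (matop f)"
  by (auto simp: lin_def fps_eq_iff matop_nth sum.distrib algebra_simps sum_distrib_left)

lemmas matop_lin = lin_simps[OF lin_matop]

lemma matop_mult: assumes "dim_col f = dim_row g" shows "matop (f * g) x = matop f (matop g x)"
proof (rule fps_ext)
  fix i
  show "fps_nth (matop (f * g) x) i = fps_nth (matop f (matop g x)) i"
  proof (cases "i < dim_row f")
    case True
    have "(\<Sum>j<dim_col g. (\<Sum>k<dim_row g. f $$ (i, k) * g $$ (k, j)) * fps_nth x j)
        = (\<Sum>k<dim_row g. f $$ (i, k) * (\<Sum>j<dim_col g. g $$ (k, j) * fps_nth x j))"
      unfolding sum_distrib_left sum_distrib_right by (subst sum.swap) (simp add: mult.assoc)
    then show ?thesis using True assms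
      by (simp add: matop_nth scalar_prod_def atLeast0LessThan)
  qed (simp add: matop_nth)
qed

lemma matop_add: assumes "f \<in> carrier_mat r c" "g \<in> carrier_mat r c" shows "matop (f + g) x = matop f x + matop g x"
  using assms by (auto simp: fps_eq_iff matop_nth algebra_simps sum.distrib)

lemma matop_diff: assumes "f \<in> carrier_mat r c" "g \<in> carrier_mat r c" shows "matop (f - g) x = matop f x - matop g x"
  using assms by (auto simp: fps_eq_iff matop_nth algebra_simps sum_subtractf)

lemma matop_smult: "matop (a \<cdot>\<^sub>m f) x = a \<star> matop f x"
  by (auto simp: fps_eq_iff matop_nth sum_distrib_left mult.assoc)

lemma matop_zero [simp]: "matop (0\<^sub>m r c) x = 0"
  by (auto simp: fps_eq_iff matop_nth)

lemma matop_one: assumes "\<And>j. n \<le> j \<Longrightarrow> fps_nth x j = 0" shows "matop (1\<^sub>m n) x = x"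
proof (rule fps_ext)
  fix i show "fps_nth (matop (1\<^sub>m n) x) i = fps_nth x i"
    using assms[of i] by (auto simp: matop_nth if_distrib if_distribR sum.delta' cong: if_cong)
qed

lemma matop_unit: "j < dim_col f \<Longrightarrow> fps_nth (matop f (unit j)) i = (if i < dim_row f then f $$ (i, j) else 0)"
  by (simp add: matop_nth if_distrib sum.delta cong: if_cong)

lemma matop_eqI: assumes "f \<in> carrier_mat r c" "g \<in> carrier_mat r c" "\<And>j. j < c \<Longrightarrow> matop f (unit j) = matop g (unit j)" shows "f = g"
proof (rule eq_matI)
  fix i j assume "i < dim_row g" "j < dim_col g"
  then show "f $$ (i, j) = g $$ (i, j)"
    using matop_unit[of j f i] matop_unit[of j g i] assms by auto
qed (use assms in auto)

lemma unit_expand: assumes "\<And>j. n \<le> j \<Longrightarrow> fps_nth x j = 0" shows "x = (\<Sum>j<n. fps_nth x j \<star> unit j)"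
proof (rule fps_ext)
  fix i show "fps_nth x i = fps_nth (\<Sum>j<n. fps_nth x j \<star> unit j) i"
    using assms[of i] by (auto simp: fps_sum_nth if_distrib sum.delta cong: if_cong)
qed

definition hsup :: "int list \<Rightarrow> int \<Rightarrow> 'k::field U \<Rightarrow> bool" where
  "hsup ds n x \<longleftrightarrow> (\<forall>j. fps_nth x j \<noteq> 0 \<longrightarrow> j < length ds \<and> ds ! j = n)"

lemma matop_hsup: assumes "f \<in> homogeneous m ds es" "hsup ds n x" shows "hsup es (n + m) (matop f x)"
  unfolding hsup_def
proof (intro allI impI)
  fix i assume i: "fps_nth (matop f x) i \<noteq> 0"
  have d: "dim_row f = length es" "dim_col f = length ds" using assms by (auto simp: homogeneous_def)
  have ir: "i < length es" using i d by (auto simp: matop_nth split: if_splits)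
  with i d obtain j where "j < length ds" "f $$ (i, j) * fps_nth x j \<noteq> 0"
    by (auto simp: matop_nth elim!: sum.not_neutral_contains_not_neutral)
  then show "i < length es \<and> es ! i = n + m"
    using ir assms by (auto simp: homogeneous_def hsup_def)
qed

text \<open>A basis vector is homogeneous but need not lie at one vertex. The part at
  \<open>w\<close> is therefore cut out as the fixed space of the idempotent.\<close>

definition dgfam :: "'k::field dgmod \<Rightarrow> 'k kmod" where
  "dgfam M = \<lparr>V = (\<lambda>n w. {x. hsup (degs M) n x \<and> matop (act M (Triv w)) x = x}),
     A = (\<lambda>w. matop (act M (Arrow w))), D = (\<lambda>n w. matop (diff M))\<rparr>"

lemma dgfam_simps [simp]: "V (dgfam M) n w = {x. hsup (degs M) n x \<and> matop (act M (Triv w)) x = x}"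
  "A (dgfam M) w = matop (act M (Arrow w))" "D (dgfam M) n w = matop (diff M)"
  by (simp_all add: dgfam_def)

lemma dgm_facts: assumes M: "dg_module M"
  shows "act M p \<in> homogeneous (int (len p)) (degs M) (degs M)" "diff M \<in> homogeneous 1 (degs M) (degs M)"
    "act M p \<in> carrier_mat (mdim M) (mdim M)" "diff M \<in> carrier_mat (mdim M) (mdim M)"
    "matop (act M p) (matop (act M q) x) = (case pmul p q of Some r \<Rightarrow> matop (act M r) x | None \<Rightarrow> 0)"
    "matop (diff M) (matop (diff M) x) = 0"
    "matop (diff M) (matop (act M p) x) = sgn_pow (int (len p)) \<star> matop (act M p) (matop (diff M) x)"
    "(\<And>j. mdim M \<le> j \<Longrightarrow> fps_nth x j = 0) \<Longrightarrow> matop (act M (Triv V1)) x + matop (act M (Triv V2)) x = x"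
proof -
  show a: "act M p \<in> homogeneous (int (len p)) (degs M) (degs M)" "diff M \<in> homogeneous 1 (degs M) (degs M)" for p
    using M by (auto simp: dg_module_def)
  then show c: "act M p \<in> carrier_mat (mdim M) (mdim M)" "diff M \<in> carrier_mat (mdim M) (mdim M)" for p
    by (auto simp: homogeneous_def)
  then have d: "dim_row (act M p) = mdim M" "dim_col (act M p) = mdim M" "dim_row (diff M) = mdim M" "dim_col (diff M) = mdim M" for p
    by auto
  have "act M p * act M q = (case pmul p q of Some r \<Rightarrow> act M r | None \<Rightarrow> 0\<^sub>m (mdim M) (mdim M))"
    using M by (auto simp: dg_module_def)
  from arg_cong[OF this, of "\<lambda>f. matop f x"]
  show "matop (act M p) (matop (act M q) x) = (case pmul p q of Some r \<Rightarrow> matop (act M r) x | None \<Rightarrow> 0)"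
    by (simp add: matop_mult d split: option.splits)
  have "diff M * diff M = 0\<^sub>m (mdim M) (mdim M)" using M by (auto simp: dg_module_def)
  from arg_cong[OF this, of "\<lambda>f. matop f x"] show "matop (diff M) (matop (diff M) x) = 0" by (simp add: matop_mult d)
  have "diff M * act M p = sgn_pow (int (len p)) \<cdot>\<^sub>m (act M p * diff M)" using M by (auto simp: dg_module_def)
  from arg_cong[OF this, of "\<lambda>f. matop f x"]
  show "matop (diff M) (matop (act M p) x) = sgn_pow (int (len p)) \<star> matop (act M p) (matop (diff M) x)"
    by (simp add: matop_mult matop_smult d)
  have "act M (Triv V1) + act M (Triv V2) = 1\<^sub>m (mdim M)" using M by (auto simp: dg_module_def)
  from arg_cong[OF this, of "\<lambda>f. matop f x"]
  show "(\<And>j. mdim M \<le> j \<Longrightarrow> fps_nth x j = 0) \<Longrightarrow> matop (act M (Triv V1)) x + matop (act M (Triv V2)) x = x"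
    by (simp add: matop_add[OF c(1) c(1)] matop_one)
qed

lemma hsup_0 [simp]: "hsup ds n 0" by (simp add: hsup_def)
lemma hsup_add: "hsup ds n x \<Longrightarrow> hsup ds n y \<Longrightarrow> hsup ds n (x + y)"
  by (auto simp: hsup_def) (metis add.right_neutral)+
lemma hsup_sc: "hsup ds n x \<Longrightarrow> hsup ds n (c \<star> x)" by (auto simp: hsup_def)

lemma hsup_ge: "hsup ds n x \<Longrightarrow> length ds \<le> j \<Longrightarrow> fps_nth x j = 0" by (force simp: hsup_def)

lemma kmod_dgfam: assumes M: "dg_module M" shows "kmod (dgfam M)"
  unfolding kmod_def
proof (intro conjI allI ballI)
  note f = dgm_facts[OF M]
  fix n w
  show "sub (V (dgfam M) n w)" by (auto simp: sub_def matop_lin hsup_add hsup_sc)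
  show "lin (A (dgfam M) w)" "lin (D (dgfam M) n w)" by (simp_all add: lin_matop)
  fix x assume x: "x \<in> V (dgfam M) n w"
  show "A (dgfam M) w x \<in> V (dgfam M) (n + 1) (opp w)"
    using x matop_hsup[OF f(1)[of "Arrow w"], of n x] by (simp add: f(5))
  show "D (dgfam M) n w x \<in> V (dgfam M) (n + 1) w"
    using x matop_hsup[OF f(2), of n x] f(7)[of "Triv w" x] by simp
  show "D (dgfam M) (n + 1) w (D (dgfam M) n w x) = 0" by (simp add: f(6))
  show "A (dgfam M) w (A (dgfam M) (opp w) (A (dgfam M) w x)) = 0" by (simp add: f(5))
  show "D (dgfam M) (n + 1) (opp w) (A (dgfam M) w x) = - A (dgfam M) w (D (dgfam M) n w x)" by (simp add: f(7))
qed

text \<open>A basis vector is the sum of its two vertex components, each of which lies in some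
  \<open>V\<close>.\<close>

lemma dgfam_eqI: assumes M: "dg_module M" and c: "f \<in> carrier_mat r (mdim M)" "g \<in> carrier_mat r (mdim M)"
    and eq: "\<And>n w x. x \<in> V (dgfam M) n w \<Longrightarrow> matop f x = matop g x" shows "f = g"
proof (rule matop_eqI[OF c])
  fix j assume j: "j < mdim M"
  note F = dgm_facts[OF M]
  have u: "hsup (degs M) (degs M ! j) (unit j)" using j by (auto simp: hsup_def split: if_splits)
  have "matop (act M (Triv w)) (unit j) \<in> V (dgfam M) (degs M ! j) w" for w
    using matop_hsup[OF F(1)[of "Triv w"] u] by (simp add: F(5))
  note eq[OF this, of V1] eq[OF this, of V2]
  moreover have "unit j = matop (act M (Triv V1)) (unit j) + matop (act M (Triv V2)) (unit j)"
    by (rule F(8)[symmetric]) (use j in auto)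
  ultimately show "matop f (unit j) = matop g (unit j)" by (metis lin_add[OF lin_matop])
qed

section \<open>Graded morphisms: matrices versus families\<close>

definition glin :: "int \<Rightarrow> 'k::field dgmod \<Rightarrow> 'k dgmod \<Rightarrow> 'k mat set" where
  "glin m M N = {f \<in> homogeneous m (degs M) (degs N). \<forall>p. f * act M p = sgn_pow (m * int (len p)) \<cdot>\<^sub>m (act N p * f)}"

definition mfam :: "'k::field mat \<Rightarrow> 'k fam" where "mfam f = (\<lambda>n w x. matop f x)"

lemma mfam_apply [simp]: "mfam f n w x = matop f x" by (simp add: mfam_def)

lemma glin_carrier: "f \<in> glin m M N \<Longrightarrow> f \<in> carrier_mat (mdim N) (mdim M)"
  by (auto simp: glin_def homogeneous_def)

lemma glin_matop: assumes M: "dg_module M" "dg_module N" and f: "f \<in> glin m M N"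
  shows "matop f (matop (act M p) x) = sgn_pow (m * int (len p)) \<star> matop (act N p) (matop f x)"
proof -
  have d: "dim_row (act K p) = mdim K" "dim_col (act K p) = mdim K" if "dg_module K" for K :: "'a dgmod"
    using dgm_facts(3)[OF that, of p] by auto
  have "f * act M p = sgn_pow (m * int (len p)) \<cdot>\<^sub>m (act N p * f)" using f by (auto simp: glin_def)
  from arg_cong[OF this, of "\<lambda>f. matop f x"] glin_carrier[OF f] show ?thesis
    by (simp add: matop_mult matop_smult d[OF M(1)] d[OF M(2)])
qed

lemma glin_hom: assumes M: "dg_module M" "dg_module N" and f: "f \<in> glin m M N"
  shows "mfam f \<in> hom m (dgfam M) (dgfam N)"
proof (rule homI)
  have h: "f \<in> homogeneous m (degs M) (degs N)" using f by (auto simp: glin_def)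
  fix n w show "lin (mfam f n w)" by (simp add: mfam_def lin_matop)
  fix x assume x: "x \<in> V (dgfam M) n w"
  show "mfam f n w x \<in> V (dgfam N) (n + m) w"
    using x matop_hsup[OF h, of n x] glin_matop[OF M f, of "Triv w" x] by simp
  show "mfam f (n + 1) (opp w) (A (dgfam M) w x) = sgn_pow m \<star> A (dgfam N) w (mfam f n w x)"
    using glin_matop[OF M f, of "Arrow w" x] by simp
qed

lemma dgfam_other: assumes M: "dg_module M" and x: "x \<in> V (dgfam M) n w" and ne: "w' \<noteq> w"
  shows "matop (act M (Triv w')) x = 0" "matop (act M (Arrow w')) x = 0"
proof -
  note F = dgm_facts[OF M]
  have x': "matop (act M (Triv w)) x = x" using x by simp
  show a: "matop (act M (Triv w')) x = 0" using F(5)[of "Triv w'" "Triv w" x] ne unfolding x' by simp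
  show "matop (act M (Arrow w')) x = 0" using F(5)[of "Arrow w'" "Triv w'" x] unfolding a by (simp add: matop_lin)
qed

text \<open>The column of a basis vector is the sum of the values of \<open>F\<close> on its two
  vertex components. Linearity is verified for idempotents and arrows; loops follow as products of
  two arrows.\<close>

lemma hom_glin: assumes M: "dg_module M" "dg_module N" and F: "F \<in> hom m (dgfam M) (dgfam N)"
  obtains f where "f \<in> glin m M N" "\<And>n w x. x \<in> V (dgfam M) n w \<Longrightarrow> matop f x = F n w x"
proof -
  note fM = dgm_facts[OF M(1)] and fN = dgm_facts[OF M(2)]
  let ?E = "\<lambda>w. matop (act M (Triv w))"
  define col where "col = (\<lambda>j. F (degs M ! j) V1 (?E V1 (unit j)) + F (degs M ! j) V2 (?E V2 (unit j)))"
  define f where "f = mat (mdim N) (mdim M) (\<lambda>(i, j). fps_nth (col j) i)"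
  have c: "f \<in> carrier_mat (mdim N) (mdim M)" by (simp add: f_def)
  have u: "hsup (degs M) (degs M ! j) (unit j)" if "j < mdim M" for j using that by (auto simp: hsup_def split: if_splits)
  have Eu: "?E w (unit j) \<in> V (dgfam M) (degs M ! j) w" if "j < mdim M" for j w
    using matop_hsup[OF fM(1)[of "Triv w"] u[OF that]] by (simp add: fM(5))
  have hc: "hsup (degs N) (degs M ! j + m) (col j)" if "j < mdim M" for j
    using homD(2)[OF F Eu[OF that, of V1]] homD(2)[OF F Eu[OF that, of V2]] by (simp add: col_def hsup_add)
  have fu: "matop f (unit j) = col j" if "j < mdim M" for j
  proof (rule fps_ext)
    fix i show "fps_nth (matop f (unit j)) i = fps_nth (col j) i"
      using that matop_unit[of j f i] hsup_ge[OF hc[OF that], of i] by (auto simp: f_def)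
  qed
  have eq: "matop f x = F n w x" if x: "x \<in> V (dgfam M) n w" for n w x
  proof -
    have hx: "hsup (degs M) n x" and Ex: "?E w x = x" using x by auto
    have ex: "x = (\<Sum>j<mdim M. fps_nth x j \<star> unit j)" by (rule unit_expand) (rule hsup_ge[OF hx])
    have l: "lin (\<lambda>x. F n V1 (?E V1 x) + F n V2 (?E V2 x))"
      by (intro lin_plus lin_comp[OF homD(1)[OF F] lin_matop])
    have "matop f x = (\<Sum>j<mdim M. fps_nth x j \<star> col j)"
      by (subst ex) (simp add: lin_sum[OF lin_matop] matop_lin fu)
    \<comment> \<open>\<open>x\<close> is supported in degree \<open>n\<close>, so wherever its
      coefficient is nonzero the degree of the basis vector is \<open>n\<close>.\<close>
    also have "\<dots> = (\<Sum>j<mdim M. fps_nth x j \<star> (F n V1 (?E V1 (unit j)) + F n V2 (?E V2 (unit j))))"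
    proof (rule sum.cong[OF refl])
      fix j show "fps_nth x j \<star> col j = fps_nth x j \<star> (F n V1 (?E V1 (unit j)) + F n V2 (?E V2 (unit j)))"
        using hx by (cases "fps_nth x j = 0") (auto simp: col_def hsup_def)
    qed
    also have "\<dots> = F n V1 (?E V1 x) + F n V2 (?E V2 x)"
      using arg_cong[OF ex, of "\<lambda>x. F n V1 (?E V1 x) + F n V2 (?E V2 x)"]
      by (simp add: lin_sum[OF l] lin_sc[OF l])
    also have "\<dots> = F n w x"
      using dgfam_other(1)[OF M(1) x, of V1] dgfam_other(1)[OF M(1) x, of V2] Ex
      by (cases w) (auto simp: lin_0[OF homD(1)[OF F]])
    finally show ?thesis .
  qed
  have "f \<in> homogeneous m (degs M) (degs N)"
    using hc by (auto simp: homogeneous_def f_def hsup_def)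
  moreover have comm: "f * act M p = sgn_pow (m * int (len p)) \<cdot>\<^sub>m (act N p * f)" if p: "\<And>v. p \<noteq> Loop v" for p
  proof (rule dgfam_eqI[OF M(1)])
    show "f * act M p \<in> carrier_mat (mdim N) (mdim M)" "sgn_pow (m * int (len p)) \<cdot>\<^sub>m (act N p * f) \<in> carrier_mat (mdim N) (mdim M)"
      using c fM(3)[of p] fN(3)[of p] by auto
    fix n w x assume x: "x \<in> V (dgfam M) n w"
    have Fx: "F n w x \<in> V (dgfam N) (n + m) w" using homD(2)[OF F x] .
    have "matop f (matop (act M p) x) = sgn_pow (m * int (len p)) \<star> matop (act N p) (matop f x)"
    proof (cases p)
      case (Triv v)
      show ?thesis
      proof (cases "v = w")
        case True then show ?thesis using x Fx eq[OF x] Triv by simp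
      next
        case False then show ?thesis using dgfam_other[OF M(1) x False] dgfam_other[OF M(2) Fx False] eq[OF x] Triv by (simp add: matop_lin)
      qed
    next
      case (Arrow v)
      show ?thesis
      proof (cases "v = w")
        case True then show ?thesis using eq[OF kmod_A[OF kmod_dgfam[OF M(1)] x]] homD(3)[OF F x] eq[OF x] Arrow by simp
      next
        case False then show ?thesis using dgfam_other[OF M(1) x False] dgfam_other[OF M(2) Fx False] eq[OF x] Arrow by (simp add: matop_lin)
      qed
    qed (use p in auto)
    then show "matop (f * act M p) x = matop (sgn_pow (m * int (len p)) \<cdot>\<^sub>m (act N p * f)) x"
      using c fM(3)[of p] fN(3)[of p] by (simp add: matop_mult matop_smult)
  qed
  moreover have "f * act M (Loop v) = sgn_pow (m * int (len (Loop v))) \<cdot>\<^sub>m (act N (Loop v) * f)" for v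
  proof (rule dgfam_eqI[OF M(1)])
    show "f * act M (Loop v) \<in> carrier_mat (mdim N) (mdim M)"
      "sgn_pow (m * int (len (Loop v))) \<cdot>\<^sub>m (act N (Loop v) * f) \<in> carrier_mat (mdim N) (mdim M)"
      using c fM(3)[of "Loop v"] fN(3)[of "Loop v"] by auto
    fix x
    have mc: "matop f (matop (act M (Arrow w)) x) = sgn_pow m \<star> matop (act N (Arrow w)) (matop f x)" for w x
      using arg_cong[OF comm[of "Arrow w"], of "\<lambda>f. matop f x"] c fM(3)[of "Arrow w"] fN(3)[of "Arrow w"]
      by (simp add: matop_mult matop_smult)
    have "matop f (matop (act M (Loop v)) x) = matop (act N (Loop v)) (matop f x)"
      using mc[of "opp v" "matop (act M (Arrow v)) x"] mc[of v x] fM(5)[of "Arrow (opp v)" "Arrow v" x]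
        fN(5)[of "Arrow (opp v)" "Arrow v" "matop f x"] by (simp add: matop_lin)
    then show "matop (f * act M (Loop v)) x = matop (sgn_pow (m * int (len (Loop v))) \<cdot>\<^sub>m (act N (Loop v) * f)) x"
      using c fM(3)[of "Loop v"] fN(3)[of "Loop v"] by (simp add: matop_mult matop_smult sgn_pow_def)
  qed
  ultimately have "f \<in> glin m M N" unfolding glin_def by (auto, metis)
  then show thesis using eq by (rule that)
qed

section \<open>Shifts, morphisms into shifts and null-homotopies\<close>

lemma homogeneous_shift:
  "homogeneous k ds (map (\<lambda>d. d - n) es) = homogeneous (k + n) ds es"
  "homogeneous k (map (\<lambda>d. d - n) ds) es = homogeneous (k - n) ds es"
  by (auto simp: homogeneous_def algebra_simps)

lemma homogeneous_smult: "f \<in> homogeneous k ds es \<Longrightarrow> c \<cdot>\<^sub>m f \<in> homogeneous k ds es"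
  by (auto simp: homogeneous_def)

lemma shift_simps [simp]: "degs (shift n M) = map (\<lambda>d. d - n) (degs M)"
  "act (shift n M) p = sgn_pow (n * int (len p)) \<cdot>\<^sub>m act M p" "diff (shift n M) = sgn_pow n \<cdot>\<^sub>m diff M"
  by (simp_all add: shift_def)

lemma len_pmul: "pmul p q = Some r \<Longrightarrow> len r = len p + len q"
  by (cases p; cases q) (auto split: if_splits)

lemma smult_smult: "a \<cdot>\<^sub>m (b \<cdot>\<^sub>m f) = (a * b) \<cdot>\<^sub>m (f :: 'a::semigroup_mult mat)"
  by (auto simp: mult.assoc)

lemma one_smult [simp]: "1 \<cdot>\<^sub>m f = (f :: 'a::monoid_mult mat)"
  by (rule eq_matI) auto

lemma dg_module_shift: assumes M: "dg_module M" shows "dg_module (shift n M)"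
proof -
  note F = dgm_facts(1-4)[OF M]
  have mm: "(a \<cdot>\<^sub>m f) * (b \<cdot>\<^sub>m g) = (a * b) \<cdot>\<^sub>m (f * g)" if "f \<in> carrier_mat (mdim M) (mdim M)" "g \<in> carrier_mat (mdim M) (mdim M)" for a b and f g :: "'a mat"
    using that by (simp add: mult_smult_distrib mult_smult_assoc_mat[of f "mdim M" "mdim M" _ "mdim M"] smult_smult mult.commute)
  show ?thesis unfolding dg_module_def
  proof (intro conjI allI)
    fix p q
    show "act (shift n M) p \<in> homogeneous (int (len p)) (degs (shift n M)) (degs (shift n M))"
      using F(1)[of p] by (simp add: homogeneous_shift homogeneous_smult)
    show "act (shift n M) p * act (shift n M) q = (case pmul p q of None \<Rightarrow> 0\<^sub>m (mdim (shift n M)) (mdim (shift n M)) | Some r \<Rightarrow> act (shift n M) r)"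
    proof -
      have "act M p * act M q = (case pmul p q of Some r \<Rightarrow> act M r | None \<Rightarrow> 0\<^sub>m (mdim M) (mdim M))"
        using M by (auto simp: dg_module_def)
      then show ?thesis
        by (auto simp: mm[OF F(3) F(3)] len_pmul sgn_pow_add[symmetric] algebra_simps split: option.splits)
    qed
    show "act (shift n M) (Triv V1) + act (shift n M) (Triv V2) = 1\<^sub>m (mdim (shift n M))"
      using M by (auto simp: dg_module_def)
    show "diff (shift n M) \<in> homogeneous 1 (degs (shift n M)) (degs (shift n M))"
      using F(2) by (simp add: homogeneous_shift homogeneous_smult)
    show "diff (shift n M) * diff (shift n M) = 0\<^sub>m (mdim (shift n M)) (mdim (shift n M))"
      using M mm[OF F(4) F(4)] by (auto simp: dg_module_def)
    show "diff (shift n M) * act (shift n M) p = sgn_pow (int (len p)) \<cdot>\<^sub>m (act (shift n M) p * diff (shift n M))"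
      using M mm[OF F(4) F(3)[of p]] mm[OF F(3)[of p] F(4)] by (auto simp: dg_module_def smult_smult mult.commute mult.left_commute)
  qed
qed

lemma shift_0: "shift 0 M = M"
  by (cases M) (simp add: shift_def)

context
  fixes M N :: "'k::field dgmod"
  assumes M: "dg_module M" and N: "dg_module N"
begin

lemma carr: "act M p \<in> carrier_mat (mdim M) (mdim M)" "act N p \<in> carrier_mat (mdim N) (mdim N)"
    "diff M \<in> carrier_mat (mdim M) (mdim M)" "diff N \<in> carrier_mat (mdim N) (mdim N)"
  using dgm_facts(3,4)[OF M] dgm_facts(3,4)[OF N] by auto

text \<open>The sign in the shifted action is absorbed by the sign rule: with the same matrix, a map
  of degree \<open>k\<close> into \<open>N[m]\<close> is one of degree \<open>k + m\<close> into
  \<open>N\<close>.\<close>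

lemma glin_shift: "{f \<in> homogeneous k (degs M) (degs (shift m N)). \<forall>p. f * act M p = sgn_pow (k * int (len p)) \<cdot>\<^sub>m (act (shift m N) p * f)}
   = glin (k + m) M N"
proof -
  have "sgn_pow (k * int (len p)) \<cdot>\<^sub>m (sgn_pow (m * int (len p)) \<cdot>\<^sub>m act N p * f) = sgn_pow ((k + m) * int (len p)) \<cdot>\<^sub>m (act N p * f)"
    if "f \<in> homogeneous k' (degs M) (degs N)" for f :: "'k mat" and p k'
  proof -
    have "f \<in> carrier_mat (mdim N) (mdim M)" using that by (auto simp: homogeneous_def)
    then show ?thesis using carr(2)[of p]
      by (simp add: mult_smult_assoc_mat[of _ "mdim N" "mdim N" _ "mdim M"] smult_smult sgn_pow_add algebra_simps)
  qed
  then show ?thesis unfolding glin_def by (auto simp: homogeneous_shift)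
qed

lemma dg_hom_shift: "dg_hom M (shift m N) = {f \<in> glin m M N. f * diff M = sgn_pow m \<cdot>\<^sub>m (diff N * f)}"
proof -
  have d: "diff (shift m N) * f = sgn_pow m \<cdot>\<^sub>m (diff N * f)" if "f \<in> glin m M N" for f
    using glin_carrier[OF that] carr(4) by (simp add: mult_smult_assoc_mat[of _ "mdim N" "mdim N" _ "mdim M"])
  have g: "f \<in> homogeneous 0 (degs M) (degs (shift m N)) \<and> (\<forall>p. f * act M p = act (shift m N) p * f) \<longleftrightarrow> f \<in> glin m M N" for f
    unfolding glin_shift[of 0 m, simplified mult_zero_left add_0 sgn_pow_0 one_smult, symmetric] by simp
  have "f \<in> dg_hom M (shift m N) \<longleftrightarrow> f \<in> glin m M N \<and> f * diff M = diff (shift m N) * f" for f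
    unfolding dg_hom_def g[symmetric] by blast
  then have "f \<in> dg_hom M (shift m N) \<longleftrightarrow> f \<in> {f \<in> glin m M N. f * diff M = sgn_pow m \<cdot>\<^sub>m (diff N * f)}" for f
    by (cases "f \<in> glin m M N") (simp_all add: d del: shift_simps)
  then show ?thesis by blast
qed

lemma null_hom_shift: "null_hom M (shift m N) = {sgn_pow m \<cdot>\<^sub>m (diff N * s) + s * diff M | s. s \<in> glin (m - 1) M N}"
proof -
  have d: "diff (shift m N) * s = sgn_pow m \<cdot>\<^sub>m (diff N * s)" if "s \<in> glin (m - 1) M N" for s
    using glin_carrier[OF that] carr(4) by (simp add: mult_smult_assoc_mat[of _ "mdim N" "mdim N" _ "mdim M"])
  have e: "-1 * int k = - int k" "-1 + m = m - 1" for k by simp_all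
  have g: "s \<in> homogeneous (- 1) (degs M) (degs (shift m N)) \<and> (\<forall>p. s * act M p = sgn_pow (int (len p)) \<cdot>\<^sub>m (act (shift m N) p * s)) \<longleftrightarrow> s \<in> glin (m - 1) M N" for s
    unfolding glin_shift[of "-1" m, unfolded e, unfolded sgn_pow_minus, symmetric] by simp
  show ?thesis unfolding null_hom_def g by (rule Collect_cong, rule ex_cong1) (use d in auto)
qed

lemma dg_hom_carrier: "f \<in> dg_hom M (shift m N) \<Longrightarrow> f \<in> carrier_mat (mdim N) (mdim M)"
  unfolding dg_hom_shift by (auto dest: glin_carrier)

lemma dg_hom_cyc1: assumes f: "f \<in> dg_hom M (shift m N)" shows "mfam f \<in> cyc m (dgfam M) (dgfam N)"
proof (rule cycI)
  have g: "f \<in> glin m M N" and d: "f * diff M = sgn_pow m \<cdot>\<^sub>m (diff N * f)" using f by (auto simp: dg_hom_shift)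
  show "mfam f \<in> hom m (dgfam M) (dgfam N)" by (rule glin_hom[OF M N g])
  fix n w x
  show "mfam f (n + 1) w (D (dgfam M) n w x) = sgn_pow m \<star> D (dgfam N) (n + m) w (mfam f n w x)"
    using arg_cong[OF d, of "\<lambda>f. matop f x"] carr glin_carrier[OF g] by (simp add: matop_mult matop_smult)
qed

lemma cyc_dg_hom: assumes F: "F \<in> cyc m (dgfam M) (dgfam N)"
  obtains f where "f \<in> dg_hom M (shift m N)" "\<And>n w x. x \<in> V (dgfam M) n w \<Longrightarrow> matop f x = F n w x"
proof -
  obtain f where f: "f \<in> glin m M N" "\<And>n w x. x \<in> V (dgfam M) n w \<Longrightarrow> matop f x = F n w x"
    by (rule hom_glin[OF M N cycD(1)[OF F]]) (rule that)
  have c: "f \<in> carrier_mat (mdim N) (mdim M)" by (rule glin_carrier[OF f(1)])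
  have "f * diff M = sgn_pow m \<cdot>\<^sub>m (diff N * f)"
  proof (rule dgfam_eqI[OF M])
    show "f * diff M \<in> carrier_mat (mdim N) (mdim M)" "sgn_pow m \<cdot>\<^sub>m (diff N * f) \<in> carrier_mat (mdim N) (mdim M)"
      using c carr by auto
    fix n w x assume x: "x \<in> V (dgfam M) n w"
    show "matop (f * diff M) x = matop (sgn_pow m \<cdot>\<^sub>m (diff N * f)) x"
      using f(2)[OF kmod_D[OF kmod_dgfam[OF M] x]] f(2)[OF x] cycD(2)[OF F x] c carr by (simp add: matop_mult matop_smult)
  qed
  then show thesis using f by (intro that[of f]) (auto simp: dg_hom_shift)
qed

lemma dg_hom_cyc: assumes c: "f \<in> carrier_mat (mdim N) (mdim M)"
  shows "f \<in> dg_hom M (shift m N) \<longleftrightarrow> mfam f \<in> cyc m (dgfam M) (dgfam N)"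
proof
  assume "mfam f \<in> cyc m (dgfam M) (dgfam N)"
  then obtain g where g: "g \<in> dg_hom M (shift m N)" "\<And>n w x. x \<in> V (dgfam M) n w \<Longrightarrow> matop g x = mfam f n w x"
    by (rule cyc_dg_hom) (rule that)
  have "f = g" using g(2) by (intro dgfam_eqI[OF M c dg_hom_carrier[OF g(1)]]) auto
  then show "f \<in> dg_hom M (shift m N)" using g(1) by simp
qed (rule dg_hom_cyc1)

text \<open>The two notions of homotopy differ by the factor \<open>(-1)^m\<close>, the sign of the
  differential of \<open>N[m]\<close>.\<close>

lemma null_hom_bdr: assumes c: "f \<in> carrier_mat (mdim N) (mdim M)"
  shows "f \<in> null_hom M (shift m N) \<longleftrightarrow> mfam f \<in> bdr m (dgfam M) (dgfam N)"
proof -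
  have matop: "matop (sgn_pow m \<cdot>\<^sub>m (diff N * s) + s * diff M) x = sgn_pow m \<star> matop (diff N) (matop s x) + matop s (matop (diff M) x)"
    and car: "sgn_pow m \<cdot>\<^sub>m (diff N * s) + s * diff M \<in> carrier_mat (mdim N) (mdim M)"
    if "s \<in> glin (m - 1) M N" for s x
    using glin_carrier[OF that] carr by (auto simp: matop_add[of _ "mdim N" "mdim M"] matop_smult matop_mult)
  show ?thesis
  proof
    assume "f \<in> null_hom M (shift m N)"
    then obtain s where s: "s \<in> glin (m - 1) M N" "f = sgn_pow m \<cdot>\<^sub>m (diff N * s) + s * diff M"
      by (auto simp: null_hom_shift)
    have "fsc (sgn_pow m) (mfam s) \<in> hom (m - 1) (dgfam M) (dgfam N)"
      by (rule hom_fsc[OF kmod_dgfam[OF N] glin_hom[OF M N s(1)]])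
    then show "mfam f \<in> bdr m (dgfam M) (dgfam N)"
      by (rule bdrI) (simp add: s(2) matop[OF s(1)] matop_lin)
  next
    assume "mfam f \<in> bdr m (dgfam M) (dgfam N)"
    then obtain S where S: "S \<in> hom (m - 1) (dgfam M) (dgfam N)"
      "\<And>n w x. x \<in> V (dgfam M) n w \<Longrightarrow> mfam f n w x = D (dgfam N) (n + m - 1) w (S n w x) + sgn_pow m \<star> S (n + 1) w (D (dgfam M) n w x)"
      by (rule bdrE) (rule that)
    obtain s where s: "s \<in> glin (m - 1) M N" "\<And>n w x. x \<in> V (dgfam M) n w \<Longrightarrow> matop s x = fsc (sgn_pow m) S n w x"
      by (rule hom_glin[OF M N hom_fsc[OF kmod_dgfam[OF N] S(1), of "sgn_pow m"]]) (rule that)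
    have "f = sgn_pow m \<cdot>\<^sub>m (diff N * s) + s * diff M"
    proof (rule dgfam_eqI[OF M c car[OF s(1)]])
      fix n w x assume x: "x \<in> V (dgfam M) n w"
      show "matop f x = matop (sgn_pow m \<cdot>\<^sub>m (diff N * s) + s * diff M) x"
        using S(2)[OF x] s(2)[OF x] s(2)[OF kmod_D[OF kmod_dgfam[OF M] x]] by (simp add: matop[OF s(1)] matop_lin)
    qed
    then show "f \<in> null_hom M (shift m N)" using s(1) by (auto simp: null_hom_shift)
  qed
qed

lemma null_hom_carrier: "f \<in> null_hom M (shift m N) \<Longrightarrow> f \<in> carrier_mat (mdim N) (mdim M)"
  unfolding null_hom_shift using carr by (auto dest!: glin_carrier)

lemma mfam_ops: "f \<in> carrier_mat (mdim N) (mdim M) \<Longrightarrow> g \<in> carrier_mat (mdim N) (mdim M) \<Longrightarrow> mfam (f + g) = mfam f + mfam g"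
  "f \<in> carrier_mat (mdim N) (mdim M) \<Longrightarrow> g \<in> carrier_mat (mdim N) (mdim M) \<Longrightarrow> mfam (f - g) = mfam f - mfam g"
  "mfam (c \<cdot>\<^sub>m f) = fsc c (mfam f)" "mfam (0\<^sub>m r s) = 0"
  by (auto simp: mfam_def fun_eq_iff matop_add matop_diff matop_smult)

lemma null_in_dg: "f \<in> null_hom M (shift m N) \<Longrightarrow> f \<in> dg_hom M (shift m N)"
proof -
  assume f: "f \<in> null_hom M (shift m N)"
  have c: "f \<in> carrier_mat (mdim N) (mdim M)" by (rule null_hom_carrier[OF f])
  note kM = kmod_dgfam[OF M] and kN = kmod_dgfam[OF N]
  from f c have "mfam f \<in> bdr m (dgfam M) (dgfam N)" by (simp add: null_hom_bdr)
  then obtain S where S: "S \<in> hom (m - 1) (dgfam M) (dgfam N)"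
      "\<And>n w x. x \<in> V (dgfam M) n w \<Longrightarrow> mfam f n w x = diff_hom (m - 1) (dgfam M) (dgfam N) S n w x" unfolding bdr_def by blast
  have b: "diff_hom (m - 1) (dgfam M) (dgfam N) S \<in> hom m (dgfam M) (dgfam N)" using diff_hom_hom[OF kM kN S(1)] by simp
  have "diff_hom (m - 1) (dgfam M) (dgfam N) S \<in> cyc m (dgfam M) (dgfam N)"
  proof (rule cycI[OF b])
    fix n w x assume x: "x \<in> V (dgfam M) n w"
    have y: "S n w x \<in> V (dgfam N) (n + (m - 1)) w" using homD(2)[OF S(1) x] .
    show "diff_hom (m - 1) (dgfam M) (dgfam N) S (n + 1) w (D (dgfam M) n w x) = sgn_pow m \<star> D (dgfam N) (n + m) w (diff_hom (m - 1) (dgfam M) (dgfam N) S n w x)"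
      using kmod_DD[OF kM x] kmod_DD[OF kN y] lin_0[OF homD(1)[OF S(1)]]
      by (simp add: diff_hom_def matop_lin sgn_pow_diff algebra_simps)
  qed
  then obtain g where g: "g \<in> dg_hom M (shift m N)" "\<And>n w x. x \<in> V (dgfam M) n w \<Longrightarrow> matop g x = diff_hom (m - 1) (dgfam M) (dgfam N) S n w x"
    by (rule cyc_dg_hom) (rule that)
  have "f = g" using g(2) S(2) by (intro dgfam_eqI[OF M c dg_hom_carrier[OF g(1)]]) auto
  then show ?thesis using g(1) by simp
qed

lemma dg_closed:
  "f \<in> dg_hom M (shift m N) \<Longrightarrow> g \<in> dg_hom M (shift m N) \<Longrightarrow> f + g \<in> dg_hom M (shift m N)"
  "f \<in> dg_hom M (shift m N) \<Longrightarrow> g \<in> dg_hom M (shift m N) \<Longrightarrow> f - g \<in> dg_hom M (shift m N)"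
  "f \<in> dg_hom M (shift m N) \<Longrightarrow> c \<cdot>\<^sub>m f \<in> dg_hom M (shift m N)"
  "0\<^sub>m (mdim N) (mdim M) \<in> dg_hom M (shift m N)"
proof -
  note c = dg_hom_carrier and Z = dg_hom_cyc1 and kN = kmod_dgfam[OF N]
  have I: "f \<in> carrier_mat (mdim N) (mdim M) \<Longrightarrow> mfam f \<in> cyc m (dgfam M) (dgfam N) \<Longrightarrow> f \<in> dg_hom M (shift m N)" for f
    using dg_hom_cyc by blast
  show "0\<^sub>m (mdim N) (mdim M) \<in> dg_hom M (shift m N)"
    by (rule I) (simp_all add: mfam_ops(4) cyc_0[OF kN])
  show "c \<cdot>\<^sub>m f \<in> dg_hom M (shift m N)" if "f \<in> dg_hom M (shift m N)"
    by (rule I) (simp_all add: mfam_ops(3) cyc_fsc[OF kN Z[OF that]] c[OF that])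
  show "f + g \<in> dg_hom M (shift m N)" if "f \<in> dg_hom M (shift m N)" "g \<in> dg_hom M (shift m N)"
    by (rule I) (simp_all add: mfam_ops(1)[OF c[OF that(1)] c[OF that(2)]] cyc_add[OF kN Z[OF that(1)] Z[OF that(2)]] c[OF that(2)])
  show "f - g \<in> dg_hom M (shift m N)" if "f \<in> dg_hom M (shift m N)" "g \<in> dg_hom M (shift m N)"
    by (rule I) (simp_all add: mfam_ops(2)[OF c[OF that(1)] c[OF that(2)]] cyc_diff[OF kN Z[OF that(1)] Z[OF that(2)]] c[OF that(2)] minus_carrier_mat)
qed

lemma null_closed:
  "f \<in> null_hom M (shift m N) \<Longrightarrow> g \<in> null_hom M (shift m N) \<Longrightarrow> f + g \<in> null_hom M (shift m N)"
  "f \<in> null_hom M (shift m N) \<Longrightarrow> g \<in> null_hom M (shift m N) \<Longrightarrow> f - g \<in> null_hom M (shift m N)"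
  "f \<in> null_hom M (shift m N) \<Longrightarrow> c \<cdot>\<^sub>m f \<in> null_hom M (shift m N)"
  "0\<^sub>m (mdim N) (mdim M) \<in> null_hom M (shift m N)"
proof -
  note c = null_hom_carrier and kN = kmod_dgfam[OF N]
  have Z: "f \<in> null_hom M (shift m N) \<Longrightarrow> mfam f \<in> bdr m (dgfam M) (dgfam N)" for f
    using null_hom_bdr[OF null_hom_carrier] by blast
  have I: "f \<in> carrier_mat (mdim N) (mdim M) \<Longrightarrow> mfam f \<in> bdr m (dgfam M) (dgfam N) \<Longrightarrow> f \<in> null_hom M (shift m N)" for f
    using null_hom_bdr by blast
  show "0\<^sub>m (mdim N) (mdim M) \<in> null_hom M (shift m N)"
    by (rule I) (simp_all add: mfam_ops(4) bdr_0[OF kN])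
  show "c \<cdot>\<^sub>m f \<in> null_hom M (shift m N)" if "f \<in> null_hom M (shift m N)"
    by (rule I) (simp_all add: mfam_ops(3) bdr_fsc[OF kN Z[OF that]] c[OF that])
  show "f + g \<in> null_hom M (shift m N)" if "f \<in> null_hom M (shift m N)" "g \<in> null_hom M (shift m N)"
    by (rule I) (simp_all add: mfam_ops(1)[OF c[OF that(1)] c[OF that(2)]] bdr_add[OF kN Z[OF that(1)] Z[OF that(2)]] c[OF that(2)])
  show "f - g \<in> null_hom M (shift m N)" if "f \<in> null_hom M (shift m N)" "g \<in> null_hom M (shift m N)"
    by (rule I) (simp_all add: mfam_ops(2)[OF c[OF that(1)] c[OF that(2)]] bdr_diff[OF kN Z[OF that(1)] Z[OF that(2)]] c[OF that(2)] minus_carrier_mat)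
qed

section \<open>The vector space of homotopy classes\<close>

abbreviation "hc m \<equiv> hclass M (shift m N)"

lemma hclass_eq: assumes "f \<in> dg_hom M (shift m N)" "g \<in> dg_hom M (shift m N)"
  shows "hc m f = hc m g \<longleftrightarrow> f - g \<in> null_hom M (shift m N)"
proof
  note c = dg_hom_carrier[OF assms(1)] dg_hom_carrier[OF assms(2)]
  assume "hc m f = hc m g"
  moreover have "f \<in> hc m f"
  proof -
    have "f - f = 0\<^sub>m (mdim N) (mdim M)" using c(1) by auto
    then show ?thesis unfolding hclass_def using assms(1) null_closed(4)[of m] by simp
  qed
  ultimately show "f - g \<in> null_hom M (shift m N)" unfolding hclass_def by auto
next
  note c = dg_hom_carrier[OF assms(1)] dg_hom_carrier[OF assms(2)]
  assume n: "f - g \<in> null_hom M (shift m N)"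
  have "h - f \<in> null_hom M (shift m N) \<longleftrightarrow> h - g \<in> null_hom M (shift m N)" if "h \<in> dg_hom M (shift m N)" for h
  proof -
    have h: "h \<in> carrier_mat (mdim N) (mdim M)" by (rule dg_hom_carrier[OF that])
    have "h - g = (h - f) + (f - g)" "h - f = (h - g) - (f - g)" using h c by auto
    then show ?thesis using null_closed(1,2)[of _ m "f - g"] n by metis
  qed
  then show "hc m f = hc m g" unfolding hclass_def by blast
qed

lemma Hom_simps: "carrier (Hom_deg m M N) = hc m ` dg_hom M (shift m N)" "zero (Hom_deg m M N) = hc m (0\<^sub>m (mdim N) (mdim M))"
proof -
  have "null_hom M (shift m N) = hc m (0\<^sub>m (mdim N) (mdim M))"
  proof -
    have "f - 0\<^sub>m (mdim N) (mdim M) = f" if "f \<in> dg_hom M (shift m N)" for f using dg_hom_carrier[OF that] by auto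
    then show ?thesis unfolding hclass_def using null_in_dg by auto
  qed
  then show "zero (Hom_deg m M N) = hc m (0\<^sub>m (mdim N) (mdim M))" by (simp add: Hom_def)
qed (simp add: Hom_def)

lemma hclassD: "g \<in> hc m f \<Longrightarrow> g \<in> dg_hom M (shift m N) \<and> g - f \<in> null_hom M (shift m N)"
  by (simp add: hclass_def)

lemma hclass_self: assumes "f \<in> dg_hom M (shift m N)" shows "f \<in> hc m f"
proof -
  have "f - f = 0\<^sub>m (mdim N) (mdim M)" using dg_hom_carrier[OF assms] by auto
  then show ?thesis unfolding hclass_def using assms null_closed(4)[of m] by simp
qed

lemma Hom_add: assumes f: "f \<in> dg_hom M (shift m N)" "g \<in> dg_hom M (shift m N)"
  shows "hc m f \<oplus>\<^bsub>Hom_deg m M N\<^esub> hc m g = hc m (f + g)"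
proof -
  have "{a + b |a b. a \<in> hc m f \<and> b \<in> hc m g} = hc m (f + g)"
  proof (rule equalityI; rule subsetI)
    fix x assume "x \<in> {a + b |a b. a \<in> hc m f \<and> b \<in> hc m g}"
    then obtain a b where x: "x = a + b" "a \<in> hc m f" "b \<in> hc m g" by blast
    note a = hclassD[OF x(2)] and b = hclassD[OF x(3)]
    have "a + b - (f + g) = (a - f) + (b - g)"
      using dg_hom_carrier[OF conjunct1[OF a]] dg_hom_carrier[OF conjunct1[OF b]] dg_hom_carrier[OF f(1)] dg_hom_carrier[OF f(2)]
      by (intro eq_matI) auto
    then show "x \<in> hc m (f + g)" unfolding hclass_def using a b dg_closed(1) null_closed(1) x(1) by simp
  next
    fix x assume "x \<in> hc m (f + g)"
    note x = hclassD[OF this]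
    have c: "x \<in> carrier_mat (mdim N) (mdim M)" "f \<in> carrier_mat (mdim N) (mdim M)" "g \<in> carrier_mat (mdim N) (mdim M)"
      using x f dg_hom_carrier by auto
    have e: "x - g - f = x - (f + g)" "x = (x - g) + g" using c by (auto simp: algebra_simps)
    have "x - g \<in> hc m f" unfolding hclass_def using x f e(1) dg_closed(2) by simp
    then show "x \<in> {a + b |a b. a \<in> hc m f \<and> b \<in> hc m g}" using e(2) hclass_self[OF f(2)] by blast
  qed
  then show ?thesis by (simp add: Hom_def)
qed

lemma Hom_smult: assumes f: "f \<in> dg_hom M (shift m N)"
  shows "c \<odot>\<^bsub>Hom_deg m M N\<^esub> hc m f = hc m (c \<cdot>\<^sub>m f)"
proof -
  have "{c \<cdot>\<^sub>m a + b |a b. a \<in> hc m f \<and> b \<in> null_hom M (shift m N)} = hc m (c \<cdot>\<^sub>m f)"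
  proof (rule equalityI; rule subsetI)
    fix x assume "x \<in> {c \<cdot>\<^sub>m a + b |a b. a \<in> hc m f \<and> b \<in> null_hom M (shift m N)}"
    then obtain a b where x: "x = c \<cdot>\<^sub>m a + b" "a \<in> hc m f" "b \<in> null_hom M (shift m N)" by blast
    note a = hclassD[OF x(2)]
    have "c \<cdot>\<^sub>m a + b - c \<cdot>\<^sub>m f = c \<cdot>\<^sub>m (a - f) + b"
      using dg_hom_carrier[OF conjunct1[OF a]] dg_hom_carrier[OF f] null_hom_carrier[OF x(3)]
      by (intro eq_matI) (auto simp: algebra_simps)
    then show "x \<in> hc m (c \<cdot>\<^sub>m f)" unfolding hclass_def
      using a dg_closed(1,3) null_closed(1,3) x(1,3) null_in_dg[OF x(3)] by simp
  next
    fix x assume "x \<in> hc m (c \<cdot>\<^sub>m f)"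
    note x = hclassD[OF this]
    have "x = c \<cdot>\<^sub>m f + (x - c \<cdot>\<^sub>m f)" using dg_hom_carrier[OF conjunct1[OF x]] dg_hom_carrier[OF f]
      by (intro eq_matI) auto
    then show "x \<in> {c \<cdot>\<^sub>m a + b |a b. a \<in> hc m f \<and> b \<in> null_hom M (shift m N)}"
      using hclass_self[OF f] x by blast
  qed
  then show ?thesis by (simp add: Hom_def)
qed

lemma vs_Hom: "vectorspace class_ring (Hom_deg m M N)"
proof -
  let ?H = "Hom_deg m M N"
  note c = dg_hom_carrier
  have ab: "abelian_group ?H"
  proof (rule abelian_groupI)
    fix x y z assume "x \<in> carrier ?H" "y \<in> carrier ?H" "z \<in> carrier ?H"
    then obtain f g h where f: "f \<in> dg_hom M (shift m N)" "g \<in> dg_hom M (shift m N)" "h \<in> dg_hom M (shift m N)"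
      and x: "x = hc m f" "y = hc m g" "z = hc m h" unfolding Hom_simps by blast
    show "x \<oplus>\<^bsub>?H\<^esub> y \<in> carrier ?H" unfolding x Hom_add[OF f(1,2)] Hom_simps using f dg_closed(1) by blast
    show "x \<oplus>\<^bsub>?H\<^esub> y \<oplus>\<^bsub>?H\<^esub> z = x \<oplus>\<^bsub>?H\<^esub> (y \<oplus>\<^bsub>?H\<^esub> z)"
      unfolding x using f by (simp add: Hom_add dg_closed assoc_add_mat[OF c c c])
    show "x \<oplus>\<^bsub>?H\<^esub> y = y \<oplus>\<^bsub>?H\<^esub> x"
      unfolding x using f by (simp add: Hom_add comm_add_mat[OF c c])
  next
    show "\<zero>\<^bsub>?H\<^esub> \<in> carrier ?H" unfolding Hom_simps using dg_closed(4) by blast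
    fix x assume "x \<in> carrier ?H"
    then obtain f where f: "f \<in> dg_hom M (shift m N)" and x: "x = hc m f" unfolding Hom_simps by blast
    show "\<zero>\<^bsub>?H\<^esub> \<oplus>\<^bsub>?H\<^esub> x = x" unfolding x Hom_simps using f dg_closed(4) by (simp add: Hom_add left_add_zero_mat[OF c])
    have "(-1) \<cdot>\<^sub>m f + f = 0\<^sub>m (mdim N) (mdim M)" using c[OF f] by (intro eq_matI) auto
    then show "\<exists>y\<in>carrier ?H. y \<oplus>\<^bsub>?H\<^esub> x = \<zero>\<^bsub>?H\<^esub>"
      unfolding x Hom_simps using f dg_closed(3)[OF f, of "-1"] by (intro bexI[of _ "hc m ((-1) \<cdot>\<^sub>m f)"]) (auto simp: Hom_add)
  qed
  have "module class_ring ?H"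
  proof (rule moduleI)
    show "cring (class_ring :: 'k ring)" by (rule class_cring.cring_axioms)
    show "abelian_group ?H" by (rule ab)
    fix a b :: 'k and x y assume "x \<in> carrier ?H" "y \<in> carrier ?H"
    then obtain f g where f: "f \<in> dg_hom M (shift m N)" "g \<in> dg_hom M (shift m N)"
      and x: "x = hc m f" "y = hc m g" unfolding Hom_simps by blast
    show "a \<odot>\<^bsub>?H\<^esub> x \<in> carrier ?H" unfolding x Hom_smult[OF f(1)] Hom_simps using dg_closed(3)[OF f(1)] by blast
    show "(a \<oplus>\<^bsub>class_ring\<^esub> b) \<odot>\<^bsub>?H\<^esub> x = a \<odot>\<^bsub>?H\<^esub> x \<oplus>\<^bsub>?H\<^esub> b \<odot>\<^bsub>?H\<^esub> x"
      unfolding x using f by (simp add: Hom_smult Hom_add dg_closed add_smult_distrib_right_mat[OF c])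
    show "a \<odot>\<^bsub>?H\<^esub> (x \<oplus>\<^bsub>?H\<^esub> y) = a \<odot>\<^bsub>?H\<^esub> x \<oplus>\<^bsub>?H\<^esub> a \<odot>\<^bsub>?H\<^esub> y"
      unfolding x using f by (simp add: Hom_smult Hom_add dg_closed add_smult_distrib_left_mat[OF c c])
    show "a \<otimes>\<^bsub>class_ring\<^esub> b \<odot>\<^bsub>?H\<^esub> x = a \<odot>\<^bsub>?H\<^esub> (b \<odot>\<^bsub>?H\<^esub> x)"
      unfolding x using f by (simp add: Hom_smult dg_closed smult_smult)
    show "\<one>\<^bsub>class_ring\<^esub> \<odot>\<^bsub>?H\<^esub> x = x" unfolding x using f by (simp add: Hom_smult)
  qed
  moreover have "field (class_ring :: 'k ring)" by (rule class_field.field_axioms)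
  ultimately show ?thesis unfolding vectorspace_def by blast
qed

end

text \<open>A basis of \<open>B\<close> is extended to one of \<open>Z\<close>, and the added
  vectors represent a basis of the quotient. The common bound \<open>K\<close> on supports gives
  finite dimension.\<close>

lemma quot_basis_exists: assumes Z: "sub Z" and B: "sub B" "B \<subseteq> Z" and fin: "\<And>x i. x \<in> Z \<Longrightarrow> i \<ge> K \<Longrightarrow> fps_nth x i = (0::'k::field)"
  shows "\<exists>b r. quot_basis (\<star>) Z B b r"
proof -
  interpret vector_space "(\<star>) :: 'k \<Rightarrow> 'k U \<Rightarrow> _"
    by unfold_locales (auto simp: sc_add sc_add_left)
  have sZ: "subspace Z" and sB: "subspace B" using Z B unfolding sub_def subspace_def by auto
  obtain C where C: "C \<subseteq> B" "independent C" "B \<subseteq> span C" using maximal_independent_subset[of B] by blast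
  obtain C' where C': "C \<subseteq> C'" "C' \<subseteq> Z" "independent C'" "Z \<subseteq> span C'"
    using maximal_independent_subset_extend[of C Z] C B by blast
  have spB: "span C = B" using C sB by (simp add: span_subspace)
  have "C' \<subseteq> span (unit ` {..<K})"
  proof
    fix x assume "x \<in> C'"
    then have "x = (\<Sum>j<K. fps_nth x j \<star> unit j)" using fin C'(2) by (intro unit_expand) auto
    also have "\<dots> \<in> span (unit ` {..<K})" by (intro span_sum span_scale span_base) auto
    finally show "x \<in> span (unit ` {..<K})" .
  qed
  then have finC': "finite C'" using independent_span_bound[OF _ C'(3)] by blast
  define r where "r = card (C' - C)"
  obtain b where b: "bij_betw b {..<r} (C' - C)"
    unfolding r_def using finC' ex_bij_betw_nat_finite[of "C' - C"] by (auto simp: atLeast0LessThan)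
  have "quot_basis (\<star>) Z B b r" unfolding quot_basis_def
  proof (intro conjI allI ballI impI)
    show "b i \<in> Z" if "i < r" for i using bij_betwE[OF b] that C'(2) by auto
  next
    fix f assume "f \<in> Z"
    then have "f \<in> span C'" using C'(4) by blast
    then obtain u where u: "f = (\<Sum>v\<in>C'. u v \<star> v)" using span_finite[OF finC'] by auto
    have "(\<Sum>v\<in>C'. u v \<star> v) = (\<Sum>v\<in>C' - C. u v \<star> v) + (\<Sum>v\<in>C. u v \<star> v)"
      using sum.subset_diff[OF C'(1) finC', of "\<lambda>v. u v \<star> v"] by simp
    moreover have "(\<Sum>v\<in>C' - C. u v \<star> v) = (\<Sum>i<r. u (b i) \<star> b i)"
      using sum.reindex_bij_betw[OF b, of "\<lambda>v. u v \<star> v"] by simp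
    moreover have "(\<Sum>v\<in>C. u v \<star> v) \<in> B" unfolding spB[symmetric] by (intro span_sum span_scale span_base)
    ultimately show "\<exists>c. f - (\<Sum>i<r. c i \<star> b i) \<in> B" using u by (intro exI[of _ "\<lambda>i. u (b i)"]) simp
  next
    fix c i assume "(\<Sum>i<r. c i \<star> b i) \<in> B" and i: "i < r"
    then have "(\<Sum>i<r. c i \<star> b i) \<in> span C" using spB by simp
    then obtain u where u: "(\<Sum>i<r. c i \<star> b i) = (\<Sum>v\<in>C. u v \<star> v)"
      using span_finite[of C] finite_subset[OF C'(1) finC'] by auto
    define a where "a v = (if v \<in> C then - u v else c (inv_into {..<r} b v))" for v
    have "(\<Sum>v\<in>C' - C. a v \<star> v) = (\<Sum>i<r. c i \<star> b i)"
    proof -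
      have "(\<Sum>i<r. a (b i) \<star> b i) = (\<Sum>v\<in>C' - C. a v \<star> v)" by (rule sum.reindex_bij_betw[OF b])
      moreover have "a (b i) = c i" if "i < r" for i
        using that bij_betwE[OF b] bij_betw_inv_into_left[OF b] by (auto simp: a_def)
      ultimately show ?thesis by simp
    qed
    moreover have "(\<Sum>v\<in>C. a v \<star> v) = - (\<Sum>v\<in>C. u v \<star> v)" by (simp add: a_def sum_negf)
    ultimately have "(\<Sum>v\<in>C'. a v \<star> v) = 0"
      using sum.subset_diff[OF C'(1) finC', of "\<lambda>v. a v \<star> v"] u by simp
    then have "a (b i) = 0" using independentD[OF C'(3) finC' subset_refl] bij_betwE[OF b] i by blast
    then show "c i = 0" using i bij_betwE[OF b] bij_betw_inv_into_left[OF b] by (auto simp: a_def)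
  qed
  then show ?thesis by blast
qed

lemma minus_zero_mat': "f \<in> carrier_mat r c \<Longrightarrow> f - 0\<^sub>m r c = (f :: 'a::group_add mat)"
  by (intro eq_matI) auto

section \<open>Bases of morphism spaces represented by matrices\<close>

context
  fixes M N :: "'k::field dgmod"
  assumes M: "dg_module M" and N: "dg_module N"
begin

text \<open>Matrices of different sizes share one type without a common zero, so a linear
  combination starts from the zero matrix of the right size.\<close>

primrec mcomb :: "(nat \<Rightarrow> 'k) \<Rightarrow> (nat \<Rightarrow> 'k mat) \<Rightarrow> nat \<Rightarrow> 'k mat" where
  "mcomb c b 0 = 0\<^sub>m (mdim N) (mdim M)"
| "mcomb c b (Suc r) = mcomb c b r + c r \<cdot>\<^sub>m b r"

definition mbasis :: "int \<Rightarrow> (nat \<Rightarrow> 'k mat) \<Rightarrow> nat \<Rightarrow> bool" where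
  "mbasis m b r \<longleftrightarrow> (\<forall>i<r. b i \<in> dg_hom M (shift m N)) \<and>
     (\<forall>f \<in> dg_hom M (shift m N). \<exists>c. f - mcomb c b r \<in> null_hom M (shift m N)) \<and>
     (\<forall>c. mcomb c b r \<in> null_hom M (shift m N) \<longrightarrow> (\<forall>i<r. c i = 0))"

lemma mcomb_dg: "(\<And>i. i < r \<Longrightarrow> b i \<in> dg_hom M (shift m N)) \<Longrightarrow> mcomb c b r \<in> dg_hom M (shift m N)"
  by (induction r) (auto simp: dg_closed[OF M N])

lemma mcomb_carrier: "(\<And>i. i < r \<Longrightarrow> b i \<in> carrier_mat (mdim N) (mdim M)) \<Longrightarrow> mcomb c b r \<in> carrier_mat (mdim N) (mdim M)"
  by (induction r) auto

lemma mfam_mcomb: assumes "\<And>i. i < r \<Longrightarrow> b i \<in> carrier_mat (mdim N) (mdim M)"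
  shows "mfam (mcomb c b r) = (\<Sum>i<r. fsc (c i) (mfam (b i)))"
  using assms
proof (induction r)
  case (Suc r)
  have "mcomb c b r \<in> carrier_mat (mdim N) (mdim M)" by (rule mcomb_carrier) (simp add: Suc)
  then have "mfam (mcomb c b (Suc r)) = mfam (mcomb c b r) + fsc (c r) (mfam (b r))"
    using Suc.prems[of r] mfam_ops(1)[OF M N, of "mcomb c b r" "c r \<cdot>\<^sub>m b r"] mfam_ops(3)[OF M N, of "c r" "b r"] by simp
  moreover have "mfam (mcomb c b r) = (\<Sum>i<r. fsc (c i) (mfam (b i)))" by (rule Suc.IH, rule Suc.prems) simp
  ultimately show ?case by (simp only: sum.lessThan_Suc)
qed (simp add: mfam_ops[OF M N])

lemma mbasis_hdim: assumes "mbasis m b r" shows "quot_basis fsc (cyc m (dgfam M) (dgfam N)) (bdr m (dgfam M) (dgfam N)) (\<lambda>i. mfam (b i)) r"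
proof -
  have b: "b i \<in> dg_hom M (shift m N)" if "i < r" for i using assms that unfolding mbasis_def by blast
  note bc = dg_hom_carrier[OF M N b]
  show ?thesis unfolding quot_basis_def
  proof (intro conjI allI ballI impI)
    show "mfam (b i) \<in> cyc m (dgfam M) (dgfam N)" if "i < r" for i using b[OF that] dg_hom_cyc1[OF M N] by blast
  next
    fix F assume "F \<in> cyc m (dgfam M) (dgfam N)"
    then obtain f where f: "f \<in> dg_hom M (shift m N)" "\<And>n w x. x \<in> V (dgfam M) n w \<Longrightarrow> matop f x = F n w x"
      by (rule cyc_dg_hom[OF M N]) (rule that)
    from assms f(1) obtain c where c: "f - mcomb c b r \<in> null_hom M (shift m N)" unfolding mbasis_def by blast
    have cc: "f \<in> carrier_mat (mdim N) (mdim M)" "mcomb c b r \<in> carrier_mat (mdim N) (mdim M)"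
      using dg_hom_carrier[OF M N f(1)] mcomb_carrier[of r b, OF bc] by auto
    have "mfam (f - mcomb c b r) \<in> bdr m (dgfam M) (dgfam N)"
      using c null_hom_bdr[OF M N minus_carrier_mat[OF cc(2)]] by blast
    then have "F - (\<Sum>i<r. fsc (c i) (mfam (b i))) \<in> bdr m (dgfam M) (dgfam N)"
      by (rule bdr_cong) (simp add: mfam_ops[OF M N] cc f(2) mfam_mcomb[of r b, OF bc, symmetric] del: mfam_apply, simp add: f(2))
    then show "\<exists>c. F - (\<Sum>i<r. fsc (c i) (mfam (b i))) \<in> bdr m (dgfam M) (dgfam N)" by blast
  next
    fix c i assume "(\<Sum>i<r. fsc (c i) (mfam (b i))) \<in> bdr m (dgfam M) (dgfam N)" "i < r"
    then have "mcomb c b r \<in> null_hom M (shift m N)"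
      using null_hom_bdr[OF M N mcomb_carrier[of r b, OF bc]] mfam_mcomb[of r b, OF bc] by simp
    then show "c i = 0" using assms \<open>i < r\<close> unfolding mbasis_def by blast
  qed
qed

lemma hdim_mbasis: assumes "hdim m (dgfam M) (dgfam N) r" shows "\<exists>b. mbasis m b r"
proof -
  obtain B where B: "quot_basis fsc (cyc m (dgfam M) (dgfam N)) (bdr m (dgfam M) (dgfam N)) B r" using assms unfolding hdim_def by blast
  have "\<exists>f. f \<in> dg_hom M (shift m N) \<and> (\<forall>n w. \<forall>x \<in> V (dgfam M) n w. matop f x = B i n w x)" if "i < r" for i
  proof -
    have "B i \<in> cyc m (dgfam M) (dgfam N)" using B that unfolding quot_basis_def by blast
    then show ?thesis using cyc_dg_hom[OF M N] by metis
  qed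
  then obtain b where b: "\<And>i. i < r \<Longrightarrow> b i \<in> dg_hom M (shift m N)"
    "\<And>i n w x. i < r \<Longrightarrow> x \<in> V (dgfam M) n w \<Longrightarrow> matop (b i) x = B i n w x" by metis
  note bc = dg_hom_carrier[OF M N b(1)]
  have S: "(\<Sum>i<r. fsc (c i) (B i)) n w x = mfam (mcomb c b r) n w x" if "x \<in> V (dgfam M) n w" for c n w x
  proof -
    have app: "(\<Sum>i\<in>I. g i) n w x = (\<Sum>i\<in>I. g i n w x)" for I :: "nat set" and g :: "nat \<Rightarrow> 'k fam"
      by (induction I rule: infinite_finite_induct) auto
    show ?thesis unfolding mfam_mcomb[of r b, OF bc, simplified] app using b(2) that by (intro sum.cong) auto
  qed
  have "mbasis m b r" unfolding mbasis_def
  proof (intro conjI allI ballI impI)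
    show "b i \<in> dg_hom M (shift m N)" if "i < r" for i using b(1) that .
  next
    fix f assume f: "f \<in> dg_hom M (shift m N)"
    then have "mfam f \<in> cyc m (dgfam M) (dgfam N)" using dg_hom_cyc1[OF M N] by blast
    then obtain c where c: "mfam f - (\<Sum>i<r. fsc (c i) (B i)) \<in> bdr m (dgfam M) (dgfam N)" using B unfolding quot_basis_def by blast
    have cc: "f \<in> carrier_mat (mdim N) (mdim M)" "mcomb c b r \<in> carrier_mat (mdim N) (mdim M)"
      using dg_hom_carrier[OF M N f(1)] mcomb_carrier[of r b, OF bc] by auto
    have "mfam (f - mcomb c b r) \<in> bdr m (dgfam M) (dgfam N)"
      using c by (rule bdr_cong) (simp add: S matop_diff[OF cc])
    then have "f - mcomb c b r \<in> null_hom M (shift m N)" using null_hom_bdr[OF M N minus_carrier_mat[OF cc(2)]] by blast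
    then show "\<exists>c. f - mcomb c b r \<in> null_hom M (shift m N)" by blast
  next
    fix c i assume "mcomb c b r \<in> null_hom M (shift m N)" "i < r"
    then have "mfam (mcomb c b r) \<in> bdr m (dgfam M) (dgfam N)" using null_hom_bdr[OF M N mcomb_carrier[of r b, OF bc]] by simp
    then have "(\<Sum>i<r. fsc (c i) (B i)) \<in> bdr m (dgfam M) (dgfam N)" by (rule bdr_cong) (simp only: S)
    then show "c i = 0" using B \<open>i < r\<close> unfolding quot_basis_def by blast
  qed
  then show ?thesis by blast
qed

text \<open>Matrices of a fixed size are encoded row by row as finite sequences, and the existence
  of bases is taken over from the sequence space.\<close>

lemma ex_mbasis: "\<exists>b r. mbasis m b r"
proof -
  let ?R = "mdim N" and ?C = "mdim M"
  define enc :: "'k mat \<Rightarrow> 'k U" where "enc f = Abs_fps (\<lambda>k. if k < ?R * ?C then f $$ (k div ?C, k mod ?C) else 0)" for f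
  have en: "fps_nth (enc f) (i * ?C + j) = f $$ (i, j)" if "i < ?R" "j < ?C" for f i j
  proof -
    have "i * ?C + j < ?R * ?C"
    proof -
      have "i * ?C + j < Suc i * ?C" using that by simp
      also have "\<dots> \<le> ?R * ?C" using that by (intro mult_right_mono) auto
      finally show ?thesis .
    qed
    moreover have "(i * c + j) div c = i" if "j < c" for c :: nat using that by simp
    from this[OF that(2)] have "(i * ?C + j) div ?C = i" .
    ultimately show ?thesis using that(2) by (simp add: enc_def)
  qed
  have inj: "f = g" if "f \<in> carrier_mat ?R ?C" "g \<in> carrier_mat ?R ?C" "enc f = enc g" for f g
    using that en by (intro eq_matI) (auto, metis)
  have dm: "k div ?C < ?R \<and> k mod ?C < ?C" if "k < ?R * ?C" for k
  proof -
    have "?C \<noteq> 0" using that by (cases "?C = 0") auto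
    then show ?thesis using that by (simp add: less_mult_imp_div_less)
  qed
  have ops: "enc (f + g) = enc f + enc g" "enc (f - g) = enc f - enc g" "enc (c \<cdot>\<^sub>m f) = c \<star> enc f"
    if "f \<in> carrier_mat ?R ?C" "g \<in> carrier_mat ?R ?C" for f g c
    using that dm by (auto simp: enc_def fps_eq_iff)
  have e0: "enc (0\<^sub>m ?R ?C) = 0" using dm by (auto simp: enc_def fps_eq_iff)
  let ?Z = "dg_hom M (shift m N)" and ?B = "null_hom M (shift m N)"
  note cl = dg_closed[OF M N] null_closed[OF M N] and zc = dg_hom_carrier[OF M N] and nc = null_hom_carrier[OF M N]
  have "sub (enc ` ?Z)" unfolding sub_def
    using cl(4)[of m] e0 by (auto simp: ops(1)[symmetric, OF zc zc] ops(3)[symmetric, OF zc zc] intro!: imageI cl intro: rev_image_eqI)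
  moreover have "sub (enc ` ?B)" unfolding sub_def
    using cl(8)[of m] e0 by (auto simp: ops(1)[symmetric, OF nc nc] ops(3)[symmetric, OF nc nc] intro!: imageI cl intro: rev_image_eqI)
  moreover have "enc ` ?B \<subseteq> enc ` ?Z" using null_in_dg[OF M N] by blast
  ultimately have "\<exists>e r. quot_basis (\<star>) (enc ` ?Z) (enc ` ?B) e r"
    by (rule quot_basis_exists[where K="?R * ?C"]) (auto simp: enc_def)
  then obtain e r where e: "quot_basis (\<star>) (enc ` ?Z) (enc ` ?B) e r" by blast
  then have "\<forall>i<r. \<exists>f. f \<in> ?Z \<and> e i = enc f" unfolding quot_basis_def by blast
  then obtain b where b: "\<And>i. i < r \<Longrightarrow> b i \<in> ?Z" "\<And>i. i < r \<Longrightarrow> e i = enc (b i)" by metis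
  note bc = zc[OF b(1)]
  have S: "enc (mcomb c b k) = (\<Sum>i<k. c i \<star> e i)" if "k \<le> r" for c k
    using that
  proof (induction k)
    case (Suc k)
    have a: "mcomb c b k \<in> carrier_mat ?R ?C" by (rule mcomb_carrier) (use Suc bc in auto)
    have "c k \<cdot>\<^sub>m b k \<in> carrier_mat ?R ?C" using bc[of k] Suc by auto
    from ops(1)[OF a this] show ?case using Suc b(2)[of k] ops(3)[OF bc bc, of k k] by simp
  qed (simp add: e0)
  have eB: "f \<in> ?B" if "enc f \<in> enc ` ?B" "f \<in> carrier_mat ?R ?C" for f
    using that inj nc by blast
  have "mbasis m b r" unfolding mbasis_def
  proof (intro conjI allI ballI impI)
    show "b i \<in> ?Z" if "i < r" for i using b(1) that .
  next
    fix f assume f: "f \<in> ?Z"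
    then obtain c where c: "enc f - (\<Sum>i<r. c i \<star> e i) \<in> enc ` ?B" using e unfolding quot_basis_def by blast
    have cc: "f \<in> carrier_mat ?R ?C" "mcomb c b r \<in> carrier_mat ?R ?C" using zc[OF f] mcomb_carrier[of r b, OF bc] by auto
    have "enc (f - mcomb c b r) \<in> enc ` ?B" using c by (simp add: ops(2)[OF cc] S)
    then show "\<exists>c. f - mcomb c b r \<in> ?B" using eB cc by (metis minus_carrier_mat)
  next
    fix c i assume "mcomb c b r \<in> ?B" "i < r"
    then have "(\<Sum>i<r. c i \<star> e i) \<in> enc ` ?B" using S[of r c] by (metis imageI order_refl)
    then show "c i = 0" using e \<open>i < r\<close> unfolding quot_basis_def by blast
  qed
  then show ?thesis by blast
qed

text \<open>\<open>lincomb\<close> runs over a set of classes, so different indices must give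
  different classes for it to become a sum over indices.\<close>

lemma mcomb_hc: assumes b: "\<And>i. i < r \<Longrightarrow> b i \<in> dg_hom M (shift m N)"
    and inj: "inj_on (\<lambda>i. hclass M (shift m N) (b i)) {..<r}"
  shows "module.lincomb (Hom_deg m M N) a ((\<lambda>i. hclass M (shift m N) (b i)) ` {..<r})
     = hclass M (shift m N) (mcomb (\<lambda>i. a (hclass M (shift m N) (b i))) b r)"
  using b inj
proof (induction r)
  let ?H = "Hom_deg m M N"
  interpret H: vectorspace class_ring ?H by (rule vs_Hom[OF M N])
  {
    case 0
    show ?case by (simp add: H.lincomb_def Hom_simps(2)[OF M N])
  next
    case (Suc r)
    let ?hc = "\<lambda>i. hclass M (shift m N) (b i)"
    have IH: "H.lincomb a (?hc ` {..<r}) = hclass M (shift m N) (mcomb (\<lambda>i. a (?hc i)) b r)"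
      using Suc by (intro Suc.IH) (auto intro: inj_on_subset)
    have br: "b r \<in> dg_hom M (shift m N)" using Suc.prems by simp
    have mc: "mcomb (\<lambda>i. a (?hc i)) b r \<in> dg_hom M (shift m N)" using Suc.prems by (intro mcomb_dg) simp
    have "?hc r \<notin> ?hc ` {..<r}"
    proof
      assume "?hc r \<in> ?hc ` {..<r}"
      then obtain i where "i < r" "?hc r = ?hc i" by auto
      then show False using inj_onD[OF Suc.prems(2), of r i] by simp
    qed
    then have "H.lincomb a (?hc ` {..<r} \<union> {?hc r}) = (a (?hc r) \<odot>\<^bsub>?H\<^esub> ?hc r) \<oplus>\<^bsub>?H\<^esub> H.lincomb a (?hc ` {..<r})"
      using Suc.prems(1) by (intro H.lincomb_insert) (auto simp: Hom_simps[OF M N])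
    moreover have "?hc ` {..<Suc r} = ?hc ` {..<r} \<union> {?hc r}" by (auto simp: lessThan_Suc)
    moreover have "c \<cdot>\<^sub>m b r + f = f + c \<cdot>\<^sub>m b r" if "f \<in> dg_hom M (shift m N)" for c f
      using dg_hom_carrier[OF M N br] dg_hom_carrier[OF M N that] by (intro comm_add_mat[of _ "mdim N" "mdim M"]) auto
    ultimately show ?case using IH br mc
      by (simp add: Hom_smult[OF M N] Hom_add[OF M N] dg_closed[OF M N])
  }
qed

lemma mcomb_cong: "(\<And>i. i < r \<Longrightarrow> c i = d i) \<Longrightarrow> mcomb c b r = mcomb d b r"
  by (induction r) auto

lemma mbasis_basis: assumes mb: "mbasis m b r"
  shows "inj_on (\<lambda>i. hclass M (shift m N) (b i)) {..<r}"
    "vectorspace.basis class_ring (Hom_deg m M N) ((\<lambda>i. hclass M (shift m N) (b i)) ` {..<r})"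
proof -
  let ?H = "Hom_deg m M N" and ?hc = "\<lambda>i. hclass M (shift m N) (b i)"
  interpret H: vectorspace class_ring ?H by (rule vs_Hom[OF M N])
  have b: "b i \<in> dg_hom M (shift m N)" if "i < r" for i using mb that unfolding mbasis_def by blast
  show inj: "inj_on ?hc {..<r}"
  proof (rule inj_onI, rule ccontr)
    fix i j assume ij: "i \<in> {..<r}" "j \<in> {..<r}" "?hc i = ?hc j" "i \<noteq> j"
    then have "b i - b j \<in> null_hom M (shift m N)" using hclass_eq[OF M N b b] by simp
    \<comment> \<open>If two classes coincided, \<open>b i - b j\<close> would be a nontrivial
      relation modulo null-homotopies.\<close>
    moreover have "mcomb (\<lambda>k. if k = i then 1 else if k = j then -1 else 0) b s = (if i < s then b i else 0\<^sub>m (mdim N) (mdim M)) - (if j < s then b j else 0\<^sub>m (mdim N) (mdim M))"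
      if "s \<le> r" for s
      using that
    proof (induction s)
      case (Suc s)
      have c: "b i \<in> carrier_mat (mdim N) (mdim M)" "b j \<in> carrier_mat (mdim N) (mdim M)" "b s \<in> carrier_mat (mdim N) (mdim M)"
        using dg_hom_carrier[OF M N b] ij Suc by auto
      show ?case using Suc c ij(4) by (auto simp: less_Suc_eq intro!: eq_matI)
    qed (auto intro!: eq_matI)
    ultimately have "mcomb (\<lambda>k. if k = i then 1 else if k = j then -1 else 0) b r \<in> null_hom M (shift m N)"
      using ij by simp
    then have "\<forall>k<r. (if k = i then 1 else if k = j then -1 else 0) = (0::'k)" using mb unfolding mbasis_def by blast
    then show False using ij by auto
  qed
  have sub: "?hc ` {..<r} \<subseteq> carrier ?H" unfolding Hom_simps(1)[OF M N] using b by auto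
  have "H.lin_indpt (?hc ` {..<r})"
  proof (rule H.finite_lin_indpt2)
    fix a assume "H.lincomb a (?hc ` {..<r}) = \<zero>\<^bsub>?H\<^esub>"
    then have "hclass M (shift m N) (mcomb (\<lambda>i. a (?hc i)) b r) = hclass M (shift m N) (0\<^sub>m (mdim N) (mdim M))"
      using mcomb_hc[OF b inj] unfolding Hom_simps(2)[OF M N] by simp
    then have "mcomb (\<lambda>i. a (?hc i)) b r - 0\<^sub>m (mdim N) (mdim M) \<in> null_hom M (shift m N)"
      using hclass_eq[OF M N mcomb_dg[of r b, OF b] dg_closed(4)[OF M N]] by simp
    moreover have "mcomb (\<lambda>i. a (?hc i)) b r - 0\<^sub>m (mdim N) (mdim M) = mcomb (\<lambda>i. a (?hc i)) b r"
      by (rule minus_zero_mat'[OF mcomb_carrier[of r b, OF dg_hom_carrier[OF M N b]]])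
    ultimately show "\<forall>v\<in>?hc ` {..<r}. a v = \<zero>\<^bsub>class_ring\<^esub>" using mb unfolding mbasis_def by auto
  qed (use sub in auto)
  moreover have "H.span (?hc ` {..<r}) = carrier ?H"
  proof
    show "H.span (?hc ` {..<r}) \<subseteq> carrier ?H" by (rule H.span_is_subset2[OF sub])
    show "carrier ?H \<subseteq> H.span (?hc ` {..<r})"
    proof
      fix F assume "F \<in> carrier ?H"
      then obtain f where f: "f \<in> dg_hom M (shift m N)" "F = hclass M (shift m N) f" unfolding Hom_simps(1)[OF M N] by blast
      then obtain c where c: "f - mcomb c b r \<in> null_hom M (shift m N)" using mb unfolding mbasis_def by blast
      define a where "a v = c (inv_into {..<r} ?hc v)" for v
      have "a (?hc i) = c i" if "i < r" for i using inv_into_f_f[OF inj, of i] that by (simp add: a_def)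
      then have "mcomb (\<lambda>i. a (?hc i)) b r = mcomb c b r" by (intro mcomb_cong) auto
      moreover have "hclass M (shift m N) f = hclass M (shift m N) (mcomb c b r)"
        using c hclass_eq[OF M N f(1) mcomb_dg[of r b, OF b]] by simp
      ultimately have "H.lincomb a (?hc ` {..<r}) = F"
        using mcomb_hc[OF b inj, of a] f(2) by simp
      then show "F \<in> H.span (?hc ` {..<r})"
        unfolding H.finite_span[OF finite_imageI[OF finite_lessThan] sub] by auto
    qed
  qed
  ultimately show "H.basis (?hc ` {..<r})" unfolding H.basis_def using sub by auto
qed

lemma basis_mbasis: assumes b: "\<And>i. i < r \<Longrightarrow> b i \<in> dg_hom M (shift m N)"
    and inj: "inj_on (\<lambda>i. hclass M (shift m N) (b i)) {..<r}"
    and bas: "vectorspace.basis class_ring (Hom_deg m M N) ((\<lambda>i. hclass M (shift m N) (b i)) ` {..<r})"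
  shows "mbasis m b r"
proof -
  let ?H = "Hom_deg m M N" and ?hc = "\<lambda>i. hclass M (shift m N) (b i)"
  interpret H: vectorspace class_ring ?H by (rule vs_Hom[OF M N])
  have sub: "?hc ` {..<r} \<subseteq> carrier ?H" unfolding Hom_simps(1)[OF M N] using b by auto
  show ?thesis unfolding mbasis_def
  proof (intro conjI allI ballI impI)
    fix f assume f: "f \<in> dg_hom M (shift m N)"
    then have "hclass M (shift m N) f \<in> H.span (?hc ` {..<r})" using bas unfolding H.basis_def Hom_simps(1)[OF M N] by auto
    then obtain a where "hclass M (shift m N) f = H.lincomb a (?hc ` {..<r})"
      unfolding H.finite_span[OF finite_imageI[OF finite_lessThan] sub] by auto
    then have "f - mcomb (\<lambda>i. a (?hc i)) b r \<in> null_hom M (shift m N)"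
      using mcomb_hc[OF b inj, of a] hclass_eq[OF M N f(1) mcomb_dg[of r b, OF b]] by simp
    then show "\<exists>c. f - mcomb c b r \<in> null_hom M (shift m N)" by blast
  next
    fix c i assume n: "mcomb c b r \<in> null_hom M (shift m N)" and i: "i < r"
    define a where "a v = c (inv_into {..<r} ?hc v)" for v
    have ac: "a (?hc i) = c i" if "i < r" for i using inv_into_f_f[OF inj, of i] that by (simp add: a_def)
    then have "mcomb (\<lambda>i. a (?hc i)) b r = mcomb c b r" by (intro mcomb_cong) auto
    moreover have "mcomb c b r - 0\<^sub>m (mdim N) (mdim M) = mcomb c b r"
      by (rule minus_zero_mat'[OF mcomb_carrier[of r b, OF dg_hom_carrier[OF M N b]]])
    ultimately have "H.lincomb a (?hc ` {..<r}) = \<zero>\<^bsub>?H\<^esub>"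
      unfolding Hom_simps(2)[OF M N] using mcomb_hc[OF b inj, of a] n hclass_eq[OF M N mcomb_dg[of r b, OF b] dg_closed(4)[OF M N]] by simp
    moreover have "H.lin_indpt (?hc ` {..<r})" using bas unfolding H.basis_def by blast
    moreover have "H.lin_dep (?hc ` {..<r})" if "a (?hc i) \<noteq> 0" "H.lincomb a (?hc ` {..<r}) = \<zero>\<^bsub>?H\<^esub>"
      unfolding H.lin_dep_def
      by (rule exI[of _ "?hc ` {..<r}"], rule exI[of _ a], rule exI[of _ "?hc i"]) (use that i in auto)
    ultimately have "a (?hc i) = 0" by blast
    then show "c i = 0" using ac i by simp
  qed (use b in blast)
qed

text \<open>From here on the number in \<open>hdim\<close> is known to be unique, being the
  dimension of the space in the definitions.\<close>

lemma hdim_dim: assumes "hdim m (dgfam M) (dgfam N) r" shows "vectorspace.dim class_ring (Hom_deg m M N) = r"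
proof -
  interpret H: vectorspace class_ring "Hom_deg m M N" by (rule vs_Hom[OF M N])
  obtain b where b: "mbasis m b r" using hdim_mbasis[OF assms] by blast
  show ?thesis using H.dim_basis[OF _ mbasis_basis(2)[OF b]] card_image[OF mbasis_basis(1)[OF b]] by simp
qed

lemma ex_hdim: "\<exists>r. hdim m (dgfam M) (dgfam N) r"
  using ex_mbasis[of m] mbasis_hdim unfolding hdim_def by blast

end

section \<open>Composition of matrices, and isomorphism as homotopy equivalence\<close>

lemma mfam_mult: "dim_col f = dim_row g \<Longrightarrow> mfam (f * g) = comp m (mfam f) (mfam g)"
  by (simp add: mfam_def comp_def matop_mult)

lemma matop_one_dgfam: "x \<in> V (dgfam M) n w \<Longrightarrow> matop (1\<^sub>m (mdim M)) x = x"
  by (rule matop_one) (auto dest: hsup_ge)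

lemma idf_cyc: "idf \<in> cyc 0 M M"
proof -
  have l: "idf n w = (\<lambda>x. x)" for n w unfolding idf_def by simp
  show ?thesis by (intro cycI homI) (auto simp: l lin_intros)
qed

lemma cyc_cong: assumes "f \<in> cyc m M N" "kmod M" "\<And>n w. lin (g n w)" "\<And>n w x. x \<in> V M n w \<Longrightarrow> f n w x = g n w x" shows "g \<in> cyc m M N"
proof -
  note h = cycD(1)[OF assms(1)]
  show ?thesis
  proof (intro cycI homI assms(3))
    fix n w x assume x: "x \<in> V M n w"
    show "g n w x \<in> V N (n + m) w" using homD(2)[OF h x] assms(4)[OF x] by simp
    show "g (n + 1) (opp w) (A M w x) = sgn_pow m \<star> A N w (g n w x)"
      using homD(3)[OF h x] assms(4)[OF x] assms(4)[OF kmod_A[OF assms(2) x]] by simp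
    show "g (n + 1) w (D M n w x) = sgn_pow m \<star> D N (n + m) w (g n w x)"
      using cycD(2)[OF assms(1) x] assms(4)[OF x] assms(4)[OF kmod_D[OF assms(2) x]] by simp
  qed
qed

lemma one_dg_hom: assumes M: "dg_module M" shows "1\<^sub>m (mdim M) \<in> dg_hom M (shift 0 M)"
proof -
  have "mfam (1\<^sub>m (mdim M)) \<in> cyc 0 (dgfam M) (dgfam M)"
    by (rule cyc_cong[OF idf_cyc kmod_dgfam[OF M]]) (simp_all add: mfam_def lin_matop matop_one_dgfam idf_def del: dgfam_simps)
  then show ?thesis using dg_hom_cyc[OF M M] by simp
qed

lemma dg_hom_mult: assumes M: "dg_module M" "dg_module N" "dg_module P" and f: "f \<in> dg_hom M (shift m N)" and g: "g \<in> dg_hom N (shift k P)"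
  shows "g * f \<in> dg_hom M (shift (m + k) P)"
proof -
  have c: "f \<in> carrier_mat (mdim N) (mdim M)" "g \<in> carrier_mat (mdim P) (mdim N)"
    using dg_hom_carrier[OF M(1,2) f] dg_hom_carrier[OF M(2,3) g] .
  have "mfam (g * f) = comp m (mfam g) (mfam f)" using c by (intro mfam_mult) auto
  then have "mfam (g * f) \<in> cyc (m + k) (dgfam M) (dgfam P)"
    using cyc_comp[OF dg_hom_cyc1[OF M(1,2) f] dg_hom_cyc1[OF M(2,3) g] kmod_dgfam[OF M(3)]] by simp
  then show ?thesis using dg_hom_cyc[OF M(1,3), of "g * f" "m + k"] c by simp
qed

lemma null_mult_right: assumes M: "dg_module M" "dg_module N" "dg_module P" and f: "f \<in> null_hom M (shift m N)" and g: "g \<in> dg_hom N (shift k P)"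
  shows "g * f \<in> null_hom M (shift (m + k) P)"
proof -
  have c: "f \<in> carrier_mat (mdim N) (mdim M)" "g \<in> carrier_mat (mdim P) (mdim N)"
    using null_hom_carrier[OF M(1,2) f] dg_hom_carrier[OF M(2,3) g] .
  have "mfam (g * f) = comp m (mfam g) (mfam f)" using c by (intro mfam_mult) auto
  then have "mfam (g * f) \<in> bdr (m + k) (dgfam M) (dgfam P)"
    using bdr_post[OF _ dg_hom_cyc1[OF M(2,3) g]] null_hom_bdr[OF M(1,2) c(1)] f kmod_dgfam M by metis
  then show ?thesis using null_hom_bdr[OF M(1,3), of "g * f" "m + k"] c by simp
qed

lemma null_mult_left: assumes M: "dg_module M" "dg_module N" "dg_module P" and f: "f \<in> dg_hom M (shift m N)" and g: "g \<in> null_hom N (shift k P)"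
  shows "g * f \<in> null_hom M (shift (m + k) P)"
proof -
  have c: "f \<in> carrier_mat (mdim N) (mdim M)" "g \<in> carrier_mat (mdim P) (mdim N)"
    using dg_hom_carrier[OF M(1,2) f] null_hom_carrier[OF M(2,3) g] .
  have "mfam (g * f) = comp m (mfam g) (mfam f)" using c by (intro mfam_mult) auto
  then have "mfam (g * f) \<in> bdr (m + k) (dgfam M) (dgfam P)"
    using bdr_pre[OF _ dg_hom_cyc1[OF M(1,2) f]] null_hom_bdr[OF M(2,3) c(2)] g kmod_dgfam M by metis
  then show ?thesis using null_hom_bdr[OF M(1,3), of "g * f" "m + k"] c by simp
qed

lemma hclass_one_iff: assumes M: "dg_module M" and h: "h \<in> dg_hom M (shift 0 M)"
  shows "hclass M M h = hclass M M (1\<^sub>m (mdim M)) \<longleftrightarrow> mfam h - idf \<in> bdr 0 (dgfam M) (dgfam M)"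
proof -
  note c = dg_hom_carrier[OF M M h]
  have "hclass M M h = hclass M M (1\<^sub>m (mdim M)) \<longleftrightarrow> h - 1\<^sub>m (mdim M) \<in> null_hom M (shift 0 M)"
    using hclass_eq[OF M M h one_dg_hom[OF M]] by (simp add: shift_0)
  also have "\<dots> \<longleftrightarrow> mfam (h - 1\<^sub>m (mdim M)) \<in> bdr 0 (dgfam M) (dgfam M)"
    by (rule null_hom_bdr[OF M M]) (simp add: minus_carrier_mat)
  also have "\<dots> \<longleftrightarrow> mfam h - idf \<in> bdr 0 (dgfam M) (dgfam M)"
  proof -
    have "mfam (h - 1\<^sub>m (mdim M)) n w x = (mfam h - idf) n w x" if "x \<in> V (dgfam M) n w" for n w x
      using matop_one_dgfam[OF that] matop_diff[OF c, of "1\<^sub>m (mdim M)"] by (simp add: idf_def)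
    then show ?thesis using bdr_cong by metis
  qed
  finally show ?thesis .
qed

text \<open>An inverse pair of families is replaced by matrices with the same values on
  \<open>V\<close>; the homotopies survive because boundaries do not see values off
  \<open>V\<close>.\<close>

lemma isom_heq: assumes M: "dg_module M" "dg_module N" shows "isom M N \<longleftrightarrow> heq 0 (dgfam M) (dgfam N)"
proof
  assume "isom M N"
  then obtain f g where f: "f \<in> dg_hom M (shift 0 N)" and g: "g \<in> dg_hom N (shift 0 M)"
    and h: "hclass M M (g * f) = hclass M M (1\<^sub>m (mdim M))" "hclass N N (f * g) = hclass N N (1\<^sub>m (mdim N))"
    unfolding isom_def shift_0 by blast
  have c: "f \<in> carrier_mat (mdim N) (mdim M)" "g \<in> carrier_mat (mdim M) (mdim N)"
    using dg_hom_carrier[OF M f] dg_hom_carrier[OF M(2,1) g] .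
  have m: "mfam (g * f) = comp 0 (mfam g) (mfam f)" "mfam (f * g) = comp 0 (mfam f) (mfam g)" using c by (auto intro!: mfam_mult)
  have d: "g * f \<in> dg_hom M (shift 0 M)" "f * g \<in> dg_hom N (shift 0 N)"
    using dg_hom_mult[OF M(1,2,1) f g] dg_hom_mult[OF M(2,1,2) g f] by auto
  show "heq 0 (dgfam M) (dgfam N)" unfolding heq_def
    using dg_hom_cyc1[OF M f] dg_hom_cyc1[OF M(2,1) g] h
    by (intro bexI[of _ "mfam f"] bexI[of _ "mfam g"]) (auto simp: hclass_one_iff[OF M(1) d(1)] hclass_one_iff[OF M(2) d(2)] m)
next
  assume "heq 0 (dgfam M) (dgfam N)"
  then obtain F G where F: "F \<in> cyc 0 (dgfam M) (dgfam N)" "G \<in> cyc 0 (dgfam N) (dgfam M)"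
    "comp 0 G F - idf \<in> bdr 0 (dgfam M) (dgfam M)" "comp 0 F G - idf \<in> bdr 0 (dgfam N) (dgfam N)" unfolding heq_def by auto
  obtain f where f: "f \<in> dg_hom M (shift 0 N)" "\<And>n w x. x \<in> V (dgfam M) n w \<Longrightarrow> matop f x = F n w x"
    by (rule cyc_dg_hom[OF M F(1)]) (rule that)
  obtain g where g: "g \<in> dg_hom N (shift 0 M)" "\<And>n w x. x \<in> V (dgfam N) n w \<Longrightarrow> matop g x = G n w x"
    by (rule cyc_dg_hom[OF M(2,1) F(2)]) (rule that)
  have c: "f \<in> carrier_mat (mdim N) (mdim M)" "g \<in> carrier_mat (mdim M) (mdim N)"
    using dg_hom_carrier[OF M f(1)] dg_hom_carrier[OF M(2,1) g(1)] .
  have m: "mfam (g * f) = comp 0 (mfam g) (mfam f)" "mfam (f * g) = comp 0 (mfam f) (mfam g)" using c by (auto intro!: mfam_mult)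
  have d: "g * f \<in> dg_hom M (shift 0 M)" "f * g \<in> dg_hom N (shift 0 N)"
    using dg_hom_mult[OF M(1,2,1) f(1) g(1)] dg_hom_mult[OF M(2,1,2) g(1) f(1)] by auto
  have "mfam (g * f) - idf \<in> bdr 0 (dgfam M) (dgfam M)"
    using F(3)
  proof (rule bdr_cong)
    fix n w x assume x: "x \<in> V (dgfam M) n w"
    show "(comp 0 G F - idf) n w x = (mfam (g * f) - idf) n w x"
      using g(2)[OF homD(2)[OF cycD(1)[OF F(1)] x]] f(2)[OF x] by (simp add: m comp_def)
  qed
  moreover have "mfam (f * g) - idf \<in> bdr 0 (dgfam N) (dgfam N)"
    using F(4)
  proof (rule bdr_cong)
    fix n w x assume x: "x \<in> V (dgfam N) n w"
    show "(comp 0 F G - idf) n w x = (mfam (f * g) - idf) n w x"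
      using f(2)[OF homD(2)[OF cycD(1)[OF F(2)] x]] g(2)[OF x] by (simp add: m comp_def)
  qed
  ultimately show "isom M N" unfolding isom_def using f(1) g(1)
    by (intro bexI[of _ f] bexI[of _ g]) (auto simp: hclass_one_iff[OF M(1) d(1)] hclass_one_iff[OF M(2) d(2)] shift_0)
qed

lemma V_shift: "V (dgfam (shift j M)) n w = V (dgfam M) (n + j) w"
  by (auto simp: hsup_def)

text \<open>The identity works in both directions: the shift relabels degrees and introduces exactly
  the signs that a map of degree \<open>j\<close> absorbs.\<close>

lemma heq_shift: assumes M: "dg_module M" shows "heq j (dgfam (shift j M)) (dgfam M)"
  unfolding heq_def
proof (intro bexI conjI)
  have l: "idf n w = (\<lambda>x. x)" for n w unfolding idf_def by simp
  note k = kmod_dgfam[OF M] kmod_dgfam[OF dg_module_shift[OF M, of j]]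
  show a: "idf \<in> cyc j (dgfam (shift j M)) (dgfam M)"
    by (intro cycI homI) (simp_all add: l lin_intros V_shift matop_smult del: dgfam_simps(1))
  show b: "idf \<in> cyc (- j) (dgfam M) (dgfam (shift j M))"
    by (intro cycI homI) (simp_all add: l lin_intros V_shift matop_smult del: dgfam_simps(1))
  show "comp j idf idf - idf \<in> bdr 0 (dgfam (shift j M)) (dgfam (shift j M))"
    "comp (- j) idf idf - idf \<in> bdr 0 (dgfam M) (dgfam M)" using bdr_0 k by simp_all
qed

lemma isom_shift_heq: assumes M: "dg_module M" "dg_module N" shows "isom M (shift j N) \<longleftrightarrow> heq j (dgfam M) (dgfam N)"
proof -
  note k = kmod_dgfam[OF M(1)] kmod_dgfam[OF M(2)] kmod_dgfam[OF dg_module_shift[OF M(2), of j]]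
  have "isom M (shift j N) \<longleftrightarrow> heq 0 (dgfam M) (dgfam (shift j N))" by (rule isom_heq[OF M(1) dg_module_shift[OF M(2)]])
  also have "\<dots> \<longleftrightarrow> heq j (dgfam M) (dgfam N)"
  proof
    assume "heq 0 (dgfam M) (dgfam (shift j N))"
    from heq_trans[OF k(1,3,2) this heq_shift[OF M(2)]] show "heq j (dgfam M) (dgfam N)" by simp
  next
    assume "heq j (dgfam M) (dgfam N)"
    from heq_trans[OF k(1,2,3) this heq_sym[OF heq_shift[OF M(2)]]] show "heq 0 (dgfam M) (dgfam (shift j N))" by simp
  qed
  finally show ?thesis .
qed

section \<open>Spherical objects in terms of dimensions\<close>

text \<open>In contrast to an algebra isomorphism, these dimensions are visibly invariant under
  equivalences and under the twist functor.\<close>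

definition sph_hdim :: "'k::field kmod \<Rightarrow> bool" where
  "sph_hdim x \<longleftrightarrow> (\<forall>n. hdim n x x (if n = 0 \<or> n = 2 then 1 else 0))"

lemma sph_hdim_heq: assumes "kmod x" "kmod y" "heq j x y" "sph_hdim x" shows "sph_hdim y"
  unfolding sph_hdim_def
proof
  fix n
  have "hdim n x x (if n = 0 \<or> n = 2 then 1 else 0)" using assms by (auto simp: sph_hdim_def)
  from hdim_pre[OF assms(1,2,2) assms(3) hdim_post[OF assms(1,1,2) assms(3) this]]
  show "hdim n y y (if n = 0 \<or> n = 2 then 1 else 0)" by simp
qed

lemma sph_hdim_Tw: assumes "kmod x" "sph_hdim x" shows "sph_hdim (Tw u x)"
  using assms hdim_Tw[OF assms(1,1)] unfolding sph_hdim_def by blast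

lemma mbasis_1: assumes M: "dg_module M" "dg_module N" and b: "b \<in> dg_hom M (shift m N)"
  shows "mbasis M N m (\<lambda>_. b) 1 \<longleftrightarrow> (\<forall>f \<in> dg_hom M (shift m N). \<exists>c. f - c \<cdot>\<^sub>m b \<in> null_hom M (shift m N)) \<and> b \<notin> null_hom M (shift m N)"
proof -
  have bc: "b \<in> carrier_mat (mdim N) (mdim M)" by (rule dg_hom_carrier[OF M b])
  have mc: "mcomb M N c (\<lambda>_. b) 1 = c 0 \<cdot>\<^sub>m b" for c using bc by (auto simp: mcomb.simps[OF M])
  have nul: "c \<cdot>\<^sub>m b \<in> null_hom M (shift m N) \<longleftrightarrow> c = 0 \<or> b \<in> null_hom M (shift m N)" for c
  proof
    assume n: "c \<cdot>\<^sub>m b \<in> null_hom M (shift m N)"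
    have "c \<noteq> 0 \<Longrightarrow> b = inverse c \<cdot>\<^sub>m (c \<cdot>\<^sub>m b)" by (simp add: smult_smult)
    then show "c = 0 \<or> b \<in> null_hom M (shift m N)" using null_closed(3)[OF M n, of "inverse c"] by metis
  next
    assume "c = 0 \<or> b \<in> null_hom M (shift m N)"
    moreover have "0 \<cdot>\<^sub>m b = 0\<^sub>m (mdim N) (mdim M)" using bc by auto
    ultimately show "c \<cdot>\<^sub>m b \<in> null_hom M (shift m N)" using null_closed(3,4)[OF M] by metis
  qed
  have e: "(\<exists>c :: nat \<Rightarrow> 'a. f - c 0 \<cdot>\<^sub>m b \<in> null_hom M (shift m N)) \<longleftrightarrow> (\<exists>d. f - d \<cdot>\<^sub>m b \<in> null_hom M (shift m N))" for f
    by (auto intro: exI[of _ "\<lambda>_. _"])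
  have "(\<forall>c :: nat \<Rightarrow> 'a. c 0 = 0 \<or> X \<longrightarrow> (\<forall>i<(1::nat). c i = 0)) \<longleftrightarrow> \<not> X" for X
    by (auto dest: spec[of _ "\<lambda>_. 1"])
  then show ?thesis unfolding mbasis_def[OF M] mc nul e using b by simp
qed

lemma mbasis_0: assumes M: "dg_module M" "dg_module N"
  shows "mbasis M N m b 0 \<longleftrightarrow> dg_hom M (shift m N) \<subseteq> null_hom M (shift m N)"
proof -
  have "f - 0\<^sub>m (mdim N) (mdim M) = f" if "f \<in> dg_hom M (shift m N)" for f
    by (rule minus_zero_mat'[OF dg_hom_carrier[OF M that]])
  then show ?thesis unfolding mbasis_def[OF M] by (auto simp: mcomb.simps[OF M])
qed

lemma spherical_sph_hdim: assumes x: "dg_module (x :: 'k::field dgmod)" and sph: "spherical x" shows "sph_hdim (dgfam x)"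
  unfolding sph_hdim_def
proof
  fix n
  let ?H = "Hom_deg n x x" and ?Z = "dg_hom x (shift n x)" and ?N = "null_hom x (shift n x)" and ?c = "hclass x (shift n x)"
  let ?O = "0\<^sub>m (mdim x) (mdim x)"
  obtain \<phi> :: "int \<Rightarrow> 'k mat set \<Rightarrow> 'k poly" where
    bij: "bij_betw (\<phi> n) (carrier ?H) (dual_numbers n)" and
    sm: "\<And>c F. F \<in> carrier ?H \<Longrightarrow> \<phi> n (c \<odot>\<^bsub>?H\<^esub> F) = Polynomial.smult c (\<phi> n F)"
    using sph unfolding spherical_def by blast
  note cl = dg_closed[OF x x]
  have car: "f \<in> ?Z \<Longrightarrow> ?c f \<in> carrier ?H" for f unfolding Hom_simps(1)[OF x x] by blast
  have sm': "f \<in> ?Z \<Longrightarrow> \<phi> n (?c (a \<cdot>\<^sub>m f)) = Polynomial.smult a (\<phi> n (?c f))" for a f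
    using sm[OF car] Hom_smult[OF x x] by metis
  have eq: "f \<in> ?Z \<Longrightarrow> g \<in> ?Z \<Longrightarrow> \<phi> n (?c f) = \<phi> n (?c g) \<longleftrightarrow> f - g \<in> ?N" for f g
    using inj_on_eq_iff[OF bij_betw_imp_inj_on[OF bij] car car] hclass_eq[OF x x] by metis
  have 0: "\<phi> n (?c ?O) = 0"
    using sm'[OF cl(4), of 0] by simp
  have nul: "f \<in> ?Z \<Longrightarrow> f \<in> ?N \<longleftrightarrow> \<phi> n (?c f) = 0" for f
    using eq[OF _ cl(4), of f] 0 minus_zero_mat'[OF dg_hom_carrier[OF x x], of f n] by metis
  show "hdim n (dgfam x) (dgfam x) (if n = 0 \<or> n = 2 then 1 else 0)"
  proof (cases "n = 0 \<or> n = 2")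
    case True
    \<comment> \<open>A generator of the degree \<open>n\<close> part of the dual numbers; a
      preimage of it spans the morphisms of that degree.\<close>
    define e :: "'k poly" where "e = (if n = 0 then 1 else [:0, 1:])"
    have dn: "dual_numbers n = range (\<lambda>c. Polynomial.smult c e)"
      using True by (auto simp: dual_numbers_def e_def)
    have e0: "e \<noteq> 0" by (simp add: e_def)
    have "e \<in> dual_numbers n" unfolding dn by (rule image_eqI[of _ _ 1]) auto
    then obtain b where b: "b \<in> ?Z" "\<phi> n (?c b) = e" using bij unfolding bij_betw_def Hom_simps(1)[OF x x] by force
    have "mbasis x x n (\<lambda>_. b) 1"
      unfolding mbasis_1[OF x x b(1)]
    proof
      show "\<forall>f\<in>?Z. \<exists>c. f - c \<cdot>\<^sub>m b \<in> ?N"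
      proof
        fix f assume f: "f \<in> ?Z"
        then have "\<phi> n (?c f) \<in> dual_numbers n" using bij car unfolding bij_betw_def by blast
        then obtain c where "\<phi> n (?c f) = Polynomial.smult c e" unfolding dn by auto
        then have "\<phi> n (?c f) = \<phi> n (?c (c \<cdot>\<^sub>m b))" using sm'[OF b(1)] b(2) by simp
        then show "\<exists>c. f - c \<cdot>\<^sub>m b \<in> ?N" using eq[OF f cl(3)[OF b(1)]] by blast
      qed
      show "b \<notin> ?N" using nul[OF b(1)] b(2) e0 by simp
    qed
    then show ?thesis using True mbasis_hdim[OF x x] unfolding hdim_def by auto
  next
    case False
    have "?Z \<subseteq> ?N"
    proof
      fix f assume f: "f \<in> ?Z"
      then have "\<phi> n (?c f) \<in> dual_numbers n" using bij car unfolding bij_betw_def by blast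
      then show "f \<in> ?N" using nul[OF f] False by (simp add: dual_numbers_def)
    qed
    then have "mbasis x x n undefined 0" unfolding mbasis_0[OF x x] .
    from mbasis_hdim[OF x x this] have "hdim n (dgfam x) (dgfam x) 0" unfolding hdim_def by blast
    then show ?thesis using False by simp
  qed
qed

text \<open>The multiplicative structure is forced by the dimensions: a one-dimensional degree-zero part is
  spanned by the identity, which is not null-homotopic since it acts on the nonzero degree-two part.\<close>

lemma sph_hdim_spherical: assumes x: "dg_module (x :: 'k::field dgmod)" and sph: "sph_hdim (dgfam x)" shows "spherical x"
proof -
  let ?Z = "\<lambda>n. dg_hom x (shift n x)" and ?N = "\<lambda>n. null_hom x (shift n x)" and ?c = "\<lambda>n. hclass x (shift n x)"
  let ?I = "1\<^sub>m (mdim x) :: 'k mat" and ?O = "0\<^sub>m (mdim x) (mdim x) :: 'k mat"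
  note cl = dg_closed[OF x x] and ncl = null_closed[OF x x] and car = dg_hom_carrier[OF x x]
  have bas: "\<exists>b. mbasis x x n b (if n = 0 \<or> n = 2 then 1 else 0)" for n
    using sph hdim_mbasis[OF x x] unfolding sph_hdim_def by blast
  have ex1: "\<exists>b\<in>?Z n. (\<forall>f \<in> ?Z n. \<exists>c. f - c \<cdot>\<^sub>m b \<in> ?N n) \<and> b \<notin> ?N n" if n: "n = 0 \<or> n = 2" for n
  proof -
    obtain b where b: "mbasis x x n b 1" using bas[of n] n by auto
    then have "b 0 \<in> ?Z n" unfolding mbasis_def[OF x x] by simp
    moreover have "mcomb x x c b 1 = mcomb x x c (\<lambda>_. b 0) 1" for c by (simp add: mcomb.simps[OF x x])
    then have "mbasis x x n (\<lambda>_. b 0) 1" using b unfolding mbasis_def[OF x x] by (metis less_one)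
    ultimately show ?thesis using mbasis_1[OF x x] by blast
  qed
  have ex0: "f \<in> ?N n" if "f \<in> ?Z n" "n \<noteq> 0" "n \<noteq> 2" for f n
    using bas[of n] that mbasis_0[OF x x] by auto
  have I: "?I \<in> ?Z 0" by (rule one_dg_hom[OF x])
  have Inn: "?I \<notin> ?N 0"
  proof
    assume n: "?I \<in> ?N 0"
    obtain b where b: "b \<in> ?Z 2" "b \<notin> ?N 2" using ex1[of 2] by auto
    have "b * ?I \<in> ?N (0 + 2)" by (rule null_mult_right[OF x x x n b(1)])
    then show False using b(2) car[OF b(1)] by simp
  qed
  have sp0: "\<exists>c. f - c \<cdot>\<^sub>m ?I \<in> ?N 0" if f: "f \<in> ?Z 0" for f
  proof -
    obtain b where b: "b \<in> ?Z 0" "\<And>f. f \<in> ?Z 0 \<Longrightarrow> \<exists>c. f - c \<cdot>\<^sub>m b \<in> ?N 0" using ex1[of 0] by auto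
    obtain d where d: "?I - d \<cdot>\<^sub>m b \<in> ?N 0" using b(2)[OF I] by blast
    obtain c where c: "f - c \<cdot>\<^sub>m b \<in> ?N 0" using b(2)[OF f] by blast
    have "d \<noteq> 0"
    proof
      assume "d = 0"
      then have "?I - d \<cdot>\<^sub>m b = ?I" using car[OF b(1)] by (intro eq_matI) auto
      then show False using d Inn by simp
    qed
    \<comment> \<open>Both \<open>f\<close> and the identity are multiples of \<open>b\<close> up to
      null-homotopy, with \<open>d\<close> nonzero, so \<open>f\<close> is a multiple of the
      identity.\<close>
    then have "f - (c / d) \<cdot>\<^sub>m ?I = (f - c \<cdot>\<^sub>m b) - (c / d) \<cdot>\<^sub>m (?I - d \<cdot>\<^sub>m b)"
      using car[OF b(1)] car[OF f] by (intro eq_matI) (auto simp: algebra_simps)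
    then show ?thesis using ncl(2)[OF c ncl(3)[OF d, of "c / d"]] by metis
  qed
  obtain b2 where b2: "b2 \<in> ?Z 2" "\<And>f. f \<in> ?Z 2 \<Longrightarrow> \<exists>c. f - c \<cdot>\<^sub>m b2 \<in> ?N 2" "b2 \<notin> ?N 2" using ex1[of 2] by auto
  define b where "b n = (if n = 0 then ?I else if n = 2 then b2 else ?O)" for n :: int
  have b: "b n \<in> ?Z n" for n using I b2(1) cl(4) by (auto simp: b_def)
  have bc: "b n \<in> carrier_mat (mdim x) (mdim x)" for n by (rule car[OF b])
  have span: "\<exists>c. f - c \<cdot>\<^sub>m b n \<in> ?N n" if f: "f \<in> ?Z n" for f n
  proof -
    consider "n = 0" | "n = 2" | "n \<noteq> 0" "n \<noteq> 2" by blast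
    then show ?thesis
    proof cases
      case 3
      have "f - 0 \<cdot>\<^sub>m b n = f" using car[OF f] bc[of n] by (intro eq_matI) auto
      then show ?thesis using ex0[OF f 3] by metis
    qed (use sp0 b2(2) f in \<open>auto simp: b_def\<close>)
  qed
  have nul: "c \<cdot>\<^sub>m b n \<in> ?N n \<longleftrightarrow> c = 0 \<or> n \<noteq> 0 \<and> n \<noteq> 2" for c n
  proof
    assume n: "c \<cdot>\<^sub>m b n \<in> ?N n"
    have "b n \<in> ?N n" if "c \<noteq> 0"
      using ncl(3)[OF n, of "inverse c"] that by (simp add: smult_smult)
    then show "c = 0 \<or> n \<noteq> 0 \<and> n \<noteq> 2" using Inn b2(3) by (auto simp: b_def)
  next
    assume "c = 0 \<or> n \<noteq> 0 \<and> n \<noteq> 2"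
    moreover have "0 \<cdot>\<^sub>m b n = ?O" using bc[of n] by (intro eq_matI) auto
    moreover have "c \<cdot>\<^sub>m ?O = ?O" by (intro eq_matI) auto
    ultimately have "c \<cdot>\<^sub>m b n = ?O" by (auto simp: b_def)
    then show "c \<cdot>\<^sub>m b n \<in> ?N n" using ncl(4) by simp
  qed
  have eqc: "?c n (c \<cdot>\<^sub>m b n) = ?c n (d \<cdot>\<^sub>m b n) \<longleftrightarrow> c = d \<or> n \<noteq> 0 \<and> n \<noteq> 2" for c d n
  proof -
    have "c \<cdot>\<^sub>m b n - d \<cdot>\<^sub>m b n = (c - d) \<cdot>\<^sub>m b n" using bc[of n] by (intro eq_matI) (auto simp: algebra_simps)
    then show ?thesis using hclass_eq[OF x x cl(3)[OF b] cl(3)[OF b], of n c d] nul[of "c - d" n] by simp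
  qed
  have rep: "\<exists>c. ?c n f = ?c n (c \<cdot>\<^sub>m b n)" if "f \<in> ?Z n" for f n
    using span[OF that] hclass_eq[OF x x that cl(3)[OF b]] by blast
  define e :: "int \<Rightarrow> 'k poly" where "e n = (if n = 0 then 1 else if n = 2 then [:0, 1:] else 0)" for n
  \<comment> \<open>The coordinate with respect to \<open>b n\<close>. In degrees other than 0 and 2
    it is not determined, but there it multiplies \<open>e n = 0\<close>.\<close>
  define \<phi> where "\<phi> n F = Polynomial.smult (SOME c. F = ?c n (c \<cdot>\<^sub>m b n)) (e n)" for n F
  have phi: "\<phi> n (?c n (c \<cdot>\<^sub>m b n)) = Polynomial.smult c (e n)" for n c
  proof -
    have "?c n (c \<cdot>\<^sub>m b n) = ?c n ((SOME d. ?c n (c \<cdot>\<^sub>m b n) = ?c n (d \<cdot>\<^sub>m b n)) \<cdot>\<^sub>m b n)"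
      by (rule someI[of _ c]) simp
    then have "c = (SOME d. ?c n (c \<cdot>\<^sub>m b n) = ?c n (d \<cdot>\<^sub>m b n)) \<or> n \<noteq> 0 \<and> n \<noteq> 2" using eqc by blast
    then show ?thesis unfolding \<phi>_def by (auto simp: e_def)
  qed
  have carr: "carrier (Hom_deg n x x) = range (\<lambda>c. ?c n (c \<cdot>\<^sub>m b n))" for n
    unfolding Hom_simps(1)[OF x x] using rep cl(3)[OF b] by (auto; blast)
  have dn: "dual_numbers n = range (\<lambda>c. Polynomial.smult c (e n))" for n
    by (auto simp: dual_numbers_def e_def)
  have inje: "Polynomial.smult c (e n) = Polynomial.smult d (e n) \<longleftrightarrow> c = d \<or> n \<noteq> 0 \<and> n \<noteq> 2" for c d n
    by (auto simp: e_def)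
  show ?thesis unfolding spherical_def
  proof (intro exI[of _ \<phi>] conjI allI ballI)
    fix n
    show "bij_betw (\<phi> n) (carrier (Hom_deg n x x)) (dual_numbers n)"
      unfolding bij_betw_def carr dn using phi eqc inje by (auto simp: inj_on_def image_image)
    {
      fix F G assume "F \<in> carrier (Hom_deg n x x)" "G \<in> carrier (Hom_deg n x x)"
      then obtain c d where F: "F = ?c n (c \<cdot>\<^sub>m b n)" "G = ?c n (d \<cdot>\<^sub>m b n)" unfolding carr by blast
      have "c \<cdot>\<^sub>m b n + d \<cdot>\<^sub>m b n = (c + d) \<cdot>\<^sub>m b n" using bc[of n] by (intro eq_matI) (auto simp: algebra_simps)
      then show "\<phi> n (F \<oplus>\<^bsub>Hom_deg n x x\<^esub> G) = \<phi> n F + \<phi> n G"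
        unfolding F using Hom_add[OF x x cl(3)[OF b] cl(3)[OF b]] by (simp add: phi smult_add_left)
    }
    fix a F assume "F \<in> carrier (Hom_deg n x x)"
    then obtain c where F: "F = ?c n (c \<cdot>\<^sub>m b n)" unfolding carr by blast
    show "\<phi> n (a \<odot>\<^bsub>Hom_deg n x x\<^esub> F) = Polynomial.smult a (\<phi> n F)"
      unfolding F using Hom_smult[OF x x cl(3)[OF b]] by (simp add: phi smult_smult)
  next
    fix m n f g assume f: "f \<in> ?Z m" and g: "g \<in> ?Z n"
    obtain c where c: "?c m f = ?c m (c \<cdot>\<^sub>m b m)" using rep[OF f] by blast
    obtain d where d: "?c n g = ?c n (d \<cdot>\<^sub>m b n)" using rep[OF g] by blast
    have nf: "f - c \<cdot>\<^sub>m b m \<in> ?N m" using hclass_eq[OF x x f cl(3)[OF b]] c by blast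
    have ng: "g - d \<cdot>\<^sub>m b n \<in> ?N n" using hclass_eq[OF x x g cl(3)[OF b]] d by blast
    have fc: "f \<in> carrier_mat (mdim x) (mdim x)" "g \<in> carrier_mat (mdim x) (mdim x)" using car f g by auto
    have mnc: "m + n = n + m" by simp
    have "f * g - (c * d) \<cdot>\<^sub>m (b m * b n) = (f - c \<cdot>\<^sub>m b m) * g + (c \<cdot>\<^sub>m b m) * (g - d \<cdot>\<^sub>m b n)"
    proof -
      have e1: "(f - c \<cdot>\<^sub>m b m) * g = f * g - c \<cdot>\<^sub>m b m * g" using fc bc by (intro minus_mult_distrib_mat) auto
      have e2: "(c \<cdot>\<^sub>m b m) * (g - d \<cdot>\<^sub>m b n) = c \<cdot>\<^sub>m b m * g - c \<cdot>\<^sub>m b m * (d \<cdot>\<^sub>m b n)"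
        using fc bc by (intro mult_minus_distrib_mat[of _ "mdim x" "mdim x" _ "mdim x"]) auto
      have e3: "c \<cdot>\<^sub>m b m * (d \<cdot>\<^sub>m b n) = (c * d) \<cdot>\<^sub>m (b m * b n)"
        using bc[of m] bc[of n] by (simp add: mult_smult_distrib mult_smult_assoc_mat[of _ "mdim x" "mdim x" _ "mdim x"] smult_smult mult.commute)
      have e4: "c \<cdot>\<^sub>m b m * g \<in> carrier_mat (mdim x) (mdim x)" "f * g \<in> carrier_mat (mdim x) (mdim x)"
        "(c * d) \<cdot>\<^sub>m (b m * b n) \<in> carrier_mat (mdim x) (mdim x)"
        using fc bc[of m] bc[of n] by auto
      have "P - R = (P - Q) + (Q - R)" if "P \<in> carrier_mat (mdim x) (mdim x)" "Q \<in> carrier_mat (mdim x) (mdim x)"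
        "R \<in> carrier_mat (mdim x) (mdim x)" for P Q R :: "'k mat"
        using that by (intro eq_matI) auto
      from this[OF e4(2,1,3)] show ?thesis unfolding e1 e2 e3 .
    qed
    also have "\<dots> \<in> ?N (m + n)"
      using null_mult_left[OF x x x g nf] null_mult_right[OF x x x ng cl(3)[OF b], of c m] unfolding mnc by (rule ncl(1))
    finally have "f * g - (c * d) \<cdot>\<^sub>m (b m * b n) \<in> ?N (m + n)" .
    moreover have "f * g \<in> ?Z (m + n)" "b m * b n \<in> ?Z (m + n)"
      using dg_hom_mult[OF x x x g f] dg_hom_mult[OF x x x b b, where m=n and k=m] by (simp_all add: mnc)
    ultimately have fg: "?c (m + n) (f * g) = ?c (m + n) ((c * d) \<cdot>\<^sub>m (b m * b n))"
      using hclass_eq[OF x x _ cl(3)] by blast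
    \<comment> \<open>A product of basis elements is a basis element if one factor is the identity,
      and null-homotopic otherwise; in particular degree 2 + 2 = 4 carries only null-homotopic
      morphisms.\<close>
    have bb: "?c (m + n) (a \<cdot>\<^sub>m (b m * b n)) = ?c (m + n) ((if m = 0 \<or> n = 0 then a else 0) \<cdot>\<^sub>m b (m + n))" for a
    proof -
      consider "m = 0" | "n = 0" | "m \<noteq> 0" "n \<noteq> 0" by blast
      then show ?thesis
      proof cases
        case 1 then show ?thesis using bc[of n] by (simp add: b_def)
      next
        case 2 then show ?thesis using bc[of m] by (simp add: b_def)
      next
        case 3
        have z: "0 \<cdot>\<^sub>m b (m + n) = ?O" using bc[of "m + n"] by (intro eq_matI) auto
        have "a \<cdot>\<^sub>m (b m * b n) \<in> ?N (m + n)"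
        proof (cases "m + n = 0 \<or> m + n = 2")
          case True
          then have "m \<noteq> 2 \<or> n \<noteq> 2" by auto
          then have "b m = ?O \<or> b n = ?O" using 3 by (auto simp: b_def)
          then have "a \<cdot>\<^sub>m (b m * b n) = ?O" using bc[of m] bc[of n] by (auto intro!: eq_matI)
          then show ?thesis using ncl(4) by simp
        next
          case False then show ?thesis using ex0[OF cl(3)[OF \<open>b m * b n \<in> ?Z (m + n)\<close>]] by auto
        qed
        moreover have "a \<cdot>\<^sub>m (b m * b n) - ?O = a \<cdot>\<^sub>m (b m * b n)"
          using bc[of m] bc[of n] by (intro minus_zero_mat') auto
        ultimately show ?thesis using 3 z hclass_eq[OF x x cl(3)[OF \<open>b m * b n \<in> ?Z (m + n)\<close>] cl(4)] by simp
      qed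
    qed
    have "\<phi> (m + n) (?c (m + n) (f * g)) = Polynomial.smult (if m = 0 \<or> n = 0 then c * d else 0) (e (m + n))"
      unfolding fg bb phi ..
    also have "\<dots> = (Polynomial.smult c (e m) * Polynomial.smult d (e n)) mod [:0, 0, 1:]"
    proof -
      have m1: "[:a:] mod [:0, 0, 1:] = [:a:]" "[:0, a:] mod [:0, 0, 1:] = [:0, a:]" for a :: 'k
        by (simp_all add: mod_poly_less)
      have "[:0, 0, a:] = [:0, 0, 1:] * [:a:]" for a :: 'k by simp
      then have m2: "[:0, 0, a:] mod [:0, 0, 1:] = 0" for a :: 'k by (metis mod_mult_self1_is_0)
      show ?thesis using m1[of "c * d"] m2[of "c * d"] by (auto simp: e_def mult.commute)
    qed
    finally show "\<phi> (m + n) (?c (m + n) (f * g)) = (\<phi> m (?c m f) * \<phi> n (?c n g)) mod [:0, 0, 1:]"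
      unfolding c d phi .
  next
    have "?I = 1 \<cdot>\<^sub>m b 0" by (simp add: b_def)
    then show "\<phi> 0 (?c 0 ?I) = 1" using phi[of 0 1] by (simp add: e_def)
  qed
qed

section \<open>Block matrices, cones and the category\<close>

definition join :: "nat \<Rightarrow> 'k::field U \<Rightarrow> 'k U \<Rightarrow> 'k U" where
  "join m a b = Abs_fps (\<lambda>i. if i < m then fps_nth a i else fps_nth b (i - m))"
definition sl :: "nat \<Rightarrow> 'k::field U \<Rightarrow> 'k U" where "sl m x = Abs_fps (\<lambda>i. if i < m then fps_nth x i else 0)"
definition sr :: "nat \<Rightarrow> 'k::field U \<Rightarrow> 'k U" where "sr m x = Abs_fps (\<lambda>i. fps_nth x (i + m))"

lemma sl_nth [simp]: "fps_nth (sl m x) i = (if i < m then fps_nth x i else 0)"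
  and sr_nth [simp]: "fps_nth (sr m x) i = fps_nth x (i + m)"
  and join_nth [simp]: "fps_nth (join m a b) i = (if i < m then fps_nth a i else fps_nth b (i - m))"
  by (simp_all add: sl_def sr_def join_def)

lemma join_sl_sr [simp]: "join m (sl m x) (sr m x) = x"
  by (simp add: fps_eq_iff)

lemma sl_join [simp]: "sl m (join m a b) = sl m a" and sr_join [simp]: "sr m (join m a b) = b"
  by (simp_all add: fps_eq_iff)

lemma lin_sl: "lin (sl m)" and lin_sr: "lin (sr m)"
  by (auto simp: lin_def fps_eq_iff)

lemma matop_four_block:
  assumes "A1 \<in> carrier_mat r1 c1" "B1 \<in> carrier_mat r1 c2" "C1 \<in> carrier_mat r2 c1" "D1 \<in> carrier_mat r2 c2"
  shows "matop (four_block_mat A1 B1 C1 D1) x = join r1 (matop A1 (sl c1 x) + matop B1 (sr c1 x)) (matop C1 (sl c1 x) + matop D1 (sr c1 x))"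
proof (rule fps_ext)
  fix i
  have s: "(\<Sum>j<c1 + c2. g j) = (\<Sum>j<c1. g j) + (\<Sum>j<c2. g (c1 + j))" for g :: "nat \<Rightarrow> 'a"
    by (induction c2) (simp_all add: add.assoc)
  show "fps_nth (matop (four_block_mat A1 B1 C1 D1) x) i =
     fps_nth (join r1 (matop A1 (sl c1 x) + matop B1 (sr c1 x)) (matop C1 (sl c1 x) + matop D1 (sr c1 x))) i"
    using assms by (auto simp: matop_nth s add.commute)
qed

lemma hsup_append: "hsup (ds @ es) n x \<longleftrightarrow> hsup ds n (sl (length ds) x) \<and> hsup es n (sr (length ds) x)"
proof
  assume h: "hsup (ds @ es) n x"
  have "hsup es n (sr (length ds) x)" unfolding hsup_def
  proof (intro allI impI)
    fix j assume "fps_nth (sr (length ds) x) j \<noteq> 0"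
    then show "j < length es \<and> es ! j = n" using h[unfolded hsup_def, rule_format, of "j + length ds"] by (simp add: nth_append)
  qed
  moreover have "hsup ds n (sl (length ds) x)" using h by (auto simp: hsup_def nth_append split: if_splits)
  ultimately show "hsup ds n (sl (length ds) x) \<and> hsup es n (sr (length ds) x)" by blast
next
  assume h: "hsup ds n (sl (length ds) x) \<and> hsup es n (sr (length ds) x)"
  show "hsup (ds @ es) n x" unfolding hsup_def
  proof (intro allI impI)
    fix j assume j: "fps_nth x j \<noteq> 0"
    show "j < length (ds @ es) \<and> (ds @ es) ! j = n"
    proof (cases "j < length ds")
      case True then show ?thesis using h j by (auto simp: hsup_def nth_append)
    next
      case False
      then have "fps_nth (sr (length ds) x) (j - length ds) \<noteq> 0" using j by simp
      then have "j - length ds < length es \<and> es ! (j - length ds) = n" using h unfolding hsup_def by blast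
      then show ?thesis using False by (auto simp: nth_append)
    qed
  qed
qed

lemma homogeneous_four_block:
  assumes "A1 \<in> homogeneous k ds es" "B1 \<in> homogeneous k ds' es" "C1 \<in> homogeneous k ds es'" "D1 \<in> homogeneous k ds' es'"
  shows "four_block_mat A1 B1 C1 D1 \<in> homogeneous k (ds @ ds') (es @ es')"
  using assms by (auto simp: homogeneous_def nth_append split: if_splits)

lemma homogeneous_0: "0\<^sub>m (length es) (length ds) \<in> homogeneous k ds es"
  by (auto simp: homogeneous_def)

lemma dg_module_mcone: assumes M: "dg_module M" and N: "dg_module N" and f: "f \<in> dg_hom M N"
  shows "dg_module (mcone M N f)"
proof -
  define S where "S = shift 1 M"
  have S: "dg_module S" unfolding S_def by (rule dg_module_shift[OF M])
  note FS = dgm_facts(1-4)[OF S] and FN = dgm_facts(1-4)[OF N]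
  have f': "f \<in> dg_hom M (shift 0 N)" using f by (simp add: shift_0)
  have fc: "f \<in> carrier_mat (mdim N) (mdim S)" using dg_hom_carrier[OF M N f'] by (simp add: S_def)
  have fh: "f \<in> homogeneous 1 (degs S) (degs N)" using f by (simp add: S_def dg_hom_def homogeneous_shift)
  have fa: "f * act S p = sgn_pow (int (len p)) \<cdot>\<^sub>m (act N p * f)" for p
  proof -
    have "f * act S p = sgn_pow (int (len p)) \<cdot>\<^sub>m (f * act M p)"
      using dg_hom_carrier[OF M N f'] dgm_facts(3)[OF M, of p] by (simp add: S_def mult_smult_distrib)
    then show ?thesis using f by (simp add: dg_hom_def)
  qed
  \<comment> \<open>Through the sign of the shifted differential, \<open>f\<close> anticommutes with
    the differentials; this is the off-diagonal block of the square in the cone.\<close>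
  have fd: "f * diff S + diff N * f = 0\<^sub>m (mdim N) (mdim S)"
  proof -
    have "f * diff S = (-1) \<cdot>\<^sub>m (diff N * f)"
      using f dg_hom_carrier[OF M N f'] dgm_facts(4)[OF M] by (simp add: S_def mult_smult_distrib dg_hom_def)
    then show ?thesis using FN(4) fc by (intro eq_matI) auto
  qed
  have K: "mcone M N f = \<lparr>degs = degs S @ degs N, act = (\<lambda>p. four_block_mat (act S p) (0\<^sub>m (mdim S) (mdim N)) (0\<^sub>m (mdim N) (mdim S)) (act N p)),
     diff = four_block_mat (diff S) (0\<^sub>m (mdim S) (mdim N)) f (diff N)\<rparr>"
    unfolding mcone_def dsum_def by (simp add: S_def)
  note z = zero_carrier_mat[of "mdim S" "mdim N"] zero_carrier_mat[of "mdim N" "mdim S"]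
  note mm = mult_four_block_mat[OF FS(3) z(1) z(2) FN(3) FS(3) z(1) z(2) FN(3)]
    mult_four_block_mat[OF FS(4) z(1) fc FN(4) FS(4) z(1) fc FN(4)]
    mult_four_block_mat[OF FS(4) z(1) fc FN(4) FS(3) z(1) z(2) FN(3)]
    mult_four_block_mat[OF FS(3) z(1) z(2) FN(3) FS(4) z(1) fc FN(4)]
  have fb0: "four_block_mat (0\<^sub>m a b) (0\<^sub>m a d) (0\<^sub>m c b) (0\<^sub>m c d) = 0\<^sub>m (a + c) (b + d)" for a b c d :: nat
    by (intro eq_matI) auto
  show ?thesis unfolding dg_module_def K dgmod.select_convs length_append
  proof (intro conjI allI)
    fix p q
    show "four_block_mat (act S p) (0\<^sub>m (mdim S) (mdim N)) (0\<^sub>m (mdim N) (mdim S)) (act N p) \<in> homogeneous (int (len p)) (degs S @ degs N) (degs S @ degs N)"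
      by (intro homogeneous_four_block FS(1) FN(1) homogeneous_0)
    show "four_block_mat (act S p) (0\<^sub>m (mdim S) (mdim N)) (0\<^sub>m (mdim N) (mdim S)) (act N p) *
       four_block_mat (act S q) (0\<^sub>m (mdim S) (mdim N)) (0\<^sub>m (mdim N) (mdim S)) (act N q) =
       (case pmul p q of None \<Rightarrow> 0\<^sub>m (mdim S + mdim N) (mdim S + mdim N) | Some r \<Rightarrow> four_block_mat (act S r) (0\<^sub>m (mdim S) (mdim N)) (0\<^sub>m (mdim N) (mdim S)) (act N r))"
    proof -
      have "act S p * act S q = (case pmul p q of Some r \<Rightarrow> act S r | None \<Rightarrow> 0\<^sub>m (mdim S) (mdim S))"
        "act N p * act N q = (case pmul p q of Some r \<Rightarrow> act N r | None \<Rightarrow> 0\<^sub>m (mdim N) (mdim N))"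
        using S N by (auto simp: dg_module_def)
      moreover have "act S p * 0\<^sub>m (mdim S) (mdim N) = 0\<^sub>m (mdim S) (mdim N)" "0\<^sub>m (mdim N) (mdim S) * act S q = 0\<^sub>m (mdim N) (mdim S)"
        "act N p * 0\<^sub>m (mdim N) (mdim S) = 0\<^sub>m (mdim N) (mdim S)" "0\<^sub>m (mdim S) (mdim N) * act N q = 0\<^sub>m (mdim S) (mdim N)" for p q
        using FS(3)[of p] FS(3)[of q] FN(3)[of p] FN(3)[of q] by auto
      ultimately show ?thesis unfolding mm using FS(3) FN(3) by (auto simp: fb0 split: option.splits)
    qed
    show "four_block_mat (act S (Triv V1)) (0\<^sub>m (mdim S) (mdim N)) (0\<^sub>m (mdim N) (mdim S)) (act N (Triv V1)) +
       four_block_mat (act S (Triv V2)) (0\<^sub>m (mdim S) (mdim N)) (0\<^sub>m (mdim N) (mdim S)) (act N (Triv V2)) = 1\<^sub>m (mdim S + mdim N)"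
    proof -
      have "act S (Triv V1) + act S (Triv V2) = 1\<^sub>m (mdim S)" "act N (Triv V1) + act N (Triv V2) = 1\<^sub>m (mdim N)"
        using S N by (auto simp: dg_module_def)
      then show ?thesis by (simp add: add_four_block_mat[OF FS(3) z(1) z(2) FN(3) FS(3) z(1) z(2) FN(3)] four_block_one_mat)
    qed
    show "four_block_mat (diff S) (0\<^sub>m (mdim S) (mdim N)) f (diff N) \<in> homogeneous 1 (degs S @ degs N) (degs S @ degs N)"
      by (intro homogeneous_four_block FS(2) FN(2) homogeneous_0 fh)
    show "four_block_mat (diff S) (0\<^sub>m (mdim S) (mdim N)) f (diff N) * four_block_mat (diff S) (0\<^sub>m (mdim S) (mdim N)) f (diff N) = 0\<^sub>m (mdim S + mdim N) (mdim S + mdim N)"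
    proof -
      have "diff S * diff S = 0\<^sub>m (mdim S) (mdim S)" "diff N * diff N = 0\<^sub>m (mdim N) (mdim N)" using S N by (auto simp: dg_module_def)
      then show ?thesis unfolding mm using fd FS(4) FN(4) fc by (simp add: fb0 left_add_zero_mat right_add_zero_mat)
    qed
    show "four_block_mat (diff S) (0\<^sub>m (mdim S) (mdim N)) f (diff N) * four_block_mat (act S p) (0\<^sub>m (mdim S) (mdim N)) (0\<^sub>m (mdim N) (mdim S)) (act N p) =
      sgn_pow (int (len p)) \<cdot>\<^sub>m (four_block_mat (act S p) (0\<^sub>m (mdim S) (mdim N)) (0\<^sub>m (mdim N) (mdim S)) (act N p) * four_block_mat (diff S) (0\<^sub>m (mdim S) (mdim N)) f (diff N))"
    proof -
      have a: "diff S * act S p = sgn_pow (int (len p)) \<cdot>\<^sub>m (act S p * diff S)" "diff N * act N p = sgn_pow (int (len p)) \<cdot>\<^sub>m (act N p * diff N)"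
        using S N by (auto simp: dg_module_def)
      have c: "act S p * diff S \<in> carrier_mat (mdim S) (mdim S)" "act N p * diff N \<in> carrier_mat (mdim N) (mdim N)" "act N p * f \<in> carrier_mat (mdim N) (mdim S)"
        using FS(3,4) FN(3,4) fc by (auto intro!: mult_carrier_mat)
      show ?thesis unfolding mm using a fa c FS(3)[of p] FS(4) FN(3)[of p] FN(4) fc
        by (intro eq_matI) auto
    qed
  qed
qed

section \<open>The modules \<open>P_v\<close> in the coordinates idempotent, arrow, loop\<close>

definition t3 :: "'k::field \<Rightarrow> 'k \<Rightarrow> 'k \<Rightarrow> 'k U" where
  "t3 a b c = Abs_fps (\<lambda>i. if i = 0 then a else if i = 1 then b else if i = 2 then c else 0)"

lemma t3_nth [simp]: "fps_nth (t3 a b c) i = (if i = 0 then a else if i = 1 then b else if i = 2 then c else 0)"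
  by (simp add: t3_def)

lemma less3: "i < (3::nat) \<longleftrightarrow> i = 0 \<or> i = 1 \<or> i = 2" by auto

lemma Pmod_simps: "degs (Pmod v) = [0, 1, 2]" "diff (Pmod v) = 0\<^sub>m 3 3"
  "act (Pmod v) p = mat 3 3 (\<lambda>(i, j). if pmul p ([Triv v, Arrow v, Loop v] ! j) = Some ([Triv v, Arrow v, Loop v] ! i) then 1 else 0)"
  by (simp_all add: Pmod_def Let_def)

lemma sum3: "(\<Sum>j<3. g j) = g 0 + g 1 + g (2 :: nat)" for g :: "nat \<Rightarrow> 'a::comm_monoid_add"
  by (simp add: eval_nat_numeral add.assoc)

lemma Pmod_matop:
  "matop (act (Pmod u) (Triv w)) x = (if w = u then t3 (fps_nth x 0) 0 (fps_nth x 2) else t3 0 (fps_nth x 1) 0)"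
  "matop (act (Pmod u) (Arrow w)) x = (if w = u then t3 0 (fps_nth x 0) 0 else t3 0 0 (fps_nth x 1))"
  "matop (act (Pmod u) (Loop w)) x = (if w = u then t3 0 0 (fps_nth x 0) else 0)"
  by (cases u; cases w; auto simp: fps_eq_iff matop_nth Pmod_simps less3 sum3)+

lemma t3_eq [simp]: "t3 a b c = t3 a' b' c' \<longleftrightarrow> a = a' \<and> b = b' \<and> c = c'"
proof
  assume "t3 a b c = t3 a' b' c'"
  then have "fps_nth (t3 a b c) i = fps_nth (t3 a' b' c') i" for i by simp
  from this[of 0] this[of 1] this[of 2] show "a = a' \<and> b = b' \<and> c = c'" by simp
qed simp

lemma t3_0 [simp]: "t3 0 0 0 = 0" by (simp add: fps_eq_iff)

lemma all_vertices: "(\<forall>v. P v) \<longleftrightarrow> P V1 \<and> P V2"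
  by (metis vertex.exhaust)

lemma all_qpath: "(\<forall>p. P p) \<longleftrightarrow> (\<forall>v. P (Triv v)) \<and> (\<forall>v. P (Arrow v)) \<and> (\<forall>v. P (Loop v))"
  by (metis qpath.exhaust)

text \<open>With the action in closed form, associativity of the action becomes a finite check over
  pairs of paths.\<close>

lemma Pmod_matop_matop:
  "matop (act (Pmod v) p) (matop (act (Pmod v) q) x) = (case pmul p q of Some r \<Rightarrow> matop (act (Pmod v) r) x | None \<Rightarrow> 0)"
proof -
  have "\<forall>p q. \<forall>v. matop (act (Pmod v) p) (matop (act (Pmod v) q) x) = (case pmul p q of Some r \<Rightarrow> matop (act (Pmod v) r) x | None \<Rightarrow> 0)"
    unfolding all_qpath all_vertices by (simp add: Pmod_matop)
  then show ?thesis by blast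
qed

lemma dg_module_Pmod: "dg_module (Pmod v :: 'k::field dgmod)"
proof -
  have c: "act (Pmod v) p \<in> carrier_mat 3 3" for p by (simp add: Pmod_simps)
  have c': "dim_row (act (Pmod v) p) = 3" "dim_col (act (Pmod v) p) = 3" for p using c[of p] by auto
  have m: "mdim (Pmod v) = 3" by (simp add: Pmod_simps)
  show ?thesis unfolding dg_module_def m
  proof (intro conjI allI)
    fix p q
    show "act (Pmod v :: 'k dgmod) p \<in> homogeneous (int (len p)) (degs (Pmod v :: 'k dgmod)) (degs (Pmod v :: 'k dgmod))"
      by (cases p; cases v) (auto simp: homogeneous_def Pmod_simps less_Suc_eq eval_nat_numeral split: if_splits)
    show "act (Pmod v) p * act (Pmod v) q = (case pmul p q of Some r \<Rightarrow> act (Pmod v) r | None \<Rightarrow> (0\<^sub>m 3 3 :: 'k mat))"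
    proof (rule matop_eqI)
      show "act (Pmod v) p * act (Pmod v) q \<in> carrier_mat 3 3" using c by (rule mult_carrier_mat[OF c])
      show "(case pmul p q of Some r \<Rightarrow> act (Pmod v) r | None \<Rightarrow> (0\<^sub>m 3 3 :: 'k mat)) \<in> carrier_mat 3 3"
        using c by (auto split: option.splits)
      fix j
      show "matop (act (Pmod v) p * act (Pmod v) q) (unit j) = matop (case pmul p q of Some r \<Rightarrow> act (Pmod v) r | None \<Rightarrow> (0\<^sub>m 3 3 :: 'k mat)) (unit j)"
        by (simp add: matop_mult c' Pmod_matop_matop split: option.splits)
    qed
    show "act (Pmod v) (Triv V1) + act (Pmod v) (Triv V2) = (1\<^sub>m 3 :: 'k mat)"
    proof (rule matop_eqI)
      show "act (Pmod v) (Triv V1) + act (Pmod v) (Triv V2) \<in> (carrier_mat 3 3 :: 'k mat set)" by (rule add_carrier_mat[OF c])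
      fix j :: nat assume "j < 3"
      have "matop (act (Pmod v) (Triv V1) + act (Pmod v) (Triv V2)) x = matop (act (Pmod v) (Triv V1)) x + matop (act (Pmod v) (Triv V2)) x" for x :: "'k U"
        by (rule matop_add[OF c c])
      then show "matop (act (Pmod v) (Triv V1) + act (Pmod v) (Triv V2)) (unit j) = matop (1\<^sub>m 3) (unit j :: 'k U)"
        using \<open>j < 3\<close> by (cases v) (auto simp: matop_one Pmod_matop fps_eq_iff less3)
    qed simp
    show "diff (Pmod v :: 'k dgmod) \<in> homogeneous 1 (degs (Pmod v :: 'k dgmod)) (degs (Pmod v :: 'k dgmod))"
      by (simp add: Pmod_simps homogeneous_def eval_nat_numeral)
    show "diff (Pmod v) * diff (Pmod v) = (0\<^sub>m 3 3 :: 'k mat)" by (simp add: Pmod_simps)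
    show "diff (Pmod v :: 'k dgmod) * act (Pmod v) p = sgn_pow (int (len p)) \<cdot>\<^sub>m (act (Pmod v) p * diff (Pmod v))"
      unfolding Pmod_simps(2) left_mult_zero_mat[OF c] right_mult_zero_mat[OF c] by (intro eq_matI) auto
  qed
qed

lemma Cat_dg_module: "x \<in> Cat \<Longrightarrow> dg_module x"
  by (induction rule: Cat.induct) (auto simp: dg_module_Pmod dg_module_shift dg_module_mcone)

section \<open>Morphisms out of the indecomposable projectives\<close>

lemma V_Pmod:
  "V (dgfam (Pmod u :: 'k::field dgmod)) n u = {t3 a 0 b | a b. (a \<noteq> 0 \<longrightarrow> n = 0) \<and> (b \<noteq> 0 \<longrightarrow> n = 2)}"
  "V (dgfam (Pmod u :: 'k::field dgmod)) n (opp u) = {t3 0 a 0 | a. a \<noteq> 0 \<longrightarrow> n = 1}"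
proof -
  have h: "hsup [0, 1, 2] n (t3 a b c) \<longleftrightarrow> (a \<noteq> 0 \<longrightarrow> n = 0) \<and> (b \<noteq> 0 \<longrightarrow> n = 1) \<and> (c \<noteq> 0 \<longrightarrow> n = 2)" for a b c :: 'k
  proof
    assume x: "hsup [0, 1, 2] n (t3 a b c)"
    from x[unfolded hsup_def, rule_format, of 0] x[unfolded hsup_def, rule_format, of 1] x[unfolded hsup_def, rule_format, of 2]
    show "(a \<noteq> 0 \<longrightarrow> n = 0) \<and> (b \<noteq> 0 \<longrightarrow> n = 1) \<and> (c \<noteq> 0 \<longrightarrow> n = 2)" by auto
  qed (auto simp: hsup_def split: if_splits)
  show "V (dgfam (Pmod u :: 'k::field dgmod)) n u = {t3 a 0 b | a b. (a \<noteq> 0 \<longrightarrow> n = 0) \<and> (b \<noteq> 0 \<longrightarrow> n = 2)}"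
  proof (rule equalityI; rule subsetI)
    fix x assume "x \<in> V (dgfam (Pmod u :: 'k::field dgmod)) n u"
    then have "hsup [0, 1, 2] n x" "t3 (fps_nth x 0) 0 (fps_nth x 2) = x" by (auto simp: Pmod_matop Pmod_simps(1))
    then show "x \<in> {t3 a 0 b | a b. (a \<noteq> 0 \<longrightarrow> n = 0) \<and> (b \<noteq> 0 \<longrightarrow> n = 2)}"
      using h[of "fps_nth x 0" 0 "fps_nth x 2"] by (intro CollectI exI[of _ "fps_nth x 0"] exI[of _ "fps_nth x 2"]) simp
  next
    fix x :: "'k U" assume "x \<in> {t3 a 0 b | a b. (a \<noteq> 0 \<longrightarrow> n = 0) \<and> (b \<noteq> 0 \<longrightarrow> n = 2)}"
    then show "x \<in> V (dgfam (Pmod u :: 'k::field dgmod)) n u" using h by (fastforce simp: Pmod_matop Pmod_simps(1))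
  qed
  show "V (dgfam (Pmod u :: 'k::field dgmod)) n (opp u) = {t3 0 a 0 | a. a \<noteq> 0 \<longrightarrow> n = 1}"
  proof (rule equalityI; rule subsetI)
    fix x assume "x \<in> V (dgfam (Pmod u :: 'k::field dgmod)) n (opp u)"
    then have "hsup [0, 1, 2] n x" "t3 0 (fps_nth x 1) 0 = x" by (auto simp: Pmod_matop Pmod_simps(1))
    then show "x \<in> {t3 0 a 0 | a. a \<noteq> 0 \<longrightarrow> n = 1}"
      using h[of 0 "fps_nth x 1" 0] by (intro CollectI exI[of _ "fps_nth x 1"]) simp
  next
    fix x :: "'k U" assume "x \<in> {t3 0 a 0 | a. a \<noteq> 0 \<longrightarrow> n = 1}"
    then show "x \<in> V (dgfam (Pmod u :: 'k::field dgmod)) n (opp u)" using h by (fastforce simp: Pmod_matop Pmod_simps(1))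
  qed
qed

lemma Pmod_AD [simp]: "A (dgfam (Pmod u)) u x = t3 0 (fps_nth x 0) 0" "A (dgfam (Pmod u)) (opp u) x = t3 0 0 (fps_nth x 1)"
   "D (dgfam (Pmod u)) n w x = 0"
  by (simp_all add: Pmod_matop Pmod_simps(2))

text \<open>The morphism of degree \<open>m\<close> that sends the idempotent to \<open>x\<close>.
  Passing an arrow costs \<open>(-1)^m\<close>, passing a loop costs nothing.\<close>

definition pev :: "vertex \<Rightarrow> int \<Rightarrow> 'k::field kmod \<Rightarrow> 'k U \<Rightarrow> 'k fam" where
  "pev u m M x = (\<lambda>n w v. if w = u then fps_nth v 0 \<star> x + fps_nth v 2 \<star> AA u M x else fps_nth v 1 \<star> sgn_pow m \<star> A M u x)"

lemma pev_simps [simp]: "pev u m M x n u v = fps_nth v 0 \<star> x + fps_nth v 2 \<star> AA u M x"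
  "pev u m M x n (opp u) v = fps_nth v 1 \<star> sgn_pow m \<star> A M u x"
  by (simp_all add: pev_def)

lemma t3_split: "t3 a 0 b = a \<star> unit 0 + b \<star> unit 2" "t3 0 c 0 = c \<star> unit 1"
  by (auto simp: fps_eq_iff)

text \<open>\<open>P_u\<close> is generated by its idempotent, so a morphism is determined by its
  value there.\<close>

lemma hom_pev: assumes M: "kmod (M :: 'k::field kmod)" and F: "F \<in> hom m (dgfam (Pmod u)) M" and v: "v \<in> V (dgfam (Pmod u)) n w"
  shows "F n w v = pev u m M (F 0 u (unit 0)) n w v" "F 0 u (unit 0) \<in> V M m u"
proof -
  note l = lin_simps[OF homD(1)[OF F]]
  have u0: "unit 0 \<in> V (dgfam (Pmod u)) 0 u" unfolding V_Pmod by (auto simp: fps_eq_iff intro!: exI[of _ 1] exI[of _ 0])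
  have u1: "unit 1 \<in> V (dgfam (Pmod u)) 1 (opp u)" unfolding V_Pmod by (auto simp: fps_eq_iff intro!: exI[of _ 1])
  have e: "t3 0 1 0 = unit 1" "t3 0 0 1 = unit 2" by (auto simp: fps_eq_iff)
  show "F 0 u (unit 0) \<in> V M m u" using homD(2)[OF F u0] by simp
  have a: "F 1 (opp u) (unit (Suc 0)) = sgn_pow m \<star> A M u (F 0 u (unit 0))" using homD(3)[OF F u0] by (simp add: e del: dgfam_simps)
  have b: "F 2 u (unit 2) = AA u M (F 0 u (unit 0))"
    using homD'[OF F u1] a by (simp add: e lin_simps[OF kmod_linA[OF M]] del: dgfam_simps)
  consider "w = u" | "w = opp u" using vertex_cases by blast
  then show "F n w v = pev u m M (F 0 u (unit 0)) n w v"
  proof cases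
    case 1
    then obtain c d where v': "v = t3 c 0 d" "c \<noteq> 0 \<longrightarrow> n = 0" "d \<noteq> 0 \<longrightarrow> n = 2" using v V_Pmod(1) by blast
    have "F n u (t3 c 0 d) = c \<star> F n u (unit 0) + d \<star> F n u (unit 2)" unfolding t3_split by (simp add: l)
    \<comment> \<open>A nonzero coefficient determines the degree \<open>n\<close>, so the family
      may be evaluated in degree 0 or 2.\<close>
    also have "\<dots> = c \<star> F 0 u (unit 0) + d \<star> F 2 u (unit 2)" using v'(2,3) by (cases "c = 0"; cases "d = 0") auto
    finally show ?thesis unfolding v' 1 by (simp add: b)
  next
    case 2
    then obtain c where v': "v = t3 0 c 0" "c \<noteq> 0 \<longrightarrow> n = 1" using v V_Pmod(2) by blast
    have "F n (opp u) (t3 0 c 0) = c \<star> F n (opp u) (unit 1)" unfolding t3_split by (simp add: l)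
    also have "\<dots> = c \<star> F 1 (opp u) (unit 1)" using v'(2) by (cases "c = 0") auto
    finally show ?thesis unfolding v' 2 using a by simp
  qed
qed

lemma pev_hom: assumes M: "kmod (M :: 'k::field kmod)" and x: "x \<in> V M m u" shows "pev u m M x \<in> hom m (dgfam (Pmod u)) M"
proof (rule homI2[where u=u])
  note cl = sub_closed[OF kmod_sub[OF M]]
  note l = lin_simps[OF kmod_linA[OF M]]
  fix n
  show "lin (pev u m M x n u)" "lin (pev u m M x n (opp u))"
    by (auto simp: lin_def sc_add_left sc_add algebra_simps)
  fix v :: "'k U"
  {
    assume "v \<in> V (dgfam (Pmod u)) n u"
    then obtain c d where v: "v = t3 c 0 d" "c \<noteq> 0 \<longrightarrow> n = 0" "d \<noteq> 0 \<longrightarrow> n = 2" unfolding V_Pmod by blast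
    have c: "c \<star> x \<in> V M (n + m) u" using v(2) x by (cases "c = 0") (auto simp: cl)
    have d: "d \<star> AA u M x \<in> V M (n + m) u" using v(3) kmod_AA[OF M x] by (cases "d = 0") (auto simp: cl add.commute)
    show "pev u m M x n u v \<in> V M (n + m) u" unfolding v using c d by (simp add: cl)
    show "pev u m M x (n + 1) (opp u) (A (dgfam (Pmod u)) u v) = sgn_pow m \<star> A M u (pev u m M x n u v)"
      unfolding v using kmod_AAA[OF M x] by (simp add: l mult.commute del: dgfam_simps)
  next
    assume "v \<in> V (dgfam (Pmod u)) n (opp u)"
    then obtain c where v: "v = t3 0 c 0" "c \<noteq> 0 \<longrightarrow> n = 1" unfolding V_Pmod by blast
    show "pev u m M x n (opp u) v \<in> V M (n + m) (opp u)"
      unfolding v using v(2) kmod_A[OF M x] by (cases "c = 0") (auto simp: cl add.commute)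
    show "pev u m M x (n + 1) u (A (dgfam (Pmod u)) (opp u) v) = sgn_pow m \<star> A M (opp u) (pev u m M x n (opp u) v)"
      unfolding v by (simp add: l mult.commute mult.left_commute del: dgfam_simps)
  }
qed

definition ker :: "'k::field kmod \<Rightarrow> int \<Rightarrow> vertex \<Rightarrow> 'k U set" where
  "ker M n u = {x \<in> V M n u. D M n u x = 0}"
definition im :: "'k::field kmod \<Rightarrow> int \<Rightarrow> vertex \<Rightarrow> 'k U set" where
  "im M n u = D M (n - 1) u ` V M (n - 1) u"

lemma D_pev: assumes M: "kmod M" and x: "x \<in> V M m u" and v: "v \<in> V (dgfam (Pmod u)) n w"
  shows "D M (n + m) w (pev u m M x n w v) = pev u (m + 1) M (D M m u x) n w v"
proof -
  note l = lin_simps[OF kmod_linA[OF M]] lin_simps[OF kmod_linD[OF M]]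
  consider "w = u" | "w = opp u" using vertex_cases by blast
  then show ?thesis
  proof cases
    case 1
    then obtain c d where v': "v = t3 c 0 d" "c \<noteq> 0 \<longrightarrow> n = 0" "d \<noteq> 0 \<longrightarrow> n = 2" using v V_Pmod(1) by blast
    have "c \<star> D M (n + m) u x = c \<star> D M m u x" using v'(2) by (cases "c = 0") auto
    moreover have "d \<star> D M (n + m) u (AA u M x) = d \<star> AA u M (D M m u x)"
      using v'(3) kmod_DAA[OF M x] by (cases "d = 0") (auto simp: add.commute sgn_pow_def)
    ultimately show ?thesis unfolding 1 v' by (simp add: l sc_add)
  next
    case 2
    then obtain c where v': "v = t3 0 c 0" "c \<noteq> 0 \<longrightarrow> n = 1" using v V_Pmod(2) by blast
    show ?thesis unfolding 2 v' using v'(2) kmod_DA[OF M x]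
      by (cases "c = 0") (auto simp: l sgn_pow_add add.commute)
  qed
qed

lemma unit0: "unit 0 \<in> V (dgfam (Pmod u)) 0 u" unfolding V_Pmod by (auto simp: fps_eq_iff intro!: exI[of _ 1] exI[of _ 0])

lemma pev_cyc: assumes M: "kmod (M :: 'k::field kmod)" and x: "x \<in> ker M m u" shows "pev u m M x \<in> cyc m (dgfam (Pmod u)) M"
proof (rule cycI)
  have x': "x \<in> V M m u" "D M m u x = 0" using x by (auto simp: ker_def)
  note l = lin_simps[OF kmod_linA[OF M]]
  show h: "pev u m M x \<in> hom m (dgfam (Pmod u)) M" by (rule pev_hom[OF M x'(1)])
  fix n w and v :: "'k U" assume v: "v \<in> V (dgfam (Pmod u)) n w"
  have "pev u (m + 1) M 0 n w v = 0" by (simp add: pev_def l)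
  then show "pev u m M x (n + 1) w (D (dgfam (Pmod u)) n w v) = sgn_pow m \<star> D M (n + m) w (pev u m M x n w v)"
    using D_pev[OF M x'(1) v] x'(2) lin_0[OF homD(1)[OF h]] by (simp del: dgfam_simps)
qed

lemma cyc_ker: assumes M: "kmod M" and F: "F \<in> cyc m (dgfam (Pmod u)) M" shows "F 0 u (unit 0) \<in> ker M m u"
proof -
  have "sgn_pow m \<star> D M m u (F 0 u (unit 0)) = 0"
    using cycD(2)[OF F unit0] lin_0[OF homD(1)[OF cycD(1)[OF F]]] by (simp del: dgfam_simps)
  then have "sgn_pow m \<star> sgn_pow m \<star> D M m u (F 0 u (unit 0)) = sgn_pow m \<star> 0" by (rule arg_cong)
  then show ?thesis using hom_pev(2)[OF M cycD(1)[OF F] unit0] by (simp add: ker_def)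
qed

text \<open>A homotopy out of \<open>P_u\<close> is again evaluation at an element. Consequently
  morphisms of degree \<open>m\<close> up to homotopy are the cohomology of \<open>M\<close> at
  \<open>u\<close> in degree \<open>m\<close>.\<close>

lemma bdr_im: assumes M: "kmod M" and F: "F \<in> cyc m (dgfam (Pmod u)) M"
  shows "F \<in> bdr m (dgfam (Pmod u)) M \<longleftrightarrow> F 0 u (unit 0) \<in> im M m u"
proof
  assume "F \<in> bdr m (dgfam (Pmod u)) M"
  then obtain s where s: "s \<in> hom (m - 1) (dgfam (Pmod u)) M"
     "\<And>n w x. x \<in> V (dgfam (Pmod u)) n w \<Longrightarrow> F n w x = D M (n + m - 1) w (s n w x) + sgn_pow m \<star> s (n + 1) w (D (dgfam (Pmod u)) n w x)"
    by (rule bdrE) (rule that)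
  have "F 0 u (unit 0) = D M (m - 1) u (s 0 u (unit 0))"
    using s(2)[OF unit0] lin_0[OF homD(1)[OF s(1)]] by (simp del: dgfam_simps)
  then show "F 0 u (unit 0) \<in> im M m u" using hom_pev(2)[OF M s(1) unit0] by (simp add: im_def)
next
  assume "F 0 u (unit 0) \<in> im M m u"
  then obtain x where x: "x \<in> V M (m - 1) u" "F 0 u (unit 0) = D M (m - 1) u x" unfolding im_def by blast
  show "F \<in> bdr m (dgfam (Pmod u)) M"
  proof (rule bdrI[OF pev_hom[OF M x(1)]])
    fix n w and v :: "'a U" assume v: "v \<in> V (dgfam (Pmod u)) n w"
    have i: "n + m - 1 = n + (m - 1)" by simp
    show "F n w v = D M (n + m - 1) w (pev u (m - 1) M x n w v) + sgn_pow m \<star> pev u (m - 1) M x (n + 1) w (D (dgfam (Pmod u)) n w v)"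
      unfolding i using hom_pev(1)[OF M cycD(1)[OF F] v] D_pev[OF M x(1) v] x(2) lin_0[OF homD(1)[OF pev_hom[OF M x(1)]]]
      by (simp del: dgfam_simps)
  qed
qed

lemma dgfam_Pmod: "kmod (dgfam (Pmod u))" by (rule kmod_dgfam[OF dg_module_Pmod])

lemma sub_ker: "kmod M \<Longrightarrow> sub (ker M n u)"
  by (auto simp: sub_def ker_def sub_closed[OF kmod_sub] lin_simps[OF kmod_linD])

lemma sub_im: assumes M: "kmod M" shows "sub (im M n u)"
  unfolding sub_def im_def
  by (auto simp: lin_add[OF kmod_linD[OF M], symmetric] lin_sc[OF kmod_linD[OF M], symmetric] sub_closed[OF kmod_sub[OF M]]
      intro!: imageI intro: rev_image_eqI[OF sub_0[OF kmod_sub[OF M]]] simp: lin_0[OF kmod_linD[OF M]])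

lemma quot_basis_hdim: assumes M: "kmod M" and q: "quot_basis (\<star>) (ker M m u) (im M m u) b r" shows "hdim m (dgfam (Pmod u)) M r"
proof -
  note l = lin_simps[OF kmod_linA[OF M]]
  have "quot_basis fsc (cyc m (dgfam (Pmod u)) M) (bdr m (dgfam (Pmod u)) M) (\<lambda>i. pev u m M (b i)) r"
  proof (rule quot_basis_transfer[OF q])
    note k = sub_closed[OF sub_ker[OF M]]
    show "0 \<in> ker M m u" "\<And>x y. x \<in> ker M m u \<Longrightarrow> y \<in> ker M m u \<Longrightarrow> x + y \<in> ker M m u"
      "\<And>x y. x \<in> ker M m u \<Longrightarrow> y \<in> ker M m u \<Longrightarrow> x - y \<in> ker M m u" "\<And>c x. x \<in> ker M m u \<Longrightarrow> c \<star> x \<in> ker M m u"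
      by (simp_all add: k)
    show "pev u m M (x + y) = pev u m M x + pev u m M y" "pev u m M (c \<star> x) = fsc c (pev u m M x)" for x y c
      by (intro ext; simp add: pev_def l sc_add mult.commute mult.left_commute algebra_simps)+
    show "pev u m M x \<in> cyc m (dgfam (Pmod u)) M" if "x \<in> ker M m u" for x by (rule pev_cyc[OF M that])
    show "pev u m M x \<in> bdr m (dgfam (Pmod u)) M \<longleftrightarrow> x \<in> im M m u" if "x \<in> ker M m u" for x
      using bdr_im[OF M pev_cyc[OF M that]] by simp
    show "\<exists>x\<in>ker M m u. F - pev u m M x \<in> bdr m (dgfam (Pmod u)) M" if F: "F \<in> cyc m (dgfam (Pmod u)) M" for F
      by (rule bexI[OF _ cyc_ker[OF M F]], rule bdr_cong[OF bdr_0[OF M]])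
        (use hom_pev(1)[OF M cycD(1)[OF F]] in \<open>simp del: dgfam_simps\<close>)
    show "x + y \<in> bdr m (dgfam (Pmod u)) M" if "x \<in> bdr m (dgfam (Pmod u)) M" "y \<in> bdr m (dgfam (Pmod u)) M" for x y
      by (rule bdr_add[OF M that])
  qed
  then show ?thesis unfolding hdim_def by blast
qed

text \<open>The converse passage: evaluation at the idempotent inverts \<open>pev\<close> up to
  boundaries.\<close>

lemma hdim_quot_basis: assumes M: "kmod M" and q: "quot_basis fsc (cyc m (dgfam (Pmod u)) M) (bdr m (dgfam (Pmod u)) M) b r"
  shows "quot_basis (\<star>) (ker M m u) (im M m u) (\<lambda>i. b i 0 u (unit 0)) r"
proof (rule quot_basis_transfer[OF q])
  show "0 \<in> cyc m (dgfam (Pmod u)) M" "\<And>x y. x \<in> cyc m (dgfam (Pmod u)) M \<Longrightarrow> y \<in> cyc m (dgfam (Pmod u)) M \<Longrightarrow> x + y \<in> cyc m (dgfam (Pmod u)) M"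
    "\<And>x y. x \<in> cyc m (dgfam (Pmod u)) M \<Longrightarrow> y \<in> cyc m (dgfam (Pmod u)) M \<Longrightarrow> x - y \<in> cyc m (dgfam (Pmod u)) M"
    "\<And>c x. x \<in> cyc m (dgfam (Pmod u)) M \<Longrightarrow> fsc c x \<in> cyc m (dgfam (Pmod u)) M"
    using cyc_0 cyc_add cyc_diff cyc_fsc M by blast+
  show "F 0 u (unit 0) \<in> ker M m u" if "F \<in> cyc m (dgfam (Pmod u)) M" for F by (rule cyc_ker[OF M that])
  show "F 0 u (unit 0) \<in> im M m u \<longleftrightarrow> F \<in> bdr m (dgfam (Pmod u)) M" if "F \<in> cyc m (dgfam (Pmod u)) M" for F
    using bdr_im[OF M that] by simp
  show "\<exists>F\<in>cyc m (dgfam (Pmod u)) M. x - F 0 u (unit 0) \<in> im M m u" if x: "x \<in> ker M m u" for x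
    by (rule bexI[OF _ pev_cyc[OF M x]]) (simp add: sub_0[OF sub_im[OF M]])
  show "x + y \<in> im M m u" if "x \<in> im M m u" "y \<in> im M m u" for x y by (rule sub_add[OF sub_im[OF M] that])
qed simp_all

section \<open>The spherical twist in \<open>P_u\<close> agrees with the twist functor\<close>

text \<open>\<open>hom_basis\<close> speaks of one degree at a time by filtering the list. The
  bijection returns to positions in the full list, which index the summands of
  \<open>ev_source\<close>.\<close>

lemma filter_bij: "\<exists>g. bij_betw g {..<length (filter P xs)} {i. i < length xs \<and> P (xs ! i)} \<and>
   (\<forall>k < length (filter P xs). filter P xs ! k = xs ! g k)"
proof (induction xs rule: rev_induct)
  case (snoc x xs)
  then obtain g where g: "bij_betw g {..<length (filter P xs)} {i. i < length xs \<and> P (xs ! i)}"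
    "\<And>k. k < length (filter P xs) \<Longrightarrow> filter P xs ! k = xs ! g k" by blast
  have gl: "k < length (filter P xs) \<Longrightarrow> g k < length xs" for k using bij_betwE[OF g(1)] by auto
  show ?case
  proof (cases "P x")
    case True
    let ?r = "length (filter P xs)"
    have S: "{i. i < length (xs @ [x]) \<and> P ((xs @ [x]) ! i)} = insert (length xs) {i. i < length xs \<and> P (xs ! i)}"
      using True by (auto simp: nth_append less_Suc_eq)
    have "bij_betw (g(?r := length xs)) (insert ?r {..<?r}) (insert (length xs) {i. i < length xs \<and> P (xs ! i)})"
    proof (rule bij_betw_combine[of _ "{?r}" "{length xs}", simplified])
      show "bij_betw (g(?r := length xs)) {..<?r} {i. i < length xs \<and> P (xs ! i)}"
        using g(1) by (rule bij_betw_cong[THEN iffD1, rotated]) auto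
    qed auto
    moreover have e: "{..<length (filter P (xs @ [x]))} = insert ?r {..<?r}" using True by auto
    moreover have "\<forall>k<length (filter P (xs @ [x])). filter P (xs @ [x]) ! k = (xs @ [x]) ! (g(?r := length xs)) k"
      using True g(2) gl by (auto simp: nth_append less_Suc_eq)
    ultimately show ?thesis unfolding S e by (intro exI[of _ "g(?r := length xs)"] conjI)
  next
    case False
    then have S: "{i. i < length (xs @ [x]) \<and> P ((xs @ [x]) ! i)} = {i. i < length xs \<and> P (xs ! i)}"
      by (auto simp: nth_append less_Suc_eq)
    show ?thesis unfolding S using False g gl by (intro exI[of _ g]) (auto simp: nth_append)
  qed
qed auto

text \<open>This justifies the choice in \<open>twist\<close>. Nonzero morphisms exist only in
  degrees that are differences of degrees of basis vectors, so finitely many bases can be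
  concatenated.\<close>

lemma ex_hom_basis: assumes a: "dg_module (a :: 'k::field dgmod)" and y: "dg_module y" shows "\<exists>fs. hom_basis a y fs"
proof -
  obtain b r where br: "\<And>n. mbasis a y n (b n) (r n)" using ex_mbasis[OF a y] by metis
  define Dl where "Dl = remdups (concat (map (\<lambda>i. map (\<lambda>j. i - j) (degs a)) (degs y)))"
  have zero: "r n = 0" if n: "n \<notin> set Dl" for n
  proof (rule ccontr)
    assume rn: "r n \<noteq> 0"
    have z: "f = 0\<^sub>m (mdim y) (mdim a)" if f: "f \<in> dg_hom a (shift n y)" for f
    proof (rule eq_matI)
      fix i j assume ij: "i < dim_row (0\<^sub>m (mdim y) (mdim a) :: 'k mat)" "j < dim_col (0\<^sub>m (mdim y) (mdim a) :: 'k mat)"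
      have "f \<in> homogeneous n (degs a) (degs y)" using f by (simp add: dg_hom_shift[OF a y] glin_def)
      moreover have "degs y ! i \<noteq> degs a ! j + n"
      proof
        assume "degs y ! i = degs a ! j + n"
        then have e: "n = degs y ! i - degs a ! j" by simp
        have "degs y ! i \<in> set (degs y)" "degs a ! j \<in> set (degs a)" using ij by auto
        then have "n \<in> set Dl" unfolding Dl_def e by auto
        then show False using n by simp
      qed
      ultimately show "f $$ (i, j) = 0\<^sub>m (mdim y) (mdim a) $$ (i, j)" using ij by (auto simp: homogeneous_def)
    qed (use dg_hom_carrier[OF a y f] in auto)
    \<comment> \<open>All morphisms of this degree are zero matrices, so the combination with all
      coefficients 1 would be a relation.\<close>
    have m: "mcomb a y (\<lambda>_. 1) (b n) (r n) \<in> null_hom a (shift n y)"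
    proof -
      have "mcomb a y (\<lambda>_. 1) (b n) (r n) \<in> dg_hom a (shift n y)"
        by (rule mcomb_dg[OF a y]) (use br[of n] in \<open>auto simp: mbasis_def[OF a y]\<close>)
      from z[OF this] show ?thesis using null_closed(4)[OF a y, of n] by simp
    qed
    then have "\<forall>i<r n. (1 :: 'k) = 0" using br[of n] unfolding mbasis_def[OF a y] by blast
    then show False using rn by auto
  qed
  define fs where "fs = concat (map (\<lambda>n. map (\<lambda>i. (n, b n i)) [0..<r n]) Dl)"
  have f1: "filter (\<lambda>(m, f). m = n) (concat (map (\<lambda>n. map (\<lambda>i. (n, b n i)) [0..<r n]) ns))
      = (if n \<in> set ns then map (\<lambda>i. (n, b n i)) [0..<r n] else [])" if "distinct ns" for ns n
    using that
  proof (induction ns)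
    case (Cons m ns)
    have "filter (\<lambda>(m, f). m = n) (map (\<lambda>i. (m, b m i)) [0..<r m]) = (if m = n then map (\<lambda>i. (n, b n i)) [0..<r n] else [])"
      by (auto simp: filter_map o_def)
    then show ?case using Cons by auto
  qed simp
  have fl: "filter (\<lambda>(m, f). m = n) fs = map (\<lambda>i. (n, b n i)) [0..<r n]" for n
    using f1[of Dl n] zero[of n] unfolding fs_def Dl_def by auto
  have "hom_basis a y fs" unfolding hom_basis_def
  proof (intro conjI allI)
    show "\<forall>(n, f)\<in>set fs. f \<in> dg_hom a (shift n y)"
      using br by (auto simp: fs_def mbasis_def[OF a y])
    fix n
    have "map (\<lambda>(m, f). hclass a (shift n y) f) (filter (\<lambda>(m, f). m = n) fs) = map (\<lambda>i. hclass a (shift n y) (b n i)) [0..<r n]"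
      unfolding fl by simp
    then show "let Fs = map (\<lambda>(m, f). hclass a (shift n y) f) (filter (\<lambda>(m, f). m = n) fs) in
       distinct Fs \<and> vectorspace.basis class_ring (Hom_deg n a y) (set Fs)"
      using mbasis_basis[OF a y br[of n]] by (simp add: distinct_map atLeast0LessThan)
  qed
  then show ?thesis by blast
qed

lemma hom_basis_mbasis: assumes a: "dg_module (a :: 'k::field dgmod)" and y: "dg_module y" and h: "hom_basis a y fs"
  shows "mbasis a y n (\<lambda>i. snd (filter (\<lambda>(m, f). m = n) fs ! i)) (length (filter (\<lambda>(m, f). m = n) fs))"
proof -
  let ?L = "filter (\<lambda>(m, f). m = n) fs"
  have e: "map (\<lambda>(m, f). hclass a (shift n y) f) ?L = map (\<lambda>i. hclass a (shift n y) (snd (?L ! i))) [0..<length ?L]"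
    by (rule nth_equalityI) (auto simp: case_prod_unfold)
  have b: "distinct (map (\<lambda>i. hclass a (shift n y) (snd (?L ! i))) [0..<length ?L])"
     "vectorspace.basis class_ring (Hom_deg n a y) (set (map (\<lambda>i. hclass a (shift n y) (snd (?L ! i))) [0..<length ?L]))"
    using h unfolding hom_basis_def Let_def e[symmetric] by blast+
  show ?thesis
  proof (rule basis_mbasis[OF a y])
    fix i assume "i < length ?L"
    then have "?L ! i \<in> set ?L" by (rule nth_mem)
    then show "snd (?L ! i) \<in> dg_hom a (shift n y)" using h unfolding hom_basis_def by auto
  qed (use b in \<open>simp_all add: distinct_map atLeast0LessThan\<close>)
qed

text \<open>The coordinates of the \<open>i\<close>-th summand of \<open>ev_source\<close>, each
  copy of \<open>P_u\<close> occupying three places.\<close>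

definition blk :: "nat \<Rightarrow> 'k::field U \<Rightarrow> 'k U" where
  "blk i x = t3 (fps_nth x (3 * i)) (fps_nth x (3 * i + 1)) (fps_nth x (3 * i + 2))"

lemma blk_0: "blk 0 x = sl 3 x" by (auto simp: blk_def fps_eq_iff less3 numeral_2_eq_2)
lemma blk_Suc: "blk (Suc i) x = blk i (sr 3 x)" by (auto simp: blk_def algebra_simps)

lemma lin_blk: "lin (blk i)" by (auto simp: lin_def blk_def fps_eq_iff)

lemma ev_source_facts:
  shows "mdim (ev_source (Pmod u :: 'k::field dgmod) fs) = 3 * length fs"
    "act (ev_source (Pmod u :: 'k dgmod) fs) p \<in> carrier_mat (3 * length fs) (3 * length fs)"
    "diff (ev_source (Pmod u :: 'k dgmod) fs) = 0\<^sub>m (3 * length fs) (3 * length fs)"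
    "i < length fs \<Longrightarrow> r < 3 \<Longrightarrow> degs (ev_source (Pmod u :: 'k dgmod) fs) ! (3 * i + r) = int r + fst (fs ! i)"
    "i < length fs \<Longrightarrow> blk i (matop (act (ev_source (Pmod u) fs) p) x) = sgn_pow (fst (fs ! i) * int (len p)) \<star> matop (act (Pmod u) p) (blk i (x :: 'k U))"
proof (induction fs arbitrary: i x)
  case (Cons nf fs)
  obtain n f where nf: "nf = (n, f)" by (cases nf)
  let ?E = "ev_source (Pmod u :: 'k dgmod) fs"
  have P: "mdim (Pmod u :: 'k dgmod) = 3" "act (Pmod u :: 'k dgmod) p \<in> carrier_mat 3 3" by (simp_all add: Pmod_simps)
  have P': "sgn_pow c \<cdot>\<^sub>m act (Pmod u :: 'k dgmod) p \<in> carrier_mat 3 3" for c using P(2) by auto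
  {
    case 1 show ?case using Cons(1) by (simp add: nf dsum_def P)
  next
    case 2 show ?case using Cons(1,2) P' by (simp add: nf dsum_def P)
  next
    case 3
    have "four_block_mat (0\<^sub>m 3 3) (0\<^sub>m 3 d) (0\<^sub>m d 3) (0\<^sub>m d d) = (0\<^sub>m (3 + d) (3 + d) :: 'k mat)" for d
      by (intro eq_matI) auto
    moreover have "c \<cdot>\<^sub>m 0\<^sub>m 3 3 = (0\<^sub>m 3 3 :: 'k mat)" for c by (intro eq_matI) auto
    ultimately show ?case using Cons(1,3) by (simp add: nf dsum_def P Pmod_simps(2))
  next
    case 4
    show ?case
    proof (cases i)
      case 0
      then show ?thesis using 4(2) by (auto simp: nf dsum_def nth_append less3 Pmod_simps(1))
    next
      case (Suc j)
      then have "degs ?E ! (3 * j + r) = int r + fst (fs ! j)" using Cons(4)[of j] 4 by simp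
      then show ?thesis using Suc by (simp add: nf dsum_def nth_append P)
    qed
  next
    case 5
    have m: "matop (act (ev_source (Pmod u) (nf # fs)) p) x =
        join 3 (sgn_pow (- n * int (len p)) \<star> matop (act (Pmod u) p) (sl 3 x)) (matop (act ?E p) (sr 3 x))"
      using matop_four_block[OF P' zero_carrier_mat zero_carrier_mat Cons(2)] Cons(1)
      by (simp add: nf dsum_def P matop_smult)
    show ?case
    proof (cases i)
      case 0
      have "sl 3 (matop (act (Pmod u) p) y) = matop (act (Pmod u) p) y" for y :: "'k U"
        using P(2) by (auto simp: fps_eq_iff matop_nth)
      then show ?thesis unfolding 0 m blk_0 by (simp add: nf lin_simps[OF lin_sl])
    next
      case (Suc j)
      then show ?thesis using 5 Cons(5)[of j "sr 3 x"] unfolding m by (simp add: blk_Suc)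
    qed
  }
qed (simp_all add: zero_dgmod_def)

lemma ev_map_facts:
  assumes "\<And>f n. (n, f) \<in> set fs \<Longrightarrow> f \<in> carrier_mat (mdim y) 3"
  shows "ev_map y fs \<in> carrier_mat (mdim y) (3 * length fs)"
    "matop (ev_map y fs) x = (\<Sum>i<length fs. matop (snd (fs ! i)) (blk i (x :: 'k::field U)))"
  using assms
proof (induction fs arbitrary: x)
  case Nil
  {
    case 1 show ?case by simp
  next
    case 2 show ?case by simp
  }
next
  case (Cons nf fs)
  obtain n f where nf: "nf = (n, f)" by (cases nf)
  {
    case 1
    have "f \<in> carrier_mat (mdim y) 3" using 1 nf by auto
    moreover have "ev_map y fs \<in> carrier_mat (mdim y) (3 * length fs)" using Cons(1) 1 by auto
    ultimately show ?case by (auto simp: nf)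
  next
    case 2
    have f: "f \<in> carrier_mat (mdim y) 3" using 2 nf by auto
    have E: "ev_map y fs \<in> carrier_mat (mdim y) (3 * length fs)" using Cons(1) 2 by auto
    have IH: "matop (ev_map y fs) z = (\<Sum>i<length fs. matop (snd (fs ! i)) (blk i z))" for z using Cons(2)[of z] 2 by auto
    have j: "join (mdim y) a 0 = a" if "\<And>i. mdim y \<le> i \<Longrightarrow> fps_nth a i = 0" for a :: "'k U"
      using that by (auto simp: fps_eq_iff)
    have "matop (ev_map y (nf # fs)) x = join (mdim y) (matop f (sl 3 x) + matop (ev_map y fs) (sr 3 x)) 0"
      using matop_four_block[OF f E, of "0\<^sub>m 0 3" 0 "0\<^sub>m 0 (3 * length fs)" x] f E by (simp add: nf)
    also have "\<dots> = matop f (sl 3 x) + matop (ev_map y fs) (sr 3 x)"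
      by (rule j) (use f E in \<open>auto simp: matop_nth\<close>)
    finally show ?case unfolding IH by (simp add: nf sum.lessThan_Suc_shift blk_0 blk_Suc del: sum.lessThan_Suc)
  }
qed

text \<open>The inverse on \<open>V\<close> must come from a linear map on the whole sequence space;
  a linear right inverse supplies one, and it is a chain map because \<open>f\<close> is
  injective.\<close>

lemma heq_bij: assumes M: "kmod (M :: 'k::field kmod)" "kmod N" and f: "f \<in> cyc 0 M N" and bij: "\<And>n w. bij_betw (f n w) (V M n w) (V N n w)"
  shows "heq 0 M N"
proof -
  have "\<exists>g. lin g \<and> (\<forall>y. g y \<in> V M n w) \<and> (\<forall>v\<in>V M n w. f n w (g (f n w v)) = f n w v)" for n w
    by (rule lin_right_inverse[OF homD(1)[OF cycD(1)[OF f]] kmod_sub[OF M(1)]])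
  then obtain g where g: "\<And>n w. lin (g n w)" "\<And>n w y. g n w y \<in> V M n w"
    "\<And>n w v. v \<in> V M n w \<Longrightarrow> f n w (g n w (f n w v)) = f n w v" by metis
  note h = cycD(1)[OF f]
  have inj: "a \<in> V M n w \<Longrightarrow> b \<in> V M n w \<Longrightarrow> f n w a = f n w b \<Longrightarrow> a = b" for n w a b
    using bij_betw_imp_inj_on[OF bij] by (auto dest: inj_onD)
  have gf: "g n w (f n w v) = v" if "v \<in> V M n w" for n w v
    using inj[OF g(2) that g(3)[OF that]] .
  have fg: "f n w (g n w v) = v" if v: "v \<in> V N n w" for n w v
  proof -
    obtain a where "a \<in> V M n w" "v = f n w a" using bij v unfolding bij_betw_def by blast
    then show ?thesis using gf by simp
  qed
  have gZ: "g \<in> cyc 0 N M"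
  proof (intro cycI homI g(1))
    fix n w v assume v: "v \<in> V N n w"
    show "g n w v \<in> V M (n + 0) w" using g(2) by simp
    have a: "g n w v \<in> V M n w" by (rule g(2))
    show "g (n + 1) (opp w) (A N w v) = sgn_pow 0 \<star> A M w (g n w v)"
      using homD(3)[OF h a] fg[OF v] gf[OF kmod_A[OF M(1) a]] by simp
    show "g (n + 1) w (D N n w v) = sgn_pow 0 \<star> D M (n + 0) w (g n w v)"
      using cycD(2)[OF f a] fg[OF v] gf[OF kmod_D[OF M(1) a]] by simp
  qed
  have "comp 0 g f - idf \<in> bdr 0 M M" by (rule bdr_cong[OF bdr_0[OF M(1)]]) (simp add: comp_def idf_def gf)
  moreover have "comp (- 0) f g - idf \<in> bdr 0 N N" by (rule bdr_cong[OF bdr_0[OF M(2)]]) (simp add: comp_def idf_def fg)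
  ultimately show ?thesis unfolding heq_def using f gZ by (intro bexI[of _ f] bexI[of _ g]) auto
qed

text \<open>The rules of \<open>Cat\<close> provide sums only through cones: a direct sum is the
  cone of a zero map, and the additional shift by -1 undoes the shift inside the cone.\<close>

lemma dsum_mcone: assumes a: "dg_module (a :: 'a::field dgmod)" and e: "dg_module e"
  shows "dsum (shift (- n) a) e = mcone (shift (- n - 1) a) e (0\<^sub>m (mdim e) (mdim a))"
proof -
  have "shift 1 (shift (- n - 1) a) = shift (- n) a"
  proof -
    have "sgn_pow 1 * sgn_pow (- n - 1) = (sgn_pow (- n) :: 'a)" "sgn_pow l * sgn_pow ((- n - 1) * l) = (sgn_pow (- n * l) :: 'a)" for l
      unfolding sgn_pow_add[symmetric] by (simp_all add: algebra_simps)
    then show ?thesis unfolding shift_def by (simp add: smult_smult o_def)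
  qed
  then show ?thesis unfolding mcone_def by (simp add: dsum_def)
qed

lemma zero_dg_hom: assumes "dg_module M" "dg_module N" shows "0\<^sub>m (mdim N) (mdim M) \<in> dg_hom M N"
  using dg_closed(4)[OF assms, of 0] by (simp add: shift_0)

lemma dg_module_zero: "dg_module (zero_dgmod :: 'k::field dgmod)"
  unfolding dg_module_def zero_dgmod_def
  by (auto simp: homogeneous_def intro!: eq_matI split: option.splits)

text \<open>The zero object is isomorphic to the cone of an identity morphism.\<close>

lemma zero_Cat: "(zero_dgmod :: 'k::field dgmod) \<in> Cat"
proof -
  let ?P = "Pmod V1 :: 'k dgmod"
  have P: "dg_module ?P" by (rule dg_module_Pmod)
  have one: "1\<^sub>m 3 \<in> dg_hom ?P ?P" using one_dg_hom[OF P] unfolding shift_0 by (simp add: Pmod_simps(1) numeral_3_eq_3)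
  let ?K = "mcone ?P ?P (1\<^sub>m 3)"
  have K: "?K \<in> Cat" by (rule Cat.Cat_cone[OF Cat.Cat_P Cat.Cat_P one])
  have dK: "dg_module ?K" by (rule Cat_dg_module[OF K])
  let ?Z = "zero_dgmod :: 'k dgmod"
  have m: "mdim ?K = 6" "mdim ?Z = 0" "mdim ?P = 3" by (simp_all add: mcone_def dsum_def Pmod_simps zero_dgmod_def)
  have z3: "sgn_pow 1 \<cdot>\<^sub>m 0\<^sub>m 3 3 = (0\<^sub>m 3 3 :: 'k mat)" by (intro eq_matI) auto
  have dif: "diff ?K = four_block_mat (0\<^sub>m 3 3) (0\<^sub>m 3 3) (1\<^sub>m 3) (0\<^sub>m 3 3)"
    by (simp add: mcone_def dsum_def Pmod_simps(2) z3[simplified] m)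
  have ac: "act ?K p = four_block_mat (sgn_pow (int (len p)) \<cdot>\<^sub>m act ?P p) (0\<^sub>m 3 3) (0\<^sub>m 3 3) (act ?P p)" for p
    by (simp add: mcone_def dsum_def m)
  have cP: "act ?P p \<in> carrier_mat 3 3" for p by (simp add: Pmod_simps)
  \<comment> \<open>The contraction of the cone of the identity moves the second summand back to the
    first.\<close>
  define s :: "'k mat" where "s = four_block_mat (0\<^sub>m 3 3) (1\<^sub>m 3) (0\<^sub>m 3 3) (0\<^sub>m 3 3)"
  have sg: "s \<in> glin (0 - 1) ?K ?K" unfolding glin_def
  proof (intro CollectI conjI allI)
    have e: "degs ?K = map (\<lambda>d. d - 1) (degs ?P) @ degs ?P" by (simp add: mcone_def dsum_def)
    have o: "1\<^sub>m 3 \<in> homogeneous (0 - 1) (degs ?P) (map (\<lambda>d. d - 1) (degs ?P))"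
      by (auto simp: homogeneous_def Pmod_simps(1) less_Suc_eq eval_nat_numeral split: if_splits)
    have z: "(0\<^sub>m 3 3 :: 'k mat) \<in> homogeneous (0 - 1) ds es" if "length ds = 3" "length es = 3" for ds es
      using homogeneous_0[where 'a='k, of es ds "0 - 1"] that by simp
    show "s \<in> homogeneous (0 - 1) (degs ?K) (degs ?K)" unfolding s_def e
      by (rule homogeneous_four_block[OF z o z z]) (simp_all add: m)
    fix p
    have c: "sgn_pow (int (len p)) \<cdot>\<^sub>m act ?P p \<in> carrier_mat 3 3" using cP[of p] by simp
    note z = zero_carrier_mat[where 'a='k, of 3 3]
    have "s * act ?K p = four_block_mat (0\<^sub>m 3 3) (act ?P p) (0\<^sub>m 3 3) (0\<^sub>m 3 3)"
      unfolding s_def ac mult_four_block_mat[OF z one_carrier_mat z z c z z cP] using cP[of p] c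
      by (simp add: left_mult_zero_mat[OF c] left_mult_zero_mat[OF cP] right_mult_zero_mat)
    moreover have "act ?K p * s = four_block_mat (0\<^sub>m 3 3) (sgn_pow (int (len p)) \<cdot>\<^sub>m act ?P p) (0\<^sub>m 3 3) (0\<^sub>m 3 3)"
      unfolding s_def ac mult_four_block_mat[OF c z z cP z one_carrier_mat z z] using cP[of p] c
      by (simp add: right_mult_zero_mat[OF c] right_mult_zero_mat[OF cP])
    ultimately show "s * act ?K p = sgn_pow ((0 - 1) * int (len p)) \<cdot>\<^sub>m (act ?K p * s)"
      using cP[of p] by (intro eq_matI) auto
  qed
  have id: "1\<^sub>m 6 \<in> null_hom ?K (shift 0 ?K)"
  proof -
    have "sgn_pow 0 \<cdot>\<^sub>m (diff ?K * s) + s * diff ?K = 1\<^sub>m 6"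
    proof -
      note z = zero_carrier_mat[where 'a='k, of 3 3]
      have "diff ?K * s = four_block_mat (0\<^sub>m 3 3) (0\<^sub>m 3 3) (0\<^sub>m 3 3) (1\<^sub>m 3)"
        unfolding s_def dif mult_four_block_mat[OF z z one_carrier_mat z z one_carrier_mat z z] by simp
      moreover have "s * diff ?K = four_block_mat (1\<^sub>m 3) (0\<^sub>m 3 3) (0\<^sub>m 3 3) (0\<^sub>m 3 3)"
        unfolding s_def dif mult_four_block_mat[OF z one_carrier_mat z z z z one_carrier_mat z] by simp
      ultimately show ?thesis by (intro eq_matI) (auto simp: less_Suc_eq)
    qed
    then show ?thesis unfolding null_hom_shift[OF dK dK] using sg by (intro CollectI exI[of _ s] conjI) (rule sym)
  qed
  have "isom ?K ?Z" unfolding isom_def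
  proof (intro bexI conjI)
    show f: "0\<^sub>m 0 6 \<in> dg_hom ?K ?Z" using zero_dg_hom[OF dK dg_module_zero] by (simp only: m)
    show g: "0\<^sub>m 6 0 \<in> dg_hom ?Z ?K" using zero_dg_hom[OF dg_module_zero dK] by (simp only: m)
    have "0\<^sub>m 6 6 - 1\<^sub>m 6 = (-1) \<cdot>\<^sub>m (1\<^sub>m 6 :: 'k mat)" by (intro eq_matI) auto
    then have "0\<^sub>m 6 6 - 1\<^sub>m 6 \<in> null_hom ?K (shift 0 ?K)" using null_closed(3)[OF dK dK id, of "-1"] by simp
    then have "hclass ?K (shift 0 ?K) (0\<^sub>m 6 6) = hclass ?K (shift 0 ?K) (1\<^sub>m 6)"
      using hclass_eq[OF dK dK, of "0\<^sub>m 6 6" 0 "1\<^sub>m 6"] dg_closed(4)[OF dK dK, of 0] one_dg_hom[OF dK] unfolding m by blast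
    moreover have "0\<^sub>m 6 0 * 0\<^sub>m 0 6 = (0\<^sub>m 6 6 :: 'k mat)" by simp
    ultimately show "hclass ?K ?K (0\<^sub>m 6 0 * 0\<^sub>m 0 6) = hclass ?K ?K (1\<^sub>m (mdim ?K))" unfolding m by (simp add: shift_0)
    have "0\<^sub>m 0 6 * 0\<^sub>m 6 0 = (1\<^sub>m 0 :: 'k mat)" by (intro eq_matI) auto
    then show "hclass ?Z ?Z (0\<^sub>m 0 6 * 0\<^sub>m 6 0) = hclass ?Z ?Z (1\<^sub>m (mdim ?Z))" unfolding m by simp
  qed
  then show ?thesis using Cat.Cat_isom[OF K dg_module_zero] by blast
qed

lemma ev_source_Cat: assumes a: "a \<in> Cat" shows "ev_source a fs \<in> Cat"
proof (induction fs)
  case (Cons nf fs)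
  obtain n f where nf: "nf = (n, f)" by (cases nf)
  note da = Cat_dg_module[OF a] and de = Cat_dg_module[OF Cons]
  have "0\<^sub>m (mdim (ev_source a fs)) (mdim a) \<in> dg_hom (shift (- n - 1) a) (ev_source a fs)"
    using zero_dg_hom[OF dg_module_shift[OF da] de, of "- n - 1"] by simp
  then show ?case unfolding nf ev_source.simps dsum_mcone[OF da de]
    by (intro Cat.Cat_cone Cat.Cat_shift a Cons)
qed (simp add: zero_Cat)

lemma dgfam_mcone: assumes M: "dg_module M" and N: "dg_module N" and f: "f \<in> carrier_mat (mdim N) (mdim M)"
  shows "x \<in> V (dgfam (mcone M N f)) n w \<longleftrightarrow> sl (mdim M) x \<in> V (dgfam M) (n + 1) w \<and> sr (mdim M) x \<in> V (dgfam N) n w"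
    "A (dgfam (mcone M N f)) w x = join (mdim M) (- A (dgfam M) w (sl (mdim M) x)) (A (dgfam N) w (sr (mdim M) x))"
    "D (dgfam (mcone M N f)) n w x = join (mdim M) (- D (dgfam M) n w (sl (mdim M) x)) (matop f (sl (mdim M) x) + D (dgfam N) n w (sr (mdim M) x))"
proof -
  note FM = dgm_facts(3,4)[OF M] and FN = dgm_facts(3,4)[OF N]
  let ?m = "mdim M"
  have S: "act (shift 1 M) p \<in> carrier_mat ?m ?m" "diff (shift 1 M) \<in> carrier_mat ?m ?m" for p using FM(1)[of p] FM(2) by auto
  note z = zero_carrier_mat[of "mdim M" "mdim N"] zero_carrier_mat[of "mdim N" "mdim M"]
  have act: "matop (act (mcone M N f) p) x = join ?m (sgn_pow (int (len p)) \<star> matop (act M p) (sl ?m x)) (matop (act N p) (sr ?m x))" for p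
    using matop_four_block[OF S(1) z FN(1), of p p x] by (simp add: mcone_def dsum_def matop_smult)
  have j: "join m a b = x \<longleftrightarrow> sl m a = sl m x \<and> b = sr m x" for m a b and x :: "'a U"
    by (metis join_sl_sr sl_join sr_join)
  have sm: "sl ?m (matop (act M p) v) = matop (act M p) v" for p v using FM(1)[of p] by (auto simp: fps_eq_iff matop_nth)
  have h: "hsup (map (\<lambda>d. d - 1) ds) n v \<longleftrightarrow> hsup ds (n + 1) v" for ds and v :: "'a U"
    by (auto simp: hsup_def)
  have d: "degs (mcone M N f) = map (\<lambda>d. d - 1) (degs M) @ degs N" by (simp add: mcone_def dsum_def)
  show "x \<in> V (dgfam (mcone M N f)) n w \<longleftrightarrow> sl (mdim M) x \<in> V (dgfam M) (n + 1) w \<and> sr (mdim M) x \<in> V (dgfam N) n w"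
    by (auto simp: act d hsup_append h j sm)
  show "A (dgfam (mcone M N f)) w x = join (mdim M) (- A (dgfam M) w (sl (mdim M) x)) (A (dgfam N) w (sr (mdim M) x))"
    by (simp add: act)
  show "D (dgfam (mcone M N f)) n w x = join (mdim M) (- D (dgfam M) n w (sl (mdim M) x)) (matop f (sl (mdim M) x) + D (dgfam N) n w (sr (mdim M) x))"
    using matop_four_block[OF S(2) z(1) f FN(2), of x] by (simp add: mcone_def matop_smult)
qed

text \<open>Collects one basis path from all summands: residue 0 for idempotents, 1 for arrows, 2
  for loops.\<close>

definition third :: "nat \<Rightarrow> 'k::field U \<Rightarrow> 'k U" where "third r x = Abs_fps (\<lambda>i. fps_nth x (3 * i + r))"
definition mix :: "nat \<Rightarrow> 'k::field U \<Rightarrow> 'k U \<Rightarrow> 'k U \<Rightarrow> 'k U" where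
  "mix N a b c = Abs_fps (\<lambda>j. if j < 3 * N then fps_nth (if j mod 3 = 0 then a else if j mod 3 = 1 then b else c) (j div 3) else 0)"

lemma third_nth [simp]: "fps_nth (third r x) i = fps_nth x (3 * i + r)" by (simp add: third_def)

lemma lin_prt: "lin (third r)" by (auto simp: lin_def fps_eq_iff)

lemma third_blk: "r < 3 \<Longrightarrow> fps_nth (third r x) i = fps_nth (blk i x) r"
  by (auto simp: blk_def less3)

lemma blk_eqI: assumes "\<And>i. blk i x = blk i y" shows "x = (y :: 'k::field U)"
proof (rule fps_ext)
  fix j :: nat
  have "j = 3 * (j div 3) + j mod 3" "j mod 3 < 3" by auto
  then obtain i r where jr: "j = 3 * i + r" "r < 3" by blast
  show "fps_nth x j = fps_nth y j"
    using third_blk[OF jr(2), of x i] third_blk[OF jr(2), of y i] assms[of i] by (simp add: jr(1))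
qed

lemma blk_mix: "blk i (mix N a b c) = (if i < N then t3 (fps_nth a i) (fps_nth b i) (fps_nth c i) else 0)"
proof -
  have "(3 * i + 1) div 3 = i" "(3 * i + 2) div 3 = i" "(3 * i + 1) mod 3 = 1" "(3 * i + 2) mod 3 = 2" by presburger+
  then show ?thesis unfolding blk_def mix_def by auto
qed

lemma third_mix: assumes "\<And>i. N \<le> i \<Longrightarrow> fps_nth a i = 0 \<and> fps_nth b i = 0 \<and> fps_nth c i = 0"
  shows "third 0 (mix N a b c) = a" "third 1 (mix N a b c) = b" "third 2 (mix N a b c) = c" "sl (3 * N) (mix N a b c) = mix N a b c"
proof -
  show "sl (3 * N) (mix N a b c) = mix N a b c" by (auto simp: fps_eq_iff mix_def)
qed (rule fps_ext, subst third_blk, simp, use assms in \<open>simp add: blk_mix\<close>)+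

lemma mix_prt: assumes "\<And>i. N \<le> i \<Longrightarrow> blk i x = 0" shows "mix N (third 0 x) (third 1 x) (third 2 x) = x"
proof (rule blk_eqI)
  fix i show "blk i (mix N (third 0 x) (third 1 x) (third 2 x)) = blk i x"
    using assms[of i] by (simp add: blk_mix) (simp add: blk_def)
qed

lemma all_less_ge: "(\<forall>i<n. P i) \<and> (\<forall>i\<ge>n. Q i) \<longleftrightarrow> (\<forall>i. if i < (n :: nat) then P i else Q i)"
  by (metis not_less)

lemma blk_zero: "blk i 0 = 0" by (rule lin_0[OF lin_blk])

section \<open>The cone of evaluation for a chosen basis of morphisms\<close>

context
  fixes u :: vertex and y :: "'k::field dgmod" and fs
  assumes y: "dg_module y" and fs: "hom_basis (Pmod u) y fs"
begin

abbreviation (input) "evE \<equiv> ev_source (Pmod u :: 'k dgmod) fs"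
abbreviation (input) "evN \<equiv> length fs"
abbreviation (input) "evd i \<equiv> fst (fs ! i)"
text \<open>The cocycle of \<open>y\<close> at \<open>u\<close> that corresponds to the
  \<open>i\<close>-th basis morphism.\<close>

definition zeta :: "nat \<Rightarrow> 'k U" where "zeta i = matop (snd (fs ! i)) (unit 0)"

lemma E_facts: "evE \<in> Cat" "dg_module evE" "mdim evE = 3 * evN"
  using ev_source_Cat[OF Cat.Cat_P] Cat_dg_module by (auto simp: ev_source_facts)

lemma fs_cyc: "i < evN \<Longrightarrow> snd (fs ! i) \<in> dg_hom (Pmod u) (shift (evd i) y)"
  "i < evN \<Longrightarrow> mfam (snd (fs ! i)) \<in> cyc (evd i) (dgfam (Pmod u)) (dgfam y)"
proof -
  show "snd (fs ! i) \<in> dg_hom (Pmod u) (shift (evd i) y)" if "i < evN" for i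
    using fs nth_mem[OF that] unfolding hom_basis_def by (auto simp: case_prod_unfold)
  then show "i < evN \<Longrightarrow> mfam (snd (fs ! i)) \<in> cyc (evd i) (dgfam (Pmod u)) (dgfam y)"
    using dg_hom_cyc1[OF dg_module_Pmod y] by blast
qed

lemma ev_facts: "ev_map y fs \<in> carrier_mat (mdim y) (3 * evN)"
  "matop (ev_map y fs) x = (\<Sum>i<evN. matop (snd (fs ! i)) (blk i x))"
proof -
  have cmap: "f \<in> carrier_mat (mdim y) 3" if "(n, f) \<in> set fs" for n f
  proof -
    have "f \<in> dg_hom (Pmod u) (shift n y)" using fs that unfolding hom_basis_def by auto
    from dg_hom_carrier[OF dg_module_Pmod y this] show ?thesis by (simp add: Pmod_simps(1) numeral_3_eq_3)
  qed
  show "ev_map y fs \<in> carrier_mat (mdim y) (3 * evN)" "matop (ev_map y fs) x = (\<Sum>i<evN. matop (snd (fs ! i)) (blk i x))"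
    by (rule ev_map_facts[OF cmap]; assumption)+
qed

text \<open>The \<open>i\<close>-th summand is shifted so that its idempotent sits in degree
  \<open>evd i\<close>; coordinates beyond the last summand vanish.\<close>

lemma ev_E: "x \<in> V (dgfam evE) n w \<longleftrightarrow> (\<forall>i<evN. blk i x \<in> V (dgfam (Pmod u)) (n - evd i) w) \<and> (\<forall>i\<ge>evN. blk i x = 0)"
proof
  assume x: "x \<in> V (dgfam evE) n w"
  have h: "hsup (degs evE) n x" and t: "matop (act evE (Triv w)) x = x" using x by simp_all
  have "blk i x \<in> V (dgfam (Pmod u)) (n - evd i) w" if i: "i < evN" for i
  proof -
    have "matop (act (Pmod u) (Triv w)) (blk i x) = blk i x" using ev_source_facts(5)[OF i, of u "Triv w" x] t by simp
    moreover have "hsup [0, 1, 2] (n - evd i) (blk i x)" unfolding hsup_def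
    proof (intro allI impI)
      fix j assume j: "fps_nth (blk i x) j \<noteq> 0"
      then have j3: "j < 3" by (auto simp: blk_def split: if_splits)
      then have "fps_nth x (3 * i + j) \<noteq> 0" using j by (auto simp: blk_def less3)
      then have "degs evE ! (3 * i + j) = n" using h unfolding hsup_def by blast
      moreover have "degs evE ! (3 * i + j) = int j + evd i" by (rule ev_source_facts(4)[OF i j3])
      ultimately have "int j = n - evd i" by simp
      then show "j < length [0, 1, 2::int] \<and> [0, 1, 2] ! j = n - evd i" using j3 by (auto simp: less3)
    qed
    ultimately show ?thesis by (simp add: Pmod_simps(1))
  qed
  moreover have "blk i x = 0" if "i \<ge> evN" for i
    using hsup_ge[OF h] that by (simp add: blk_def E_facts(3))
  ultimately show "(\<forall>i<evN. blk i x \<in> V (dgfam (Pmod u)) (n - evd i) w) \<and> (\<forall>i\<ge>evN. blk i x = 0)" by blast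
next
  assume a: "(\<forall>i<evN. blk i x \<in> V (dgfam (Pmod u)) (n - evd i) w) \<and> (\<forall>i\<ge>evN. blk i x = 0)"
  have m0: "blk i (matop (act evE p) v) = 0" if "i \<ge> evN" for i p and v :: "'k U"
    using ev_source_facts(2)[of u fs p] that by (auto simp: blk_def matop_nth)
  have "matop (act evE (Triv w)) x = x"
  proof (rule blk_eqI)
    fix i show "blk i (matop (act evE (Triv w)) x) = blk i x"
      using a m0[of i] ev_source_facts(5)[of i fs u "Triv w" x] by (cases "i < evN") auto
  qed
  moreover have "hsup (degs evE) n x" unfolding hsup_def
  proof (intro allI impI)
    fix j assume j: "fps_nth x j \<noteq> 0"
    define i r where "i = j div 3" and "r = j mod 3"
    have jr: "j = 3 * i + r" "r < 3" by (auto simp: i_def r_def)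
    have b: "fps_nth (blk i x) r \<noteq> 0" using j jr(2) unfolding jr(1) by (auto simp: blk_def less3)
    then have i: "i < evN" using a by (metis fps_zero_nth not_less)
    then have "hsup [0, 1, 2] (n - evd i) (blk i x)" using a by (simp add: Pmod_simps(1))
    then have "[0, 1, 2] ! r = n - evd i" using b unfolding hsup_def by blast
    then have "int r + evd i = n" using jr(2) by (auto simp: less3)
    moreover have "degs evE ! (3 * i + r) = int r + evd i" by (rule ev_source_facts(4)[OF i jr(2)])
    ultimately show "j < mdim evE \<and> degs evE ! j = n" using i jr by (simp add: E_facts(3))
  qed
  ultimately show "x \<in> V (dgfam evE) n w" by simp
qed

lemma f_blk: assumes i: "i < evN" and x: "x \<in> V (dgfam evE) n w"
  shows "matop (snd (fs ! i)) (blk i x) \<in> V (dgfam y) n w"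
    "matop (snd (fs ! i)) (A (dgfam (Pmod u)) w (blk i x)) = sgn_pow (evd i) \<star> A (dgfam y) w (matop (snd (fs ! i)) (blk i x))"
    "matop (diff y) (matop (snd (fs ! i)) (blk i x)) = 0"
    "matop (snd (fs ! i)) (blk i x) = pev u (evd i) (dgfam y) (zeta i) (n - evd i) w (blk i x)"
proof -
  have b: "blk i x \<in> V (dgfam (Pmod u)) (n - evd i) w" using x i unfolding ev_E by blast
  note Z = fs_cyc(2)[OF i] note h = cycD(1)[OF Z]
  show "matop (snd (fs ! i)) (blk i x) \<in> V (dgfam y) n w" using homD(2)[OF h b] by simp
  show "matop (snd (fs ! i)) (A (dgfam (Pmod u)) w (blk i x)) = sgn_pow (evd i) \<star> A (dgfam y) w (matop (snd (fs ! i)) (blk i x))"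
    using homD(3)[OF h b] by simp
  have "sgn_pow (evd i) \<star> matop (diff y) (matop (snd (fs ! i)) (blk i x)) = 0"
    using cycD(2)[OF Z b] by (simp add: Pmod_simps(2) matop_lin)
  then have "sgn_pow (evd i) \<star> sgn_pow (evd i) \<star> matop (diff y) (matop (snd (fs ! i)) (blk i x)) = sgn_pow (evd i) \<star> 0" by (rule arg_cong)
  then show "matop (diff y) (matop (snd (fs ! i)) (blk i x)) = 0" by simp
  show "matop (snd (fs ! i)) (blk i x) = pev u (evd i) (dgfam y) (zeta i) (n - evd i) w (blk i x)"
    using hom_pev(1)[OF kmod_dgfam[OF y] h b] by (simp add: zeta_def)
qed

text \<open>The sign \<open>(-1)^(evd i)\<close> in the action on the shifted summand cancels
  against the sign with which a morphism of that degree passes an arrow.\<close>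

lemma ev_dg_hom: "ev_map y fs \<in> dg_hom evE y"
proof -
  note ky = kmod_dgfam[OF y]
  have "mfam (ev_map y fs) \<in> cyc 0 (dgfam evE) (dgfam y)"
  proof (intro cycI homI)
    fix n w show "lin (mfam (ev_map y fs) n w)" by (simp add: mfam_def lin_matop)
    fix x assume x: "x \<in> V (dgfam evE) n w"
    show "mfam (ev_map y fs) n w x \<in> V (dgfam y) (n + 0) w"
      unfolding mfam_apply ev_facts(2) add_0_right by (rule sub_sum[OF kmod_sub[OF ky]]) (rule f_blk(1)[OF _ x], simp)
    have "matop (snd (fs ! i)) (blk i (A (dgfam evE) w x)) = A (dgfam y) w (matop (snd (fs ! i)) (blk i x))" if i: "i < evN" for i
    proof -
      have "blk i (A (dgfam evE) w x) = sgn_pow (evd i) \<star> A (dgfam (Pmod u)) w (blk i x)"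
        using ev_source_facts(5)[OF i, where p="Arrow w" and x=x] by simp
      then show ?thesis using f_blk(2)[OF i x] by (simp add: matop_lin del: dgfam_simps)
    qed
    then show "mfam (ev_map y fs) (n + 1) (opp w) (A (dgfam evE) w x) = sgn_pow 0 \<star> A (dgfam y) w (mfam (ev_map y fs) n w x)"
      by (simp add: ev_facts(2) lin_sum[OF kmod_linA[OF ky]] del: dgfam_simps)
    have "matop (diff y) (\<Sum>i<evN. matop (snd (fs ! i)) (blk i x)) = 0"
      using f_blk(3)[OF _ x] by (simp add: lin_sum[OF lin_matop])
    then show "mfam (ev_map y fs) (n + 1) w (D (dgfam evE) n w x) = sgn_pow 0 \<star> D (dgfam y) (n + 0) w (mfam (ev_map y fs) n w x)"
      by (simp add: ev_facts(2) ev_source_facts(3) blk_zero matop_lin)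
  qed
  then show ?thesis using dg_hom_cyc[OF E_facts(2) y, of "ev_map y fs" 0] ev_facts(1) by (simp add: E_facts(3) shift_0)
qed

text \<open>The graded vector space on the entries of the list, entry \<open>i\<close> having degree
  \<open>evd i\<close>; it plays the part of the cohomology of \<open>y\<close> at
  \<open>u\<close>.\<close>

definition Hsp :: "int \<Rightarrow> 'k U set" where "Hsp n = {a. \<forall>i. fps_nth a i \<noteq> 0 \<longrightarrow> i < evN \<and> evd i = n}"
definition cmap :: "int \<Rightarrow> 'k U \<Rightarrow> 'k U" where "cmap n a = (\<Sum>i<evN. fps_nth a i \<star> zeta i)"

lemma z_ker: "i < evN \<Longrightarrow> zeta i \<in> ker (dgfam y) (evd i) u"
  using cyc_ker[OF kmod_dgfam[OF y] fs_cyc(2)] by (simp add: zeta_def)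

lemma H_ge: "a \<in> Hsp n \<Longrightarrow> evN \<le> i \<Longrightarrow> fps_nth a i = 0" by (force simp: Hsp_def)

lemma sub_H: "sub (Hsp n)" by (auto simp: sub_def Hsp_def) (metis add.right_neutral)+

lemma c_V: assumes "a \<in> Hsp n" shows "cmap n a \<in> ker (dgfam y) n u"
  unfolding cmap_def
proof (rule sub_sum[OF sub_ker[OF kmod_dgfam[OF y]]])
  fix i assume i: "i \<in> {..<evN}"
  show "fps_nth a i \<star> zeta i \<in> ker (dgfam y) n u"
    using assms z_ker[of i] i sub_sc[OF sub_ker[OF kmod_dgfam[OF y]]] sub_0[OF sub_ker[OF kmod_dgfam[OF y]]]
    by (cases "fps_nth a i = 0") (auto simp: Hsp_def)
qed

lemma lin_c: "lin (cmap n)"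
  by (auto simp: lin_def cmap_def sc_add_left sum.distrib matop_lin) (simp add: lin_sum[of "\<lambda>x. _ \<star> x", OF lin_scale[OF lin_id]])

lemma cpx_H: "cpx u Hsp cmap (\<lambda>n x. 0) (dgfam y)"
  unfolding cpx_def using c_V sub_0[OF sub_H] lin_0[OF lin_c]
  by (auto simp: sub_H lin_c lin_zero ker_def simp del: dgfam_simps)

text \<open>The cocycles \<open>zeta i\<close> represent a basis of the cohomology at
  \<open>u\<close>, so \<open>cmap\<close> identifies \<open>Hsp\<close> with it, and the complex at
  \<open>u\<close> splits accordingly.\<close>

lemma heq_H: "heq 0 (TT u Hsp cmap (\<lambda>n x. 0) (dgfam y)) (Tw u (dgfam y))"
proof (rule exists_splitting[OF kmod_dgfam[OF y] cpx_H])
  fix n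
  let ?L = "filter (\<lambda>(m, f). m = n) fs" and ?P = "\<lambda>(m, f). m = n"
  obtain g where g: "bij_betw g {..<length ?L} {i. i < evN \<and> ?P (fs ! i)}" "\<And>k. k < length ?L \<Longrightarrow> ?L ! k = fs ! g k"
    using filter_bij[of ?P fs] by blast
  have S: "{i. i < evN \<and> ?P (fs ! i)} = {i. i < evN \<and> evd i = n}" by (auto simp: case_prod_unfold)
  note g1 = g(1)[unfolded S]
  \<comment> \<open>The basis condition for degree \<open>n\<close>, rewritten over positions in the
    full list.\<close>
  have q: "quot_basis (\<star>) (ker (dgfam y) n u) (im (dgfam y) n u) (\<lambda>k. zeta (g k)) (length ?L)"
  proof -
    have "quot_basis (\<star>) (ker (dgfam y) n u) (im (dgfam y) n u) (\<lambda>k. matop (snd (?L ! k)) (unit 0)) (length ?L)"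
      using hdim_quot_basis[OF kmod_dgfam[OF y] mbasis_hdim[OF dg_module_Pmod y hom_basis_mbasis[OF dg_module_Pmod y fs]], of n] by simp
    moreover have "matop (snd (?L ! k)) (unit 0) = zeta (g k)" if "k < length ?L" for k using g(2)[OF that] by (simp add: zeta_def)
    ultimately show ?thesis unfolding quot_basis_def by simp
  qed
  have coord: "cmap n a = (\<Sum>k<length ?L. fps_nth a (g k) \<star> zeta (g k))" if a: "a \<in> Hsp n" for a
  proof -
    have "cmap n a = (\<Sum>i\<in>{i. i < evN \<and> evd i = n}. fps_nth a i \<star> zeta i)" unfolding cmap_def
      by (rule sum.mono_neutral_right) (use a in \<open>auto simp: Hsp_def, metis sc_simps(3)\<close>)
    then show ?thesis using sum.reindex_bij_betw[OF g1, of "\<lambda>i. fps_nth a i \<star> zeta i"] by simp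
  qed
  {
    fix x assume "x \<in> V (dgfam y) n u" "D (dgfam y) n u x = 0"
    then have "x \<in> ker (dgfam y) n u" by (simp add: ker_def)
    then obtain d where d: "x - (\<Sum>k<length ?L. d k \<star> zeta (g k)) \<in> im (dgfam y) n u" using q unfolding quot_basis_def by blast
    define a where "a = Abs_fps (\<lambda>i. if i < evN \<and> evd i = n then d (inv_into {..<length ?L} g i) else 0)"
    have a: "a \<in> Hsp n" by (auto simp: Hsp_def a_def)
    have "fps_nth a (g k) = d k" if "k < length ?L" for k
      using bij_betwE[OF g1] that bij_betw_inv_into_left[OF g1] by (auto simp: a_def)
    then have "x - cmap n a \<in> im (dgfam y) n u" using d by (simp add: coord[OF a])
    then obtain w where "w \<in> V (dgfam y) (n - 1) u" "x - cmap n a = D (dgfam y) (n - 1) u w" unfolding im_def by blast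
    then show "\<exists>a\<in>Hsp n. \<exists>w\<in>V (dgfam y) (n - 1) u. x = cmap n a + D (dgfam y) (n - 1) u w"
      by (intro bexI[OF _ a] bexI[of _ w]) (simp_all add: algebra_simps)
  next
    fix a w assume a: "a \<in> Hsp n" and w: "w \<in> V (dgfam y) (n - 1) u" "cmap n a = D (dgfam y) (n - 1) u w"
    have "(\<Sum>k<length ?L. fps_nth a (g k) \<star> zeta (g k)) \<in> im (dgfam y) n u"
      using w unfolding coord[OF a, symmetric] im_def by blast
    moreover have q3: "(\<Sum>k<length ?L. d k \<star> zeta (g k)) \<in> im (dgfam y) n u \<Longrightarrow> \<forall>k<length ?L. d k = 0" for d
      using q unfolding quot_basis_def by blast
    ultimately have 0: "\<forall>k<length ?L. fps_nth a (g k) = 0" by (intro q3)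
    show "a = 0"
    proof (rule fps_ext)
      fix i show "fps_nth a i = fps_nth 0 i"
      proof (rule ccontr)
        assume ne: "fps_nth a i \<noteq> fps_nth 0 i"
        then have "i \<in> {i. i < evN \<and> evd i = n}" using a by (auto simp: Hsp_def)
        then obtain k where "k < length ?L" "i = g k" using g1 unfolding bij_betw_def by blast
        then show False using 0 ne by simp
      qed
    qed
  }
qed

text \<open>The signs by which the arrow copies of the cone differ from those of \<open>TT\<close>:
  \<open>(-1)^(evd i)\<close> from the shift of the summand, and the minus from the shift inside the
  cone.\<close>

definition sdm :: "'k U \<Rightarrow> 'k U" where "sdm a = Abs_fps (\<lambda>i. if i < evN then - (sgn_pow (evd i) * fps_nth a i) else 0)"

lemma sdm_nth [simp]: "fps_nth (sdm a) i = (if i < evN then - (sgn_pow (evd i) * fps_nth a i) else 0)" by (simp add: sdm_def)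

lemma lin_sd: "lin sdm" by (auto simp: lin_def fps_eq_iff algebra_simps)

abbreviation (input) "evK \<equiv> mcone evE y (ev_map y fs)"

definition cone_iso :: "'k fam" where
  "cone_iso = (\<lambda>n w x. if w = u then pr (pr (third 0 (sl (3 * evN) x)) (third 2 (sl (3 * evN) x))) (sr (3 * evN) x)
     else pr (sdm (third 1 (sl (3 * evN) x))) (sr (3 * evN) x))"

lemma cone_iso_simps [simp]: "cone_iso n u x = pr (pr (third 0 (sl (3 * evN) x)) (third 2 (sl (3 * evN) x))) (sr (3 * evN) x)"
  "cone_iso n (opp u) x = pr (sdm (third 1 (sl (3 * evN) x))) (sr (3 * evN) x)"
  by (simp_all add: cone_iso_def)

lemma E_u: "x \<in> V (dgfam evE) n u \<longleftrightarrow> third 0 x \<in> Hsp n \<and> third 1 x = 0 \<and> third 2 x \<in> Hsp (n - 2)"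
proof -
  have p: "t3 a b cmap \<in> V (dgfam (Pmod u :: 'k dgmod)) m u \<longleftrightarrow> (a \<noteq> 0 \<longrightarrow> m = 0) \<and> b = 0 \<and> (cmap \<noteq> 0 \<longrightarrow> m = 2)" for a b cmap m
    unfolding V_Pmod(1) by auto
  have zeta: "t3 a b cmap = 0 \<longleftrightarrow> a = 0 \<and> b = 0 \<and> cmap = 0" for a b cmap :: 'k using t3_eq[of a b cmap 0 0 0] by simp
  have "x \<in> V (dgfam evE) n u \<longleftrightarrow> (\<forall>i. (fps_nth x (3 * i) \<noteq> 0 \<longrightarrow> i < evN \<and> evd i = n) \<and> fps_nth x (3 * i + 1) = 0 \<and> (fps_nth x (3 * i + 2) \<noteq> 0 \<longrightarrow> i < evN \<and> evd i = n - 2))"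
    unfolding ev_E all_less_ge unfolding blk_def p zeta by (intro iff_allI) auto
  then show ?thesis by (auto simp: Hsp_def fps_eq_iff)
qed

lemma E_o: "x \<in> V (dgfam evE) n (opp u) \<longleftrightarrow> third 0 x = 0 \<and> third 1 x \<in> Hsp (n - 1) \<and> third 2 x = 0"
proof -
  have p: "t3 a b cmap \<in> V (dgfam (Pmod u :: 'k dgmod)) m (opp u) \<longleftrightarrow> a = 0 \<and> (b \<noteq> 0 \<longrightarrow> m = 1) \<and> cmap = 0" for a b cmap m
    unfolding V_Pmod(2) by auto
  have zeta: "t3 a b cmap = 0 \<longleftrightarrow> a = 0 \<and> b = 0 \<and> cmap = 0" for a b cmap :: 'k using t3_eq[of a b cmap 0 0 0] by simp
  have "x \<in> V (dgfam evE) n (opp u) \<longleftrightarrow> (\<forall>i. fps_nth x (3 * i) = 0 \<and> (fps_nth x (3 * i + 1) \<noteq> 0 \<longrightarrow> i < evN \<and> evd i = n - 1) \<and> fps_nth x (3 * i + 2) = 0)"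
    unfolding ev_E all_less_ge unfolding blk_def p zeta by (intro iff_allI) auto
  then show ?thesis by (auto simp: Hsp_def fps_eq_iff)
qed

lemma K_facts: "x \<in> V (dgfam evK) n w \<longleftrightarrow> sl (3 * evN) x \<in> V (dgfam evE) (n + 1) w \<and> sr (3 * evN) x \<in> V (dgfam y) n w"
    "A (dgfam evK) w x = join (3 * evN) (- A (dgfam evE) w (sl (3 * evN) x)) (A (dgfam y) w (sr (3 * evN) x))"
    "D (dgfam evK) n w x = join (3 * evN) 0 (matop (ev_map y fs) (sl (3 * evN) x) + D (dgfam y) n w (sr (3 * evN) x))"
proof -
  have e: "ev_map y fs \<in> carrier_mat (mdim y) (mdim evE)" using ev_facts(1) by (simp add: E_facts(3))
  have d: "D (dgfam evE) n w x = 0" for x n w by (simp add: ev_source_facts(3))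
  note k = dgfam_mcone[OF E_facts(2) y e, unfolded E_facts(3) d minus_zero]
  show "x \<in> V (dgfam evK) n w \<longleftrightarrow> sl (3 * evN) x \<in> V (dgfam evE) (n + 1) w \<and> sr (3 * evN) x \<in> V (dgfam y) n w"
    "A (dgfam evK) w x = join (3 * evN) (- A (dgfam evE) w (sl (3 * evN) x)) (A (dgfam y) w (sr (3 * evN) x))"
    "D (dgfam evK) n w x = join (3 * evN) 0 (matop (ev_map y fs) (sl (3 * evN) x) + D (dgfam y) n w (sr (3 * evN) x))"
    by (rule k)+
qed

lemma third_E: "i < evN \<Longrightarrow> fps_nth (A (dgfam evE) u x) (Suc (3 * i)) = sgn_pow (evd i) * fps_nth x (3 * i)"
   "i < evN \<Longrightarrow> fps_nth (A (dgfam evE) (opp u) x) (Suc (Suc (3 * i))) = sgn_pow (evd i) * fps_nth x (Suc (3 * i))"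
   "i < evN \<Longrightarrow> fps_nth (A (dgfam evE) (opp u) x) (3 * i) = 0"
proof -
  have b: "fps_nth v (3 * i) = fps_nth (blk i v) 0" "fps_nth v (Suc (3 * i)) = fps_nth (blk i v) 1" "fps_nth v (Suc (Suc (3 * i))) = fps_nth (blk i v) 2"
    for i and v :: "'k U" by (simp_all add: blk_def)
  show "i < evN \<Longrightarrow> fps_nth (A (dgfam evE) u x) (Suc (3 * i)) = sgn_pow (evd i) * fps_nth x (3 * i)"
   "i < evN \<Longrightarrow> fps_nth (A (dgfam evE) (opp u) x) (Suc (Suc (3 * i))) = sgn_pow (evd i) * fps_nth x (Suc (3 * i))"
   "i < evN \<Longrightarrow> fps_nth (A (dgfam evE) (opp u) x) (3 * i) = 0"
    unfolding b
    using ev_source_facts(5)[of i fs u "Arrow u" x] ev_source_facts(5)[of i fs u "Arrow (opp u)" x]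
    by (simp_all add: Pmod_matop)
qed

text \<open>Both modules have the same elements in different arrangements: triples of coordinates,
  one per summand, against one sequence per basis path. Apart from the signs on arrow copies nothing
  changes.\<close>

lemma heq_K: "heq 0 (dgfam evK) (TT u Hsp cmap (\<lambda>n x. 0) (dgfam y))"
proof (rule heq_bij[of _ _ cone_iso])
  let ?T = "TT u Hsp cmap (\<lambda>n x. 0) (dgfam y)"
  note ky = kmod_dgfam[OF y]
  have dK: "dg_module evK" by (rule dg_module_mcone[OF E_facts(2) y ev_dg_hom])
  show "kmod (dgfam evK)" by (rule kmod_dgfam[OF dK])
  show kT: "kmod ?T" by (rule kmod_TT[OF ky cpx_H])
  have slE: "sl (3 * evN) x = x" if "x \<in> V (dgfam evE) n w" for x n w
    using that hsup_ge[of "degs evE" n x] by (auto simp: fps_eq_iff E_facts(3))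
  have sdH: "sdm a \<in> Hsp n" if "a \<in> Hsp n" for a n using that by (auto simp: Hsp_def split: if_splits)
  have sdsd: "sdm (sdm a) = a" if "a \<in> Hsp n" for a n
    using that unfolding fps_eq_iff sdm_nth by (force simp: Hsp_def)
  show "bij_betw (cone_iso n w) (V (dgfam evK) n w) (V ?T n w)" for n w
  proof -
    consider "w = u" | "w = opp u" using vertex_cases by blast
    then show ?thesis
    proof cases
      case 1
      have p: "third 0 (mix evN a 0 b) = a \<and> third 1 (mix evN a 0 b) = 0 \<and> third 2 (mix evN a 0 b) = b \<and> sl (3 * evN) (mix evN a 0 b) = mix evN a 0 b"
        if "a \<in> Hsp m" "b \<in> Hsp m'" for a b m m'
        using third_mix[of evN a 0 b] H_ge[OF that(1)] H_ge[OF that(2)] by (simp del: One_nat_def)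
      have m: "mix evN (third 0 v) 0 (third 2 v) = v" if "v \<in> V (dgfam evE) m u" for v m
        using mix_prt[of evN v] that[unfolded E_u] that[unfolded ev_E] by simp
      show ?thesis unfolding 1
      proof (rule bij_betwI[where g="\<lambda>t. join (3 * evN) (mix evN (p1 (p1 t)) 0 (p2 (p1 t))) (p2 t)"])
        show "cone_iso n u \<in> V (dgfam evK) n u \<rightarrow> V ?T n u"
          by (auto simp: K_facts(1) E_u simp del: dgfam_simps One_nat_def)
        show "(\<lambda>t. join (3 * evN) (mix evN (p1 (p1 t)) 0 (p2 (p1 t))) (p2 t)) \<in> V ?T n u \<rightarrow> V (dgfam evK) n u"
          using p by (auto simp: K_facts(1) E_u simp del: dgfam_simps One_nat_def)
        fix x assume "x \<in> V (dgfam evK) n u"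
        then show "join (3 * evN) (mix evN (p1 (p1 (cone_iso n u x))) 0 (p2 (p1 (cone_iso n u x)))) (p2 (cone_iso n u x)) = x"
          using m[of "sl (3 * evN) x" "n + 1"] by (simp add: K_facts(1) del: dgfam_simps One_nat_def)
      next
        fix t assume "t \<in> V ?T n u"
        then show "cone_iso n u (join (3 * evN) (mix evN (p1 (p1 t)) 0 (p2 (p1 t))) (p2 t)) = t"
          using p[of "p1 (p1 t)" "n + 1" "p2 (p1 t)" "n - 1"] by (simp del: dgfam_simps One_nat_def)
      qed
    next
      case 2
      have p: "third 0 (mix evN 0 a 0) = 0 \<and> third 1 (mix evN 0 a 0) = a \<and> third 2 (mix evN 0 a 0) = 0 \<and> sl (3 * evN) (mix evN 0 a 0) = mix evN 0 a 0"
        if "a \<in> Hsp m" for a m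
        using third_mix[of evN 0 a 0] H_ge[OF that] by (simp del: One_nat_def)
      have m: "mix evN 0 (third 1 v) 0 = v" if "v \<in> V (dgfam evE) m (opp u)" for v m
        using mix_prt[of evN v] that[unfolded E_o] that[unfolded ev_E] by simp
      show ?thesis unfolding 2
      proof (rule bij_betwI[where g="\<lambda>t. join (3 * evN) (mix evN 0 (sdm (p1 t)) 0) (p2 t)"])
        show "cone_iso n (opp u) \<in> V (dgfam evK) n (opp u) \<rightarrow> V ?T n (opp u)"
          using sdH by (auto simp: K_facts(1) E_o simp del: dgfam_simps One_nat_def)
        show "(\<lambda>t. join (3 * evN) (mix evN 0 (sdm (p1 t)) 0) (p2 t)) \<in> V ?T n (opp u) \<rightarrow> V (dgfam evK) n (opp u)"
          using p[OF sdH] sdH by (auto simp: K_facts(1) E_o simp del: dgfam_simps One_nat_def)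
        fix x assume x: "x \<in> V (dgfam evK) n (opp u)"
        then have "sdm (sdm (third 1 (sl (3 * evN) x))) = third 1 (sl (3 * evN) x)" by (intro sdsd) (auto simp: K_facts(1) E_o simp del: dgfam_simps)
        with x show "join (3 * evN) (mix evN 0 (sdm (p1 (cone_iso n (opp u) x))) 0) (p2 (cone_iso n (opp u) x)) = x"
          using m[of "sl (3 * evN) x" "n + 1"] by (simp add: K_facts(1) del: dgfam_simps One_nat_def)
      next
        fix t assume "t \<in> V ?T n (opp u)"
        then show "cone_iso n (opp u) (join (3 * evN) (mix evN 0 (sdm (p1 t)) 0) (p2 t)) = t"
          using p[OF sdH, of "p1 t" n] sdsd[of "p1 t" n] by (simp del: dgfam_simps One_nat_def)
      qed
    qed
  qed
  have bij: "x \<in> V (dgfam evK) n w \<Longrightarrow> cone_iso n w x \<in> V ?T n w" for x n w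
    using \<open>\<And>n w. bij_betw (cone_iso n w) (V (dgfam evK) n w) (V ?T n w)\<close> bij_betwE by blast
  note lA = lin_simps[OF kmod_linA[OF ky]]
  note lp = lin_simps[OF lin_prt] lin_simps[OF lin_sd]
  show "cone_iso \<in> cyc 0 (dgfam evK) ?T"
  proof (rule cycI2[where u=u])
    show "cone_iso \<in> hom 0 (dgfam evK) ?T"
    proof (rule homI2[where u=u])
      fix n
      have lsl: "lin (\<lambda>x. third r (sl (3 * evN) x))" for r by (rule lin_comp[OF lin_prt lin_sl])
      show "lin (cone_iso n u)" unfolding cone_iso_simps[abs_def] by (intro lin_pr lsl lin_sr)
      show "lin (cone_iso n (opp u))" unfolding cone_iso_simps[abs_def] by (intro lin_pr lin_comp[OF lin_sd lsl] lin_sr)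
      fix x
      {
        assume x: "x \<in> V (dgfam evK) n u"
        show "cone_iso n u x \<in> V ?T (n + 0) u" using bij[OF x] by (simp del: TT_simps cone_iso_simps dgfam_simps)
        define s where "s = sl (3 * evN) x"
        have s: "s \<in> V (dgfam evE) (n + 1) u" using x unfolding K_facts(1) s_def by blast
        have As: "A (dgfam evE) u s \<in> V (dgfam evE) (n + 1 + 1) (opp u)" by (rule kmod_A[OF kmod_dgfam[OF E_facts(2)] s])
        have "sdm (third 1 (- A (dgfam evE) u s)) = third 0 s"
          using s[unfolded E_u] unfolding fps_eq_iff
          by (auto simp: lp third_E Hsp_def simp del: dgfam_simps) 
        then show "cone_iso (n + 1) (opp u) (A (dgfam evK) u x) = sgn_pow 0 \<star> A ?T u (cone_iso n u x)"
          using slE[OF As] by (simp add: K_facts(2) lin_simps[OF lin_sl] s_def del: dgfam_simps)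
      next
        assume x: "x \<in> V (dgfam evK) n (opp u)"
        show "cone_iso n (opp u) x \<in> V ?T (n + 0) (opp u)" using bij[OF x] by (simp del: TT_simps cone_iso_simps dgfam_simps)
        define s where "s = sl (3 * evN) x"
        have s: "s \<in> V (dgfam evE) (n + 1) (opp u)" using x unfolding K_facts(1) s_def by blast
        have As: "A (dgfam evE) (opp u) s \<in> V (dgfam evE) (n + 1 + 1) u" using kmod_A'[OF kmod_dgfam[OF E_facts(2)] s] .
        have Au: "third 0 (A (dgfam evE) (opp u) s) = 0"
          using As[unfolded E_u] third_E(3)[of _ s] unfolding fps_eq_iff by (force simp: Hsp_def simp del: dgfam_simps)
        have "third 2 (A (dgfam evE) (opp u) s) \<in> Hsp (n + 1 + 1 - 2)" using As unfolding E_u by blast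
        note A0 = H_ge[OF this]
        have "third 2 (- A (dgfam evE) (opp u) s) = sdm (third 1 s)"
        proof (rule fps_ext)
          fix i show "fps_nth (third 2 (- A (dgfam evE) (opp u) s)) i = fps_nth (sdm (third 1 s)) i"
            using A0[of i] third_E(2)[of i s] by (cases "i < evN") (simp_all del: dgfam_simps)
        qed
        then show "cone_iso (n + 1) u (A (dgfam evK) (opp u) x) = sgn_pow 0 \<star> A ?T (opp u) (cone_iso n (opp u) x)"
          using slE[OF As] Au by (simp add: K_facts(2) lin_simps[OF lin_sl] lp s_def del: dgfam_simps)
      }
    qed
    fix n x
    have sl0: "sl m 0 = 0" for m by (simp add: lin_0[OF lin_sl])
    {
      assume x: "x \<in> V (dgfam evK) n u"
      define s where "s = sl (3 * evN) x"
      have s: "s \<in> V (dgfam evE) (n + 1) u" using x unfolding K_facts(1) s_def by blast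
      have "matop (ev_map y fs) s = (\<Sum>i<evN. fps_nth (third 0 s) i \<star> zeta i + AA u (dgfam y) (fps_nth (third 2 s) i \<star> zeta i))"
        unfolding ev_facts(2) by (rule sum.cong[OF refl], subst f_blk(4)[OF _ s]) (auto simp: blk_def lA simp del: dgfam_simps)
      also have "\<dots> = cmap (n + 1) (third 0 s) + AA u (dgfam y) (cmap (n - 1) (third 2 s))"
        unfolding cmap_def sum.distrib by (simp add: lin_sum[OF lin_AA[OF ky]] del: dgfam_simps)
      finally show "cone_iso (n + 1) u (D (dgfam evK) n u x) = sgn_pow 0 \<star> D ?T (n + 0) u (cone_iso n u x)"
        by (simp add: K_facts(3) sl0 lp s_def del: dgfam_simps)
    next
      assume x: "x \<in> V (dgfam evK) n (opp u)"
      define s where "s = sl (3 * evN) x"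
      have s: "s \<in> V (dgfam evE) (n + 1) (opp u)" using x unfolding K_facts(1) s_def by blast
      have "matop (ev_map y fs) s = (\<Sum>i<evN. - A (dgfam y) u (fps_nth (sdm (third 1 s)) i \<star> zeta i))"
        unfolding ev_facts(2) by (rule sum.cong[OF refl], subst f_blk(4)[OF _ s]) (auto simp: blk_def lA mult.commute simp del: dgfam_simps)
      also have "\<dots> = - A (dgfam y) u (cmap n (sdm (third 1 s)))"
        unfolding cmap_def by (simp add: lin_sum[OF kmod_linA[OF ky]] lA sum_negf del: dgfam_simps)
      finally show "cone_iso (n + 1) (opp u) (D (dgfam evK) n (opp u) x) = sgn_pow 0 \<star> D ?T (n + 0) (opp u) (cone_iso n (opp u) x)"
        by (simp add: K_facts(3) sl0 lp s_def del: dgfam_simps)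
    }
  qed
qed

end

text \<open>The equivalences \<open>heq_K\<close> and \<open>heq_H\<close> combine; the basis chosen
  inside \<open>twist\<close> disappears up to homotopy.\<close>

lemma twist_facts: assumes y: "dg_module (y :: 'k::field dgmod)"
  shows "dg_module (twist (Pmod u) y)" "heq 0 (dgfam (twist (Pmod u) y)) (Tw u (dgfam y))" "y \<in> Cat \<Longrightarrow> twist (Pmod u) y \<in> Cat"
proof -
  define fs where "fs = (SOME fs. hom_basis (Pmod u) y fs)"
  have fs: "hom_basis (Pmod u) y fs" unfolding fs_def by (rule someI_ex[OF ex_hom_basis[OF dg_module_Pmod y]])
  have t: "twist (Pmod u) y = mcone (ev_source (Pmod u) fs) y (ev_map y fs)" by (simp add: twist_def fs_def Let_def)
  note ev = ev_dg_hom[OF y fs] and E = E_facts(1,2)[OF y fs]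
  show d: "dg_module (twist (Pmod u) y)" unfolding t by (rule dg_module_mcone[OF E(2) y ev])
  show "y \<in> Cat \<Longrightarrow> twist (Pmod u) y \<in> Cat" unfolding t by (intro Cat.Cat_cone E ev)
  note ky = kmod_dgfam[OF y]
  show "heq 0 (dgfam (twist (Pmod u) y)) (Tw u (dgfam y))"
    using heq_trans[OF kmod_dgfam[OF d] kmod_TT[OF ky cpx_H[OF y fs]] kmod_Tw[OF ky] heq_K[OF y fs, folded t] heq_H[OF y fs]] by simp
qed

section \<open>Classes of spherical objects\<close>

lemma quot_basis_coord:
  assumes "sub Z" and g: "bij_betw g {..<r} I" and iso: "\<And>x. x \<in> Z \<longleftrightarrow> (\<forall>k. fps_nth x k \<noteq> 0 \<longrightarrow> k \<in> I)"
  shows "quot_basis (\<star>) Z {0} (\<lambda>k. unit (g k)) r"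
  unfolding quot_basis_def
proof (intro conjI ballI allI impI)
  have s: "fps_nth (\<Sum>k<r. c k \<star> unit (g k)) j = (\<Sum>k<r. if g k = j then c k else 0)" for c j
    by (auto simp: fps_sum_nth intro!: sum.cong)
  have sg: "fps_nth (\<Sum>k<r. c k \<star> unit (g k)) (g i) = c i" if "i < r" for c i
  proof -
    have "(\<Sum>k<r. if g k = g i then c k else 0) = (\<Sum>k<r. if k = i then c k else 0)"
      using bij_betw_imp_inj_on[OF g] that by (intro sum.cong) (auto dest: inj_onD)
    then show ?thesis unfolding s using that by simp
  qed
  show "unit (g i) \<in> Z" if "i < r" for i using bij_betwE[OF g] that by (auto simp: iso)
  show "\<exists>c. f - (\<Sum>k<r. c k \<star> unit (g k)) \<in> {0}" if "f \<in> Z" for f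
  proof (intro exI[of _ "\<lambda>k. fps_nth f (g k)"])
    have "fps_nth f j = fps_nth (\<Sum>k<r. fps_nth f (g k) \<star> unit (g k)) j" for j
    proof (cases "j \<in> I")
      case True
      then obtain i where "i < r" "j = g i" using g unfolding bij_betw_def by blast
      then show ?thesis by (simp add: sg)
    next
      case False
      then have "fps_nth f j = 0" using that iso by blast
      moreover have "(if g k = j then c k else 0) = 0" if "k < r" for k c using bij_betwE[OF g] that False by auto
      ultimately show ?thesis unfolding s by (simp add: sum.neutral)
    qed
    then have "f = (\<Sum>k<r. fps_nth f (g k) \<star> unit (g k))" by (rule fps_ext)
    then show "f - (\<Sum>k<r. fps_nth f (g k) \<star> unit (g k)) \<in> {0}" by simp
  qed
  fix c i assume "(\<Sum>k<r. c k \<star> unit (g k)) \<in> {0}" "i < r"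
  then show "c i = 0" using sg[of i c] by simp
qed

lemma ex_quot_basis_coord: assumes "finite I" and iso: "\<And>x. x \<in> Z \<longleftrightarrow> (\<forall>k. fps_nth x k \<noteq> 0 \<longrightarrow> k \<in> I)"
  shows "\<exists>b. quot_basis (\<star>) Z {0::'k::field U} b (card I)"
proof -
  obtain g where "bij_betw g {..<card I} I" using ex_bij_betw_nat_finite[OF assms(1)] by (auto simp: atLeast0LessThan)
  moreover have "sub Z" by (auto simp: sub_def iso) (metis add.right_neutral)+
  ultimately show ?thesis using quot_basis_coord[OF _ _ iso] by blast
qed

lemma hdim_Pmod_coord: assumes M: "kmod M" and D: "\<And>x. x \<in> V M m u \<Longrightarrow> D M m u x = 0" "\<And>x. x \<in> V M (m - 1) u \<Longrightarrow> D M (m - 1) u x = 0"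
    and iso: "finite I" "\<And>x. x \<in> V M m u \<longleftrightarrow> (\<forall>k. fps_nth x k \<noteq> 0 \<longrightarrow> k \<in> I)"
  shows "hdim m (dgfam (Pmod u)) (M :: 'k::field kmod) (card I)"
proof -
  have "ker M m u = V M m u" using D(1) by (auto simp: ker_def)
  moreover have "im M m u = {0}" using D(2) sub_0[OF kmod_sub[OF M]] by (auto simp: im_def image_iff intro!: bexI[of _ 0])
  ultimately show ?thesis using ex_quot_basis_coord[OF iso] quot_basis_hdim[OF M] by metis
qed

lemma V_Pmod_coord: "x \<in> V (dgfam (Pmod w :: 'k::field dgmod)) n u \<longleftrightarrow>
   (\<forall>k. fps_nth x k \<noteq> 0 \<longrightarrow> k \<in> (if w = u then (if n = 0 then {0} else if n = 2 then {2} else {}) else if n = 1 then {1} else {}))"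
proof -
  have "x = t3 (fps_nth x 0) 0 (fps_nth x 2) \<and> (fps_nth x 0 \<noteq> 0 \<longrightarrow> n = 0) \<and> (fps_nth x 2 \<noteq> 0 \<longrightarrow> n = 2) \<Longrightarrow> x \<in> V (dgfam (Pmod u :: 'k dgmod)) n u"
    "x = t3 0 (fps_nth x 1) 0 \<and> (fps_nth x 1 \<noteq> 0 \<longrightarrow> n = 1) \<Longrightarrow> x \<in> V (dgfam (Pmod w :: 'k dgmod)) n (opp w)"
    unfolding V_Pmod by blast+
  moreover have "x = t3 (fps_nth x 0) 0 (fps_nth x 2)" if "\<forall>k. fps_nth x k \<noteq> 0 \<longrightarrow> k \<in> (if n = 0 then {0} else if n = 2 then {2} else {})"
    using that by (intro fps_ext) (auto split: if_splits)
  moreover have "x = t3 0 (fps_nth x 1) 0" if "\<forall>k. fps_nth x k \<noteq> 0 \<longrightarrow> k \<in> (if n = 1 then {1} else {})"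
    using that by (intro fps_ext) (auto split: if_splits)
  moreover have "\<forall>k. fps_nth x k \<noteq> 0 \<longrightarrow> k \<in> (if n = 0 then {0} else if n = 2 then {2} else {})" if "x \<in> V (dgfam (Pmod u :: 'k dgmod)) n u"
    using that unfolding V_Pmod by (auto split: if_splits)
  moreover have "\<forall>k. fps_nth x k \<noteq> 0 \<longrightarrow> k \<in> (if n = 1 then {1} else {})" if "x \<in> V (dgfam (Pmod w :: 'k dgmod)) n (opp w)"
    using that unfolding V_Pmod by (auto split: if_splits)
  moreover have "\<forall>k. fps_nth x k \<noteq> 0 \<longrightarrow> k \<in> (if n = 0 then {0} else if n = 2 then {2} else {}) \<Longrightarrow> (fps_nth x 0 \<noteq> 0 \<longrightarrow> n = 0) \<and> (fps_nth x 2 \<noteq> 0 \<longrightarrow> n = 2)"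
    "\<forall>k. fps_nth x k \<noteq> 0 \<longrightarrow> k \<in> (if n = 1 then {1} else {}) \<Longrightarrow> fps_nth x 1 \<noteq> 0 \<longrightarrow> n = 1"
    by (force split: if_splits)+
  ultimately have "x \<in> V (dgfam (Pmod u :: 'k dgmod)) n u \<longleftrightarrow> (\<forall>k. fps_nth x k \<noteq> 0 \<longrightarrow> k \<in> (if n = 0 then {0} else if n = 2 then {2} else {}))"
    "x \<in> V (dgfam (Pmod w :: 'k dgmod)) n (opp w) \<longleftrightarrow> (\<forall>k. fps_nth x k \<noteq> 0 \<longrightarrow> k \<in> (if n = 1 then {1} else {}))"
    by blast+
  note e = this
  show ?thesis
  proof (cases "w = u")
    case True
    then show ?thesis using e(1) by (simp only: if_True simp_thms)
  next
    case False
    then have "opp w = u" using vertex_cases[of u w] by blast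
    then show ?thesis using e(2) False by (simp only: if_False simp_thms)
  qed
qed

text \<open>The differential vanishes, and the paths of length \<open>n\<close> from
  \<open>w\<close> to \<open>u\<close> form a basis of the morphisms of degree
  \<open>n\<close>.\<close>

lemma hdim_Pmod: "hdim n (dgfam (Pmod u)) (dgfam (Pmod w :: 'k::field dgmod)) (if w = u then (if n = 0 \<or> n = 2 then 1 else 0) else if n = 1 then 1 else 0)"
proof -
  let ?I = "if w = u then (if n = 0 then {0} else if n = 2 then {2} else {}) else if n = 1 then {1} else {} :: nat set"
  have "hdim n (dgfam (Pmod u)) (dgfam (Pmod w :: 'k dgmod)) (card ?I)"
    by (rule hdim_Pmod_coord[OF dgfam_Pmod]) (simp_all add: V_Pmod_coord Pmod_simps(2) del: dgfam_simps(1))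
  moreover have "card ?I = (if w = u then (if n = 0 \<or> n = 2 then 1 else 0) else if n = 1 then 1 else 0)" by simp
  ultimately show ?thesis by simp
qed

lemma sph_hdim_Pmod: "sph_hdim (dgfam (Pmod u :: 'k::field dgmod))"
  unfolding sph_hdim_def
proof
  fix n show "hdim n (dgfam (Pmod u)) (dgfam (Pmod u :: 'k dgmod)) (if n = 0 \<or> n = 2 then 1 else 0)"
    using hdim_Pmod[of n u u, where 'k='k] by (simp only: simp_thms if_True)
qed

text \<open>The twist in \<open>P\<close> shifts \<open>P\<close> itself: the summands \<open>P\<close> and one of the two copies of \<open>P\<close> in the source
  of the evaluation map cancel.\<close>

lemma heq_Tw_Pmod: "heq 1 (dgfam (Pmod u :: 'k::field dgmod)) (Tw u (dgfam (Pmod u)))"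
proof -
  let ?P = "dgfam (Pmod u :: 'k dgmod)" and ?T = "Tw u (dgfam (Pmod u :: 'k dgmod))"
  \<comment> \<open>The idempotent goes to \<open>loop \<otimes> 1 - 1 \<otimes> loop\<close>, which
    generates the kernel of evaluation \<open>P_u \<otimes> e_u P_u -> P_u\<close>, a copy of
    \<open>P_u\<close>.\<close>
  define f :: "'k fam" where "f = (\<lambda>n w x. if w = u then pr (pr (t3 0 0 (- fps_nth x 0)) (t3 (fps_nth x 0) 0 (- fps_nth x 2))) 0
    else pr (t3 0 0 (fps_nth x 1)) 0)"
  define g :: "'k fam" where "g = (\<lambda>n w x. if w = u then t3 (- fps_nth (p1 (p1 x)) 2) 0 (- fps_nth (p2 (p1 x)) 2)
    else t3 0 (fps_nth (p1 x) 2) 0)"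
  define h :: "'k fam" where "h = (\<lambda>n w x. if w = u then pr (pr (t3 (- fps_nth (p2 x) 0) 0 0) (t3 (- fps_nth (p2 x) 2) 0 0)) 0
    else pr (t3 (fps_nth (p2 x) 1) 0 0) 0)"
  have fs [simp]: "f n u x = pr (pr (t3 0 0 (- fps_nth x 0)) (t3 (fps_nth x 0) 0 (- fps_nth x 2))) 0" "f n (opp u) x = pr (t3 0 0 (fps_nth x 1)) 0"
    "g n u x = t3 (- fps_nth (p1 (p1 x)) 2) 0 (- fps_nth (p2 (p1 x)) 2)" "g n (opp u) x = t3 0 (fps_nth (p1 x) 2) 0"
    "h n u x = pr (pr (t3 (- fps_nth (p2 x) 0) 0 0) (t3 (- fps_nth (p2 x) 2) 0 0)) 0" "h n (opp u) x = pr (t3 (fps_nth (p2 x) 1) 0 0) 0" for n x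
    by (simp_all add: f_def g_def h_def)
  have Vu: "x \<in> V ?P n u \<longleftrightarrow> (\<forall>k. fps_nth x k \<noteq> 0 \<longrightarrow> k = 0 \<and> n = 0 \<or> k = 2 \<and> n = 2)"
    and Vo: "x \<in> V ?P n (opp u) \<longleftrightarrow> (\<forall>k. fps_nth x k \<noteq> 0 \<longrightarrow> k = 1 \<and> n = 1)" for x n
    unfolding V_Pmod_coord by auto
  have lt: "t3 a b c + t3 a' b' c' = t3 (a + a') (b + b') (c + c')" "k \<star> t3 a b c = t3 (k * a) (k * b) (k * c)"
     "t3 a b c - t3 a' b' c' = t3 (a - a') (b - b') (c - c')" "- t3 a b c = t3 (- a) (- b) (- c)" for a b c a' b' c' k :: 'k
    by (auto simp: fps_eq_iff)
  have l: "lin (f n w)" "lin (g n w)" "lin (h n w)" for n w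
    by (auto simp: lin_def f_def g_def h_def lt)
  have z: "fps_nth x k = 0" if "x \<in> V ?P n u" "\<not> (k = 0 \<and> n = 0 \<or> k = 2 \<and> n = 2)" for x n k using that unfolding Vu by blast
  have zo: "fps_nth x k = 0" if "x \<in> V ?P n (opp u)" "\<not> (k = 1 \<and> n = 1)" for x n k using that unfolding Vo by blast
  have tu: "x = t3 (fps_nth x 0) 0 (fps_nth x 2)" if "x \<in> V ?P n u" for x n
    using z[OF that] by (auto simp: fps_eq_iff)
  have to: "x = t3 0 (fps_nth x 1) 0" if "x \<in> V ?P n (opp u)" for x n
    using zo[OF that] by (auto simp: fps_eq_iff)
  have fZ: "f \<in> cyc 1 ?P ?T"
  proof (rule cycI2[where u=u], rule homI2[where u=u])
    fix n x
    {
      assume x: "x \<in> V ?P n u"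
      show "f n u x \<in> V ?T (n + 1) u" using x by (auto simp: Vu simp del: dgfam_simps)
      show "f (n + 1) (opp u) (A ?P u x) = sgn_pow 1 \<star> A ?T u (f n u x)" by (simp add: lt del: dgfam_simps)
      show "f (n + 1) u (D ?P n u x) = sgn_pow 1 \<star> D ?T (n + 1) u (f n u x)" by (simp add: lt del: dgfam_simps)
    next
      assume x: "x \<in> V ?P n (opp u)"
      show "f n (opp u) x \<in> V ?T (n + 1) (opp u)" using x by (auto simp: Vu Vo simp del: dgfam_simps)
      show "f (n + 1) u (A ?P (opp u) x) = sgn_pow 1 \<star> A ?T (opp u) (f n (opp u) x)" by (simp add: lt del: dgfam_simps)
      show "f (n + 1) (opp u) (D ?P n (opp u) x) = sgn_pow 1 \<star> D ?T (n + 1) (opp u) (f n (opp u) x)" by (simp add: lt del: dgfam_simps)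
    }
  qed (rule l)+
  have gZ: "g \<in> cyc (- 1) ?T ?P"
  proof (rule cycI2[where u=u], rule homI2[where u=u])
    fix n x
    {
      assume x: "x \<in> V ?T n u"
      then have x': "p1 (p1 x) \<in> V ?P (n + 1) u" "p2 (p1 x) \<in> V ?P (n - 1) u" "p2 x \<in> V ?P n u" by simp_all
      show "g n u x \<in> V ?P (n + - 1) u" using x' by (auto simp: Vu simp del: dgfam_simps)
      show "g (n + 1) (opp u) (A ?T u x) = sgn_pow (- 1) \<star> A ?P u (g n u x)" by (simp add: lt del: dgfam_simps)
      show "g (n + 1) u (D ?T n u x) = sgn_pow (- 1) \<star> D ?P (n + - 1) u (g n u x)" by (simp add: lt del: dgfam_simps)
    next
      assume x: "x \<in> V ?T n (opp u)"
      then have x': "p1 x \<in> V ?P n u" "p2 x \<in> V ?P n (opp u)" by simp_all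
      show "g n (opp u) x \<in> V ?P (n + - 1) (opp u)" using x' by (auto simp: Vu Vo simp del: dgfam_simps)
      show "g (n + 1) u (A ?T (opp u) x) = sgn_pow (- 1) \<star> A ?P (opp u) (g n (opp u) x)" by (simp add: lt del: dgfam_simps)
      show "g (n + 1) (opp u) (D ?T n (opp u) x) = sgn_pow (- 1) \<star> D ?P (n + - 1) (opp u) (g n (opp u) x)" by (simp add: lt del: dgfam_simps)
    }
  qed (rule l)+
  have gf: "comp 1 g f - idf \<in> bdr 0 ?P ?P"
  proof (rule bdr_cong[OF bdr_0[OF dgfam_Pmod]])
    fix n w x assume x: "x \<in> V ?P n w"
    have "g n' w (f n w x) = x" for n'
    proof (cases "w = u")
      case True then show ?thesis using tu[of x n] x by (simp del: dgfam_simps)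
    next
      case False
      then have "w = opp u" using vertex_cases by blast
      then show ?thesis using to[of x n] x by (simp del: dgfam_simps)
    qed
    then show "(0 :: 'k fam) n w x = (comp 1 g f - idf) n w x" by (simp add: comp_def idf_def)
  qed
  have fg: "comp (- 1) f g - idf \<in> bdr 0 ?T ?T"
  proof (rule bdrI2[where u=u and s=h], rule homI2[where u=u])
    fix n x
    {
      assume x: "x \<in> V ?T n u"
      then have x': "p1 (p1 x) \<in> V ?P (n + 1) u" "p2 (p1 x) \<in> V ?P (n - 1) u" "p2 x \<in> V ?P n u" by simp_all
      show "h n u x \<in> V ?T (n + (0 - 1)) u" using x' by (auto simp: Vu simp del: dgfam_simps)
      show "h (n + 1) (opp u) (A ?T u x) = sgn_pow (0 - 1) \<star> A ?T u (h n u x)" by (simp add: lt del: dgfam_simps)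
      have e: "p1 (p1 x) = t3 (fps_nth (p1 (p1 x)) 0) 0 (fps_nth (p1 (p1 x)) 2)" "p2 (p1 x) = t3 (fps_nth (p2 (p1 x)) 0) 0 (fps_nth (p2 (p1 x)) 2)"
         "p2 x = t3 (fps_nth (p2 x) 0) 0 (fps_nth (p2 x) 2)"
        using tu x' by blast+
      show "(comp (- 1) f g - idf) n u x = D ?T (n + 0 - 1) u (h n u x) + sgn_pow 0 \<star> h (n + 1) u (D ?T n u x)"
      proof -
        have "x = pr (pr (p1 (p1 x)) (p2 (p1 x))) (p2 x)" by simp
        then obtain a b c d r s where x: "x = pr (pr (t3 a 0 b) (t3 c 0 d)) (t3 r 0 s)" using e by metis
        show ?thesis unfolding x by (simp add: comp_def idf_def lt del: dgfam_simps)
      qed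
    next
      assume x: "x \<in> V ?T n (opp u)"
      then have x': "p1 x \<in> V ?P n u" "p2 x \<in> V ?P n (opp u)" by simp_all
      show "h n (opp u) x \<in> V ?T (n + (0 - 1)) (opp u)" using x' by (auto simp: Vu Vo simp del: dgfam_simps)
      show "h (n + 1) u (A ?T (opp u) x) = sgn_pow (0 - 1) \<star> A ?T (opp u) (h n (opp u) x)" by (simp add: lt del: dgfam_simps)
      have e: "p1 x = t3 (fps_nth (p1 x) 0) 0 (fps_nth (p1 x) 2)" "p2 x = t3 0 (fps_nth (p2 x) 1) 0"
        using tu[OF x'(1)] to[OF x'(2)] .
      show "(comp (- 1) f g - idf) n (opp u) x = D ?T (n + 0 - 1) (opp u) (h n (opp u) x) + sgn_pow 0 \<star> h (n + 1) (opp u) (D ?T n (opp u) x)"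
      proof -
        have "x = pr (p1 x) (p2 x)" by simp
        then obtain a b c where x: "x = pr (t3 a 0 b) (t3 0 c 0)" using e by metis
        show ?thesis unfolding x by (simp add: comp_def idf_def lt del: dgfam_simps)
      qed
    }
  qed (rule l)+
  show ?thesis unfolding heq_def using fZ gZ gf fg by (intro bexI[of _ f] bexI[of _ g]) auto
qed

section \<open>Spherical classes through equivalence up to shift\<close>

definition heq_any :: "'k::field kmod \<Rightarrow> 'k kmod \<Rightarrow> bool" where "heq_any M N \<longleftrightarrow> (\<exists>j. heq j M N)"

lemma heq_any_refl: "kmod M \<Longrightarrow> heq_any M M" unfolding heq_any_def using heq_refl by blast
lemma heq_any_sym: "heq_any M N \<Longrightarrow> heq_any N M" unfolding heq_any_def using heq_sym by blast
lemma heq_any_trans: "heq_any M N \<Longrightarrow> heq_any N P \<Longrightarrow> kmod M \<Longrightarrow> kmod N \<Longrightarrow> kmod P \<Longrightarrow> heq_any M P"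
  unfolding heq_any_def using heq_trans by blast
lemma heq_any_Tw: "heq_any M N \<Longrightarrow> kmod M \<Longrightarrow> kmod N \<Longrightarrow> heq_any (Tw u M) (Tw u N)"
  unfolding heq_any_def using heq_Tw by blast
lemma heq_any_Ti: "heq_any M N \<Longrightarrow> kmod M \<Longrightarrow> kmod N \<Longrightarrow> heq_any (Ti u M) (Ti u N)"
  unfolding heq_any_def using heq_Ti by blast

lemma sph_objects_iff: "x \<in> sph_objects \<longleftrightarrow> x \<in> Cat \<and> sph_hdim (dgfam x)"
  unfolding sph_objects_def using spherical_sph_hdim sph_hdim_spherical Cat_dg_module by blast

lemma isom_heq_any: "dg_module x \<Longrightarrow> dg_module y \<Longrightarrow> (\<exists>j. isom y (shift j x)) \<longleftrightarrow> heq_any (dgfam y) (dgfam x)"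
  unfolding heq_any_def using isom_shift_heq by blast

lemma sph_dg: "x \<in> sph_objects \<Longrightarrow> dg_module x" "x \<in> sph_objects \<Longrightarrow> kmod (dgfam x)"
  using Cat_dg_module kmod_dgfam unfolding sph_objects_def by blast+

lemma sph_class_iff: "x \<in> sph_objects \<Longrightarrow> y \<in> sph_class x \<longleftrightarrow> y \<in> sph_objects \<and> heq_any (dgfam y) (dgfam x)"
  unfolding sph_class_def using isom_heq_any sph_dg by blast

lemma sph_class_eq: assumes "x \<in> sph_objects" "y \<in> sph_objects"
  shows "sph_class x = sph_class y \<longleftrightarrow> heq_any (dgfam x) (dgfam y)"
proof
  assume "sph_class x = sph_class y"
  moreover have "x \<in> sph_class x" using assms sph_class_iff heq_any_refl sph_dg by blast
  ultimately show "heq_any (dgfam x) (dgfam y)" using sph_class_iff assms by blast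
next
  assume "heq_any (dgfam x) (dgfam y)"
  note s = this heq_any_sym[OF this]
  note k = sph_dg(2)[OF assms(1)] sph_dg(2)[OF assms(2)]
  have "heq_any (dgfam z) (dgfam x) \<longleftrightarrow> heq_any (dgfam z) (dgfam y)" if "z \<in> sph_objects" for z
    using heq_any_trans[OF _ s(1) sph_dg(2)[OF that] k] heq_any_trans[OF _ s(2) sph_dg(2)[OF that] k(2,1)] by blast
  then show "sph_class x = sph_class y" using sph_class_iff assms by blast
qed

lemma rep_facts: assumes "X \<in> \<S>" shows "rep X \<in> sph_objects" "sph_class (rep X) = X"
proof -
  obtain x where x: "x \<in> sph_objects" "X = sph_class x" using assms unfolding \<S>_def by blast
  have "x \<in> X" using x sph_class_iff heq_any_refl sph_dg by blast
  then have "rep X \<in> X" unfolding rep_def by (rule someI)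
  then show r: "rep X \<in> sph_objects" using x sph_class_iff by blast
  show "sph_class (rep X) = X" unfolding x(2) using sph_class_eq[OF r x(1)] \<open>rep X \<in> X\<close> x sph_class_iff by blast
qed

abbreviation krep :: "'k::field dgmod set \<Rightarrow> 'k kmod" where "krep X \<equiv> dgfam (rep X)"

lemma krep: "X \<in> \<S> \<Longrightarrow> kmod (krep X)" using rep_facts sph_dg by blast

lemma \<S>_eq_iff: "X \<in> \<S> \<Longrightarrow> Y \<in> \<S> \<Longrightarrow> X = Y \<longleftrightarrow> heq_any (krep X) (krep Y)"
  using rep_facts sph_class_eq by metis

lemma class_in: assumes "x \<in> sph_objects" shows "sph_class x \<in> \<S>" "heq_any (krep (sph_class x)) (dgfam x)"
proof -
  show X: "sph_class x \<in> \<S>" using assms unfolding \<S>_def by blast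
  show "heq_any (krep (sph_class x)) (dgfam x)" using rep_facts[OF X] sph_class_eq assms by blast
qed

lemma Pmod_sph: "Pmod u \<in> sph_objects" using Cat.Cat_P sph_hdim_Pmod sph_objects_iff by blast

text \<open>Sphericity survives because \<open>Tw\<close> preserves the dimensions of all morphism
  spaces, and the cone stays in \<open>Cat\<close>.\<close>

lemma twist_class: assumes X: "X \<in> \<S>" shows "twist_class u X \<in> \<S>" "heq_any (krep (twist_class u X)) (Tw u (krep X))"
proof -
  note r = rep_facts(1)[OF X] note d = sph_dg(1)[OF r] note k = krep[OF X]
  note t = twist_facts[OF d, of u] note kt = kmod_dgfam[OF t(1)]
  have "sph_hdim (Tw u (krep X))" using sph_hdim_Tw[OF k] r sph_objects_iff by blast
  then have "sph_hdim (dgfam (twist (Pmod u) (rep X)))" using sph_hdim_heq[OF kmod_Tw[OF k] kt heq_sym[OF t(2)]] by simp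
  then have s: "twist (Pmod u) (rep X) \<in> sph_objects" using t(3) r sph_objects_iff by blast
  show "twist_class u X \<in> \<S>" unfolding twist_class_def by (rule class_in[OF s])
  show "heq_any (krep (twist_class u X)) (Tw u (krep X))"
    using class_in(2)[OF s] t(2) kt kmod_Tw[OF k] krep[OF class_in(1)[OF s]] unfolding twist_class_def
    by (meson heq_any_trans heq_any_def)
qed

section \<open>Total dimensions of morphism spaces\<close>

definition hom_total :: "'k::field dgmod \<Rightarrow> 'k dgmod \<Rightarrow> nat" where
  "hom_total a x = (\<Sum>n | vectorspace.dim class_ring (Hom_deg n a x) \<noteq> 0. vectorspace.dim class_ring (Hom_deg n a x))"

text \<open>A constant offset in degree only reindexes the sum, so totals are insensitive to shifts
  of either argument.\<close>

lemma hom_total_eqI: assumes "dg_module a" "dg_module x" and h: "\<And>n. hdim (n + k) (dgfam a) (dgfam x) (d n)"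
  shows "hom_total a x = (\<Sum>n | d n \<noteq> 0. d n)"
proof -
  have e: "vectorspace.dim class_ring (Hom_deg (n + k) a x) = d n" for n by (rule hdim_dim[OF assms(1,2) h])
  have e': "vectorspace.dim class_ring (Hom_deg n a x) = d (n - k)" for n using e[of "n - k"] by simp
  have "bij_betw (\<lambda>n. n + k) {n. d n \<noteq> 0} {n. d (n - k) \<noteq> 0}"
    by (rule bij_betwI[where g="\<lambda>n. n - k"]) auto
  from sum.reindex_bij_betw[OF this, of "\<lambda>n. d (n - k)"] show ?thesis unfolding hom_total_def e' by simp
qed

lemma hom_total_cong: assumes "dg_module (a :: 'k::field dgmod)" "dg_module (x :: 'k dgmod)" "dg_module (a' :: 'k dgmod)" "dg_module (x' :: 'k dgmod)"
    and h: "\<And>n r. hdim n (dgfam a) (dgfam x) r \<Longrightarrow> hdim (n + k) (dgfam a') (dgfam x') r"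
  shows "hom_total a x = hom_total a' x'"
proof -
  obtain d where d: "\<And>n. hdim n (dgfam a) (dgfam x) (d n)" using ex_hdim[OF assms(1,2)] by metis
  show ?thesis using hom_total_eqI[OF assms(1,2), of 0 d] hom_total_eqI[OF assms(3,4), of k d] d h by simp
qed

lemma hom_total_heq_any: assumes "dg_module (a :: 'k::field dgmod)" "dg_module (x :: 'k dgmod)" "dg_module (a' :: 'k dgmod)" "dg_module (x' :: 'k dgmod)"
    and "heq_any (dgfam a) (dgfam a')" "heq_any (dgfam x) (dgfam x')"
  shows "hom_total a x = hom_total a' x'"
proof -
  obtain j j' where j: "heq j (dgfam a) (dgfam a')" "heq j' (dgfam x) (dgfam x')" using assms unfolding heq_any_def by blast
  note k = kmod_dgfam[OF assms(1)] kmod_dgfam[OF assms(2)] kmod_dgfam[OF assms(3)] kmod_dgfam[OF assms(4)]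
  show ?thesis
    by (rule hom_total_cong[OF assms(1-4), of "j' - j"])
      (use hdim_pre[OF k(1,3,4) j(1) hdim_post[OF k(1,2,4) j(2)]] in \<open>simp add: algebra_simps\<close>)
qed

lemma hom_total_Tw: assumes "dg_module (a :: 'k::field dgmod)" "dg_module (x :: 'k dgmod)" "dg_module (a' :: 'k dgmod)" "dg_module (x' :: 'k dgmod)"
    and "heq_any (dgfam a') (Tw u (dgfam a))" "heq_any (dgfam x') (Tw u (dgfam x))"
  shows "hom_total a' x' = hom_total a x"
proof -
  obtain j j' where j: "heq j (Tw u (dgfam a)) (dgfam a')" "heq j' (Tw u (dgfam x)) (dgfam x')"
    using assms heq_any_sym unfolding heq_any_def by blast
  note k = kmod_dgfam[OF assms(1)] kmod_dgfam[OF assms(2)] kmod_dgfam[OF assms(3)] kmod_dgfam[OF assms(4)]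
  note kT = kmod_Tw[OF k(1), of u] kmod_Tw[OF k(2), of u]
  have "hom_total a x = hom_total a' x'"
    by (rule hom_total_cong[OF assms(1-4), of "j' - j"])
      (use hdim_pre[OF kT(1) k(3,4) j(1) hdim_post[OF kT k(4) j(2) hdim_Tw[OF k(1,2)]]] in \<open>simp add: algebra_simps\<close>)
  then show ?thesis by simp
qed

definition hom_cls :: "'k::field dgmod set \<Rightarrow> 'k dgmod set \<Rightarrow> nat" where
  "hom_cls X Y = hom_bar (rep X) (rep Y)"

text \<open>The case distinction in \<open>hom_bar\<close>, isomorphism up to shift, becomes
  equality of classes.\<close>

lemma hom_cls_eq: assumes "X \<in> \<S>" "Y \<in> \<S>" shows "hom_cls X Y = (if X = Y then 0 else hom_total (rep X) (rep Y))"
proof -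
  have "(\<exists>j. isom (rep Y) (shift j (rep X))) \<longleftrightarrow> Y = X"
    using isom_heq_any[of "rep X" "rep Y"] \<S>_eq_iff[OF assms(2,1)] rep_facts(1) sph_dg assms by blast
  then show ?thesis unfolding hom_cls_def hom_bar_def hom_total_def by auto
qed

section \<open>Explicit models\<close>

text \<open>A pair in \<open>I\<close> consists of a degree and an index, so \<open>coord I\<close>
  is a graded space of total dimension \<open>card I\<close> whenever \<open>I\<close> is
  finite.\<close>

definition coord :: "(int \<times> nat) set \<Rightarrow> int \<Rightarrow> 'k::field U set" where
  "coord I n = {x. \<forall>k. fps_nth x k \<noteq> 0 \<longrightarrow> (n, k) \<in> I}"

text \<open>The index set of a direct sum under the pairing \<open>pr\<close>: even places for the
  first summand, odd ones for the second, with degrees moved by \<open>s\<close> and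
  \<open>t\<close>.\<close>

definition interleave :: "int \<Rightarrow> int \<Rightarrow> (int \<times> nat) set \<Rightarrow> (int \<times> nat) set \<Rightarrow> (int \<times> nat) set" where
  "interleave s t I J = (\<lambda>(n, k). (n + s, 2 * k)) ` I \<union> (\<lambda>(n, k). (n + t, 2 * k + 1)) ` J"

lemma interleave_iff: "(n, 2 * k) \<in> interleave s t I J \<longleftrightarrow> (n - s, k) \<in> I" "(n, Suc (2 * k)) \<in> interleave s t I J \<longleftrightarrow> (n - t, k) \<in> J"
proof -
  have "(n, 2 * k) = (m + s, 2 * l) \<longleftrightarrow> m = n - s \<and> l = k" "(n, 2 * k) \<noteq> (m + t, 2 * l + 1)"
    "(n, Suc (2 * k)) = (m + t, 2 * l + 1) \<longleftrightarrow> m = n - t \<and> l = k" "(n, Suc (2 * k)) \<noteq> (m + s, 2 * l)" for m l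
    by (auto, presburger+)
  then show "(n, 2 * k) \<in> interleave s t I J \<longleftrightarrow> (n - s, k) \<in> I" "(n, Suc (2 * k)) \<in> interleave s t I J \<longleftrightarrow> (n - t, k) \<in> J"
    unfolding interleave_def by (auto simp: image_iff case_prod_unfold) (metis prod.collapse fst_conv snd_conv)+
qed

lemma card_jn: assumes "finite I" "finite J" shows "finite (interleave s t I J)" "card (interleave s t I J) = card I + card J"
proof -
  show "finite (interleave s t I J)" unfolding interleave_def using assms by blast
  have "inj_on (\<lambda>(n, k). (n + s, 2 * k)) I" "inj_on (\<lambda>(n, k). (n + t, 2 * k + 1)) J" by (auto simp: inj_on_def)
  moreover have "(\<lambda>(n, k). (n + s, 2 * k)) ` I \<inter> (\<lambda>(n, k). (n + t, 2 * k + 1)) ` J = {}"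
    by (auto, presburger)
  ultimately show "card (interleave s t I J) = card I + card J"
    unfolding interleave_def using assms by (simp add: card_Un_disjoint card_image)
qed

lemma coord_jn: "w \<in> coord (interleave s t I J) n \<longleftrightarrow> p1 w \<in> coord I (n - s) \<and> p2 w \<in> coord J (n - t)"
proof -
  have "(\<forall>k. P k) \<longleftrightarrow> (\<forall>k. P (2 * k)) \<and> (\<forall>k. P (Suc (2 * k)))" for P :: "nat \<Rightarrow> bool"
    by (metis even_Suc_div_two odd_Suc_div_two dvd_mult_div_cancel evenE oddE Suc_eq_plus1)
  from this[of "\<lambda>k. fps_nth w k \<noteq> 0 \<longrightarrow> (n, k) \<in> interleave s t I J"] show ?thesis
    by (simp add: coord_def interleave_iff p1_def p2_def)
qed

lemma sub_coord: "sub (coord I n)" by (auto simp: sub_def coord_def) (metis add.right_neutral)+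

text \<open>The right inverse is asked for only when \<open>a > 0\<close>: for \<open>P_2\<close>
  itself both \<open>X\<close> and \<open>K\<close> vanish, and nothing maps onto
  \<open>Y\<close>.\<close>

definition has_model :: "nat \<Rightarrow> nat \<Rightarrow> 'k::field kmod \<Rightarrow> bool" where
  "has_model a c y \<longleftrightarrow> (\<exists>I J L B K \<mu>. finite I \<and> finite J \<and> card I = a \<and> card J = c \<and> mdl (coord I) (coord J) L B K \<and>
     linv (coord I) (coord J) L B \<mu> \<and> (a > 0 \<longrightarrow> (\<exists>\<nu>. rinv (coord I) (coord J) B K \<nu>)) \<and> heq_any y (Model V1 (coord I) (coord J) L B K))"

lemma has_modelI: assumes "finite I" "finite J" "card I = a" "card J = c" "mdl (coord I) (coord J) L B K"
     "linv (coord I) (coord J) L B \<mu>" "a > 0 \<Longrightarrow> rinv (coord I) (coord J) B K \<nu>" "heq_any y (Model V1 (coord I) (coord J) L B K)"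
  shows "has_model a c (y :: 'k::field kmod)"
  unfolding has_model_def
  by (rule exI[of _ I], rule exI[of _ J], rule exI[of _ L], rule exI[of _ B], rule exI[of _ K], rule exI[of _ \<mu>])
    (use assms in auto)

lemma XT_coord: "XT (coord I) (coord J) = (coord (interleave 1 0 I J) :: int \<Rightarrow> 'k::field U set)"
  by (rule ext, rule equalityI; rule subsetI; simp add: coord_jn)

lemma YI_coord: "YI (coord I) (coord J) = (coord (interleave 0 (- 1) I J) :: int \<Rightarrow> 'k::field U set)"
  by (rule ext, rule equalityI; rule subsetI; simp add: coord_jn)

text \<open>The twist adds \<open>c\<close> copies of \<open>P_1\<close>, keeps the left inverse and
  supplies a right inverse even if the old model had none.\<close>

lemma has_model_Tw: assumes "has_model a c y" "kmod y" "kmod y'" "heq_any y' (Tw V1 y)" shows "has_model (a + c) c (y' :: 'k::field kmod)"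
proof -
  obtain I J L B K \<mu> where m: "finite I" "finite J" "card I = a" "card J = c" "mdl (coord I) (coord J) L B K"
     "linv (coord I) (coord J) L B \<mu>" "heq_any y (Model V1 (coord I) (coord J) L B K)" using assms(1) unfolding has_model_def by blast
  note k = kmod_Model[OF m(5), of V1]
  have mT: "mdl (coord (interleave 1 0 I J)) (coord J) (LT L B) BT K" using mdl_T[OF m(5)] by (simp add: XT_coord)
  have "heq_any (Tw V1 (Model V1 (coord I) (coord J) L B K)) (Model V1 (coord (interleave 1 0 I J)) (coord J) (LT L B) BT K)"
    using heq_Tw_Model[OF m(5,6), of V1] unfolding heq_any_def XT_coord by blast
  moreover have "heq_any (Tw V1 y) (Tw V1 (Model V1 (coord I) (coord J) L B K))" by (rule heq_any_Tw[OF m(7) assms(2) k])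
  ultimately have s: "heq_any y' (Model V1 (coord (interleave 1 0 I J)) (coord J) (LT L B) BT K)"
    using heq_any_trans assms(2-4) kmod_Tw[OF assms(2)] kmod_Tw[OF k] kmod_Model[OF mT] by metis
  show ?thesis
    by (rule has_modelI[OF _ m(2) _ m(4) mT linv_T[OF m(5,6), unfolded XT_coord] rinv_T[OF m(5), unfolded XT_coord] s])
      (simp_all add: card_jn[OF m(1,2)] m)
qed

text \<open>The unit recovers \<open>y\<close> from its twist by the inverse twist, whose effect on
  models is known; the splitting it requires is available because \<open>a > 0\<close>.\<close>

lemma has_model_Ti: assumes "has_model a c y0" "a > 0" "kmod y0" "kmod y" "heq_any y0 (Tw V2 y)"
  obtains I J L B K \<mu> \<nu> where "finite I" "finite J" "card I = a" "card J = c" "mdl (coord I) (coord J) L B K"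
     "rinv (coord I) (coord J) B K \<nu>" "heq_any y (Model V1 (coord I) (coord (interleave 0 (- 1) I J)) L BI (KI B (K :: int \<Rightarrow> 'k::field U \<Rightarrow> 'k U)))"
proof -
  obtain I J L B K \<mu> \<nu> where m: "finite I" "finite J" "card I = a" "card J = c" "mdl (coord I) (coord J) L B K"
     "rinv (coord I) (coord J) B K \<nu>" "heq_any y0 (Model V1 (coord I) (coord J) L B (K :: int \<Rightarrow> 'k U \<Rightarrow> 'k U))" using assms(1,2) unfolding has_model_def by blast
  note k = kmod_Model[OF m(5), of V1] and kI = kmod_Model[OF mdl_I[OF m(5)], of V1, unfolded YI_coord]
  have "heq_any (Ti V2 (Model V1 (coord I) (coord J) L B K)) (Model V1 (coord I) (coord (interleave 0 (- 1) I J)) L BI (KI B K))"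
    using heq_Ti_Model[OF m(5,6), of V1] unfolding heq_any_def YI_coord by auto
  moreover have "heq_any (Ti V2 y0) (Ti V2 (Model V1 (coord I) (coord J) L B K))" by (rule heq_any_Ti[OF m(7) assms(3) k])
  moreover have "heq_any (Ti V2 (Tw V2 y)) (Ti V2 y0)" by (rule heq_any_Ti[OF heq_any_sym[OF assms(5)] kmod_Tw[OF assms(4)] assms(3)])
  moreover have "heq_any y (Ti V2 (Tw V2 y))" unfolding heq_any_def using heq_Ti_Tw[OF assms(4)] by blast
  ultimately have "heq_any y (Model V1 (coord I) (coord (interleave 0 (- 1) I J)) L BI (KI B K))"
    using heq_any_trans assms(3,4) kmod_Tw[OF assms(4)] kmod_Ti[OF kmod_Tw[OF assms(4)]] kmod_Ti[OF assms(3)] kmod_Ti[OF k] kI by metis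
  then show ?thesis using that m by blast
qed

lemma has_model_I: assumes "has_model a c y0" "a > 0" "kmod y0" "kmod y" "heq_any y0 (Tw V2 y)"
  shows "has_model a (a + c) (y :: 'k::field kmod)"
proof -
  from assms obtain I J L B K \<nu> where m: "finite I" "finite J" "card I = a" "card J = c" "mdl (coord I) (coord J) L B K"
     "rinv (coord I) (coord J) B K \<nu>" "heq_any y (Model V1 (coord I) (coord (interleave 0 (- 1) I J)) L BI (KI B (K :: int \<Rightarrow> 'k U \<Rightarrow> 'k U)))"
    by (rule has_model_Ti)
  have mI: "mdl (coord I) (coord (interleave 0 (- 1) I J)) L BI (KI B K)" using mdl_I[OF m(5)] by (simp add: YI_coord)
  show ?thesis
    by (rule has_modelI[OF m(1) _ m(3) _ mI linv_I[OF m(5), unfolded YI_coord] rinv_I[OF m(5,6), unfolded YI_coord] m(7)])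
      (simp_all add: card_jn[OF m(1,2)] m)
qed

lemma sum_card_fibres: assumes "finite (I :: (int \<times> nat) set)" shows "(\<Sum>n | card {k. (n, k) \<in> I} \<noteq> 0. card {k. (n, k) \<in> I}) = card I"
proof -
  have f: "finite {k. (n, k) \<in> I}" for n by (rule finite_subset[of _ "snd ` I"]) (use assms in force)+
  have "card I = card (SIGMA n:fst ` I. {k. (n, k) \<in> I})" by (rule arg_cong[of _ _ card]) force
  also have "\<dots> = (\<Sum>n\<in>fst ` I. card {k. (n, k) \<in> I})" using assms f by (simp add: card_SigmaI)
  also have "\<dots> = (\<Sum>n | card {k. (n, k) \<in> I} \<noteq> 0. card {k. (n, k) \<in> I})"
    by (rule sum.mono_neutral_right) (use assms f in \<open>auto intro: rev_image_eqI\<close>)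
  finally show ?thesis by simp
qed

text \<open>Morphisms from \<open>P_1\<close> are the cohomology at \<open>V1\<close>. After the
  inverse twist the cycles are triples \<open>(x2, p, q)\<close> and the boundaries are
  \<open>(L x0, - x0, 0)\<close>. Hence \<open>p\<close> can be eliminated, and \<open>X\<close>
  moved by 2 degrees together with \<open>Y\<close> remains.\<close>

lemma hom_total_Ti: assumes "has_model a c y0" "a > 0" "kmod y0" "dg_module y" "heq_any y0 (Tw V2 (dgfam y))"
  shows "hom_total (Pmod V1 :: 'k::field dgmod) y = a + c"
proof -
  note ky = kmod_dgfam[OF assms(4)]
  from assms(1-3) ky assms(5) obtain I J L B K \<nu> where m: "finite I" "finite J" "card I = a" "card J = c" "mdl (coord I) (coord J) L B K"
     "rinv (coord I) (coord J) B K \<nu>" "heq_any (dgfam y) (Model V1 (coord I) (coord (interleave 0 (- 1) I J)) L BI (KI B (K :: int \<Rightarrow> 'k U \<Rightarrow> 'k U)))"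
    by (rule has_model_Ti)
  let ?M = "Model V1 (coord I) (coord (interleave 0 (- 1) I J)) L BI (KI B K)"
  let ?J = "interleave 2 0 I J"
  note kM = kmod_Model[OF mdl_I[OF m(5)], of V1, unfolded YI_coord]
  note fJ = card_jn[OF m(1,2), of 2 0]
  note mf = mdl_facts[OF m(5)]
  note cl = sub_closed[OF sub_coord]
  have "hdim n (dgfam (Pmod V1)) ?M (card {k. (n, k) \<in> ?J})" for n
  proof -
    have fin: "finite {k. (n, k) \<in> ?J}" by (rule finite_subset[of _ "snd ` ?J"]) (use fJ in force)+
    obtain b where q: "quot_basis (\<star>) (coord ?J n) {0::'k U} b (card {k. (n, k) \<in> ?J})"
      using ex_quot_basis_coord[OF fin, of "coord ?J n"] by (auto simp: coord_def)
    have "quot_basis (\<star>) (ker ?M n V1) (im ?M n V1) (\<lambda>i. pr 0 (pr (p1 (b i)) (pr 0 (p2 (b i))))) (card {k. (n, k) \<in> ?J})"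
    proof (rule quot_basis_transfer[OF q])
      have kerM: "x \<in> ker ?M n V1 \<longleftrightarrow> p1 x = 0 \<and> p1 (p2 x) \<in> coord I (n - 2) \<and> p1 (p2 (p2 x)) \<in> coord I (n - 1) \<and> p2 (p2 (p2 x)) \<in> coord J n" for x
        unfolding ker_def using cl lin_simps[OF mf(3)] by (auto simp: coord_jn BI_def)
      have imM: "x \<in> im ?M n V1 \<longleftrightarrow> (\<exists>x0 \<in> coord I (n - 1). x = pr 0 (pr (L (n - 1) x0) (pr (- x0) 0)))" for x
      proof
        assume "\<exists>x0 \<in> coord I (n - 1). x = pr 0 (pr (L (n - 1) x0) (pr (- x0) 0))"
        then obtain x0 where x0: "x0 \<in> coord I (n - 1)" "x = pr 0 (pr (L (n - 1) x0) (pr (- x0) 0))" by blast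
        have "pr x0 0 \<in> V ?M (n - 1) V1" using x0 by (simp add: coord_jn cl)
        moreover have "x = D ?M (n - 1) V1 (pr x0 0)" by (simp add: x0 BI_def)
        ultimately show "x \<in> im ?M n V1" unfolding im_def by blast
      qed (auto simp: im_def BI_def)
      show "\<And>x y. x \<in> coord ?J n \<Longrightarrow> y \<in> coord ?J n \<Longrightarrow> x + y \<in> coord ?J n" "\<And>x y. x \<in> coord ?J n \<Longrightarrow> y \<in> coord ?J n \<Longrightarrow> x - y \<in> coord ?J n"
        "0 \<in> coord ?J n" "\<And>c x. x \<in> coord ?J n \<Longrightarrow> c \<star> x \<in> coord ?J n" by (simp_all add: cl)
      show "pr 0 (pr (p1 (x + y)) (pr 0 (p2 (x + y)))) = pr 0 (pr (p1 x) (pr 0 (p2 x))) + pr 0 (pr (p1 y) (pr 0 (p2 y)))"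
        "pr 0 (pr (p1 (c \<star> x)) (pr 0 (p2 (c \<star> x)))) = c \<star> pr 0 (pr (p1 x) (pr 0 (p2 x)))" for x y :: "'k U" and c by simp_all
      show "pr 0 (pr (p1 x) (pr 0 (p2 x))) \<in> ker ?M n V1" if "x \<in> coord ?J n" for x
        using that cl by (simp add: kerM coord_jn)
      show "pr 0 (pr (p1 x) (pr 0 (p2 x))) \<in> im ?M n V1 \<longleftrightarrow> x \<in> {0}" if "x \<in> coord ?J n" for x
      proof
        assume "pr 0 (pr (p1 x) (pr 0 (p2 x))) \<in> im ?M n V1"
        then obtain x0 where "p1 x = L (n - 1) x0" "x0 = 0" "p2 x = 0" unfolding imM by auto
        then have "p1 x = p1 0" "p2 x = p2 0" using lin_simps[OF mf(3)] by auto
        then show "x \<in> {0}" using pr_eqI by blast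
      next
        assume "x \<in> {0}"
        then show "pr 0 (pr (p1 x) (pr 0 (p2 x))) \<in> im ?M n V1" by (simp add: sub_0[OF sub_im[OF kM]])
      qed
      show "\<exists>y\<in>coord ?J n. x - pr 0 (pr (p1 y) (pr 0 (p2 y))) \<in> im ?M n V1" if x: "x \<in> ker ?M n V1" for x
      \<comment> \<open>Adding \<open>L p\<close> to the first component compensates for the
        boundary of \<open>- p\<close>, which removes the component \<open>p\<close>.\<close>
      proof (rule bexI[of _ "pr (p1 (p2 x) + L (n - 1) (p1 (p2 (p2 x)))) (p2 (p2 (p2 x)))"])
        have "L (n - 1) (p1 (p2 (p2 x))) \<in> coord I (n - 2)" using mf(6) x unfolding kerM by simp
        then show "pr (p1 (p2 x) + L (n - 1) (p1 (p2 (p2 x)))) (p2 (p2 (p2 x))) \<in> coord ?J n"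
          using x unfolding kerM coord_jn by (simp add: cl)
        have "x = pr (p1 x) (pr (p1 (p2 x)) (pr (p1 (p2 (p2 x))) (p2 (p2 (p2 x)))))" by simp
        then obtain r p q where x': "x = pr 0 (pr r (pr p q))" using x unfolding kerM by metis
        have "x - pr 0 (pr (p1 (p2 x) + L (n - 1) (p1 (p2 (p2 x)))) (pr 0 (p2 (p2 (p2 x))))) =
            pr 0 (pr (- L (n - 1) (p1 (p2 (p2 x)))) (pr (p1 (p2 (p2 x))) 0))"
          unfolding x' by simp
        then show "x - pr 0 (pr (p1 (pr (p1 (p2 x) + L (n - 1) (p1 (p2 (p2 x)))) (p2 (p2 (p2 x)))))
             (pr 0 (p2 (pr (p1 (p2 x) + L (n - 1) (p1 (p2 (p2 x)))) (p2 (p2 (p2 x))))))) \<in> im ?M n V1"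
          unfolding p1_pr p2_pr imM using x[unfolded kerM] cl lin_simps[OF mf(3)] by (intro bexI[of _ "- p1 (p2 (p2 x))"]) auto
      qed
      show "\<And>x y. x \<in> im ?M n V1 \<Longrightarrow> y \<in> im ?M n V1 \<Longrightarrow> x + y \<in> im ?M n V1" by (rule sub_add[OF sub_im[OF kM]])
    qed
    then show ?thesis by (rule quot_basis_hdim[OF kM])
  qed
  note h = this
  obtain j where j: "heq j ?M (dgfam y)" using heq_any_sym[OF m(7)] unfolding heq_any_def by blast
  have "hom_total (Pmod V1 :: 'k dgmod) y = (\<Sum>n | card {k. (n, k) \<in> ?J} \<noteq> 0. card {k. (n, k) \<in> ?J})"
    by (rule hom_total_eqI[OF dg_module_Pmod assms(4), of j]) (rule hdim_post[OF dgfam_Pmod kM ky j h])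
  then show ?thesis using sum_card_fibres[OF fJ(1)] fJ(2) m(3,4) by simp
qed

text \<open>The model without copies of \<open>P_1\<close>, with one index in degree 0 for
  \<open>P_2\<close> and zero differential; \<open>f\<close> only rearranges the three
  coordinates.\<close>

lemma has_model_Pmod: assumes "heq_any y (dgfam (Pmod V2 :: 'k::field dgmod))" "kmod y" shows "has_model 0 1 y"
proof -
  let ?P = "dgfam (Pmod V2 :: 'k dgmod)" and ?J = "{(0, 0)} :: (int \<times> nat) set"
  let ?M = "Model V1 (coord {}) (coord ?J) (\<lambda>_ _. 0) (\<lambda>_ _. 0) (\<lambda>_ _. 0) :: 'k kmod"
  have md: "mdl (coord {}) (coord ?J :: int \<Rightarrow> 'k U set) (\<lambda>_ _. 0) (\<lambda>_ _. 0) (\<lambda>_ _. 0)"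
    unfolding mdl_def by (auto simp: sub_coord lin_zero sub_0[OF sub_coord])
  have e: "x \<in> coord {} n \<longleftrightarrow> x = 0" "x \<in> coord ?J n \<longleftrightarrow> (\<exists>a. x = t3 a 0 0 \<and> (a \<noteq> 0 \<longrightarrow> n = 0))" for x :: "'k U" and n
  proof -
    show "x \<in> coord {} n \<longleftrightarrow> x = 0" by (auto simp: coord_def fps_eq_iff)
    show "x \<in> coord ?J n \<longleftrightarrow> (\<exists>a. x = t3 a 0 0 \<and> (a \<noteq> 0 \<longrightarrow> n = 0))"
    proof
      assume x: "x \<in> coord ?J n"
      then have "x = t3 (fps_nth x 0) 0 0" by (auto simp: coord_def fps_eq_iff)
      moreover have "fps_nth x 0 \<noteq> 0 \<longrightarrow> n = 0" using x by (auto simp: coord_def)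
      ultimately show "\<exists>a. x = t3 a 0 0 \<and> (a \<noteq> 0 \<longrightarrow> n = 0)" by blast
    qed (auto simp: coord_def split: if_splits)
  qed
  have t0: "t3 a 0 0 = 0 \<longleftrightarrow> a = 0" for a :: 'k using t3_eq[of a 0 0 0 0 0] by simp
  define f :: "'k fam" where "f = (\<lambda>n w x. if w = V1 then pr 0 (pr 0 (t3 (fps_nth x 1) 0 0)) else pr 0 (pr (t3 (fps_nth x 0) 0 0) (t3 (fps_nth x 2) 0 0)))"
  note VP = V_Pmod[of V2, where 'k='k, unfolded opp.simps] and AP = Pmod_AD[of V2, unfolded opp.simps]
  note MS = Model_simps[of V1, unfolded opp.simps]
  have lt: "t3 (a + b) 0 0 = t3 a 0 0 + t3 b 0 0" "t3 (c * a) 0 0 = c \<star> t3 a 0 0" for a b c :: 'k by (auto simp: fps_eq_iff)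
  have "heq 0 ?P ?M"
  proof (rule heq_bij[OF dgfam_Pmod kmod_Model[OF md]])
    have VM1: "x \<in> V ?M n V1 \<longleftrightarrow> (\<exists>a. x = pr 0 (pr 0 (t3 a 0 0)) \<and> (a \<noteq> 0 \<longrightarrow> n = 1))" for x n
    proof
      assume "x \<in> V ?M n V1"
      then have "p1 x = 0" "p1 (p2 x) = 0" "\<exists>a. p2 (p2 x) = t3 a 0 0 \<and> (a \<noteq> 0 \<longrightarrow> n = 1)" by (simp_all add: MS e)
      moreover have "x = pr (p1 x) (pr (p1 (p2 x)) (p2 (p2 x)))" by simp
      ultimately show "\<exists>a. x = pr 0 (pr 0 (t3 a 0 0)) \<and> (a \<noteq> 0 \<longrightarrow> n = 1)" by metis
    qed (auto simp: MS e t0)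
    have VM2: "x \<in> V ?M n V2 \<longleftrightarrow> (\<exists>a b. x = pr 0 (pr (t3 a 0 0) (t3 b 0 0)) \<and> (a \<noteq> 0 \<longrightarrow> n = 0) \<and> (b \<noteq> 0 \<longrightarrow> n = 2))" for x n
    proof
      assume "x \<in> V ?M n V2"
      then have "p1 x = 0" "\<exists>a. p1 (p2 x) = t3 a 0 0 \<and> (a \<noteq> 0 \<longrightarrow> n = 0)" "\<exists>b. p2 (p2 x) = t3 b 0 0 \<and> (b \<noteq> 0 \<longrightarrow> n = 2)" by (simp_all add: MS e)
      moreover have "x = pr (p1 x) (pr (p1 (p2 x)) (p2 (p2 x)))" by simp
      ultimately show "\<exists>a b. x = pr 0 (pr (t3 a 0 0) (t3 b 0 0)) \<and> (a \<noteq> 0 \<longrightarrow> n = 0) \<and> (b \<noteq> 0 \<longrightarrow> n = 2)" by metis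
    qed (auto simp: MS e t0)
    have bij: "bij_betw (f n w) (V ?P n w) (V ?M n w)" for n w
    proof (cases w)
      case V1
      show ?thesis unfolding V1
      proof (rule bij_betwI[where g="\<lambda>x. t3 0 (fps_nth (p2 (p2 x)) 0) 0"])
        show "f n V1 \<in> V ?P n V1 \<rightarrow> V ?M n V1" unfolding VP by (auto simp: VM1 f_def t0 simp del: Model_simps)
        show "(\<lambda>x. t3 0 (fps_nth (p2 (p2 x)) 0) 0) \<in> V ?M n V1 \<rightarrow> V ?P n V1" unfolding VP by (auto simp: VM1 t0 simp del: Model_simps)
      qed (auto simp: VP VM1 f_def t0 simp del: dgfam_simps Model_simps)
    next
      case V2
      show ?thesis unfolding V2
      proof (rule bij_betwI[where g="\<lambda>x. t3 (fps_nth (p1 (p2 x)) 0) 0 (fps_nth (p2 (p2 x)) 0)"])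
        show "f n V2 \<in> V ?P n V2 \<rightarrow> V ?M n V2" unfolding VP by (auto simp: VM2 f_def t0 simp del: Model_simps)
        show "(\<lambda>x. t3 (fps_nth (p1 (p2 x)) 0) 0 (fps_nth (p2 (p2 x)) 0)) \<in> V ?M n V2 \<rightarrow> V ?P n V2" unfolding VP by (auto simp: VM2 t0 simp del: Model_simps)
      qed (auto simp: VP VM2 f_def t0 simp del: dgfam_simps Model_simps)
    qed
    then show "\<And>n w. bij_betw (f n w) (V ?P n w) (V ?M n w)" .
    show "f \<in> cyc 0 ?P ?M"
    proof (intro cycI homI)
      fix n w show "lin (f n w)" by (auto simp: lin_def f_def lt)
      fix x assume x: "x \<in> V ?P n w"
      show "f n w x \<in> V ?M (n + 0) w" using bij_betwE[OF bij] x by simp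
      show "f (n + 1) (opp w) (A ?P w x) = sgn_pow 0 \<star> A ?M w (f n w x)"
        by (cases w) (auto simp: AP MS f_def simp del: dgfam_simps)
      show "f (n + 1) w (D ?P n w x) = sgn_pow 0 \<star> D ?M (n + 0) w (f n w x)"
        by (cases w) (auto simp: AP MS f_def simp del: dgfam_simps)
    qed
  qed
  then have s: "heq_any y ?M" using heq_any_trans[OF assms(1) _ assms(2) dgfam_Pmod kmod_Model[OF md]] unfolding heq_any_def by blast
  have "linv (coord {}) (coord ?J :: int \<Rightarrow> 'k U set) (\<lambda>_ _. 0) (\<lambda>_ _. 0) (\<lambda>_ _. 0)"
    unfolding linv_def by (auto simp: lin_zero e)
  then show ?thesis unfolding has_model_def using s md
    by (intro exI[of _ "{}"] exI[of _ ?J] exI[of _ "\<lambda>_ _. 0"] conjI) auto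
qed

lemma hom_total_Pmod: "hom_total (Pmod V1 :: 'k::field dgmod) (Pmod V2) = 1"
proof -
  have "hom_total (Pmod V1 :: 'k::field dgmod) (Pmod V2) = (\<Sum>n | (if n = 1 then 1 else 0) \<noteq> (0::nat). if n = (1::int) then 1 else 0)"
    by (rule hom_total_eqI[OF dg_module_Pmod dg_module_Pmod, of 0]) (use hdim_Pmod[of _ V1 V2, where 'k='k] in simp)
  then show ?thesis by simp
qed

section \<open>Slopes and the determinant formula\<close>

abbreviation vec2 :: "int \<Rightarrow> int \<Rightarrow> real^2" where "vec2 a c \<equiv> vector [of_int a, of_int c]"

lemma vec2_eq: "vector [x, y] = (vector [x', y'] :: real^2) \<longleftrightarrow> x = x' \<and> y = y'"
  by (metis vector_2)

lemma vec2_all: "(v :: real^2) = vector [v $ 1, v $ 2]"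
  by (simp add: Finite_Cartesian_Product.vec_eq_iff forall_2)

lemma scale_vec2: "r *\<^sub>R vector [x, y] = (vector [r * x, r * y] :: real^2)"
  by (simp add: Finite_Cartesian_Product.vec_eq_iff forall_2)

lemma line_scale: assumes "r \<noteq> 0" shows "line (r *\<^sub>R v) = line v"
proof -
  have "\<exists>d. c *\<^sub>R v = d *\<^sub>R r *\<^sub>R v \<and> d \<noteq> 0" if "c \<noteq> 0" for c
    using that assms by (intro exI[of _ "c / r"]) simp
  moreover have "\<exists>d. c *\<^sub>R r *\<^sub>R v = d *\<^sub>R v \<and> d \<noteq> 0" if "c \<noteq> 0" for c
    using that assms by (intro exI[of _ "c * r"]) simp
  ultimately show ?thesis unfolding line_def by blast
qed

lemma coprime_shift: "coprime a (c - a) \<longleftrightarrow> coprime a c" "coprime a (c + a) \<longleftrightarrow> coprime a c"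
  "coprime (b + k * c) c \<longleftrightarrow> coprime b c" "coprime (b + c) c \<longleftrightarrow> coprime b c" "coprime (b - c) c \<longleftrightarrow> coprime b c" for a b c k :: int
proof -
  have g: "coprime a (k * a + c) \<longleftrightarrow> coprime a c" for a c k :: int
    by (simp only: coprime_iff_gcd_eq_1 gcd_add_mult)
  show "coprime a (c - a) \<longleftrightarrow> coprime a c" "coprime a (c + a) \<longleftrightarrow> coprime a c"
    using g[of a "-1" c] g[of a 1 c] by (simp_all add: add.commute)
  show "coprime (b + k * c) c \<longleftrightarrow> coprime b c" "coprime (b + c) c \<longleftrightarrow> coprime b c" "coprime (b - c) c \<longleftrightarrow> coprime b c"
    unfolding coprime_commute[of _ c] using g[of c k b] g[of c 1 b] g[of c "-1" b] by (simp_all add: add.commute)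
qed

lemma line_eq_iff: "v \<noteq> 0 \<Longrightarrow> line v = line w \<longleftrightarrow> (\<exists>r. r \<noteq> 0 \<and> w = r *\<^sub>R v)"
proof
  assume "line v = line w"
  moreover have "w \<in> line w" unfolding line_def by (rule CollectI, rule exI[of _ 1]) simp
  ultimately show "\<exists>r. r \<noteq> 0 \<and> w = r *\<^sub>R v" unfolding line_def by blast
qed (use line_scale in auto)

text \<open>Proportionality gives \<open>a' c = a c'\<close>, which coprimality turns into mutual
  divisibility of the entries. Mixed signs would force one entry to vanish.\<close>

lemma line_vec2_eq: assumes "coprime a c" "coprime a' c'" "line (vec2 a c) = line (vec2 a' c')"
  shows "a' = a \<and> c' = c \<or> a' = - a \<and> c' = - c"
proof -
  have "vec2 a c \<noteq> 0"
  proof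
    assume "vec2 a c = 0"
    then have "vec2 a c $ 1 = 0" "vec2 a c $ 2 = 0" by (simp_all only: zero_index)
    then have "a = 0" "c = 0" by simp_all
    then show False using assms(1) by simp
  qed
  then obtain r where r: "r \<noteq> 0" "vec2 a' c' = r *\<^sub>R vec2 a c" using line_eq_iff assms(3) by metis
  then have e: "of_int a' = r * of_int a" "of_int c' = r * of_int c" unfolding scale_vec2 vec2_eq by blast+
  then have "real_of_int (a' * c) = of_int (a * c')" by simp
  then have d: "a' * c = a * c'" using of_int_eq_iff by blast
  have "a dvd a' * c" "a' dvd a * c'" "c dvd a * c'" "c' dvd a' * c" using d by (metis dvd_triv_left dvd_triv_right)+
  then have "a dvd a'" "a' dvd a" "c dvd c'" "c' dvd c" using assms(1,2)
    by (simp_all add: coprime_dvd_mult_left_iff coprime_dvd_mult_right_iff coprime_commute)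
  then have "\<bar>a\<bar> = \<bar>a'\<bar>" "\<bar>c\<bar> = \<bar>c'\<bar>" using zdvd_antisym_abs by blast+
  then have "a' = a \<or> a' = - a" "c' = c \<or> c' = - c" using abs_eq_iff[of a' a] abs_eq_iff[of c' c] by metis+
  moreover have "a = 0 \<or> c = 0" if "a' = a" "c' = - c" using d unfolding that by simp
  moreover have "a = 0 \<or> c = 0" if "a' = - a" "c' = c" using d unfolding that by simp
  ultimately show ?thesis by force
qed

lemma line_neg: "line (vec2 (- a) (- c)) = line (vec2 a c)"
  using line_scale[of "-1" "vec2 a c"] by (simp add: scale_vec2 del: scaleR_minus_left scaleR_minus1_left)

lemma P1_Z_iff: "l \<in> P1_Z \<longleftrightarrow> (\<exists>a c. coprime a c \<and> l = line (vec2 a c))"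
proof
  assume "l \<in> P1_Z"
  then obtain v :: "real^2" where v: "l = line v" "v \<noteq> 0" "\<forall>i. v $ i \<in> \<int>" unfolding P1_Z_def by blast
  then obtain a c where ac: "v $ 1 = of_int a" "v $ 2 = of_int c" by (metis Ints_cases)
  then have ve: "v = vec2 a c" using vec2_all by metis
  have ne: "gcd a c \<noteq> 0"
  proof
    assume "gcd a c = 0"
    then have "v = 0" unfolding Finite_Cartesian_Product.vec_eq_iff forall_2 using ac by simp
    then show False using v by simp
  qed
  define g where "g = gcd a c"
  have g: "a = g * (a div g)" "c = g * (c div g)" "g \<noteq> 0" unfolding g_def using ne by simp_all
  have "v = of_int g *\<^sub>R vec2 (a div g) (c div g)" unfolding scale_vec2 ve vec2_eq
    using g(1,2) by (metis of_int_mult)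
  then have "l = line (vec2 (a div g) (c div g))" using line_scale g(3) v(1) by auto
  moreover have "coprime (a div g) (c div g)" unfolding g_def using ne by (intro div_gcd_coprime) auto
  ultimately show "\<exists>a c. coprime a c \<and> l = line (vec2 a c)" by blast
next
  assume "\<exists>a c. coprime a c \<and> l = line (vec2 a c)"
  then obtain a c where ac: "coprime a c" "l = line (vec2 a c)" by blast
  have "vec2 a c \<noteq> 0"
  proof
    assume "vec2 a c = 0"
    then have "vec2 a c $ 1 = 0" "vec2 a c $ 2 = 0" by (simp_all only: zero_index)
    then show False using ac(1) by simp
  qed
  moreover have "\<forall>i. vec2 a c $ i \<in> \<int>" unfolding forall_2 by simp
  ultimately show "l \<in> P1_Z" using ac(2) unfolding P1_Z_def by blast
qed

lemma sigma_line: "(*v) (sigma_mat V1) ` line (vec2 a c) = line (vec2 (a + c) c)"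
  "(*v) (sigma_mat V2) ` line (vec2 a c) = line (vec2 a (c - a))"
proof -
  have m: "(*v) M ` line v = line (M *v v)" for M :: "real^2^2" and v
    unfolding line_def by (auto simp: matrix_vector_mult_scaleR image_iff) (metis matrix_vector_mult_scaleR)
  have "sigma_mat V1 *v vec2 a c = vec2 (a + c) c" "sigma_mat V2 *v vec2 a c = vec2 a (c - a)"
    by (simp_all add: Finite_Cartesian_Product.vec_eq_iff forall_2 matrix_vector_mult_def sum_2)
  then show "(*v) (sigma_mat V1) ` line (vec2 a c) = line (vec2 (a + c) c)"
    "(*v) (sigma_mat V2) ` line (vec2 a c) = line (vec2 a (c - a))" unfolding m by simp_all
qed

section \<open>The action of twists on slopes\<close>

context
  fixes i :: "'k::field dgmod set \<Rightarrow> (real^2) set"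
  assumes i: "is_slope_map i"
begin

lemma i_bij: "bij_betw i \<S> P1_Z" using i unfolding is_slope_map_def by blast

lemma i_eq: "X \<in> \<S> \<Longrightarrow> Y \<in> \<S> \<Longrightarrow> i X = i Y \<Longrightarrow> X = Y"
  by (rule inj_onD[OF bij_betw_imp_inj_on[OF i_bij]])

lemma i_ex: "coprime a c \<Longrightarrow> \<exists>X\<in>\<S>. i X = line (vec2 a c)"
  using bij_betw_imp_surj_on[OF i_bij] P1_Z_iff by (metis imageE)

lemma i_slope: "X \<in> \<S> \<Longrightarrow> \<exists>a c. coprime a c \<and> i X = line (vec2 a c)"
  using i_bij P1_Z_iff unfolding bij_betw_def by blast

text \<open>Equivariance for one-letter braid words.\<close>

lemma i_twist: assumes "X \<in> \<S>" "i X = line (vec2 a c)"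
  shows "i (twist_class V1 X) = line (vec2 (a + c) c)" "i (twist_class V2 X) = line (vec2 a (c - a))"
proof -
  have "i (braid_act [(u, False)] X) = (*v) (braid_mat [(u, False)]) ` i X" for u
    using i assms(1) unfolding is_slope_map_def by blast
  then have "i (twist_class u X) = (*v) (sigma_mat u) ` i X" for u by (simp add: matrix_mul_rid)
  then show "i (twist_class V1 X) = line (vec2 (a + c) c)" "i (twist_class V2 X) = line (vec2 a (c - a))"
    unfolding assms(2) sigma_line[symmetric] by blast+
qed

text \<open>Injectivity is read off from slopes: the generators act injectively on primitive vectors
  up to sign, and a slope determines its class.\<close>

lemma twist_inj: assumes "X \<in> (\<S> :: 'k dgmod set set)" "Y \<in> \<S>" "twist_class u X = twist_class u Y" shows "X = Y"
proof -
  obtain a c where ac: "coprime a c" "i X = line (vec2 a c)" using i_slope[OF assms(1)] by blast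
  obtain b d where diff_hom: "coprime b d" "i Y = line (vec2 b d)" using i_slope[OF assms(2)] by blast
  have "i (twist_class u X) = i (twist_class u Y)" using assms(3) by simp
  then have "a = b \<and> c = d \<or> b = - a \<and> d = - c"
  proof (cases u)
    case V1
    have "coprime (a + c) c" "coprime (b + d) d" using ac(1) diff_hom(1) by (simp_all add: coprime_shift)
    from line_vec2_eq[OF this] show ?thesis
      using \<open>i (twist_class u X) = i (twist_class u Y)\<close> unfolding V1 i_twist(1)[OF assms(1) ac(2)] i_twist(1)[OF assms(2) diff_hom(2)] by auto
  next
    case V2
    have "coprime a (c - a)" "coprime b (d - b)" using ac(1) diff_hom(1) by (simp_all add: coprime_shift)
    from line_vec2_eq[OF this] show ?thesis
      using \<open>i (twist_class u X) = i (twist_class u Y)\<close> unfolding V2 i_twist(2)[OF assms(1) ac(2)] i_twist(2)[OF assms(2) diff_hom(2)] by auto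
  qed
  then have "i X = i Y" using ac(2) diff_hom(2) line_neg by auto
  then show ?thesis using i_eq assms by blast
qed

text \<open>Untwisting by means of slopes: an object with the preimage slope exists by surjectivity
  of \<open>i\<close>, and its twist has the slope of \<open>X\<close>, hence is
  \<open>X\<close>.\<close>

lemma twist_from: assumes "X \<in> \<S>" "coprime a c"
  shows "i X = line (vec2 (a + c) c) \<Longrightarrow> \<exists>Y\<in>\<S>. i Y = line (vec2 a c) \<and> twist_class V1 Y = X"
    "i X = line (vec2 a (c - a)) \<Longrightarrow> \<exists>Y\<in>\<S>. i Y = line (vec2 a c) \<and> twist_class V2 Y = X"
proof -
  obtain Y where Y: "Y \<in> \<S>" "i Y = line (vec2 a c)" using i_ex[OF assms(2)] by blast
  show "\<exists>Y\<in>\<S>. i Y = line (vec2 a c) \<and> twist_class V1 Y = X" if "i X = line (vec2 (a + c) c)"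
    using i_eq[OF twist_class(1)[OF Y(1)] assms(1)] i_twist(1)[OF Y] that Y by auto
  show "\<exists>Y\<in>\<S>. i Y = line (vec2 a c) \<and> twist_class V2 Y = X" if "i X = line (vec2 a (c - a))"
    using i_eq[OF twist_class(1)[OF Y(1)] assms(1)] i_twist(2)[OF Y] that Y by auto
qed

text \<open>Totals are preserved by \<open>Tw\<close>, and injectivity on classes preserves the case
  in which the value is set to 0.\<close>

lemma hom_cls_twist: assumes "X \<in> (\<S> :: 'k dgmod set set)" "Y \<in> \<S>" shows "hom_cls (twist_class u X) (twist_class u Y) = hom_cls X Y"
proof -
  note t = twist_class[OF assms(1), of u] twist_class[OF assms(2), of u]
  have "hom_total (rep (twist_class u X)) (rep (twist_class u Y)) = hom_total (rep X) (rep Y)"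
    using hom_total_Tw[of "rep X" "rep Y"] t rep_facts(1) sph_dg(1) assms by blast
  then show ?thesis using hom_cls_eq[OF assms] hom_cls_eq[OF t(1,3)] twist_inj[OF assms] by auto
qed

section \<open>The classes of \<open>P_1\<close> and \<open>P_2\<close>, and models for positive
  slopes\<close>

definition "P1c = (sph_class (Pmod V1) :: 'k dgmod set)"
definition "P2c = (sph_class (Pmod V2) :: 'k dgmod set)"

lemma Pc: "P1c \<in> \<S>" "P2c \<in> \<S>" "heq_any (krep P1c) (dgfam (Pmod V1))" "heq_any (krep P2c) (dgfam (Pmod V2))"
  unfolding P1c_def P2c_def using class_in[OF Pmod_sph] by blast+

lemma i_P1: "i P1c = line (vec2 1 0)" using i unfolding is_slope_map_def P1c_def by simp

text \<open>The twist in \<open>P_2\<close> fixes the class of \<open>P_2\<close>, and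
  \<open>[0 : 1]\<close> is the only slope fixed by the second generator.\<close>

lemma i_P2: "i P2c = line (vec2 0 1)"
proof -
  have k: "kmod (krep P2c)" by (rule krep[OF Pc(2)])
  note t = twist_class[OF Pc(2), of V2]
  have "heq_any (Tw V2 (krep P2c)) (Tw V2 (dgfam (Pmod V2)))" by (rule heq_any_Tw[OF Pc(4) k dgfam_Pmod])
  moreover have "heq_any (Tw V2 (dgfam (Pmod V2))) (dgfam (Pmod V2 :: 'k dgmod))" using heq_Tw_Pmod heq_any_sym unfolding heq_any_def by blast
  ultimately have "heq_any (krep (twist_class V2 P2c)) (krep P2c)"
    using t(2) heq_any_sym[OF Pc(4)] heq_any_trans krep[OF t(1)] kmod_Tw[OF k] kmod_Tw[OF dgfam_Pmod] dgfam_Pmod k by metis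
  then have e: "twist_class V2 P2c = P2c" using \<S>_eq_iff t(1) Pc(2) by blast
  obtain a c where ac: "coprime a c" "i P2c = line (vec2 a c)" using i_slope[OF Pc(2)] by blast
  have "line (vec2 a c) = line (vec2 a (c - a))" using i_twist(2)[OF Pc(2) ac(2)] e ac(2) by simp
  moreover have "coprime a (c - a)" using ac(1) by (simp add: coprime_shift)
  ultimately have "c - a = c \<or> a = - a" using line_vec2_eq[OF ac(1)] by blast
  then have "a = 0" by auto
  then have "c = 1 \<or> c = - 1" using ac(1) by auto
  then show ?thesis using ac(2) line_neg[of 0 1] \<open>a = 0\<close> by auto
qed

text \<open>For \<open>a \<ge> c\<close> the object is a twist in \<open>P_1\<close> of one of slope
  \<open>[a - c : c]\<close>. For \<open>0 < a < c\<close> it is an inverse twist in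
  \<open>P_2\<close> of its own twist, which has slope \<open>[a : c - a]\<close>. The recursion
  ends at \<open>P_2\<close>.\<close>

lemma all_modeled: "coprime a c \<Longrightarrow> a \<ge> 0 \<Longrightarrow> c \<ge> 1 \<Longrightarrow> X \<in> \<S> \<Longrightarrow> i X = line (vec2 a c) \<Longrightarrow> has_model (nat a) (nat c) (krep X)"
proof (induction "nat (a + c)" arbitrary: a c X rule: less_induct)
  case less
  note kX = krep[OF less.prems(4)]
  consider "a = 0" | "a \<ge> c" | "0 < a" "a < c" using less.prems by linarith
  then show ?case
  proof cases
    case 1
    then have "c = 1" using less.prems by simp
    then have "X = P2c" using i_eq[OF less.prems(4) Pc(2)] i_P2 less.prems(5) 1 by simp
    then show ?thesis using has_model_Pmod[OF Pc(4)] kX 1 \<open>c = 1\<close> by simp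
  next
    case 2
    have co: "coprime (a - c) c" using less.prems(1) by (simp add: coprime_shift)
    have "i X = line (vec2 (a - c + c) c)" using less.prems(5) by simp
    from twist_from(1)[OF less.prems(4) co this]
    obtain Y where Y: "Y \<in> \<S>" "i Y = line (vec2 (a - c) c)" "twist_class V1 Y = X" by blast
    have "has_model (nat (a - c)) (nat c) (krep Y)" by (rule less.hyps[OF _ co _ _ Y(1,2)]) (use 2 less.prems in auto)
    from has_model_Tw[OF this krep[OF Y(1)] kX] twist_class(2)[OF Y(1), of V1] Y(3)
    have "has_model (nat (a - c) + nat c) (nat c) (krep X)" by simp
    moreover have "nat (a - c) + nat c = nat a" using 2 less.prems by simp
    ultimately show ?thesis by simp
  next
    case 3
    note Y = twist_class[OF less.prems(4), of V2]
    have co: "coprime a (c - a)" using less.prems(1) by (simp add: coprime_shift)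
    have "has_model (nat a) (nat (c - a)) (krep (twist_class V2 X))"
      by (rule less.hyps[OF _ co _ _ Y(1) i_twist(2)[OF less.prems(4,5)]]) (use 3 less.prems in auto)
    from has_model_I[OF this _ krep[OF Y(1)] kX Y(2)] 3 have "has_model (nat a) (nat a + nat (c - a)) (krep X)" by simp
    moreover have "nat a + nat (c - a) = nat c" using 3 by simp
    ultimately show ?thesis by simp
  qed
qed

lemma hom_total_P1: assumes "X \<in> \<S>" shows "hom_total (rep P1c) (rep X) = hom_total (Pmod V1) (rep X)"
  using hom_total_heq_any[OF sph_dg(1)[OF rep_facts(1)[OF Pc(1)]] _ dg_module_Pmod _ Pc(3) heq_any_refl] sph_dg[OF rep_facts(1)[OF assms]] by blast

text \<open>For \<open>0 < a < c\<close> the object is an inverse twist in \<open>P_2\<close> of a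
  model with multiplicities \<open>a\<close> and \<open>c - a\<close>, which is the situation
  counted by \<open>hom_total_Ti\<close>; for \<open>a = 0\<close> it is \<open>P_2\<close>.\<close>

lemma hom_cls_P1_small: assumes "coprime a c" "0 \<le> a" "a < c" "X \<in> \<S>" "i X = line (vec2 a c)" shows "hom_cls P1c X = nat c"
proof -
  have ne: "X \<noteq> P1c"
  proof
    assume "X = P1c"
    then have "line (vec2 a c) = line (vec2 1 0)" using assms(5) i_P1 by simp
    then show False using line_vec2_eq[OF assms(1), of 1 0] assms(2,3) by auto
  qed
  have h: "hom_cls P1c X = hom_total (Pmod V1) (rep X)" using hom_cls_eq[OF Pc(1) assms(4)] ne hom_total_P1[OF assms(4)] by auto
  note dX = sph_dg(1)[OF rep_facts(1)[OF assms(4)]]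
  show ?thesis
  proof (cases "a = 0")
    case True
    then have c: "c = 1" using assms by simp
    then have "X = P2c" using i_eq[OF assms(4) Pc(2)] i_P2 assms(5) True by simp
    then have "hom_total (Pmod V1) (rep X) = hom_total (Pmod V1) (Pmod V2 :: 'k dgmod)"
      using hom_total_heq_any[OF dg_module_Pmod dX dg_module_Pmod dg_module_Pmod heq_any_refl[OF dgfam_Pmod]] Pc(4) by blast
    then show ?thesis using h c hom_total_Pmod by simp
  next
    case False
    note Y = twist_class[OF assms(4), of V2]
    have co: "coprime a (c - a)" using assms(1) by (simp add: coprime_shift)
    have "has_model (nat a) (nat (c - a)) (krep (twist_class V2 X))"
      by (rule all_modeled[OF co _ _ Y(1) i_twist(2)[OF assms(4,5)]]) (use assms in auto)
    from hom_total_Ti[OF this _ krep[OF Y(1)] dX Y(2)] False assms(2) have "hom_total (Pmod V1) (rep X) = nat a + nat (c - a)" by simp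
    then show ?thesis using h assms(2,3) by simp
  qed
qed

lemma P1_fixed: "twist_class V1 P1c = P1c"
  using i_twist(1)[OF Pc(1) i_P1] i_P1 i_eq[OF twist_class(1)[OF Pc(1)] Pc(1)] by simp

text \<open>The twist in \<open>P_1\<close> fixes \<open>P_1\<close> and adds \<open>c\<close> to
  \<open>a\<close>, so for positive \<open>c\<close> the entry \<open>a\<close> may be reduced
  modulo \<open>c\<close>. A negative \<open>c\<close> is handled by changing the sign of the
  vector.\<close>

lemma hom_cls_P1: assumes "coprime a c" "X \<in> \<S>" "i X = line (vec2 a c)" shows "hom_cls P1c X = nat \<bar>c\<bar>"
proof -
  have step: "hom_cls P1c X = nat c" if "coprime b c" "0 \<le> b" "b < c" "X \<in> \<S>" "i X = line (vec2 (b + int n * c) c)" for b c X n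
    using that
  proof (induction n arbitrary: X)
    case 0
    then show ?case using hom_cls_P1_small by simp
  next
    case (Suc n)
    have co: "coprime (b + int n * c) c" using Suc.prems(1) by (simp add: coprime_shift)
    have "i X = line (vec2 (b + int n * c + c) c)" using Suc.prems(5) by (simp add: algebra_simps)
    from twist_from(1)[OF Suc.prems(4) co this] obtain Y where Y: "Y \<in> \<S>" "i Y = line (vec2 (b + int n * c) c)" "twist_class V1 Y = X" by blast
    have "hom_cls P1c Y = nat c" by (rule Suc.IH[OF Suc.prems(1-3) Y(1,2)])
    then show ?case using hom_cls_twist[OF Pc(1) Y(1), of V1] Y(3) P1_fixed by simp
  qed
  have step': "hom_cls P1c X = nat c" if "coprime b c" "0 \<le> b" "b < c" "X \<in> \<S>" "i X = line (vec2 (b - int n * c) c)" for b c X n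
    using that
  proof (induction n arbitrary: X)
    case 0
    then show ?case using hom_cls_P1_small by simp
  next
    case (Suc n)
    note Y = twist_class(1)[OF Suc.prems(4), of V1]
    have "i (twist_class V1 X) = line (vec2 (b - int (Suc n) * c + c) c)" by (rule i_twist(1)[OF Suc.prems(4,5)])
    also have "b - int (Suc n) * c + c = b - int n * c" by (simp add: algebra_simps)
    finally have "hom_cls P1c (twist_class V1 X) = nat c" using Suc.IH[OF Suc.prems(1-3) Y] by blast
    then show ?case using hom_cls_twist[OF Pc(1) Suc.prems(4), of V1] P1_fixed by simp
  qed
  have pos: "hom_cls P1c X = nat c" if "coprime a c" "c > 0" "i X = line (vec2 a c)" for a c
  proof -
    have co: "coprime (a mod c) c" using that(1) by (simp add: coprime_iff_gcd_eq_1 gcd_red_int[symmetric] gcd.commute)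
    have b: "0 \<le> a mod c" "a mod c < c" using that(2) by simp_all
    show ?thesis
    proof (cases "a div c \<ge> 0")
      case True
      then have "a mod c + int (nat (a div c)) * c = a" by simp
      then show ?thesis using step[OF co b assms(2), of "nat (a div c)"] that(3) by simp
    next
      case False
      then have "a mod c - int (nat (- (a div c))) * c = a" by simp
      then show ?thesis using step'[OF co b assms(2), of "nat (- (a div c))"] that(3) by simp
    qed
  qed
  consider "c > 0" | "c < 0" | "c = 0" by linarith
  then show ?thesis
  proof cases
    case 1 then show ?thesis using pos[OF assms(1) _ assms(3)] by simp
  next
    case 2 then show ?thesis using pos[of "- a" "- c"] assms(1,3) line_neg[of a c] by simp
  next
    case 3
    then have "a = 1 \<or> a = - 1" using assms(1) by auto
    then have "i X = i P1c" using assms(3) line_neg[of 1 0] i_P1 3 by auto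
    then have "X = P1c" using i_eq[OF assms(2) Pc(1)] by blast
    then show ?thesis using hom_cls_eq[OF Pc(1) Pc(1)] 3 by simp
  qed
qed

text \<open>Both sides are unchanged when \<open>X\<close> and \<open>Y\<close> are twisted
  simultaneously. As long as both entries of the slope of \<open>X\<close> are nonzero, adding one
  to the other or subtracting it shortens the vector, until \<open>X\<close> is \<open>P_1\<close>
  or \<open>P_2\<close>.\<close>

lemma hom_cls_det: "coprime a c \<Longrightarrow> coprime b d \<Longrightarrow> X \<in> \<S> \<Longrightarrow> Y \<in> \<S> \<Longrightarrow> i X = line (vec2 a c) \<Longrightarrow> i Y = line (vec2 b d) \<Longrightarrow>
    hom_cls X Y = nat \<bar>a * d - b * c\<bar>"
proof (induction "nat (\<bar>a\<bar> + \<bar>c\<bar>)" arbitrary: a b c d X Y rule: less_induct)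
  case less
  note p = less.prems
  have up: "hom_cls X Y = nat \<bar>a * d - b * c\<bar>"
    if "\<bar>a + c\<bar> < \<bar>a\<bar>"
  proof -
    have "hom_cls (twist_class V1 X) (twist_class V1 Y) = nat \<bar>(a + c) * d - (b + d) * c\<bar>"
      by (rule less.hyps[OF _ _ _ twist_class(1)[OF p(3)] twist_class(1)[OF p(4)] i_twist(1)[OF p(3,5)] i_twist(1)[OF p(4,6)]])
        (use that p in \<open>auto simp: coprime_shift\<close>)
    then show ?thesis using hom_cls_twist[OF p(3,4), of V1] by (simp add: algebra_simps)
  qed
  have right: "hom_cls X Y = nat \<bar>a * d - b * c\<bar>" if "\<bar>c - a\<bar> < \<bar>c\<bar>"
  proof -
    have "hom_cls (twist_class V2 X) (twist_class V2 Y) = nat \<bar>a * (d - b) - b * (c - a)\<bar>"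
      by (rule less.hyps[OF _ _ _ twist_class(1)[OF p(3)] twist_class(1)[OF p(4)] i_twist(2)[OF p(3,5)] i_twist(2)[OF p(4,6)]])
        (use that p in \<open>auto simp: coprime_shift\<close>)
    then show ?thesis using hom_cls_twist[OF p(3,4), of V2] by (simp add: algebra_simps)
  qed
  have up': "hom_cls X Y = nat \<bar>a * d - b * c\<bar>" if l: "\<bar>a - c\<bar> < \<bar>a\<bar>"
  proof -
    have co: "coprime (a - c) c" "coprime (b - d) d" using p(1,2) by (simp_all add: coprime_shift)
    have e: "i X = line (vec2 (a - c + c) c)" "i Y = line (vec2 (b - d + d) d)" using p(5,6) by simp_all
    obtain X' where X': "X' \<in> \<S>" "i X' = line (vec2 (a - c) c)" "twist_class V1 X' = X" using twist_from(1)[OF p(3) co(1) e(1)] by blast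
    obtain Y' where Y': "Y' \<in> \<S>" "i Y' = line (vec2 (b - d) d)" "twist_class V1 Y' = Y" using twist_from(1)[OF p(4) co(2) e(2)] by blast
    have "hom_cls X' Y' = nat \<bar>(a - c) * d - (b - d) * c\<bar>" by (rule less.hyps[OF _ co X'(1) Y'(1) X'(2) Y'(2)]) (use l p in auto)
    then show ?thesis using hom_cls_twist[OF X'(1) Y'(1), of V1] X'(3) Y'(3) by (simp add: algebra_simps)
  qed
  have right': "hom_cls X Y = nat \<bar>a * d - b * c\<bar>" if l: "\<bar>c + a\<bar> < \<bar>c\<bar>"
  proof -
    have co: "coprime a (c + a)" "coprime b (d + b)" using p(1,2) by (simp_all add: coprime_shift)
    have e: "i X = line (vec2 a (c + a - a))" "i Y = line (vec2 b (d + b - b))" using p(5,6) by simp_all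
    obtain X' where X': "X' \<in> \<S>" "i X' = line (vec2 a (c + a))" "twist_class V2 X' = X" using twist_from(2)[OF p(3) co(1) e(1)] by blast
    obtain Y' where Y': "Y' \<in> \<S>" "i Y' = line (vec2 b (d + b))" "twist_class V2 Y' = Y" using twist_from(2)[OF p(4) co(2) e(2)] by blast
    have "hom_cls X' Y' = nat \<bar>a * (d + b) - b * (c + a)\<bar>" by (rule less.hyps[OF _ co X'(1) Y'(1) X'(2) Y'(2)]) (use l p in auto)
    then show ?thesis using hom_cls_twist[OF X'(1) Y'(1), of V2] X'(3) Y'(3) by (simp add: algebra_simps)
  qed
  consider "c = 0" | "a = 0" | "c \<noteq> 0" "a \<noteq> 0" by blast
  then show ?case
  proof cases
    case 1
    then have a: "a = 1 \<or> a = - 1" using p(1) by auto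
    then have "i X = i P1c" using p(5) line_neg[of 1 0] i_P1 1 by auto
    then have "X = P1c" using i_eq[OF p(3) Pc(1)] by blast
    then show ?thesis using hom_cls_P1[OF p(2,4,6)] 1 a by (auto simp: abs_mult)
  next
    case 2
    \<comment> \<open>\<open>\<sigma>\<^sub>2 \<sigma>\<^sub>1\<close> maps \<open>[0 : 1]\<close> to \<open>[1 : 0]\<close>.\<close>
    then have c: "c = 1 \<or> c = - 1" using p(1) by auto
    let ?X = "twist_class V2 (twist_class V1 X)" and ?Y = "twist_class V2 (twist_class V1 Y)"
    note t1 = twist_class(1)[OF p(3), of V1] twist_class(1)[OF p(4), of V1]
    note t2 = twist_class(1)[OF t1(1), of V2] twist_class(1)[OF t1(2), of V2]
    have iX: "i ?X = line (vec2 c 0)" using i_twist(2)[OF t1(1) i_twist(1)[OF p(3,5)]] 2 by simp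
    have "i ?Y = line (vec2 (b + d) (d - (b + d)))" by (rule i_twist(2)[OF t1(2) i_twist(1)[OF p(4,6)]])
    then have iY: "i ?Y = line (vec2 (b + d) (- b))" by simp
    have co: "coprime (b + d) (- b)" using p(2) by (simp add: coprime_iff_gcd_eq_1 gcd.commute add.commute)
    have "i ?X = i P1c" using iX c line_neg[of 1 0] i_P1 by auto
    then have "?X = P1c" using i_eq[OF t2(1) Pc(1)] by blast
    then have "hom_cls ?X ?Y = nat \<bar>- b\<bar>" using hom_cls_P1[OF co t2(2) iY] by simp
    then have "hom_cls X Y = nat \<bar>- b\<bar>" using hom_cls_twist[OF t1, of V2] hom_cls_twist[OF p(3,4), of V1] by simp
    then show ?thesis using 2 c by auto
  next
    case 3
    then have "\<bar>a + c\<bar> < \<bar>a\<bar> \<or> \<bar>a - c\<bar> < \<bar>a\<bar> \<or> \<bar>c - a\<bar> < \<bar>c\<bar> \<or> \<bar>c + a\<bar> < \<bar>c\<bar>" by linarith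
    then show ?thesis using up up' right right' by blast
  qed
qed

end

section \<open>Topology\<close>

definition det2 :: "real^2 \<Rightarrow> real^2 \<Rightarrow> real" where "det2 v w = v $ 1 * w $ 2 - w $ 1 * v $ 2"

lemma det2_scale: "det2 (r *\<^sub>R v) w = r * det2 v w" "det2 v (r *\<^sub>R w) = r * det2 v w"
  by (simp_all add: det2_def algebra_simps)

lemma PS_class_scale: assumes "r \<noteq> 0" shows "PS_class (\<lambda>X\<in>\<S>. r * u X) = PS_class u"
proof -
  have a: "\<exists>d. (\<lambda>X\<in>\<S>. c * (\<lambda>X\<in>\<S>. r * u X) X) = (\<lambda>X\<in>\<S>. d * u X) \<and> d \<noteq> 0" if "c \<noteq> 0" for c
    using that assms by (intro exI[of _ "c * r"]) (auto simp: restrict_def)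
  moreover have "\<exists>d. (\<lambda>X\<in>\<S>. c * u X) = (\<lambda>X\<in>\<S>. d * (\<lambda>X\<in>\<S>. r * u X) X) \<and> d \<noteq> 0" if "c \<noteq> 0" for c
    using that assms by (intro exI[of _ "c / r"]) (auto simp: restrict_def)
  ultimately show ?thesis unfolding PS_class_def by blast
qed

lemma PS_class_self: "u \<in> extensional \<S> \<Longrightarrow> u \<in> PS_class u"
  unfolding PS_class_def by (intro CollectI exI[of _ 1]) (auto simp: restrict_def extensional_def)

lemma PS_class_eqD: assumes "PS_class u = PS_class w" "w \<in> extensional \<S>"
  shows "\<exists>c. c \<noteq> 0 \<and> (\<forall>X\<in>\<S>. w X = c * u X)"
proof -
  have "w \<in> PS_class u" using PS_class_self[OF assms(2)] assms(1) by simp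
  then obtain c where "c \<noteq> 0" "w = (\<lambda>X\<in>\<S>. c * u X)" unfolding PS_class_def by blast
  then show ?thesis by (intro exI[of _ c]) simp
qed

section \<open>Coordinates and separation in the projective space of functions\<close>

abbreviation RS0 :: "('k::field dgmod set \<Rightarrow> real) topology" where "RS0 \<equiv> subtopology RS (- {\<lambda>X\<in>\<S>. 0})"

lemma topspace_RS0: "w \<in> topspace RS0 \<longleftrightarrow> w \<in> extensional \<S> \<and> w \<noteq> (\<lambda>X\<in>\<S>. 0)"
  by (auto simp: RS_def PiE_def)

lemma cont_RS_apply: "X \<in> \<S> \<Longrightarrow> continuous_map RS0 euclideanreal (\<lambda>w. w X)"
  unfolding RS_def by (intro continuous_map_from_subtopology continuous_map_product_projection)

lemma PS_quot: "quotient_map RS0 PS PS_class" unfolding PS_def by (rule quotient_map_quotient_topology)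
lemma P1_quot: "quotient_map (top_of_set (UNIV - {0})) P1_R line" unfolding P1_R_def by (rule quotient_map_quotient_topology)

lemma topspace_PS: "topspace PS = PS_class ` topspace RS0"
  using quotient_imp_surjective_map[OF PS_quot] by (rule sym)

text \<open>Distinct points of \<open>P\<^sup>S\<close> have distinct ratios at some pair of coordinates. The set
  \<open>\<bar>w X * u Y - w Y * u X\<bar> < \<bar>w X * u' Y - w Y * u' X\<bar>\<close> is invariant under scaling of \<open>w\<close>.\<close>

lemma Hausdorff_PS: "Hausdorff_space (PS :: ('k::field dgmod set \<Rightarrow> real) set topology)"
  unfolding Hausdorff_space_def
proof (intro allI impI)
  fix p p' assume "p \<in> topspace (PS :: ('k dgmod set \<Rightarrow> real) set topology) \<and> p' \<in> topspace (PS :: ('k dgmod set \<Rightarrow> real) set topology) \<and> p \<noteq> p'"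
  then obtain u u' where u: "u \<in> topspace RS0" "p = PS_class u" and u': "u' \<in> topspace RS0" "p' = PS_class u'" and ne: "p \<noteq> p'"
    unfolding topspace_PS by blast
  \<comment> \<open>If all 2 by 2 minors of \<open>u\<close> and \<open>u'\<close> vanished, the two
    functions would be proportional, hence equal in \<open>PS\<close>.\<close>
  have "\<exists>X\<in>\<S>. \<exists>Y\<in>\<S>. u X * u' Y \<noteq> u Y * u' X"
  proof (rule ccontr)
    assume "\<not> ?thesis"
    then have e: "u X * u' Y = u Y * u' X" if "X \<in> \<S>" "Y \<in> \<S>" for X Y using that by blast
    have nz: "\<exists>X\<in>\<S>. w X \<noteq> 0" if "w \<in> topspace RS0" for w :: "'k dgmod set \<Rightarrow> real"
    proof (rule ccontr)
      assume "\<not> ?thesis"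
      then have "w = (\<lambda>X\<in>\<S>. 0)" using that unfolding topspace_RS0 by (auto simp: extensional_def restrict_def)
      then show False using that unfolding topspace_RS0 by blast
    qed
    obtain X where X: "X \<in> \<S>" "u X \<noteq> 0" using nz[OF u(1)] by blast
    obtain Z where Z: "Z \<in> \<S>" "u' Z \<noteq> 0" using nz[OF u'(1)] by blast
    have "u' X \<noteq> 0" using e[OF X(1) Z(1)] X(2) Z(2) by auto
    moreover have "u' Y = (u' X / u X) * u Y" if "Y \<in> \<S>" for Y using e[OF X(1) that] X(2) by (simp add: field_simps)
    then have "u' = (\<lambda>Y\<in>\<S>. (u' X / u X) * u Y)" using u'(1) unfolding topspace_RS0 by (auto simp: extensional_def restrict_def)
    ultimately show False using PS_class_scale[of "u' X / u X" u] X(2) ne u(2) u'(2) by simp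
  qed
  then obtain X Y where XY: "X \<in> \<S>" "Y \<in> \<S>" "u X * u' Y \<noteq> u Y * u' X" by blast
  define W where "W = (\<lambda>a b. {w \<in> topspace RS0. \<bar>w X * a Y - w Y * a X\<bar> < \<bar>w X * b Y - w Y * b X\<bar>})" for a b :: "'k dgmod set \<Rightarrow> real"
  have op: "openin PS (PS_class ` W a b)" for a b
  proof -
    have "openin RS0 (W a b)"
    proof -
      have c: "continuous_map RS0 euclideanreal (\<lambda>w. \<bar>w X * b Y - w Y * b X\<bar> - \<bar>w X * a Y - w Y * a X\<bar>)"
        by (intro continuous_intros cont_RS_apply XY)
      have "W a b = {w \<in> topspace RS0. \<bar>w X * b Y - w Y * b X\<bar> - \<bar>w X * a Y - w Y * a X\<bar> \<in> {0<..}}"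
        unfolding W_def by auto
      then show ?thesis using openin_continuous_map_preimage[OF c, of "{0<..}"] by simp
    qed
    moreover have "{w \<in> topspace RS0. PS_class w \<in> PS_class ` W a b} = W a b"
    proof (rule equalityI; rule subsetI)
      fix w assume w: "w \<in> {w \<in> topspace RS0. PS_class w \<in> PS_class ` W a b}"
      then obtain w' where w': "w' \<in> W a b" "PS_class w' = PS_class w" by fastforce
      obtain c where c: "c \<noteq> 0" "\<forall>X\<in>\<S>. w X = c * w' X"
        using PS_class_eqD[OF w'(2)] w unfolding topspace_RS0 by blast
      have "w X * e Y - w Y * e X = c * (w' X * e Y - w' Y * e X)" for e using c(2) XY by (simp add: algebra_simps)
      then show "w \<in> W a b" using w' w c(1) unfolding W_def by (simp add: abs_mult)
    qed (auto simp: W_def)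
    moreover have "W a b \<subseteq> topspace RS0" unfolding W_def by blast
    ultimately show ?thesis unfolding PS_def openin_quotient_topology
      by (intro conjI image_mono) simp_all
  qed
  have mem: "p \<in> PS_class ` W u u'" "p' \<in> PS_class ` W u' u"
    using u u' XY(3) by (auto simp: W_def algebra_simps intro!: imageI)
  have "disjnt (PS_class ` W u u') (PS_class ` W u' u)"
  proof (rule ccontr)
    assume "\<not> ?thesis"
    then obtain w w' where w: "w \<in> W u u'" "w' \<in> W u' u" "PS_class w = PS_class w'" unfolding disjnt_def by fastforce
    have "w' \<in> extensional \<S>" using w(2) unfolding W_def topspace_RS0 by blast
    from PS_class_eqD[OF w(3) this] obtain c where c: "c \<noteq> 0" "\<forall>X\<in>\<S>. w' X = c * w X" by blast
    have "w' X * e Y - w' Y * e X = c * (w X * e Y - w Y * e X)" for e using c(2) XY by (simp add: algebra_simps)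
    then show False using w c(1) unfolding W_def by (simp add: abs_mult)
  qed
  then show "\<exists>U W. openin PS U \<and> openin PS W \<and> p \<in> U \<and> p' \<in> W \<and> disjnt U W" using op mem by blast
qed

text \<open>Every line meets the unit circle, which is compact.\<close>

lemma compact_P1: "compact_space P1_R"
proof -
  have c: "compactin (top_of_set (UNIV - {0})) (sphere 0 1 :: (real^2) set)"
    unfolding compactin_subtopology by (auto simp: compactin_euclidean_iff)
  have "compactin P1_R (line ` (sphere 0 1 :: (real^2) set))"
    by (rule image_compactin[OF c quotient_imp_continuous_map[OF P1_quot]])
  moreover have "line ` (sphere 0 1 :: (real^2) set) = topspace P1_R"
  proof -
    have t: "topspace P1_R = line ` (UNIV - {0})" using quotient_imp_surjective_map[OF P1_quot] by simp
    have "line v \<in> line ` sphere 0 1" if "v \<noteq> 0" for v :: "real^2"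
      using that line_scale[of "1 / norm v" v] by (intro image_eqI[of _ _ "(1 / norm v) *\<^sub>R v"]) auto
    then have "line ` (UNIV - {0 :: real^2}) \<subseteq> line ` sphere 0 1" by blast
    moreover have "line ` sphere 0 1 \<subseteq> line ` (UNIV - {0 :: real^2})" by (intro image_mono) auto
    ultimately show ?thesis unfolding t by blast
  qed
  ultimately show ?thesis unfolding compact_space_def by simp
qed

section \<open>The extension of \<open>h\<close> to real slopes\<close>

context
  fixes i :: "'k::field dgmod set \<Rightarrow> (real^2) set"
  assumes i: "is_slope_map i"
begin

text \<open>The primitive vector is unique up to sign. One of the two is chosen, and it enters only
  through absolute values of determinants.\<close>

definition prim_vec :: "'k dgmod set \<Rightarrow> real^2" where
  "prim_vec X = (SOME v. \<exists>a c. v = vec2 a c \<and> coprime a c \<and> i X = line v)"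

lemma prim_vec: assumes "X \<in> \<S>" shows "\<exists>a c. prim_vec X = vec2 a c \<and> coprime a c \<and> i X = line (prim_vec X)"
  unfolding prim_vec_def by (rule someI_ex) (use i_slope[OF i assms] in blast)

lemma hom_cls_dt: assumes "X \<in> \<S>" "Y \<in> \<S>" shows "real (hom_cls X Y) = \<bar>det2 (prim_vec X) (prim_vec Y)\<bar>"
proof -
  obtain a c where ac: "prim_vec X = vec2 a c" "coprime a c" "i X = line (prim_vec X)" using prim_vec[OF assms(1)] by blast
  obtain b d where diff_hom: "prim_vec Y = vec2 b d" "coprime b d" "i Y = line (prim_vec Y)" using prim_vec[OF assms(2)] by blast
  have "hom_cls X Y = nat \<bar>a * d - b * c\<bar>"
    by (rule hom_cls_det[OF i ac(2) diff_hom(2) assms]) (use ac diff_hom in simp_all)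
  then show ?thesis unfolding ac(1) diff_hom(1) det2_def by simp
qed

definition hom_fun :: "real^2 \<Rightarrow> 'k dgmod set \<Rightarrow> real" where
  "hom_fun v = (\<lambda>Y\<in>\<S>. \<bar>det2 v (prim_vec Y)\<bar>)"

definition hom_map :: "(real^2) set \<Rightarrow> ('k dgmod set \<Rightarrow> real) set" where
  "hom_map l = PS_class (hom_fun (SOME v. v \<noteq> 0 \<and> l = line v))"

lemma hom_fun_scale: "r \<noteq> 0 \<Longrightarrow> PS_class (hom_fun (r *\<^sub>R v)) = PS_class (hom_fun v)"
proof -
  have "hom_fun (r *\<^sub>R v) = (\<lambda>X\<in>\<S>. \<bar>r\<bar> * hom_fun v X)" by (auto simp: hom_fun_def det2_scale abs_mult restrict_def)
  then show "r \<noteq> 0 \<Longrightarrow> PS_class (hom_fun (r *\<^sub>R v)) = PS_class (hom_fun v)" using PS_class_scale[of "\<bar>r\<bar>" "hom_fun v"] by simp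
qed

lemma hom_map_line: assumes "v \<noteq> 0" shows "hom_map (line v) = PS_class (hom_fun v)"
proof -
  define w where "w = (SOME w. w \<noteq> 0 \<and> line v = line w)"
  have "w \<noteq> 0 \<and> line v = line w" unfolding w_def by (rule someI[of _ v]) (use assms in simp)
  then obtain r where "r \<noteq> 0" "w = r *\<^sub>R v" using line_eq_iff[OF assms] by blast
  then show ?thesis unfolding hom_map_def w_def[symmetric] using hom_fun_scale by simp
qed

text \<open>Surjectivity of \<open>i\<close> makes every primitive vector available as a test
  object; the absolute value removes the ambiguity of sign.\<close>

lemma slope_val: assumes "coprime a c" shows "\<exists>X\<in>\<S>. \<forall>v. hom_fun v X = \<bar>det2 v (vec2 a c)\<bar>"
proof -
  obtain X where X: "X \<in> \<S>" "i X = line (vec2 a c)" using i_ex[OF i assms] by blast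
  obtain b d where diff_hom: "prim_vec X = vec2 b d" "coprime b d" "i X = line (prim_vec X)" using prim_vec[OF X(1)] by blast
  have "b = a \<and> d = c \<or> b = - a \<and> d = - c" using line_vec2_eq[OF assms diff_hom(2)] X(2) diff_hom by simp
  then have "\<bar>det2 v (prim_vec X)\<bar> = \<bar>det2 v (vec2 a c)\<bar>" for v unfolding diff_hom(1) det2_def by (auto simp: algebra_simps abs_minus_commute)
  then show ?thesis using X(1) by (intro bexI[of _ X]) (simp_all add: hom_fun_def)
qed

text \<open>The test slopes \<open>(1, 0)\<close>, \<open>(0, 1)\<close> and \<open>(1, 1)\<close>
  suffice; the third fixes the relative sign of the two coordinates.\<close>

lemma hom_fun_inj: assumes "v \<noteq> 0" "w \<noteq> 0" "\<forall>X\<in>\<S>. hom_fun w X = r * hom_fun v X" "r \<noteq> 0" shows "line v = line w"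
proof -
  have e: "\<bar>det2 w (vec2 a c)\<bar> = r * \<bar>det2 v (vec2 a c)\<bar>" if "coprime a c" for a c
    using slope_val[OF that] assms(3) by metis
  have e1: "\<bar>w $ 2\<bar> = r * \<bar>v $ 2\<bar>" using e[of 1 0] by (simp add: det2_def)
  have e2: "\<bar>w $ 1\<bar> = r * \<bar>v $ 1\<bar>" using e[of 0 1] by (simp add: det2_def)
  have e3: "\<bar>w $ 1 - w $ 2\<bar> = r * \<bar>v $ 1 - v $ 2\<bar>" using e[of 1 1] by (simp add: det2_def)
  \<comment> \<open>Points of \<open>PS\<close> allow negative scalars, but both functions are
    nonnegative and that of \<open>v\<close> takes a positive value.\<close>
  have r: "r > 0"
  proof -
    have "v $ 1 \<noteq> 0 \<or> v $ 2 \<noteq> 0" using assms(1) by (auto simp: Finite_Cartesian_Product.vec_eq_iff forall_2)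
    then have "0 \<le> r * \<bar>v $ 1\<bar> \<and> \<bar>v $ 1\<bar> > 0 \<or> 0 \<le> r * \<bar>v $ 2\<bar> \<and> \<bar>v $ 2\<bar> > 0" using e1 e2 by (metis abs_ge_zero zero_less_abs_iff)
    then have "r \<ge> 0" by (auto simp: zero_le_mult_iff)
    then show ?thesis using assms(4) by simp
  qed
  define x y where "x = r * v $ 1" and "y = r * v $ 2"
  have "\<bar>w $ 2\<bar> = \<bar>y\<bar>" "\<bar>w $ 1\<bar> = \<bar>x\<bar>" "\<bar>w $ 1 - w $ 2\<bar> = \<bar>x - y\<bar>"
    using e1 e2 e3 r unfolding x_def y_def by (simp_all add: abs_mult right_diff_distrib[symmetric])
  then have "w $ 1 = x \<and> w $ 2 = y \<or> w $ 1 = - x \<and> w $ 2 = - y" by linarith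
  then have "w = r *\<^sub>R v \<or> w = (- r) *\<^sub>R v" unfolding x_def y_def by (auto simp: Finite_Cartesian_Product.vec_eq_iff forall_2)
  then show ?thesis using line_eq_iff[OF assms(1)] assms(4) by (metis neg_equal_0_iff_equal)
qed

lemma hom_fun_top: assumes "v \<noteq> 0" shows "hom_fun v \<in> topspace RS0"
proof -
  have "hom_fun v \<noteq> (\<lambda>X\<in>\<S>. 0)"
  proof
    assume "hom_fun v = (\<lambda>X\<in>\<S>. 0)"
    then have e: "\<bar>det2 v (vec2 a c)\<bar> = 0" if "coprime a c" for a c using slope_val[OF that] by (metis restrict_apply')
    from e[of 1 0] e[of 0 1] have "v $ 2 = 0" "v $ 1 = 0" by (simp_all add: det2_def)
    then show False using assms by (simp add: Finite_Cartesian_Product.vec_eq_iff forall_2)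
  qed
  then show ?thesis unfolding topspace_RS0 by (simp add: hom_fun_def)
qed

text \<open>\<open>hom_fun\<close> is continuous in every coordinate, and continuity descends along
  the quotient map \<open>line\<close>.\<close>

lemma cont_Hm: "continuous_map P1_R PS hom_map"
proof -
  have f: "continuous_map (top_of_set (UNIV - {0})) RS0 hom_fun"
  proof -
    have "continuous_map (top_of_set (UNIV - {0})) RS hom_fun" unfolding RS_def continuous_map_componentwise
    proof (intro conjI ballI)
      show "hom_fun ` topspace (top_of_set (UNIV - {0})) \<subseteq> extensional \<S>" by (auto simp: hom_fun_def)
      fix Y :: "'k dgmod set" assume Y: "Y \<in> \<S>"
      have "continuous_map (top_of_set (UNIV - {0})) euclideanreal (\<lambda>v. \<bar>det2 v (prim_vec Y)\<bar>)"
        unfolding continuous_map_iff_continuous det2_def by (intro continuous_intros)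
      then show "continuous_map (top_of_set (UNIV - {0})) euclideanreal (\<lambda>v. hom_fun v Y)" using Y by (simp add: hom_fun_def)
    qed
    then show ?thesis unfolding continuous_map_in_subtopology using hom_fun_top unfolding topspace_RS0 by (auto simp: image_subset_iff)
  qed
  have "continuous_map (top_of_set (UNIV - {0})) PS (PS_class \<circ> hom_fun)"
    by (rule continuous_map_compose[OF f quotient_imp_continuous_map[OF PS_quot]])
  then have "continuous_map (top_of_set (UNIV - {0})) PS (hom_map \<circ> line)"
    by (rule continuous_map_eq) (simp add: hom_map_line)
  then show ?thesis using continuous_compose_quotient_map_eq[OF P1_quot] by blast
qed

lemma emb_Hm: "embedding_map P1_R PS hom_map"
proof -
  have "inj_on hom_map (topspace P1_R)"
  proof (rule inj_onI)
    fix l l' assume l: "l \<in> topspace P1_R" "l' \<in> topspace P1_R" "hom_map l = hom_map l'"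
    have t: "topspace P1_R = line ` (UNIV - {0})" using quotient_imp_surjective_map[OF P1_quot] by simp
    obtain v w where vw: "v \<noteq> 0" "l = line v" "w \<noteq> 0" "l' = line w" using l unfolding t by blast
    have "PS_class (hom_fun v) = PS_class (hom_fun w)" using l(3) vw hom_map_line by simp
    from PS_class_eqD[OF this] obtain c where "c \<noteq> 0" "\<forall>X\<in>\<S>. hom_fun w X = c * hom_fun v X" by (auto simp: hom_fun_def)
    then show "l = l'" using hom_fun_inj vw by blast
  qed
  moreover have "closed_map P1_R PS hom_map"
    by (rule continuous_imp_closed_map[OF cont_Hm compact_P1 Hausdorff_PS])
  ultimately show ?thesis using injective_closed_imp_embedding_map cont_Hm by blast
qed

lemma hom_map_i: assumes "X \<in> \<S>" shows "hom_map (i X) = hmap X"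
proof -
  obtain a c where ac: "prim_vec X = vec2 a c" "coprime a c" "i X = line (prim_vec X)" using prim_vec[OF assms] by blast
  have "prim_vec X \<noteq> 0"
  proof
    assume "prim_vec X = 0"
    then have "vec2 a c $ 1 = 0" "vec2 a c $ 2 = 0" unfolding ac(1) by (simp_all only: zero_index)
    then show False using ac(2) by simp
  qed
  then have "hom_map (i X) = PS_class (hom_fun (prim_vec X))" using ac(3) hom_map_line by simp
  also have "hom_fun (prim_vec X) = (\<lambda>Y\<in>\<S>. real (hom_bar (rep X) (rep Y)))"
    unfolding hom_fun_def using hom_cls_dt[OF assms] by (auto simp: hom_cls_def restrict_def)
  finally show ?thesis unfolding hmap_def .
qed

end

theorem proposition7p16:
  fixes i :: "'k::field dgmod set \<Rightarrow> (real^2) set"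
  assumes "is_slope_map i"
  shows "\<exists>H :: (real^2) set \<Rightarrow> ('k dgmod set \<Rightarrow> real) set.
    continuous_map P1_R PS H \<and> (\<forall>X \<in> \<S>. H (i X) = hmap X) \<and> embedding_map P1_R PS H"
  using cont_Hm[OF assms] hom_map_i[OF assms] emb_Hm[OF assms] by blast

end
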